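(* Suppose that $d(s)=1$ for all $s\in\mathbb S$ and that $\operatorname E\|\varepsilon_0\|^p<\infty$ for some $p>2$. Then $$(\sqrt n\log n)^{-1}\zeta_n\xrightarrow{\mathcal D}\mathcal G'\quad\text{as } n\to\infty$$ (convergence in distribution) in the space $C([0,1];L_2(\mu))$.
   Context: $(\mathbb S,\mathcal S,\mu)$ is a $\sigma$-finite measure space such that the real Hilbert space $L_2(\mu)=L_2(\mathbb S,\mathcal S,\mu)$ is separable; $\|\cdot\|$ is its norm. $d:\mathbb S\to\mathbb R$ is a measurable function. $\{\varepsilon_k\}_{k\in\mathbb Z}$, $\varepsilon_k=\{\varepsilon_k(s):s\in\mathbb S\}$, are independent and identically distributed measurable stochastic processes on a probability space $(\Omega,\mathcal F,P)$ (each $\varepsilon_k:\Omega\times\mathbb S\to\mathbb R$ is $\mathcal F\otimes\mathcal S$-measurable) with $\operatorname E\varepsilon_0(s)=0$ and $\operatorname E\varepsilon_0^2(s)<\infty$ for each $s\in\mathbb S$, regarded also as $L_2(\mu)$-valued random elements with $\operatorname E\|\varepsilon_0\|^2<\infty$. Put $\sigma(r,s)=\operatorname E[\varepsilon_0(r)\varepsilon_0(s)]$. For $k\ge1$, $X_k(s)=\sum_{j=0}^\infty(j+1)^{-d(s)}\varepsilon_{k-j}(s)$; $X_k=\{X_k(s):s\in\mathbb S\}$ is regarded as an $L_2(\mu)$-valued random element. With $S_m=X_1+\cdots+X_m$ ($S_0=0$), the random polygonal function $\zeta_n$ is $\zeta_n(t)=S_{\lfloor nt\rfloor}+\{nt\}X_{\lfloor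 nt\rfloor+1}$, $t\in[0,1]$, where $\lfloor x\rfloor$ is the floor and $\{x\}=x-\lfloor x\rfloor$ the fractional part of $x$. $C([0,1];L_2(\mu))$ is the separable Banach space of continuous functions $f:[0,1]\to L_2(\mu)$ with norm $\sup_{t\in[0,1]}\|f(t)\|$. $\mathcal G'=\{\mathcal G'(s,t):(s,t)\in\mathbb S\times[0,1]\}$ is the zero-mean Gaussian process with covariance function $\operatorname E[\mathcal G'(r,t)\mathcal G'(s,u)]=\sigma(r,s)\min(t,u)$; $\{\mathcal G'(\cdot,t):t\in[0,1]\}$ is an $L_2(\mu)$-valued Gaussian process having a continuous version, and $\mathcal G'$ denotes this continuous version, considered as a Gaussian random element of $C([0,1];L_2(\mu))$ (an $L_2(\mu)$-valued Wiener process). *)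

theory Defs
  imports "HOL-Probability.Probability"
begin

section \<open>The space \<open>L\<^sub>2(\<mu>)\<close> as a metric space of equivalence classes\<close>

definition L2_funs :: "'s measure \<Rightarrow> ('s \<Rightarrow> real) set" where
  "L2_funs \<mu> = {f \<in> borel_measurable \<mu>. integrable \<mu> (\<lambda>s. (f s)\<^sup>2)}"

definition L2_norm :: "'s measure \<Rightarrow> ('s \<Rightarrow> real) \<Rightarrow> real" where
  "L2_norm \<mu> f = sqrt (\<integral>s. (f s)\<^sup>2 \<partial>\<mu>)"

definition L2_class :: "'s measure \<Rightarrow> ('s \<Rightarrow> real) \<Rightarrow> ('s \<Rightarrow> real) set" where
  "L2_class \<mu> f = {g \<in> borel_measurable \<mu>. AE s in \<mu>. g s = f s}"

definition L2_carrier :: "'s measure \<Rightarrow> ('s \<Rightarrow> real) set set" where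
  "L2_carrier \<mu> = L2_class \<mu> ` L2_funs \<mu>"

definition L2_dist :: "'s measure \<Rightarrow> ('s \<Rightarrow> real) set \<Rightarrow> ('s \<Rightarrow> real) set \<Rightarrow> real" where
  "L2_dist \<mu> A B = L2_norm \<mu> (\<lambda>s. (SOME f. f \<in> A) s - (SOME g. g \<in> B) s)"

definition L2 :: "'s measure \<Rightarrow> ('s \<Rightarrow> real) set metric" where
  "L2 \<mu> = metric (L2_carrier \<mu>, L2_dist \<mu>)"

text \<open>The type \<^typ>\<open>'a metric\<close> is a subtype, so \<^const>\<open>L2\<close> has the intended carrier and
  distance only once the metric axioms are verified: see \<open>mspace_L2\<close>, \<open>mdist_L2\<close> and
  \<open>mdist_L2_class\<close> below.\<close>

lemma L2_class_self: "f \<in> L2_funs \<mu> \<Longrightarrow> f \<in> L2_class \<mu> f"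
  by (simp add: L2_class_def L2_funs_def)

lemma L2_mult_integrable:
  assumes "f \<in> L2_funs \<mu>" "g \<in> L2_funs \<mu>"
  shows "integrable \<mu> (\<lambda>s. f s * g s)"
proof (rule Bochner_Integration.integrable_bound)
  show "integrable \<mu> (\<lambda>s. (f s)\<^sup>2 + (g s)\<^sup>2)"
    using assms by (auto simp: L2_funs_def)
  show "(\<lambda>s. f s * g s) \<in> borel_measurable \<mu>"
    using assms by (auto simp: L2_funs_def)
  have "\<bar>x * y\<bar> \<le> x\<^sup>2 + y\<^sup>2" for x y :: real
  proof -
    have "2 * \<bar>x\<bar> * \<bar>y\<bar> \<le> x\<^sup>2 + y\<^sup>2"
      using sum_squares_bound[of "\<bar>x\<bar>" "\<bar>y\<bar>"] by simp
    moreover have "0 \<le> \<bar>x\<bar> * \<bar>y\<bar>" by simp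
    ultimately show ?thesis unfolding abs_mult by linarith
  qed
  then show "AE s in \<mu>. norm (f s * g s) \<le> norm ((f s)\<^sup>2 + (g s)\<^sup>2)"
    by simp
qed

lemma L2_funs_add:
  assumes "f \<in> L2_funs \<mu>" "g \<in> L2_funs \<mu>"
  shows "(\<lambda>s. f s + g s) \<in> L2_funs \<mu>"
  using assms L2_mult_integrable[OF assms]
  by (auto simp: L2_funs_def power2_sum mult.assoc)

lemma L2_funs_diff:
  assumes "f \<in> L2_funs \<mu>" "g \<in> L2_funs \<mu>"
  shows "(\<lambda>s. f s - g s) \<in> L2_funs \<mu>"
  using assms L2_mult_integrable[OF assms]
  by (auto simp: L2_funs_def power2_diff mult.assoc)

lemma L2_norm_nonneg: "0 \<le> L2_norm \<mu> f"
  by (simp add: L2_norm_def)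

lemma L2_norm_zero_iff:
  assumes "f \<in> L2_funs \<mu>"
  shows "L2_norm \<mu> f = 0 \<longleftrightarrow> (AE s in \<mu>. f s = 0)"
  using assms integral_nonneg_eq_0_iff_AE[of \<mu> "\<lambda>s. (f s)\<^sup>2"]
  by (auto simp: L2_norm_def L2_funs_def)

lemma L2_norm_cong_AE:
  assumes "f \<in> borel_measurable \<mu>" "g \<in> borel_measurable \<mu>" "AE s in \<mu>. f s = g s"
  shows "L2_norm \<mu> f = L2_norm \<mu> g"
proof -
  have "(\<integral>s. (f s)\<^sup>2 \<partial>\<mu>) = (\<integral>s. (g s)\<^sup>2 \<partial>\<mu>)"
    using assms by (intro integral_cong_AE) auto
  then show ?thesis by (simp add: L2_norm_def)
qed

lemma L2_Cauchy_Schwarz: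
  assumes f: "f \<in> L2_funs \<mu>" and g: "g \<in> L2_funs \<mu>"
  shows "(\<integral>s. f s * g s \<partial>\<mu>) \<le> L2_norm \<mu> f * L2_norm \<mu> g"
proof (cases "L2_norm \<mu> f = 0 \<or> L2_norm \<mu> g = 0")
  case True
  then have "(AE s in \<mu>. f s = 0) \<or> (AE s in \<mu>. g s = 0)"
    using f g by (simp add: L2_norm_zero_iff)
  then have ae: "AE s in \<mu>. f s * g s = 0"
    by auto
  then have "(\<integral>s. f s * g s \<partial>\<mu>) = 0"
    by (rule integral_eq_zero_AE)
  then show ?thesis using True by auto
next
  case False
  define a b where "a = L2_norm \<mu> f" and "b = L2_norm \<mu> g"
  have ab: "a > 0" "b > 0"
    using False L2_norm_nonneg[of \<mu> f] L2_norm_nonneg[of \<mu> g] by (auto simp: a_def b_def)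
  have a2: "(\<integral>s. (f s)\<^sup>2 \<partial>\<mu>) = a\<^sup>2" and b2: "(\<integral>s. (g s)\<^sup>2 \<partial>\<mu>) = b\<^sup>2"
    by (auto simp: a_def b_def L2_norm_def)
  have i: "integrable \<mu> (\<lambda>s. (f s)\<^sup>2)" "integrable \<mu> (\<lambda>s. (g s)\<^sup>2)"
    using f g by (auto simp: L2_funs_def)
  have "2 * (a * b * (x * y)) \<le> b\<^sup>2 * x\<^sup>2 + a\<^sup>2 * y\<^sup>2" for x y
    using sum_squares_bound[of "b * x" "a * y"] by (simp add: power_mult_distrib mult_ac)
  then have "(\<integral>s. 2 * (a * b * (f s * g s)) \<partial>\<mu>) \<le> (\<integral>s. b\<^sup>2 * (f s)\<^sup>2 + a\<^sup>2 * (g s)\<^sup>2 \<partial>\<mu>)"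
    using i L2_mult_integrable[OF f g] by (intro integral_mono) auto
  also have "\<dots> = 2 * (a * b * (a * b))"
    using i by (simp add: a2 b2) (simp add: power2_eq_square)
  finally have "a * b * (\<integral>s. f s * g s \<partial>\<mu>) \<le> a * b * (a * b)"
    by simp
  then show ?thesis using ab unfolding a_def[symmetric] b_def[symmetric] by simp
qed

lemma L2_norm_triangle:
  assumes f: "f \<in> L2_funs \<mu>" and g: "g \<in> L2_funs \<mu>"
  shows "L2_norm \<mu> (\<lambda>s. f s + g s) \<le> L2_norm \<mu> f + L2_norm \<mu> g"
proof -
  have i: "integrable \<mu> (\<lambda>s. (f s)\<^sup>2)" "integrable \<mu> (\<lambda>s. (g s)\<^sup>2)" "integrable \<mu> (\<lambda>s. f s * g s)"
    using f g L2_mult_integrable[OF f g] by (auto simp: L2_funs_def)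
  have "(\<integral>s. (f s + g s)\<^sup>2 \<partial>\<mu>) = (\<integral>s. (f s)\<^sup>2 \<partial>\<mu>) + (\<integral>s. (g s)\<^sup>2 \<partial>\<mu>) + 2 * (\<integral>s. f s * g s \<partial>\<mu>)"
    using i by (simp add: power2_sum mult.assoc)
  also have "\<dots> \<le> (L2_norm \<mu> f)\<^sup>2 + (L2_norm \<mu> g)\<^sup>2 + 2 * (L2_norm \<mu> f * L2_norm \<mu> g)"
    using L2_Cauchy_Schwarz[OF f g] by (simp add: L2_norm_def)
  also have "\<dots> = (L2_norm \<mu> f + L2_norm \<mu> g)\<^sup>2"
    by (simp add: power2_sum)
  finally have "(\<integral>s. (f s + g s)\<^sup>2 \<partial>\<mu>) \<le> (L2_norm \<mu> f + L2_norm \<mu> g)\<^sup>2" .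
  then have "L2_norm \<mu> (\<lambda>s. f s + g s) \<le> sqrt ((L2_norm \<mu> f + L2_norm \<mu> g)\<^sup>2)"
    unfolding L2_norm_def[of \<mu> "\<lambda>s. f s + g s"] by (rule real_sqrt_le_mono)
  then show ?thesis
    by (simp add: L2_norm_nonneg)
qed

lemma L2_dist_class:
  assumes f: "f \<in> L2_funs \<mu>" and g: "g \<in> L2_funs \<mu>"
  shows "L2_dist \<mu> (L2_class \<mu> f) (L2_class \<mu> g) = L2_norm \<mu> (\<lambda>s. f s - g s)"
proof -
  have 1: "(SOME f'. f' \<in> L2_class \<mu> f) \<in> L2_class \<mu> f"
    by (rule someI[of "\<lambda>x. x \<in> L2_class \<mu> f", OF L2_class_self[OF f]])
  have 2: "(SOME g'. g' \<in> L2_class \<mu> g) \<in> L2_class \<mu> g"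
    by (rule someI[of "\<lambda>x. x \<in> L2_class \<mu> g", OF L2_class_self[OF g]])
  show ?thesis
    unfolding L2_dist_def
  proof (rule L2_norm_cong_AE)
    show "AE s in \<mu>. (SOME f'. f' \<in> L2_class \<mu> f) s - (SOME g'. g' \<in> L2_class \<mu> g) s = f s - g s"
      using 1 2 unfolding L2_class_def by auto
  qed (use 1 2 f g in \<open>auto simp: L2_class_def L2_funs_def\<close>)
qed

lemma L2_class_eq_iff:
  assumes f: "f \<in> L2_funs \<mu>" and g: "g \<in> L2_funs \<mu>"
  shows "L2_class \<mu> f = L2_class \<mu> g \<longleftrightarrow> (AE s in \<mu>. f s = g s)"
proof
  assume "L2_class \<mu> f = L2_class \<mu> g"
  then have "f \<in> L2_class \<mu> g" using L2_class_self[OF f] by simp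
  then show "AE s in \<mu>. f s = g s" by (simp add: L2_class_def)
next
  assume ae: "AE s in \<mu>. f s = g s"
  have "(AE s in \<mu>. h s = f s) \<longleftrightarrow> (AE s in \<mu>. h s = g s)" for h
    using ae by (auto elim: AE_mp)
  then show "L2_class \<mu> f = L2_class \<mu> g" by (simp add: L2_class_def)
qed

lemma Metric_space_L2: "Metric_space (L2_carrier \<mu>) (L2_dist \<mu>)"
proof
  show "0 \<le> L2_dist \<mu> A B" for A B
    by (simp add: L2_dist_def L2_norm_nonneg)
  show "L2_dist \<mu> A B = L2_dist \<mu> B A" for A B
    by (simp add: L2_dist_def L2_norm_def power2_commute)
  show "L2_dist \<mu> A B = 0 \<longleftrightarrow> A = B" if AB: "A \<in> L2_carrier \<mu>" "B \<in> L2_carrier \<mu>" for A B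
  proof -
    obtain f g where fg: "f \<in> L2_funs \<mu>" "g \<in> L2_funs \<mu>" "A = L2_class \<mu> f" "B = L2_class \<mu> g"
      using AB by (auto simp: L2_carrier_def)
    then show ?thesis
      by (simp add: L2_dist_class L2_class_eq_iff L2_norm_zero_iff L2_funs_diff)
  qed
  show "L2_dist \<mu> A C \<le> L2_dist \<mu> A B + L2_dist \<mu> B C"
    if ABC: "A \<in> L2_carrier \<mu>" "B \<in> L2_carrier \<mu>" "C \<in> L2_carrier \<mu>" for A B C
  proof -
    obtain f g h where fg: "f \<in> L2_funs \<mu>" "g \<in> L2_funs \<mu>" "h \<in> L2_funs \<mu>"
      "A = L2_class \<mu> f" "B = L2_class \<mu> g" "C = L2_class \<mu> h"
      using ABC by (auto simp: L2_carrier_def)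
    then show ?thesis
      using L2_norm_triangle[OF L2_funs_diff[of f \<mu> g] L2_funs_diff[of g \<mu> h]]
      by (simp add: L2_dist_class)
  qed
qed

lemma mspace_L2: "mspace (L2 \<mu>) = L2_carrier \<mu>"
  by (simp add: L2_def Metric_space.mspace_metric[OF Metric_space_L2])

lemma mdist_L2: "mdist (L2 \<mu>) = L2_dist \<mu>"
  by (simp add: L2_def Metric_space.mdist_metric[OF Metric_space_L2])

lemma mdist_L2_class:
  "f \<in> L2_funs \<mu> \<Longrightarrow> g \<in> L2_funs \<mu> \<Longrightarrow>
    mdist (L2 \<mu>) (L2_class \<mu> f) (L2_class \<mu> g) = L2_norm \<mu> (\<lambda>s. f s - g s)"
  by (simp add: mdist_L2 L2_dist_class)


section \<open>The space \<open>C([0,1]; L\<^sub>2(\<mu>))\<close>\<close>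

definition C01_L2 :: "'s measure \<Rightarrow> (real \<Rightarrow> ('s \<Rightarrow> real) set) metric" where
  "C01_L2 \<mu> = cfunspace (top_of_set {0..1}) (L2 \<mu>)"

text \<open>Elements of a \<^const>\<open>cfunspace\<close> are extensional, hence the restriction to \<open>[0,1]\<close> here.\<close>

definition L2_path :: "'s measure \<Rightarrow> (real \<Rightarrow> 's \<Rightarrow> real) \<Rightarrow> real \<Rightarrow> ('s \<Rightarrow> real) set" where
  "L2_path \<mu> f = (\<lambda>t\<in>{0..1}. L2_class \<mu> (f t))"


section \<open>Random elements of a metric space and convergence in distribution\<close>

definition mborel :: "'a metric \<Rightarrow> 'a measure" where
  "mborel m = sigma (mspace m) {U. openin (mtopology_of m) U}"

definition weak_conv_metric :: "'a metric \<Rightarrow> (nat \<Rightarrow> 'a measure) \<Rightarrow> 'a measure \<Rightarrow> bool" where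
  "weak_conv_metric m N N' \<longleftrightarrow>
    (\<forall>F :: 'a \<Rightarrow> real. continuous_map (mtopology_of m) euclideanreal F \<and> bounded (F ` mspace m)
      \<longrightarrow> (\<lambda>n. \<integral>x. F x \<partial>N n) \<longlonglongrightarrow> (\<integral>x. F x \<partial>N'))"

text \<open>The maps \<open>X n\<close> need to be random elements of \<open>m\<close> only up to a null set; this is part of the
  assertion. The choice of the modifications \<open>Y n\<close> does not affect their laws. The limit lives on a
  probability space of its own.\<close>

definition conv_in_distr ::
  "'a metric \<Rightarrow> 'w measure \<Rightarrow> (nat \<Rightarrow> 'w \<Rightarrow> 'a) \<Rightarrow> 'v measure \<Rightarrow> ('v \<Rightarrow> 'a) \<Rightarrow> bool" where
  "conv_in_distr m P X Q Z \<longleftrightarrow>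
    Z \<in> Q \<rightarrow>\<^sub>M mborel m \<and>
    (\<exists>Y. (\<forall>n. Y n \<in> P \<rightarrow>\<^sub>M mborel m \<and> (AE \<omega> in P. X n \<omega> = Y n \<omega>)) \<and>
         weak_conv_metric m (\<lambda>n. distr P (mborel m) (Y n)) (distr Q (mborel m) Z))"


section \<open>Independent and identically distributed measurable processes\<close>

text \<open>A process indexed by \<open>space \<mu>\<close> is a random element of the product space
  \<open>\<real>\<^bsup>\<bbbS>\<^esup>\<close>; independence and equality of laws refer to its product \<open>\<sigma>\<close>-algebra,
  i.e. to the finite-dimensional distributions.\<close>

definition iid_processes ::
  "'w measure \<Rightarrow> 's measure \<Rightarrow> (int \<Rightarrow> 'w \<Rightarrow> 's \<Rightarrow> real) \<Rightarrow> bool" where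
  "iid_processes P \<mu> \<epsilon> \<longleftrightarrow>
    (\<forall>k. (\<lambda>(\<omega>, s). \<epsilon> k \<omega> s) \<in> borel_measurable (P \<Otimes>\<^sub>M \<mu>)) \<and>
    prob_space.indep_vars P (\<lambda>_. Pi\<^sub>M (space \<mu>) (\<lambda>_. borel))
      (\<lambda>k \<omega>. restrict (\<epsilon> k \<omega>) (space \<mu>)) UNIV \<and>
    (\<forall>k. distr P (Pi\<^sub>M (space \<mu>) (\<lambda>_. borel)) (\<lambda>\<omega>. restrict (\<epsilon> k \<omega>) (space \<mu>)) =
         distr P (Pi\<^sub>M (space \<mu>) (\<lambda>_. borel)) (\<lambda>\<omega>. restrict (\<epsilon> 0 \<omega>) (space \<mu>)))"


section \<open>The linear process and its polygonal partial sum process\<close>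

definition lin_proc ::
  "('s \<Rightarrow> real) \<Rightarrow> (int \<Rightarrow> 'w \<Rightarrow> 's \<Rightarrow> real) \<Rightarrow> nat \<Rightarrow> 'w \<Rightarrow> 's \<Rightarrow> real" where
  "lin_proc d \<epsilon> k \<omega> s = (\<Sum>j. real (j + 1) powr (- d s) * \<epsilon> (int k - int j) \<omega> s)"

definition partial_sum :: "(nat \<Rightarrow> 'w \<Rightarrow> 's \<Rightarrow> real) \<Rightarrow> nat \<Rightarrow> 'w \<Rightarrow> 's \<Rightarrow> real" where
  "partial_sum X m \<omega> s = (\<Sum>k=1..m. X k \<omega> s)"

definition zeta ::
  "(nat \<Rightarrow> 'w \<Rightarrow> 's \<Rightarrow> real) \<Rightarrow> nat \<Rightarrow> 'w \<Rightarrow> real \<Rightarrow> 's \<Rightarrow> real" where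
  "zeta X n \<omega> t s =
    partial_sum X (nat \<lfloor>real n * t\<rfloor>) \<omega> s + frac (real n * t) * X (nat \<lfloor>real n * t\<rfloor> + 1) \<omega> s"


section \<open>Gaussian processes and the limit process\<close>

definition gaussian_rv :: "'v measure \<Rightarrow> ('v \<Rightarrow> real) \<Rightarrow> bool" where
  "gaussian_rv Q X \<longleftrightarrow> X \<in> borel_measurable Q \<and>
    (\<exists>m. distr Q borel X = return borel m \<or> (\<exists>\<sigma>>0. distributed Q lborel X (normal_density m \<sigma>)))"

definition gaussian_process :: "'v measure \<Rightarrow> 'i set \<Rightarrow> ('v \<Rightarrow> 'i \<Rightarrow> real) \<Rightarrow> bool" where
  "gaussian_process Q T g \<longleftrightarrow>
    (\<forall>J a. finite J \<and> J \<subseteq> T \<longrightarrow> gaussian_rv Q (\<lambda>v. \<Sum>i\<in>J. a i * g v i))"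

definition centered_gaussian_process ::
  "'v measure \<Rightarrow> 'i set \<Rightarrow> ('i \<Rightarrow> 'i \<Rightarrow> real) \<Rightarrow> ('v \<Rightarrow> 'i \<Rightarrow> real) \<Rightarrow> bool" where
  "centered_gaussian_process Q T K g \<longleftrightarrow>
    gaussian_process Q T g \<and>
    (\<forall>i\<in>T. (\<integral>v. g v i \<partial>Q) = 0) \<and>
    (\<forall>i\<in>T. \<forall>j\<in>T. (\<integral>v. g v i * g v j \<partial>Q) = K i j)"

text \<open>\<open>G\<close> is a random element of \<open>C([0,1]; L\<^sub>2(\<mu>))\<close> which is a version of the
  \<open>L\<^sub>2(\<mu>)\<close>-valued process \<open>t \<mapsto> g(\<cdot>,t)\<close>, where \<open>g\<close> is a zero-mean Gaussian process on
  \<open>\<bbbS> \<times> [0,1]\<close> with covariance \<open>\<sigma>(r,s) min(t,u)\<close>. Joint measurability of \<open>g\<close> in \<open>(v,s)\<close> is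
  what lets \<open>g(\<cdot>,t)\<close> be regarded as an \<open>L\<^sub>2(\<mu>)\<close>-valued random element; square integrability
  of its paths is forced by \<open>G v t\<close> lying in \<open>L\<^sub>2(\<mu>)\<close>.\<close>

definition L2_Wiener ::
  "'s measure \<Rightarrow> ('s \<Rightarrow> 's \<Rightarrow> real) \<Rightarrow> 'v measure \<Rightarrow> ('v \<Rightarrow> real \<Rightarrow> ('s \<Rightarrow> real) set) \<Rightarrow> bool"
  where
  "L2_Wiener \<mu> \<sigma> Q G \<longleftrightarrow>
    G \<in> Q \<rightarrow>\<^sub>M mborel (C01_L2 \<mu>) \<and>
    (\<exists>g :: 'v \<Rightarrow> 's \<times> real \<Rightarrow> real.
      centered_gaussian_process Q (space \<mu> \<times> {0..1}) (\<lambda>(r, t) (s, u). \<sigma> r s * min t u) g \<and>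
      (\<forall>t\<in>{0..1}. (\<lambda>(v, s). g v (s, t)) \<in> borel_measurable (Q \<Otimes>\<^sub>M \<mu>)) \<and>
      (\<forall>t\<in>{0..1}. AE v in Q. G v t = L2_class \<mu> (\<lambda>s. g v (s, t))))"

end

theory Submission
  imports Defs
begin

text \<open>Write \<open>S\<^sub>m\<close> for the partial sums of the linear process, \<open>W\<^sub>m\<close> for those of the innovations
  and \<open>H\<^sub>n\<close> for the harmonic numbers. Up to time \<open>n\<close>, the difference \<open>S\<^sub>m - H\<^sub>n W\<^sub>m\<close> consists of the
  increments of the random walk over \<open>j < n\<close> steps weighted by \<open>1 / (j + 1)\<close>, and of a remainder
  with square summable coefficients. Only the weights with \<open>j \<ge> L\<close> can meet large increments, and their
  total is bounded when \<open>L\<close> is a fixed fraction of \<open>n\<close>; so the modulus of continuity of the walk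
  shows that the difference is \<open>o(sqrt n * ln n)\<close> uniformly in \<open>m\<close>. Since \<open>H\<^sub>n / ln n \<longlonglongrightarrow> 1\<close>, the
  claim reduces to Donsker's theorem for the innovations in \<open>L\<^sub>2(\<mu>)\<close>. All moment estimates are made
  at fixed \<open>s\<close> and then integrated: the modulus is controlled by Doob's inequality after truncation,
  so second moments suffice. Both the walk and the Wiener process are finally compared
  with polygons having finitely many nodes in a finite-dimensional subspace, where convergence of
  characteristic functions is enough.\<close>

section \<open>Maximal inequalities for sums of independent random variables\<close>

text \<open>Tightness is never shown. The comparisons are made on one probability space in mean
  distance, which bounded Lipschitz functions turn into differences of expectations; accuracy comes
  first, then the fraction of \<open>n\<close>, the number of nodes, the number of coordinates, and
  \<open>n\<close> last. Passing from fixed \<open>s\<close> to norms is cheap: the maximum over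
  times of an \<open>L2_norm\<close> is at most the root of the integral over \<open>s\<close> of
  the pointwise maximum of squares, so scalar maximal inequalities suffice. The price is that all
  bounds must be integrable in \<open>s\<close>, which the integrable diagonal of the covariance
  provides. The real obstacle is on the Gaussian side. The limit is specified through its values at
  points \<open>s\<close>, while coordinates in an orthonormal basis are integrals over
  \<open>s\<close>, whose joint law is not given. The bridge is that the mean square error of
  replacing such an integral by a finite combination of point values is a function of the covariance
  alone. One choice of points therefore serves the walk and the Wiener process alike.\<close>

primrec rmax :: "(nat \<Rightarrow> real) \<Rightarrow> nat \<Rightarrow> real" where
  "rmax x 0 = x 0"
| "rmax x (Suc n) = max (rmax x n) (x (Suc n))"

lemma rmax_ge: "i \<le> n \<Longrightarrow> x i \<le> rmax x n"
  by (induction n) (auto simp: le_Suc_eq max_def)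

lemma rmax_attained: "\<exists>i\<le>n. rmax x n = x i"
proof (induction n)
  case (Suc n)
  then obtain i where "i \<le> n" "rmax x n = x i" by auto
  then show ?case
    by (cases "rmax x n \<le> x (Suc n)") (auto simp: max_def intro: le_SucI)
qed simp

lemma rmax_cong: "(\<And>i. i \<le> n \<Longrightarrow> x i = y i) \<Longrightarrow> rmax x n = rmax y n"
  by (induction n) auto

lemma rmax_nonneg: "0 \<le> x 0 \<Longrightarrow> 0 \<le> rmax x n"
  using rmax_ge[of 0 n x] by simp

lemma measurable_rmax[measurable (raw)]:
  assumes "\<And>i. i \<le> n \<Longrightarrow> (\<lambda>\<omega>. x \<omega> i) \<in> borel_measurable M"
  shows "(\<lambda>\<omega>. rmax (x \<omega>) n) \<in> borel_measurable M"
  using assms by (induction n) auto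

text \<open>Summation by parts, using that \<open>x\<close> equals its running maximum whenever the latter increases.\<close>

lemma rmax_pathwise:
  "(rmax x n)\<^sup>2 / 2 + (\<Sum>i<n. rmax x i * (x (Suc i) - x i)) \<le> rmax x n * x n"
proof (induction n)
  case 0
  then show ?case by (simp add: power2_eq_square)
next
  case (Suc n)
  let ?a = "rmax x n" and ?b = "rmax x (Suc n)"
  have "?b\<^sup>2 / 2 - ?a\<^sup>2 / 2 \<le> (?b - ?a) * x (Suc n)"
  proof (cases "x (Suc n) \<le> ?a")
    case True
    then show ?thesis by (simp add: max_def)
  next
    case False
    then have "?b = x (Suc n)" by (simp add: max_def)
    moreover have "(x (Suc n))\<^sup>2 / 2 - ?a\<^sup>2 / 2 \<le> (x (Suc n) - ?a) * x (Suc n)"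
      using sum_squares_bound[of ?a "x (Suc n)"] by (simp add: power2_eq_square algebra_simps)
    ultimately show ?thesis by simp
  qed
  with Suc show ?case by (simp add: algebra_simps del: rmax.simps)
qed

text \<open>Young's inequality gives back half of the square on the left of
  \<open>rmax_pathwise\<close>; multiplying by 4 produces Doob's constant. The sum is a discrete
  stochastic integral, of which only the sign of the mean will matter.\<close>

lemma rmax_pathwise_Doob:
  "(rmax x n)\<^sup>2 + 4 * (\<Sum>i<n. rmax x i * (x (Suc i) - x i)) \<le> 4 * (x n)\<^sup>2"
proof -
  have "rmax x n * x n \<le> (rmax x n)\<^sup>2 / 4 + (x n)\<^sup>2"
    using sum_squares_bound[of "rmax x n / 2" "x n"] by (simp add: power2_eq_square algebra_simps)
  then show ?thesis using rmax_pathwise[of x n] by simp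
qed

lemma rmax_sq_le_sum:
  assumes "\<And>i. 0 \<le> x i"
  shows "(rmax x n)\<^sup>2 \<le> (\<Sum>i\<le>n. (x i)\<^sup>2)"
proof -
  obtain i where "i \<le> n" "rmax x n = x i" using rmax_attained by blast
  then show ?thesis using member_le_sum[of i "{..n}" "\<lambda>i. (x i)\<^sup>2"] by simp
qed

lemma integrable_mult_L2:
  fixes f g :: "'a \<Rightarrow> real"
  assumes [measurable]: "f \<in> borel_measurable M" "g \<in> borel_measurable M"
    and "integrable M (\<lambda>x. (f x)\<^sup>2)" "integrable M (\<lambda>x. (g x)\<^sup>2)"
  shows "integrable M (\<lambda>x. f x * g x)"
  by (rule L2_mult_integrable) (use assms in \<open>auto simp: L2_funs_def\<close>)

text \<open>The pathwise bound is integrated, and \<open>sub\<close> is all that is left of the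
  submartingale property: the increments, weighted by the running maximum, have nonnegative mean. No
  filtration or conditional expectation enters.\<close>

lemma Doob_L2:
  fixes x :: "'w \<Rightarrow> nat \<Rightarrow> real"
  assumes [measurable]: "\<And>i. (\<lambda>\<omega>. x \<omega> i) \<in> borel_measurable M"
    and int: "\<And>i. integrable M (\<lambda>\<omega>. (x \<omega> i)\<^sup>2)"
    and nn: "\<And>\<omega> i. 0 \<le> x \<omega> i"
    and sub: "\<And>i. 0 \<le> (\<integral>\<omega>. rmax (x \<omega>) i * (x \<omega> (Suc i) - x \<omega> i) \<partial>M)"
  shows "integrable M (\<lambda>\<omega>. (rmax (x \<omega>) n)\<^sup>2)"
    and "(\<integral>\<omega>. (rmax (x \<omega>) n)\<^sup>2 \<partial>M) \<le> 4 * (\<integral>\<omega>. (x \<omega> n)\<^sup>2 \<partial>M)"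
proof -
  show i: "integrable M (\<lambda>\<omega>. (rmax (x \<omega>) n)\<^sup>2)" for n
  proof (rule Bochner_Integration.integrable_bound)
    show "integrable M (\<lambda>\<omega>. \<Sum>i\<le>n. (x \<omega> i)\<^sup>2)" using int by auto
    show "AE \<omega> in M. norm ((rmax (x \<omega>) n)\<^sup>2) \<le> norm (\<Sum>i\<le>n. (x \<omega> i)\<^sup>2)"
      using rmax_sq_le_sum[of "x _" n, OF nn] by (auto simp: sum_nonneg)
  qed measurable
  have j: "integrable M (\<lambda>\<omega>. rmax (x \<omega>) i * (x \<omega> (Suc i) - x \<omega> i))" for i
    unfolding right_diff_distrib
    by (intro Bochner_Integration.integrable_diff integrable_mult_L2 i int) measurable
  have "(\<integral>\<omega>. (rmax (x \<omega>) n)\<^sup>2 \<partial>M) \<le> (\<integral>\<omega>. (rmax (x \<omega>) n)\<^sup>2 \<partial>M) +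
      4 * (\<Sum>i<n. (\<integral>\<omega>. rmax (x \<omega>) i * (x \<omega> (Suc i) - x \<omega> i) \<partial>M))"
    using sub by (simp add: sum_nonneg)
  also have "\<dots> = (\<integral>\<omega>. (rmax (x \<omega>) n)\<^sup>2 + 4 * (\<Sum>i<n. rmax (x \<omega>) i * (x \<omega> (Suc i) - x \<omega> i)) \<partial>M)"
    using i j by (simp add: Bochner_Integration.integral_add Bochner_Integration.integral_sum)
  also have "\<dots> \<le> (\<integral>\<omega>. 4 * (x \<omega> n)\<^sup>2 \<partial>M)"
    using i j int by (intro integral_mono rmax_pathwise_Doob) auto
  finally show "(\<integral>\<omega>. (rmax (x \<omega>) n)\<^sup>2 \<partial>M) \<le> 4 * (\<integral>\<omega>. (x \<omega> n)\<^sup>2 \<partial>M)" by simp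
qed

context prob_space
begin

text \<open>Innovations are indexed by integers, the maximal inequalities by natural numbers; this
  carries independence over to shifted and reversed windows.\<close>

lemma indep_vars_inj:
  assumes ind: "indep_vars M' X K" and f: "inj_on f I" "f ` I \<subseteq> K"
  shows "indep_vars (\<lambda>i. M' (f i)) (\<lambda>i. X (f i)) I"
  unfolding indep_vars_def2 indep_sets_def
proof (intro conjI ballI allI impI)
  let ?F = "\<lambda>i. {X i -` A \<inter> space M |A. A \<in> sets (M' i)}"
  have ins: "indep_sets ?F K" and rv: "\<And>i. i \<in> K \<Longrightarrow> random_variable (M' i) (X i)"
    using ind by (auto simp: indep_vars_def2)
  show "random_variable (M' (f i)) (X (f i))" if "i \<in> I" for i
    using rv[of "f i"] f(2) that by blast
  show "?F (f i) \<subseteq> events" if "i \<in> I" for i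
    using ins[unfolded indep_sets_def, THEN conjunct1] f(2) that by blast
  fix J A assume J: "J \<subseteq> I" "J \<noteq> {}" "finite J" and A: "A \<in> (\<Pi> i\<in>J. ?F (f i))"
  have inj: "inj_on f J" using f(1) J(1) by (rule inj_on_subset)
  \<comment> \<open>The product rule of the original family wants events indexed by its own indices,
    so the events are carried along \<open>f\<close>; injectivity makes this unambiguous.\<close>
  define A' where "A' k = A (inv_into J f k)" for k
  have A': "A' (f j) = A j" if "j \<in> J" for j using inj that by (simp add: A'_def)
  have "A' \<in> (\<Pi> k\<in>f ` J. ?F k)"
  proof (rule Pi_I)
    fix k assume "k \<in> f ` J"
    then obtain j where "j \<in> J" "k = f j" by blast
    then show "A' k \<in> ?F k" using A A'[of j] Pi_mem[OF A, of j] by simp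
  qed
  then have "prob (\<Inter>k\<in>f ` J. A' k) = (\<Prod>k\<in>f ` J. prob (A' k))"
    using ins[unfolded indep_sets_def, THEN conjunct2, rule_format, of "f ` J" A'] J f(2) by fast
  then show "prob (\<Inter>j\<in>J. A j) = (\<Prod>j\<in>J. prob (A j))"
    using inj A' by (simp add: prod.reindex)
qed

lemma integrable_L2: 
  fixes f :: "'a \<Rightarrow> real"
  shows "f \<in> borel_measurable M \<Longrightarrow> integrable M (\<lambda>x. (f x)\<^sup>2) \<Longrightarrow> integrable M f"
  using square_integrable_imp_integrable by blast

text \<open>Being determined by the past is expressed by a measurable \<open>H\<close> of the
  restricted tuple, the form in which independence of disjoint index blocks applies. It plays the
  part of conditioning on the past.\<close>

lemma indep_past_mult:
  fixes y :: "nat \<Rightarrow> 'a \<Rightarrow> real" and g :: "real \<Rightarrow> real"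
  assumes ind: "indep_vars (\<lambda>_. borel) y UNIV"
    and H: "H \<in> borel_measurable (Pi\<^sub>M {..<k} (\<lambda>_. borel))"
    and h: "\<And>\<omega>. h \<omega> = H (restrict (\<lambda>i. y i \<omega>) {..<k})" and ih: "integrable M h"
    and g: "g \<in> borel_measurable borel" and ig: "integrable M (\<lambda>\<omega>. g (y k \<omega>))"
  shows "(\<integral>\<omega>. h \<omega> * g (y k \<omega>) \<partial>M) = (\<integral>\<omega>. h \<omega> \<partial>M) * (\<integral>\<omega>. g (y k \<omega>) \<partial>M)"
proof -
  have "indep_var borel (H \<circ> (\<lambda>\<omega>. restrict (\<lambda>i. y i \<omega>) {..<k})) borel
     ((\<lambda>z. g (z k)) \<circ> (\<lambda>\<omega>. restrict (\<lambda>i. y i \<omega>) {k}))"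
    using H measurable_compose[OF measurable_component_singleton[of k "{k}"] g]
    by (intro indep_var_compose[OF indep_var_restrict[OF ind]]) auto
  moreover have "H \<circ> (\<lambda>\<omega>. restrict (\<lambda>i. y i \<omega>) {..<k}) = h"
    by (simp add: fun_eq_iff h)
  moreover have "(\<lambda>z. g (z k)) \<circ> (\<lambda>\<omega>. restrict (\<lambda>i. y i \<omega>) {k}) = (\<lambda>\<omega>. g (y k \<omega>))"
    by (simp add: fun_eq_iff)
  ultimately show ?thesis
    using indep_var_lebesgue_integral[OF _ ih ig] by metis
qed

lemma indep_past_orthogonal:
  fixes y :: "nat \<Rightarrow> 'a \<Rightarrow> real"
  assumes "indep_vars (\<lambda>_. borel) y UNIV"
    and "H \<in> borel_measurable (Pi\<^sub>M {..<k} (\<lambda>_. borel))"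
    and "\<And>\<omega>. h \<omega> = H (restrict (\<lambda>i. y i \<omega>) {..<k})" and "integrable M h"
    and "integrable M (y k)" "(\<integral>\<omega>. y k \<omega> \<partial>M) = 0"
  shows "(\<integral>\<omega>. h \<omega> * y k \<omega> \<partial>M) = 0"
  using indep_past_mult[of y H k h "\<lambda>x. x", OF assms(1-4)] assms(5,6) by simp

lemma indep_sum_sq:
  fixes y :: "nat \<Rightarrow> 'a \<Rightarrow> real"
  assumes ind: "indep_vars (\<lambda>_. borel) y UNIV"
    and E0: "\<And>i. (\<integral>\<omega>. y i \<omega> \<partial>M) = 0" and int: "\<And>i. integrable M (\<lambda>\<omega>. (y i \<omega>)\<^sup>2)"
  shows "integrable M (\<lambda>\<omega>. (\<Sum>i<n. y i \<omega>)\<^sup>2)"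
    and "(\<integral>\<omega>. (\<Sum>i<n. y i \<omega>)\<^sup>2 \<partial>M) = (\<Sum>i<n. \<integral>\<omega>. (y i \<omega>)\<^sup>2 \<partial>M)"
proof -
  have [measurable]: "y i \<in> borel_measurable M" for i
    using ind by (simp add: indep_vars_def2)
  have *: "integrable M (\<lambda>\<omega>. (\<Sum>i<n. y i \<omega>)\<^sup>2) \<and>
    (\<integral>\<omega>. (\<Sum>i<n. y i \<omega>)\<^sup>2 \<partial>M) = (\<Sum>i<n. \<integral>\<omega>. (y i \<omega>)\<^sup>2 \<partial>M)"
  proof (induction n)
    case (Suc n)
    have iy: "integrable M (y i)" for i by (rule integrable_L2[OF _ int]) simp
    have i1: "integrable M (\<lambda>\<omega>. (\<Sum>i<n. y i \<omega>) * y n \<omega>)"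
      using Suc int by (intro integrable_mult_L2) auto
    have z: "(\<integral>\<omega>. (\<Sum>i<n. y i \<omega>) * y n \<omega> \<partial>M) = 0"
      by (rule indep_past_orthogonal[OF ind, of "\<lambda>z. \<Sum>i<n. z i"]) (use iy E0 in auto)
    have eq: "(\<Sum>i<Suc n. y i \<omega>)\<^sup>2 = (\<Sum>i<n. y i \<omega>)\<^sup>2 + (y n \<omega>)\<^sup>2 + 2 * ((\<Sum>i<n. y i \<omega>) * y n \<omega>)" for \<omega>
      by (simp add: power2_sum)
    have i: "integrable M (\<lambda>\<omega>. (\<Sum>i<n. y i \<omega>)\<^sup>2)" "integrable M (\<lambda>\<omega>. (y n \<omega>)\<^sup>2)"
      "integrable M (\<lambda>\<omega>. 2 * ((\<Sum>i<n. y i \<omega>) * y n \<omega>))"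
      using Suc int i1 by auto
    show ?case
      unfolding eq using i Suc z
      by (simp add: Bochner_Integration.integral_add[OF Bochner_Integration.integrable_add])
  qed simp
  then show "integrable M (\<lambda>\<omega>. (\<Sum>i<n. y i \<omega>)\<^sup>2)"
    and "(\<integral>\<omega>. (\<Sum>i<n. y i \<omega>)\<^sup>2 \<partial>M) = (\<Sum>i<n. \<integral>\<omega>. (y i \<omega>)\<^sup>2 \<partial>M)" by auto
qed

text \<open>Since \<open>\<bar>w + y\<bar> - \<bar>w\<bar> \<ge> sgn w * y\<close>, the weighted
  increment dominates the product of \<open>y k\<close> with a function of the past, and that
  product has mean zero.\<close>

lemma Doob_sum_abs:
  fixes y :: "nat \<Rightarrow> 'a \<Rightarrow> real"
  assumes ind: "indep_vars (\<lambda>_. borel) y UNIV"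
    and E0: "\<And>i. (\<integral>\<omega>. y i \<omega> \<partial>M) = 0" and int: "\<And>i. integrable M (\<lambda>\<omega>. (y i \<omega>)\<^sup>2)"
  shows "integrable M (\<lambda>\<omega>. (rmax (\<lambda>k. \<bar>\<Sum>i<k. y i \<omega>\<bar>) n)\<^sup>2)"
    and "(\<integral>\<omega>. (rmax (\<lambda>k. \<bar>\<Sum>i<k. y i \<omega>\<bar>) n)\<^sup>2 \<partial>M) \<le> 4 * (\<Sum>i<n. \<integral>\<omega>. (y i \<omega>)\<^sup>2 \<partial>M)"
proof -
  have m[measurable]: "y i \<in> borel_measurable M" for i
    using ind by (simp add: indep_vars_def2)
  let ?w = "\<lambda>\<omega> k. \<Sum>i<k. y i \<omega>"
  have iw: "integrable M (\<lambda>\<omega>. \<bar>?w \<omega> k\<bar>\<^sup>2)" for k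
    using indep_sum_sq(1)[OF ind E0 int] by simp
  have ir: "integrable M (\<lambda>\<omega>. (rmax (\<lambda>k. \<bar>?w \<omega> k\<bar>) k)\<^sup>2)" for k
  proof (rule Bochner_Integration.integrable_bound)
    show "integrable M (\<lambda>\<omega>. \<Sum>i\<le>k. \<bar>?w \<omega> i\<bar>\<^sup>2)" using iw by (intro Bochner_Integration.integrable_sum) 
    show "AE \<omega> in M. norm ((rmax (\<lambda>k. \<bar>?w \<omega> k\<bar>) k)\<^sup>2) \<le> norm (\<Sum>i\<le>k. \<bar>?w \<omega> i\<bar>\<^sup>2)"
      using rmax_sq_le_sum[of "\<lambda>k. \<bar>?w _ k\<bar>" k] by (auto simp: sum_nonneg)
  qed measurable
  have sub: "0 \<le> (\<integral>\<omega>. rmax (\<lambda>k. \<bar>?w \<omega> k\<bar>) k * (\<bar>?w \<omega> (Suc k)\<bar> - \<bar>?w \<omega> k\<bar>) \<partial>M)" for k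
  proof -
    define H where "H = (\<lambda>z. rmax (\<lambda>k. \<bar>\<Sum>i<k. z i\<bar>) k * sgn (\<Sum>i<k. z i :: real))"
    have mH: "H \<in> borel_measurable (Pi\<^sub>M {..<k} (\<lambda>_. borel))"
      unfolding H_def by measurable
    have Heq: "H (restrict (\<lambda>i. y i \<omega>) {..<k}) = rmax (\<lambda>k. \<bar>?w \<omega> k\<bar>) k * sgn (?w \<omega> k)" for \<omega>
    proof -
      have "rmax (\<lambda>k. \<bar>\<Sum>i<k. restrict (\<lambda>i. y i \<omega>) {..<k'} i\<bar>) k' = rmax (\<lambda>k. \<bar>?w \<omega> k\<bar>) k'" for k'
        by (intro rmax_cong arg_cong[where f=abs] sum.cong) auto
      then show ?thesis by (simp add: H_def)
    qed
    have irr: "integrable M (\<lambda>\<omega>. rmax (\<lambda>k. \<bar>?w \<omega> k\<bar>) k)"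
      by (rule integrable_L2[OF _ ir]) measurable
    have iH: "integrable M (\<lambda>\<omega>. rmax (\<lambda>k. \<bar>?w \<omega> k\<bar>) k * sgn (?w \<omega> k))"
      by (rule Bochner_Integration.integrable_bound[OF irr]) (auto simp: abs_mult sgn_real_def)
    have iy: "integrable M (y i)" for i by (rule integrable_L2[OF _ int]) simp
    have z: "(\<integral>\<omega>. (rmax (\<lambda>k. \<bar>?w \<omega> k\<bar>) k * sgn (?w \<omega> k)) * y k \<omega> \<partial>M) = 0"
      by (rule indep_past_orthogonal[OF ind mH Heq[symmetric] iH iy E0])
    have "0 = (\<integral>\<omega>. (rmax (\<lambda>k. \<bar>?w \<omega> k\<bar>) k * sgn (?w \<omega> k)) * y k \<omega> \<partial>M)" using z by simp
    also have "\<dots> \<le> (\<integral>\<omega>. rmax (\<lambda>k. \<bar>?w \<omega> k\<bar>) k * (\<bar>?w \<omega> (Suc k)\<bar> - \<bar>?w \<omega> k\<bar>) \<partial>M)"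
    proof (rule integral_mono)
      have "integrable M (\<lambda>\<omega>. (rmax (\<lambda>k. \<bar>?w \<omega> k\<bar>) k * sgn (?w \<omega> k))\<^sup>2)"
        by (rule Bochner_Integration.integrable_bound[OF ir[of k]])
          (auto simp: power_mult_distrib sgn_real_def)
      then show "integrable M (\<lambda>\<omega>. (rmax (\<lambda>k. \<bar>?w \<omega> k\<bar>) k * sgn (?w \<omega> k)) * y k \<omega>)"
        using int by (intro integrable_mult_L2) auto
      show "integrable M (\<lambda>\<omega>. rmax (\<lambda>k. \<bar>?w \<omega> k\<bar>) k * (\<bar>?w \<omega> (Suc k)\<bar> - \<bar>?w \<omega> k\<bar>))"
        unfolding right_diff_distrib using ir iw
        by (intro Bochner_Integration.integrable_diff integrable_mult_L2 ir iw) measurable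
      show "(rmax (\<lambda>k. \<bar>?w \<omega> k\<bar>) k * sgn (?w \<omega> k)) * y k \<omega> \<le> rmax (\<lambda>k. \<bar>?w \<omega> k\<bar>) k * (\<bar>?w \<omega> (Suc k)\<bar> - \<bar>?w \<omega> k\<bar>)" for \<omega>
        unfolding mult.assoc
        by (rule mult_left_mono[OF _ rmax_nonneg]) (auto simp: sgn_real_def abs_if)
    qed
    finally show ?thesis .
  qed
  show "integrable M (\<lambda>\<omega>. (rmax (\<lambda>k. \<bar>\<Sum>i<k. y i \<omega>\<bar>) n)\<^sup>2)"
    by (rule ir)
  show "(\<integral>\<omega>. (rmax (\<lambda>k. \<bar>\<Sum>i<k. y i \<omega>\<bar>) n)\<^sup>2 \<partial>M) \<le> 4 * (\<Sum>i<n. \<integral>\<omega>. (y i \<omega>)\<^sup>2 \<partial>M)"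
    using Doob_L2(2)[of "\<lambda>\<omega> k. \<bar>?w \<omega> k\<bar>" M n, OF _ iw _ sub] indep_sum_sq(2)[OF ind E0 int, of n] by simp
qed

text \<open>In the expansion of the fourth power the terms linear in the new summand or in the old
  sum have mean zero. The rest grows by at most \<open>(6 * n + 1) * B ^ 4\<close>, and
  \<open>3 * n\<^sup>2 + 6 * n + 1\<close> is below \<open>3 * (n + 1)\<^sup>2\<close>.\<close>

lemma indep_sum_pow4:
  fixes y :: "nat \<Rightarrow> 'a \<Rightarrow> real"
  assumes ind: "indep_vars (\<lambda>_. borel) y UNIV"
    and E0: "\<And>i. (\<integral>\<omega>. y i \<omega> \<partial>M) = 0" and bd: "\<And>i \<omega>. \<bar>y i \<omega>\<bar> \<le> B"
  shows "(\<integral>\<omega>. (\<Sum>i<n. y i \<omega>) ^ 4 \<partial>M) \<le> 3 * (real n)\<^sup>2 * B ^ 4"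
proof -
  have [measurable]: "y i \<in> borel_measurable M" for i
    using ind by (simp add: indep_vars_def2)
  have B0: "0 \<le> B" using bd[of 0] by (meson abs_ge_zero order_trans)
  let ?w = "\<lambda>\<omega> k. \<Sum>i<k. y i \<omega>"
  have bw: "\<bar>?w \<omega> k\<bar> \<le> k * B" for k \<omega>
    by (rule order_trans[OF sum_abs]) (use sum_bounded_above[of "{..<k}" "\<lambda>i. \<bar>y i \<omega>\<bar>" B] bd in auto)
  have iw: "integrable M (\<lambda>\<omega>. ?w \<omega> k ^ p)" for k p
    by (rule integrable_const_bound[of _ "(k * B) ^ p"])
      (auto simp: power_abs intro!: power_mono[OF bw])
  have iy: "integrable M (\<lambda>\<omega>. y k \<omega> ^ p)" for k p
    by (rule integrable_const_bound[of _ "B ^ p"]) (auto simp: power_abs intro!: power_mono[OF bd])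
  have i: "integrable M (\<lambda>\<omega>. ?w \<omega> k ^ p * y k \<omega> ^ q)" for k p q
    by (rule integrable_const_bound[of _ "(k * B) ^ p * B ^ q"])
      (auto simp: power_abs abs_mult intro!: AE_I2 mult_mono power_mono bw bd B0 zero_le_power mult_nonneg_nonneg)
  have prod: "(\<integral>\<omega>. ?w \<omega> k ^ p * y k \<omega> ^ q \<partial>M) = (\<integral>\<omega>. ?w \<omega> k ^ p \<partial>M) * (\<integral>\<omega>. y k \<omega> ^ q \<partial>M)" for k p q
    by (rule indep_past_mult[OF ind, of "\<lambda>z. (\<Sum>i<k. z i) ^ p"]) (use iw iy in auto)
  have y2: "(\<integral>\<omega>. y k \<omega> ^ 2 \<partial>M) \<le> B ^ 2" for k
    using integral_mono[OF iy[of k 2] integrable_const[of "B^2"]] power_mono[OF bd, where n=2]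
    by (simp add: prob_space)
  have y4: "(\<integral>\<omega>. y k \<omega> ^ 4 \<partial>M) \<le> B ^ 4" for k
    using integral_mono[OF iy[of k 4] integrable_const[of "B^4"]] power_mono[OF bd, where n=4]
    by (simp add: prob_space)
  have w2: "(\<integral>\<omega>. ?w \<omega> k ^ 2 \<partial>M) \<le> k * B ^ 2" for k
    using indep_sum_sq(2)[OF ind E0 iy, of k] sum_bounded_above[of "{..<k}" "\<lambda>i. \<integral>\<omega>. y i \<omega> ^ 2 \<partial>M"] y2 by simp
  have exp4: "(a + b) ^ 4 = a ^ 4 + 4 * (a ^ 3 * b ^ 1) + 6 * (a ^ 2 * b ^ 2) + 4 * (a ^ 1 * b ^ 3) + b ^ 4" for a b :: real
    by (simp add: power4_eq_xxxx power3_eq_cube power2_eq_square algebra_simps)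
  show ?thesis
  proof (induction n)
    case (Suc n)
    have "(\<integral>\<omega>. ?w \<omega> (Suc n) ^ 4 \<partial>M) = (\<integral>\<omega>. ?w \<omega> n ^ 4 \<partial>M) + 6 * ((\<integral>\<omega>. ?w \<omega> n ^ 2 \<partial>M) * (\<integral>\<omega>. y n \<omega> ^ 2 \<partial>M)) + (\<integral>\<omega>. y n \<omega> ^ 4 \<partial>M)"
    proof -
      have "(\<integral>\<omega>. ?w \<omega> n ^ 1 \<partial>M) = 0"
        using E0 iy[of _ 1] by (simp add: Bochner_Integration.integral_sum)
      moreover have "(\<integral>\<omega>. y n \<omega> ^ 1 \<partial>M) = 0" using E0 by simp
      ultimately show ?thesis
        unfolding sum.lessThan_Suc exp4 using i iw iy
        by (simp add: prod Bochner_Integration.integral_add prob_space del: power_one_right power_0 One_nat_def) 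
    qed
    also have "\<dots> \<le> 3 * (real n)\<^sup>2 * B ^ 4 + 6 * ((n * B ^ 2) * B ^ 2) + B ^ 4"
      using Suc w2[of n] y2[of n] y4[of n] B0
      by (intro add_mono mult_left_mono mult_mono) auto
    also have "\<dots> = (3 * (real n)\<^sup>2 + 6 * n + 1) * B ^ 4"
      by (simp add: algebra_simps power4_eq_xxxx power2_eq_square)
    also have "\<dots> \<le> 3 * (real (Suc n))\<^sup>2 * B ^ 4"
      using B0 by (intro mult_right_mono) (auto simp: power2_eq_square algebra_simps)
    finally show ?case .
  qed simp
qed

text \<open>In \<open>(w + y)\<^sup>2 - w\<^sup>2 = 2 * w * y + y\<^sup>2\<close> the first term has
  mean zero against a factor from the past and the second is nonnegative, so the squares satisfy
  \<open>sub\<close> in \<open>Doob_L2\<close>. The 12 is Doob's 4 times the 3 of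
  \<open>indep_sum_pow4\<close>.\<close>

lemma Doob_sum_sq:
  fixes y :: "nat \<Rightarrow> 'a \<Rightarrow> real"
  assumes ind: "indep_vars (\<lambda>_. borel) y UNIV"
    and E0: "\<And>i. (\<integral>\<omega>. y i \<omega> \<partial>M) = 0" and bd: "\<And>i \<omega>. \<bar>y i \<omega>\<bar> \<le> B"
  shows "integrable M (\<lambda>\<omega>. (rmax (\<lambda>k. (\<Sum>i<k. y i \<omega>)\<^sup>2) n)\<^sup>2)"
    and "(\<integral>\<omega>. (rmax (\<lambda>k. (\<Sum>i<k. y i \<omega>)\<^sup>2) n)\<^sup>2 \<partial>M) \<le> 12 * (real n)\<^sup>2 * B ^ 4"
proof -
  have [measurable]: "y i \<in> borel_measurable M" for i
    using ind by (simp add: indep_vars_def2)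
  have B0: "0 \<le> B" using bd[of 0] by (meson abs_ge_zero order_trans)
  let ?w = "\<lambda>\<omega> k. \<Sum>i<k. y i \<omega>"
  let ?r = "\<lambda>\<omega> k. rmax (\<lambda>k. (?w \<omega> k)\<^sup>2) k"
  have bw: "\<bar>?w \<omega> k\<bar> \<le> k * B" for k \<omega>
    by (rule order_trans[OF sum_abs]) (use sum_bounded_above[of "{..<k}" "\<lambda>i. \<bar>y i \<omega>\<bar>" B] bd in auto)
  have bw2: "(?w \<omega> k)\<^sup>2 \<le> (k * B)\<^sup>2" for k \<omega>
    using power_mono[OF bw, where n=2] by simp
  have br: "\<bar>?r \<omega> k\<bar> \<le> (k * B)\<^sup>2" for k \<omega>
  proof -
    obtain i where "i \<le> k" "?r \<omega> k = (?w \<omega> i)\<^sup>2" using rmax_attained by metis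
    moreover have "(real i * B)\<^sup>2 \<le> (real k * B)\<^sup>2" if "i \<le> k"
      using that B0 by (intro power_mono mult_right_mono) auto
    ultimately show ?thesis using bw2[of \<omega> i] by simp
  qed
  have iw: "integrable M (\<lambda>\<omega>. ((?w \<omega> k)\<^sup>2)\<^sup>2)" for k
    by (rule integrable_const_bound[of _ "((k * B)\<^sup>2)\<^sup>2"])
      (use power_mono[OF bw2, where n=2] in \<open>auto simp del: power_mult_distrib\<close>)
  have sub: "0 \<le> (\<integral>\<omega>. ?r \<omega> k * ((?w \<omega> (Suc k))\<^sup>2 - (?w \<omega> k)\<^sup>2) \<partial>M)" for k
  proof -
    define H where "H = (\<lambda>z. rmax (\<lambda>k. (\<Sum>i<k. z i)\<^sup>2) k * (\<Sum>i<k. z i :: real))"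
    have mH: "H \<in> borel_measurable (Pi\<^sub>M {..<k} (\<lambda>_. borel))"
      unfolding H_def by measurable
    have Heq: "H (restrict (\<lambda>i. y i \<omega>) {..<k}) = ?r \<omega> k * ?w \<omega> k" for \<omega>
    proof -
      have "rmax (\<lambda>k. (\<Sum>i<k. restrict (\<lambda>i. y i \<omega>) {..<k'} i)\<^sup>2) k' = rmax (\<lambda>k. (?w \<omega> k)\<^sup>2) k'" for k'
        by (intro rmax_cong arg_cong[where f="\<lambda>x. x\<^sup>2"] sum.cong) auto
      then show ?thesis by (simp add: H_def)
    qed
    have iH: "integrable M (\<lambda>\<omega>. ?r \<omega> k * ?w \<omega> k)"
      by (rule integrable_const_bound[of _ "(k * B)\<^sup>2 * (k * B)"])
        (use bw br B0 in \<open>auto simp: abs_mult intro!: mult_mono\<close>)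
    have iy: "integrable M (y i)" for i
      by (rule integrable_const_bound[of _ B]) (use bd in auto)
    have i1: "integrable M (\<lambda>\<omega>. (?r \<omega> k * ?w \<omega> k) * y k \<omega>)"
      by (rule integrable_const_bound[of _ "(k * B)\<^sup>2 * (k * B) * B"])
        (use bw br bd B0 in \<open>auto simp: abs_mult intro!: mult_mono\<close>)
    have z: "(\<integral>\<omega>. (?r \<omega> k * ?w \<omega> k) * y k \<omega> \<partial>M) = 0"
      by (rule indep_past_orthogonal[OF ind mH Heq[symmetric] iH iy E0])
    have i2: "integrable M (\<lambda>\<omega>. ?r \<omega> k * (y k \<omega>)\<^sup>2)"
      by (rule integrable_const_bound[of _ "(k * B)\<^sup>2 * B\<^sup>2"])
        (use br power_mono[OF bd, where n=2] in \<open>auto simp: abs_mult intro!: mult_mono\<close>)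
    have "(\<integral>\<omega>. ?r \<omega> k * ((?w \<omega> (Suc k))\<^sup>2 - (?w \<omega> k)\<^sup>2) \<partial>M) =
        (\<integral>\<omega>. 2 * ((?r \<omega> k * ?w \<omega> k) * y k \<omega>) + ?r \<omega> k * (y k \<omega>)\<^sup>2 \<partial>M)"
      by (intro Bochner_Integration.integral_cong) (auto simp: power2_sum algebra_simps)
    also have "\<dots> = (\<integral>\<omega>. ?r \<omega> k * (y k \<omega>)\<^sup>2 \<partial>M)"
      using i1 i2 z by simp
    also have "\<dots> \<ge> 0"
      by (intro integral_nonneg_AE AE_I2 mult_nonneg_nonneg rmax_nonneg) auto
    finally show ?thesis .
  qed
  show "integrable M (\<lambda>\<omega>. (rmax (\<lambda>k. (\<Sum>i<k. y i \<omega>)\<^sup>2) n)\<^sup>2)"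
    using Doob_L2(1)[of "\<lambda>\<omega> k. (?w \<omega> k)\<^sup>2" M n, OF _ iw _ sub] by simp
  have "(\<integral>\<omega>. (?r \<omega> n)\<^sup>2 \<partial>M) \<le> 4 * (\<integral>\<omega>. ((?w \<omega> n)\<^sup>2)\<^sup>2 \<partial>M)"
    using Doob_L2(2)[of "\<lambda>\<omega> k. (?w \<omega> k)\<^sup>2" M n, OF _ iw _ sub] by simp
  also have "\<dots> = 4 * (\<integral>\<omega>. ?w \<omega> n ^ 4 \<partial>M)" by simp
  also have "\<dots> \<le> 4 * (3 * (real n)\<^sup>2 * B ^ 4)"
    using indep_sum_pow4[OF ind E0 bd] by (intro mult_left_mono) auto
  finally show "(\<integral>\<omega>. (?r \<omega> n)\<^sup>2 \<partial>M) \<le> 12 * (real n)\<^sup>2 * B ^ 4" by simp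
qed


section \<open>Almost sure convergence of centred series\<close>

text \<open>\<open>T m\<close> is the squared largest fluctuation after time \<open>m\<close>. Doob
  bounds its mean by four times the tail of the variances, so the infimum over \<open>m\<close>
  vanishes almost surely, which is the Cauchy criterion.\<close>

lemma kolmogorov_summable:
  fixes y :: "nat \<Rightarrow> 'a \<Rightarrow> real"
  assumes ind: "indep_vars (\<lambda>_. borel) y UNIV"
    and E0: "\<And>i. (\<integral>\<omega>. y i \<omega> \<partial>M) = 0" and int: "\<And>i. integrable M (\<lambda>\<omega>. (y i \<omega>)\<^sup>2)"
    and summ: "summable (\<lambda>i. \<integral>\<omega>. (y i \<omega>)\<^sup>2 \<partial>M)"
  shows "AE \<omega> in M. summable (\<lambda>i. y i \<omega>)"
proof -
  have [measurable]: "y i \<in> borel_measurable M" for i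
    using ind by (simp add: indep_vars_def2)
  define v where "v i = (\<integral>\<omega>. (y i \<omega>)\<^sup>2 \<partial>M)" for i
  have v0: "0 \<le> v i" for i by (simp add: v_def)
  define R where "R m n \<omega> = rmax (\<lambda>k. \<bar>\<Sum>i<k. y (i + m) \<omega>\<bar>) n" for m n \<omega>
  have [measurable]: "R m n \<in> borel_measurable M" for m n
    unfolding R_def by measurable
  define T where "T m \<omega> = (SUP n. ennreal ((R m n \<omega>)\<^sup>2))" for m \<omega>
  have [measurable]: "T m \<in> borel_measurable M" for m
    unfolding T_def by measurable
  have T: "(\<integral>\<^sup>+\<omega>. T m \<omega> \<partial>M) \<le> ennreal (4 * (\<Sum>i. v (i + m)))" for m
  proof -
    have ind': "indep_vars (\<lambda>_. borel) (\<lambda>i. y (i + m)) UNIV"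
      using indep_vars_inj[OF ind, of "\<lambda>i. i + m" UNIV] by (simp add: inj_on_def)
    have "incseq (\<lambda>n. ennreal ((R m n \<omega>)\<^sup>2))" for \<omega>
      by (intro incseq_SucI ennreal_leI power_mono) (auto simp: R_def intro: rmax_nonneg)
    then have "(\<integral>\<^sup>+\<omega>. T m \<omega> \<partial>M) = (SUP n. \<integral>\<^sup>+\<omega>. ennreal ((R m n \<omega>)\<^sup>2) \<partial>M)"
      unfolding T_def by (intro nn_integral_monotone_convergence_SUP) (auto simp: incseq_def le_fun_def)
    also have "\<dots> \<le> ennreal (4 * (\<Sum>i. v (i + m)))"
    proof (intro SUP_least)
      fix n
      have "(\<integral>\<^sup>+\<omega>. ennreal ((R m n \<omega>)\<^sup>2) \<partial>M) = ennreal (\<integral>\<omega>. (R m n \<omega>)\<^sup>2 \<partial>M)"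
        using Doob_sum_abs(1)[OF ind' E0 int] unfolding R_def by (intro nn_integral_eq_integral) auto
      also have "\<dots> \<le> ennreal (4 * (\<Sum>i<n. v (i + m)))"
        using Doob_sum_abs(2)[OF ind' E0 int, of n] unfolding R_def v_def by (intro ennreal_leI) auto
      also have "\<dots> \<le> ennreal (4 * (\<Sum>i. v (i + m)))"
        using summable_ignore_initial_segment[OF summ, of m] v0
        by (intro ennreal_leI mult_left_mono sum_le_suminf) (auto simp: v_def[abs_def])
      finally show "(\<integral>\<^sup>+\<omega>. ennreal ((R m n \<omega>)\<^sup>2) \<partial>M) \<le> ennreal (4 * (\<Sum>i. v (i + m)))" .
    qed
    finally show ?thesis .
  qed
  have "(\<integral>\<^sup>+\<omega>. (INF m. T m \<omega>) \<partial>M) \<le> 0"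
  proof (rule LIMSEQ_le_const)
    have "(\<lambda>m. \<Sum>i. v (i + m)) \<longlonglongrightarrow> 0"
      using summ suminf_exist_split2[of v] by (simp add: v_def[abs_def])
    then have "(\<lambda>m. 4 * (\<Sum>i. v (i + m))) \<longlonglongrightarrow> 4 * 0"
      by (intro tendsto_intros)
    then show "(\<lambda>m. ennreal (4 * (\<Sum>i. v (i + m)))) \<longlonglongrightarrow> 0"
      using tendsto_ennrealI by fastforce
    have "(\<integral>\<^sup>+\<omega>. (INF m. T m \<omega>) \<partial>M) \<le> ennreal (4 * (\<Sum>i. v (i + m)))" for m
      by (rule order_trans[OF nn_integral_mono T]) (auto intro: INF_lower)
    then show "\<exists>N. \<forall>m\<ge>N. (\<integral>\<^sup>+\<omega>. (INF m. T m \<omega>) \<partial>M) \<le> ennreal (4 * (\<Sum>i. v (i + m)))"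
      by blast
  qed
  then have "AE \<omega> in M. (INF m. T m \<omega>) = 0"
    by (subst (asm) le_zero_eq, subst (asm) nn_integral_0_iff_AE) auto
  then show ?thesis
  proof eventually_elim
    case (elim \<omega>)
    show ?case
      unfolding summable_Cauchy
    proof safe
      fix e :: real assume "0 < e"
      then have "(INF m. T m \<omega>) < ennreal ((e/2)\<^sup>2)" using elim by simp
      then obtain m where m: "T m \<omega> < ennreal ((e/2)\<^sup>2)" by (auto simp: INF_less_iff)
      have small: "\<bar>\<Sum>i<k. y (i + m) \<omega>\<bar> < e/2" for k
      proof -
        have "ennreal ((R m k \<omega>)\<^sup>2) \<le> T m \<omega>" unfolding T_def by (rule SUP_upper) simp
        also note m
        finally have "(R m k \<omega>)\<^sup>2 < (e/2)\<^sup>2" by (simp add: ennreal_less_iff)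
        then have "R m k \<omega> < e/2" by (rule power_less_imp_less_base) (use \<open>0 < e\<close> in simp)
        then show ?thesis using rmax_ge[of k k "\<lambda>k. \<bar>\<Sum>i<k. y (i + m) \<omega>\<bar>"] by (simp add: R_def)
      qed
      \<comment> \<open>An arbitrary stretch is a difference of two sums started at
        \<open>m\<close>, which is why each was kept below \<open>e/2\<close>.\<close>
      have "norm (sum (\<lambda>i. y i \<omega>) {a..<b}) < e" if "a \<ge> m" for a b
      proof (cases "a \<le> b")
        case True
        have sh: "(\<Sum>i<c - m. y (i + m) \<omega>) = (\<Sum>i\<in>{m..<c}. y i \<omega>)" if "c \<ge> m" for c
          using sum.shift_bounds_nat_ivl[of "\<lambda>i. y i \<omega>" 0 m "c - m"] that
          by (simp add: lessThan_atLeast0)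
        have "sum (\<lambda>i. y i \<omega>) {m..<a} + sum (\<lambda>i. y i \<omega>) {a..<b} = sum (\<lambda>i. y i \<omega>) {m..<b}"
          using that True by (intro sum.atLeastLessThan_concat) auto
        then show ?thesis
          using small[of "a - m"] small[of "b - m"] sh[of a] sh[of b] that True by auto
      qed (use \<open>0 < e\<close> in simp)
      then show "\<exists>N. \<forall>m\<ge>N. \<forall>n. norm (sum (\<lambda>i. y i \<omega>) {m..<n}) < e" by blast
    qed
  qed
qed

end

section \<open>Modulus of continuity of a random walk\<close>

text \<open>Squares are kept so that integrating over \<open>s\<close> and taking a root bounds the
  norms of all short increments at once.\<close>

definition wmod :: "nat \<Rightarrow> nat \<Rightarrow> (nat \<Rightarrow> real) \<Rightarrow> real" where
  "wmod N L z = Max ((\<lambda>(a, b). (\<Sum>i\<in>{a..<b}. z i)\<^sup>2) ` {(a, b). a \<le> b \<and> b \<le> N \<and> b - a \<le> L})"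

lemma finite_wmod: "finite {(a, b). a \<le> b \<and> b \<le> (N::nat) \<and> b - a \<le> L}"
  by (rule finite_subset[of _ "{..N} \<times> {..N}"]) auto

lemma wmod_ge: "a \<le> b \<Longrightarrow> b \<le> N \<Longrightarrow> b - a \<le> L \<Longrightarrow> (\<Sum>i\<in>{a..<b}. z i)\<^sup>2 \<le> wmod N L z"
  unfolding wmod_def by (rule Max_ge) (use finite_wmod in auto)

lemma wmod_le:
  assumes "\<And>a b. a \<le> b \<Longrightarrow> b \<le> N \<Longrightarrow> b - a \<le> L \<Longrightarrow> (\<Sum>i\<in>{a..<b}. z i)\<^sup>2 \<le> c"
  shows "wmod N L z \<le> c"
  unfolding wmod_def using assms finite_wmod[of N L] by (subst Max_le_iff) (auto intro!: exI[of _ 0])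

lemma wmod_nonneg: "0 \<le> wmod N L z"
  using wmod_ge[of 0 0 N L z] by simp

lemma measurable_wmod[measurable (raw)]:
  assumes [measurable]: "\<And>i. (\<lambda>\<omega>. z \<omega> i) \<in> borel_measurable M"
  shows "(\<lambda>\<omega>. wmod N L (z \<omega>)) \<in> borel_measurable M"
proof -
  have "(\<lambda>\<omega>. Max ((\<lambda>p. (\<Sum>i\<in>{fst p..<snd p}. z \<omega> i)\<^sup>2) ` {(a, b). a \<le> b \<and> b \<le> N \<and> b - a \<le> L})) \<in> borel_measurable M"
    by (rule borel_measurable_Max[OF finite_wmod]) measurable
  then show ?thesis by (simp add: wmod_def case_prod_beta')
qed

lemma wmod_add: "wmod N L (\<lambda>i. y i + z i) \<le> 2 * wmod N L y + 2 * wmod N L z"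
proof (rule wmod_le)
  fix a b assume ab: "a \<le> b" "b \<le> N" "b - a \<le> L"
  have "(p + q)\<^sup>2 \<le> 2 * p\<^sup>2 + 2 * q\<^sup>2" for p q :: real
    using sum_squares_bound[of p q] by (simp add: power2_sum)
  then have "(\<Sum>i\<in>{a..<b}. y i + z i)\<^sup>2 \<le> 2 * (\<Sum>i\<in>{a..<b}. y i)\<^sup>2 + 2 * (\<Sum>i\<in>{a..<b}. z i)\<^sup>2"
    by (simp add: sum.distrib)
  with wmod_ge[OF ab, of y] wmod_ge[OF ab, of z]
  show "(\<Sum>i\<in>{a..<b}. y i + z i)\<^sup>2 \<le> 2 * wmod N L y + 2 * wmod N L z" by linarith
qed

lemma wmod_le_rmax: "wmod N L z \<le> 4 * (rmax (\<lambda>k. \<bar>\<Sum>i<k. z i\<bar>) N)\<^sup>2"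
proof (rule wmod_le)
  fix a b assume ab: "a \<le> b" "b \<le> N"
  let ?r = "rmax (\<lambda>k. \<bar>\<Sum>i<k. z i\<bar>) N"
  have "(\<Sum>i\<in>{a..<b}. z i) = (\<Sum>i<b. z i) - (\<Sum>i<a. z i)"
    using sum.atLeastLessThan_concat[of 0 a b z] ab by (simp add: lessThan_atLeast0)
  then have "\<bar>\<Sum>i\<in>{a..<b}. z i\<bar> \<le> 2 * ?r"
    using rmax_ge[of a N "\<lambda>k. \<bar>\<Sum>i<k. z i\<bar>"] rmax_ge[of b N "\<lambda>k. \<bar>\<Sum>i<k. z i\<bar>"] ab by simp
  then have "\<bar>\<Sum>i\<in>{a..<b}. z i\<bar>\<^sup>2 \<le> (2 * ?r)\<^sup>2" by (intro power_mono) auto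
  then show "(\<Sum>i\<in>{a..<b}. z i)\<^sup>2 \<le> 4 * ?r\<^sup>2" by (simp add: power_mult_distrib)
qed

text \<open>An increment of at most \<open>L\<close> steps starts in some block of length
  \<open>L\<close> and ends within \<open>2 * L\<close> steps of the left end of that block, so it
  is a difference of two partial sums started there. The maximum over blocks is bounded by the sum
  only after squaring, which is cheap because each block then contributes order
  \<open>L\<^sup>2\<close>.\<close>

lemma wmod_sq_le_blocks:
  assumes L: "1 \<le> L"
  shows "(wmod N L z)\<^sup>2 \<le> 16 * (\<Sum>q\<le>N div L. (rmax (\<lambda>k. (\<Sum>i<k. z (i + q * L))\<^sup>2) (2 * L))\<^sup>2)"
proof -
  define R where "R q = rmax (\<lambda>k. (\<Sum>i<k. z (i + q * L))\<^sup>2) (2 * L)" for q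
  have R0: "0 \<le> R q" for q unfolding R_def by (rule rmax_nonneg) simp
  have sh: "(\<Sum>i<k. z (i + q * L)) = (\<Sum>i<q * L + k. z i) - (\<Sum>i<q * L. z i)" for k q
    using sum.atLeastLessThan_concat[of 0 "q * L" "q * L + k" z]
      sum.shift_bounds_nat_ivl[of z 0 "q * L" k] by (simp add: lessThan_atLeast0 add.commute)
  have key: "\<exists>q\<le>N div L. (\<Sum>i\<in>{a..<b}. z i)\<^sup>2 \<le> 4 * R q" if ab: "a \<le> b" "b \<le> N" "b - a \<le> L" for a b
  proof (intro exI conjI)
    let ?q = "a div L"
    show "?q \<le> N div L" using ab by (intro div_le_mono) auto
    have q: "?q * L \<le> a" "a < ?q * L + L"
      using L dividend_less_div_times[of L a] by auto
    let ?A = "\<Sum>i<a - ?q * L. z (i + ?q * L)" and ?B = "\<Sum>i<b - ?q * L. z (i + ?q * L)"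
    have "(\<Sum>i\<in>{a..<b}. z i) = (\<Sum>i<b. z i) - (\<Sum>i<a. z i)"
      using sum.atLeastLessThan_concat[of 0 a b z] ab by (simp add: lessThan_atLeast0)
    also have "\<dots> = ?B - ?A"
    proof -
      have "?q * L + (b - ?q * L) = b" "?q * L + (a - ?q * L) = a" using q ab by linarith+
      then show ?thesis unfolding sh by simp
    qed
    finally have e: "(\<Sum>i\<in>{a..<b}. z i) = ?B - ?A" .
    have "?A\<^sup>2 \<le> R ?q" "?B\<^sup>2 \<le> R ?q"
      unfolding R_def using q ab
      by (auto intro!: rmax_ge[where x="\<lambda>k. (\<Sum>i<k. z (i + a div L * L))\<^sup>2"])
    moreover have "(?B - ?A)\<^sup>2 \<le> 2 * ?A\<^sup>2 + 2 * ?B\<^sup>2"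
      using sum_squares_bound[of "-?A" ?B] by (simp add: power2_diff mult_ac)
    ultimately show "(\<Sum>i\<in>{a..<b}. z i)\<^sup>2 \<le> 4 * R ?q" unfolding e by linarith
  qed
  have "wmod N L z \<in> (\<lambda>(a, b). (\<Sum>i\<in>{a..<b}. z i)\<^sup>2) ` {(a, b). a \<le> b \<and> b \<le> N \<and> b - a \<le> L}"
    unfolding wmod_def by (rule Max_in[OF finite_imageI[OF finite_wmod]]) (auto intro!: exI[of _ 0])
  then obtain a b where ab: "a \<le> b" "b \<le> N" "b - a \<le> L" "wmod N L z = (\<Sum>i\<in>{a..<b}. z i)\<^sup>2"
    by auto
  obtain q where q: "q \<le> N div L" "wmod N L z \<le> 4 * R q"
    using key[OF ab(1-3)] ab(4) by metis
  have "(wmod N L z)\<^sup>2 \<le> (4 * R q)\<^sup>2" using q wmod_nonneg by (intro power_mono) auto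
  also have "\<dots> = 16 * (R q)\<^sup>2" by (simp add: power_mult_distrib)
  also have "\<dots> \<le> 16 * (\<Sum>q\<le>N div L. (R q)\<^sup>2)"
    using q member_le_sum[of q "{..N div L}" "\<lambda>q. (R q)\<^sup>2"] by simp
  finally show ?thesis by (simp add: R_def)
qed

context prob_space
begin

text \<open>Every increment is a difference of two partial sums, so short ones gain nothing here;
  the 16 is the 4 of \<open>wmod_le_rmax\<close> times Doob's 4. It gives integrability and handles
  the small variance left over by truncation.\<close>

lemma wmod_expectation_crude:
  fixes y :: "nat \<Rightarrow> 'a \<Rightarrow> real"
  assumes ind: "indep_vars (\<lambda>_. borel) y UNIV"
    and E0: "\<And>i. (\<integral>\<omega>. y i \<omega> \<partial>M) = 0" and int: "\<And>i. integrable M (\<lambda>\<omega>. (y i \<omega>)\<^sup>2)"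
    and v: "\<And>i. (\<integral>\<omega>. (y i \<omega>)\<^sup>2 \<partial>M) \<le> v"
  shows "integrable M (\<lambda>\<omega>. wmod N L (\<lambda>i. y i \<omega>))"
    and "(\<integral>\<omega>. wmod N L (\<lambda>i. y i \<omega>) \<partial>M) \<le> 16 * real N * v"
proof -
  have [measurable]: "y i \<in> borel_measurable M" for i
    using ind by (simp add: indep_vars_def2)
  note D = Doob_sum_abs[OF ind E0 int, of N]
  show i: "integrable M (\<lambda>\<omega>. wmod N L (\<lambda>i. y i \<omega>))"
    by (rule Bochner_Integration.integrable_bound[OF integrable_mult_right[OF D(1), of 4]])
      (use wmod_le_rmax wmod_nonneg in \<open>auto simp: abs_of_nonneg\<close>)
  have "(\<integral>\<omega>. wmod N L (\<lambda>i. y i \<omega>) \<partial>M) \<le> (\<integral>\<omega>. 4 * (rmax (\<lambda>k. \<bar>\<Sum>i<k. y i \<omega>\<bar>) N)\<^sup>2 \<partial>M)"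
    using i D(1) by (intro integral_mono wmod_le_rmax) auto
  also have "\<dots> \<le> 4 * (4 * (\<Sum>i<N. v))"
    using D(2) sum_mono[of "{..<N}" "\<lambda>i. \<integral>\<omega>. (y i \<omega>)\<^sup>2 \<partial>M" "\<lambda>_. v"] v
    by (simp add: mult.commute)
  finally show "(\<integral>\<omega>. wmod N L (\<lambda>i. y i \<omega>) \<partial>M) \<le> 16 * real N * v" by simp
qed

text \<open>Each of the at most \<open>2 * N / L\<close> blocks contributes order
  \<open>L\<^sup>2 * B ^ 4\<close> to the second moment, in all \<open>N * L * B ^ 4\<close>. After
  taking the root this beats the crude order \<open>N\<close> when \<open>L\<close> is a small
  fraction of \<open>N\<close>.\<close>

lemma wmod_expectation_bounded:
  fixes y :: "nat \<Rightarrow> 'a \<Rightarrow> real"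
  assumes ind: "indep_vars (\<lambda>_. borel) y UNIV"
    and E0: "\<And>i. (\<integral>\<omega>. y i \<omega> \<partial>M) = 0" and bd: "\<And>i \<omega>. \<bar>y i \<omega>\<bar> \<le> B"
    and L: "1 \<le> L" "L \<le> N"
  shows "(\<integral>\<omega>. wmod N L (\<lambda>i. y i \<omega>) \<partial>M) \<le> 40 * sqrt (N * L) * B\<^sup>2"
proof -
  have [measurable]: "y i \<in> borel_measurable M" for i
    using ind by (simp add: indep_vars_def2)
  have B0: "0 \<le> B" using bd[of 0] by (meson abs_ge_zero order_trans)
  define R where "R q \<omega> = rmax (\<lambda>k. (\<Sum>i<k. y (i + q * L) \<omega>)\<^sup>2) (2 * L)" for q \<omega>
  have ind': "indep_vars (\<lambda>_. borel) (\<lambda>i. y (i + m)) UNIV" for m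
    using indep_vars_inj[OF ind, of "\<lambda>i. i + m" UNIV] by (simp add: inj_on_def)
  note D = Doob_sum_sq[OF ind' E0 bd, of _ "2 * L", folded R_def]
  have iR: "integrable M (\<lambda>\<omega>. (R q \<omega>)\<^sup>2)" for q using D(1)[of "q * L"] by (simp add: R_def)
  have ER: "(\<integral>\<omega>. (R q \<omega>)\<^sup>2 \<partial>M) \<le> 12 * (real (2 * L))\<^sup>2 * B ^ 4" for q
    using D(2)[of "q * L"] by (simp add: R_def)
  let ?w = "\<lambda>\<omega>. wmod N L (\<lambda>i. y i \<omega>)"
  have w2: "(?w \<omega>)\<^sup>2 \<le> 16 * (\<Sum>q\<le>N div L. (R q \<omega>)\<^sup>2)" for \<omega>
    using wmod_sq_le_blocks[OF L(1), of N "\<lambda>i. y i \<omega>"] by (simp add: R_def)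
  have i16: "integrable M (\<lambda>\<omega>. 16 * (\<Sum>q\<le>N div L. (R q \<omega>)\<^sup>2))"
    using iR by auto
  have iw2: "integrable M (\<lambda>\<omega>. (?w \<omega>)\<^sup>2)"
    by (rule Bochner_Integration.integrable_bound[OF i16]) (use w2 in \<open>auto simp: sum_nonneg\<close>)
  have "(\<integral>\<omega>. (?w \<omega>)\<^sup>2 \<partial>M) \<le> (\<integral>\<omega>. 16 * (\<Sum>q\<le>N div L. (R q \<omega>)\<^sup>2) \<partial>M)"
    by (intro integral_mono iw2 i16 w2)
  also have "\<dots> = 16 * (\<Sum>q\<le>N div L. (\<integral>\<omega>. (R q \<omega>)\<^sup>2 \<partial>M))"
    using iR by (simp add: Bochner_Integration.integral_sum)
  also have "\<dots> \<le> 16 * (\<Sum>q\<le>N div L. 12 * (real (2 * L))\<^sup>2 * B ^ 4)"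
    by (intro mult_left_mono sum_mono ER) auto
  \<comment> \<open>\<open>768 = 16 * 12 * 4\<close>, the last factor coming from
    \<open>(2 * L)\<^sup>2\<close>.\<close>
  also have "\<dots> = 768 * (real (N div L) + 1) * (real L)\<^sup>2 * B ^ 4"
    by (simp add: power_mult_distrib)
  also have "\<dots> \<le> 768 * (2 * (real N / L)) * (real L)\<^sup>2 * B ^ 4"
  proof -
    have "real (N div L) \<le> real N / L" by (rule of_nat_div_le_of_nat)
    moreover have "1 \<le> real N / L" using L by simp
    ultimately show ?thesis using B0 by (intro mult_right_mono mult_left_mono) auto
  qed
  also have "\<dots> = 1536 * (N * L) * B ^ 4"
    using L by (simp add: power2_eq_square)
  \<comment> \<open>Rounded up to the square \<open>1600 = 40\<^sup>2\<close>, so that the root is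
    explicit.\<close>
  also have "\<dots> \<le> 1600 * (N * L) * B ^ 4"
    using B0 by (intro mult_right_mono) auto
  also have "\<dots> = (40 * sqrt (N * L) * B\<^sup>2)\<^sup>2"
    by (simp add: power_mult_distrib)
  finally have E2: "(\<integral>\<omega>. (?w \<omega>)\<^sup>2 \<partial>M) \<le> (40 * sqrt (N * L) * B\<^sup>2)\<^sup>2" .
  have "(\<integral>\<omega>. ?w \<omega> \<partial>M)\<^sup>2 \<le> (\<integral>\<omega>. (?w \<omega>)\<^sup>2 \<partial>M)"
    using variance_positive[of ?w] variance_eq[OF integrable_L2[OF _ iw2] iw2] by simp
  also note E2
  finally show ?thesis
    using B0 by (intro power2_le_imp_le[of "(\<integral>\<omega>. ?w \<omega> \<partial>M)"]) auto
qed

text \<open>The centred truncation is bounded by \<open>2 * A\<close> and gets the fourth-moment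
  bound; the centred remainder has variance at most \<open>\<tau>\<close> and gets the crude one.
  \<open>320 = 2 * 40 * 4\<close> and \<open>32 = 2 * 16\<close>, the 2 coming from
  \<open>wmod_add\<close>.\<close>

lemma wmod_expectation_truncated:
  fixes y :: "nat \<Rightarrow> 'a \<Rightarrow> real"
  assumes ind: "indep_vars (\<lambda>_. borel) y UNIV"
    and E0: "\<And>i. (\<integral>\<omega>. y i \<omega> \<partial>M) = 0" and int: "\<And>i. integrable M (\<lambda>\<omega>. (y i \<omega>)\<^sup>2)"
    and A: "0 \<le> A" and \<tau>: "\<And>i. (\<integral>\<omega>. (y i \<omega>)\<^sup>2 * indicator {x. A < \<bar>x\<bar>} (y i \<omega>) \<partial>M) \<le> \<tau>"
    and L: "1 \<le> L" "L \<le> N"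
  shows "(\<integral>\<omega>. wmod N L (\<lambda>i. y i \<omega>) \<partial>M) \<le> 32 * real N * \<tau> + 320 * sqrt (N * L) * A\<^sup>2"
proof -
  have [measurable]: "y i \<in> borel_measurable M" for i
    using ind by (simp add: indep_vars_def2)
  have iy: "integrable M (y i)" for i
    by (rule integrable_L2[OF _ int]) simp
  define I where "I = (indicator {x. A < \<bar>x\<bar>} :: real \<Rightarrow> real)"
  have [measurable]: "I \<in> borel_measurable borel" unfolding I_def by measurable
  have I01: "I x = 0 \<or> I x = 1" for x by (simp add: I_def indicator_def)
  define f where "f i = (\<integral>\<omega>. y i \<omega> * I (y i \<omega>) \<partial>M)" for i
  \<comment> \<open>As \<open>y i\<close> is centred, its two pieces have opposite means, and the
    one number \<open>f i\<close> centres both.\<close>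
  define y1 where "y1 i \<omega> = y i \<omega> * (1 - I (y i \<omega>)) + f i" for i \<omega>
  define y2 where "y2 i \<omega> = y i \<omega> * I (y i \<omega>) - f i" for i \<omega>
  have sum: "y i \<omega> = y1 i \<omega> + y2 i \<omega>" for i \<omega> by (simp add: y1_def y2_def algebra_simps)
  have ind1: "indep_vars (\<lambda>_. borel) y1 UNIV"
    using indep_vars_compose2[OF ind, of "\<lambda>i x. x * (1 - I x) + f i" "\<lambda>_. borel"] by (simp add: y1_def[abs_def])
  have ind2: "indep_vars (\<lambda>_. borel) y2 UNIV"
    using indep_vars_compose2[OF ind, of "\<lambda>i x. x * I x - f i" "\<lambda>_. borel"] by (simp add: y2_def[abs_def])
  have iyI: "integrable M (\<lambda>\<omega>. y i \<omega> * I (y i \<omega>))" for i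
    by (rule Bochner_Integration.integrable_bound[OF iy[of i]]) (auto simp: abs_mult I_def indicator_def)
  have iyI2: "integrable M (\<lambda>\<omega>. (y i \<omega> * I (y i \<omega>))\<^sup>2)" for i
  proof (rule Bochner_Integration.integrable_bound[OF int[of i]])
    show "AE x in M. norm ((y i x * I (y i x))\<^sup>2) \<le> norm ((y i x)\<^sup>2)"
    proof (rule AE_I2)
      show "norm ((y i x * I (y i x))\<^sup>2) \<le> norm ((y i x)\<^sup>2)" for x
        using I01[of "y i x"] by auto
    qed
  qed simp
  have E2: "(\<integral>\<omega>. y2 i \<omega> \<partial>M) = 0" for i
    using iyI by (simp add: y2_def f_def prob_space)
  have E1: "(\<integral>\<omega>. y1 i \<omega> \<partial>M) = 0" for i
    using iyI iy E0 by (simp add: y1_def f_def prob_space right_diff_distrib)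
  have i2: "integrable M (\<lambda>\<omega>. (y2 i \<omega>)\<^sup>2)" for i
    unfolding y2_def power2_diff using iyI iyI2 by simp
  have v2: "(\<integral>\<omega>. (y2 i \<omega>)\<^sup>2 \<partial>M) \<le> \<tau>" for i
  proof -
    have "(\<integral>\<omega>. (y2 i \<omega>)\<^sup>2 \<partial>M) \<le> (\<integral>\<omega>. (y i \<omega> * I (y i \<omega>))\<^sup>2 \<partial>M)"
      using variance_eq[OF iyI iyI2, of i] by (simp add: y2_def f_def)
    also have "\<dots> = (\<integral>\<omega>. (y i \<omega>)\<^sup>2 * indicator {x. A < \<bar>x\<bar>} (y i \<omega>) \<partial>M)"
      by (intro Bochner_Integration.integral_cong) (auto simp: I_def indicator_def)
    finally show ?thesis using \<tau>[of i] by simp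
  qed
  have bd1: "\<bar>y1 i \<omega>\<bar> \<le> 2 * A" for i \<omega>
  proof -
    have *: "\<bar>y i \<omega> * (1 - I (y i \<omega>))\<bar> \<le> A" for \<omega> using A by (auto simp: I_def indicator_def)
    have "(\<integral>\<omega>. y i \<omega> * (1 - I (y i \<omega>)) \<partial>M) = - f i"
      using iyI iy E0 by (simp add: f_def right_diff_distrib)
    moreover have "\<bar>\<integral>\<omega>. y i \<omega> * (1 - I (y i \<omega>)) \<partial>M\<bar> \<le> A"
      using integral_abs_bound[of M "\<lambda>\<omega>. y i \<omega> * (1 - I (y i \<omega>))"]
        integral_mono[of M "\<lambda>\<omega>. \<bar>y i \<omega> * (1 - I (y i \<omega>))\<bar>" "\<lambda>_. A"] * iyI iy
      by (simp add: right_diff_distrib prob_space)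
    ultimately show ?thesis using *[of \<omega>] by (auto simp: y1_def)
  qed
  have i1: "integrable M (\<lambda>\<omega>. (y1 i \<omega>)\<^sup>2)" for i
    by (rule integrable_const_bound[of _ "(2 * A)\<^sup>2"])
      (use power_mono[OF bd1, where n=2] in \<open>auto simp: y1_def\<close>)
  have w1: "integrable M (\<lambda>\<omega>. wmod N L (\<lambda>i. y1 i \<omega>))"
  proof (rule wmod_expectation_crude(1)[OF ind1 E1 i1])
    show "(\<integral>\<omega>. (y1 i \<omega>)\<^sup>2 \<partial>M) \<le> (2 * A)\<^sup>2" for i
      using integral_mono[OF i1[of i] integrable_const[of "(2 * A)\<^sup>2"]] power_mono[OF bd1, where n=2]
      by (simp add: prob_space)
  qed
  note w2 = wmod_expectation_crude[OF ind2 E2 i2 v2, of N L]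
  have le: "wmod N L (\<lambda>i. y i \<omega>) \<le> 2 * wmod N L (\<lambda>i. y1 i \<omega>) + 2 * wmod N L (\<lambda>i. y2 i \<omega>)" for \<omega>
    unfolding sum by (rule wmod_add)
  have i12: "integrable M (\<lambda>\<omega>. 2 * wmod N L (\<lambda>i. y1 i \<omega>) + 2 * wmod N L (\<lambda>i. y2 i \<omega>))"
    using w1 w2(1) by simp
  have iw: "integrable M (\<lambda>\<omega>. wmod N L (\<lambda>i. y i \<omega>))"
  proof (rule Bochner_Integration.integrable_bound[OF i12])
    show "AE \<omega> in M. norm (wmod N L (\<lambda>i. y i \<omega>)) \<le>
        norm (2 * wmod N L (\<lambda>i. y1 i \<omega>) + 2 * wmod N L (\<lambda>i. y2 i \<omega>))"
      using le wmod_nonneg by (intro AE_I2) (simp add: abs_of_nonneg)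
  qed measurable
  have "(\<integral>\<omega>. wmod N L (\<lambda>i. y i \<omega>) \<partial>M) \<le> (\<integral>\<omega>. 2 * wmod N L (\<lambda>i. y1 i \<omega>) + 2 * wmod N L (\<lambda>i. y2 i \<omega>) \<partial>M)"
    by (rule integral_mono[OF iw i12 le])
  also have "\<dots> = 2 * (\<integral>\<omega>. wmod N L (\<lambda>i. y1 i \<omega>) \<partial>M) + 2 * (\<integral>\<omega>. wmod N L (\<lambda>i. y2 i \<omega>) \<partial>M)"
    using w1 w2 by simp
  also have "\<dots> \<le> 2 * (40 * sqrt (N * L) * (2 * A)\<^sup>2) + 2 * (16 * real N * \<tau>)"
    using w2(2) wmod_expectation_bounded[OF ind1 E1 bd1 L] by simp
  finally show ?thesis by (simp add: power_mult_distrib)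
qed

end

section \<open>Weak convergence and Lipschitz functions\<close>

lemma openin_mtopology_of_iff:
  "openin (mtopology_of m) U \<longleftrightarrow>
    U \<subseteq> mspace m \<and> (\<forall>x\<in>U. \<exists>r>0. \<forall>y\<in>mspace m. mdist m x y < r \<longrightarrow> y \<in> U)"
proof -
  interpret Metric_space "mspace m" "mdist m" by (rule Metric_space_mspace_mdist)
  show ?thesis
  proof (cases "U \<subseteq> mspace m")
    case True
    have "mball x r \<subseteq> U \<longleftrightarrow> (\<forall>y\<in>mspace m. mdist m x y < r \<longrightarrow> y \<in> U)" if "x \<in> U" for x r
      using True that by (auto simp: subset_eq)
    then show ?thesis unfolding mtopology_of_def openin_mtopology by blast
  next
    case False
    then show ?thesis unfolding mtopology_of_def openin_mtopology by blast
  qed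
qed

lemma space_mborel [simp]: "space (mborel m) = mspace m"
  unfolding mborel_def by (rule space_measure_of) (auto simp: openin_mtopology_of_iff)

lemma sets_mborel_openin: "openin (mtopology_of m) U \<Longrightarrow> U \<in> sets (mborel m)"
  unfolding mborel_def by (subst sets_measure_of) (auto simp: openin_mtopology_of_iff)

lemma measurable_mborelI:
  assumes "\<And>\<omega>. \<omega> \<in> space M \<Longrightarrow> f \<omega> \<in> mspace m"
    and "\<And>U. openin (mtopology_of m) U \<Longrightarrow> f -` U \<inter> space M \<in> sets M"
  shows "f \<in> M \<rightarrow>\<^sub>M mborel m"
  unfolding mborel_def
  by (rule measurable_measure_of) (use assms in \<open>auto simp: openin_mtopology_of_iff\<close>)

lemma continuous_map_mborel_measurable:
  fixes F :: "'a \<Rightarrow> real"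
  assumes "continuous_map (mtopology_of m) euclideanreal F"
  shows "F \<in> borel_measurable (mborel m)"
proof (rule borel_measurableI)
  fix S :: "real set" assume "open S"
  then have "openin (mtopology_of m) {x \<in> topspace (mtopology_of m). F x \<in> S}"
    using assms by (auto simp: continuous_map_def)
  moreover have "{x \<in> topspace (mtopology_of m). F x \<in> S} = F -` S \<inter> space (mborel m)"
    by auto
  ultimately show "F -` S \<inter> space (mborel m) \<in> sets (mborel m)"
    using sets_mborel_openin by metis
qed

text \<open>A limit lies in the open set \<open>U\<close> exactly when, for some \<open>k\<close>,
  the approximants eventually lie in the set \<open>V k\<close> of points whose ball of radius
  slightly above \<open>1 / Suc k\<close> stays inside \<open>U\<close>. The slack in the radius
  makes \<open>V k\<close> open, so only countable operations on measurable sets occur.\<close>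

lemma measurable_mborel_limit:
  assumes Y: "\<And>k::nat. Y k \<in> M \<rightarrow>\<^sub>M mborel m"
    and Z: "\<And>\<omega>. \<omega> \<in> space M \<Longrightarrow> Z \<omega> \<in> mspace m"
    and lim: "\<And>\<omega>. \<omega> \<in> space M \<Longrightarrow> (\<lambda>k. mdist m (Y k \<omega>) (Z \<omega>)) \<longlonglongrightarrow> 0"
  shows "Z \<in> M \<rightarrow>\<^sub>M mborel m"
proof (rule measurable_mborelI[OF Z])
  fix U assume U: "openin (mtopology_of m) U"
  interpret Metric_space "mspace m" "mdist m" by (rule Metric_space_mspace_mdist)
  define V where "V k = {x \<in> mspace m. \<exists>r>1 / real (Suc k). \<forall>y\<in>mspace m. mdist m x y < r \<longrightarrow> y \<in> U}" for k
  have "openin (mtopology_of m) (V k)" for k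
    unfolding openin_mtopology_of_iff
  proof safe
    fix x assume "x \<in> V k"
    then obtain r where r: "x \<in> mspace m" "r > 1 / real (Suc k)" "\<And>y. y \<in> mspace m \<Longrightarrow> mdist m x y < r \<Longrightarrow> y \<in> U"
      by (auto simp: V_def)
    \<comment> \<open>Half of the slack: after a move by \<open>\<delta>\<close> the remaining
      radius is still above the threshold.\<close>
    define \<delta> where "\<delta> = (r - 1 / real (Suc k)) / 2"
    have half: "c < r - (r - c) / 2" if "c < r" for c r :: real using that by (simp add: field_simps)
    have "\<delta> > 0" using r(2) by (simp add: \<delta>_def)
    moreover have "r - \<delta> > 1 / real (Suc k)" unfolding \<delta>_def by (rule half[OF r(2)])
    moreover have "z \<in> V k" if z: "z \<in> mspace m" "mdist m x z < \<delta>" for z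
    proof -
      have "y \<in> U" if y: "y \<in> mspace m" "mdist m z y < r - \<delta>" for y
        using triangle[OF r(1) z(1) y(1)] z y by (intro r(3)) auto
      then show ?thesis using z \<open>r - \<delta> > 1 / real (Suc k)\<close> by (auto simp: V_def)
    qed
    ultimately show "\<exists>r>0. \<forall>y\<in>mspace m. mdist m x y < r \<longrightarrow> y \<in> V k" by blast
  qed (auto simp: V_def)
  then have meas: "Y n -` V k \<inter> space M \<in> sets M" for n k
    using Y sets_mborel_openin by (metis measurable_sets)
  have "Z \<omega> \<in> U \<longleftrightarrow> (\<exists>k N. \<forall>n\<ge>N. Y n \<omega> \<in> V k)" if \<omega>: "\<omega> \<in> space M" for \<omega>
  proof
    have Ym: "Y n \<omega> \<in> mspace m" for n using measurable_space[OF Y \<omega>] by simp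
    note Zm = Z[OF \<omega>]
    {
      assume "Z \<omega> \<in> U"
      then obtain r where r: "r > 0" "\<And>y. y \<in> mspace m \<Longrightarrow> mdist m (Z \<omega>) y < r \<Longrightarrow> y \<in> U"
        using U by (auto simp: openin_mtopology_of_iff)
      obtain k where k: "1 / real (Suc k) < r / 2"
        using r(1) reals_Archimedean[of "r/2"] by (auto simp: inverse_eq_divide)
      obtain N where N: "\<And>n. n \<ge> N \<Longrightarrow> mdist m (Y n \<omega>) (Z \<omega>) < r / 2"
        using order_tendstoD(2)[OF lim[OF \<omega>], of "r/2"] r(1) by (auto simp: eventually_sequentially)
      have "Y n \<omega> \<in> V k" if "n \<ge> N" for n
      proof -
        have "\<forall>y\<in>mspace m. mdist m (Y n \<omega>) y < r / 2 \<longrightarrow> y \<in> U"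
        proof (intro ballI impI)
          fix y assume that: "y \<in> mspace m" "mdist m (Y n \<omega>) y < r / 2"
          show "y \<in> U"
          using triangle[OF Zm Ym[of n] that(1)] N[OF \<open>n \<ge> N\<close>] that commute[of "Y n \<omega>" "Z \<omega>"]
          by (intro r(2)) auto
        qed
        then show ?thesis using Ym k unfolding V_def by blast
      qed
      then show "\<exists>k N. \<forall>n\<ge>N. Y n \<omega> \<in> V k" by blast
    }
    assume "\<exists>k N. \<forall>n\<ge>N. Y n \<omega> \<in> V k"
    then obtain k N where kN: "\<And>n. n \<ge> N \<Longrightarrow> Y n \<omega> \<in> V k" by blast
    obtain N' where N': "\<And>n. n \<ge> N' \<Longrightarrow> mdist m (Y n \<omega>) (Z \<omega>) < 1 / real (Suc k)"
      using order_tendstoD(2)[OF lim[OF \<omega>], of "1 / real (Suc k)"] by (auto simp: eventually_sequentially)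
    show "Z \<omega> \<in> U"
      using kN[of "max N N'"] N'[of "max N N'"] Zm by (force simp: V_def)
  qed
  then have 1: "\<omega> \<in> Z -` U \<inter> space M \<longleftrightarrow> \<omega> \<in> space M \<and> (\<exists>k N. \<forall>n\<in>{N..}. Y n \<omega> \<in> V k)" for \<omega>
    by (cases "\<omega> \<in> space M") (simp_all add: Ball_def)
  have 2: "\<omega> \<in> space M \<and> (\<exists>k N. \<forall>n\<in>{N..}. Y n \<omega> \<in> V k) \<longleftrightarrow>
      \<omega> \<in> (\<Union>k. \<Union>N. \<Inter>n\<in>{N..}. Y n -` V k \<inter> space M)" for \<omega>
    by auto
  have "Z -` U \<inter> space M = (\<Union>k. \<Union>N. \<Inter>n\<in>{N..}. Y n -` V k \<inter> space M)"
    by (intro set_eqI) (rule trans[OF 1 2])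
  also have "\<dots> \<in> sets M"
    by (intro sets.countable_UN sets.countable_INT' image_subsetI meas) auto
  finally show "Z -` U \<inter> space M \<in> sets M" .
qed

lemma Lipschitz_continuous_map:
  fixes F :: "'a \<Rightarrow> real"
  assumes L: "\<And>x y. x \<in> mspace m \<Longrightarrow> y \<in> mspace m \<Longrightarrow> \<bar>F x - F y\<bar> \<le> L * mdist m x y"
  shows "continuous_map (mtopology_of m) euclideanreal F"
  unfolding continuous_map_def
proof (intro conjI allI impI)
  fix S :: "real set" assume "openin euclideanreal S"
  then have S: "open S" by simp
  show "openin (mtopology_of m) {x \<in> topspace (mtopology_of m). F x \<in> S}"
    unfolding openin_mtopology_of_iff
  proof safe
    fix x assume x: "x \<in> topspace (mtopology_of m)" "F x \<in> S"
    then obtain e where e: "e > 0" "\<And>z. \<bar>z - F x\<bar> < e \<Longrightarrow> z \<in> S"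
      using S unfolding open_dist by (auto simp: dist_real_def)
    have "F y \<in> S" if y: "y \<in> mspace m" "mdist m x y < e / (\<bar>L\<bar> + 1)" for y
    proof (rule e(2))
      have "\<bar>F y - F x\<bar> \<le> L * mdist m x y" using L[of x y] x y by (auto simp: abs_minus_commute)
      also have "\<dots> \<le> (\<bar>L\<bar> + 1) * mdist m x y"
        by (intro mult_right_mono) auto
      also have "\<dots> < e" using y by (simp add: field_simps add_pos_nonneg)
      finally show "\<bar>F y - F x\<bar> < e" .
    qed
    then show "\<exists>r>0. \<forall>y\<in>mspace m. mdist m x y < r \<longrightarrow> y \<in> {x \<in> topspace (mtopology_of m). F x \<in> S}"
      using e(1) by (intro exI[of _ "e / (\<bar>L\<bar> + 1)"]) auto
  qed auto
qed auto

lemma integrable_bounded_continuous_map: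
  fixes F :: "'a \<Rightarrow> real"
  assumes "continuous_map (mtopology_of m) euclideanreal F" "\<And>x. x \<in> mspace m \<Longrightarrow> \<bar>F x\<bar> \<le> B"
    and "prob_space N" "sets N = sets (mborel m)"
  shows "integrable N F"
proof -
  interpret prob_space N by fact
  have "space N = mspace m" using sets_eq_imp_space_eq[OF assms(4)] by simp
  moreover have "F \<in> borel_measurable N"
    using continuous_map_mborel_measurable[OF assms(1)] measurable_cong_sets[OF assms(4) refl] by blast
  ultimately show ?thesis using assms(2) by (intro integrable_const_bound[of _ B]) auto
qed

text \<open>The Lipschitz functions \<open>x \<mapsto> inf\<^sub>y (F y + k * d(x,y))\<close> increase to \<open>F\<close>.\<close>

lemma weak_conv_lower:
  fixes F :: "'a \<Rightarrow> real"
  assumes N: "\<And>n. prob_space (N n)" "\<And>n. sets (N n) = sets (mborel m)"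
    and N': "prob_space N'" "sets N' = sets (mborel m)"
    and lip: "\<And>(F::'a \<Rightarrow> real) L B. (\<And>x y. x \<in> mspace m \<Longrightarrow> y \<in> mspace m \<Longrightarrow> \<bar>F x - F y\<bar> \<le> L * mdist m x y) \<Longrightarrow>
      (\<And>x. x \<in> mspace m \<Longrightarrow> \<bar>F x\<bar> \<le> B) \<Longrightarrow> (\<lambda>n. \<integral>x. F x \<partial>N n) \<longlonglongrightarrow> (\<integral>x. F x \<partial>N')"
    and F: "continuous_map (mtopology_of m) euclideanreal F" and B: "\<And>x. x \<in> mspace m \<Longrightarrow> \<bar>F x\<bar> \<le> B"
    and a: "a < (\<integral>x. F x \<partial>N')"
  shows "eventually (\<lambda>n. a < (\<integral>x. F x \<partial>N n)) sequentially"
proof -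
  interpret Metric_space "mspace m" "mdist m" by (rule Metric_space_mspace_mdist)
  interpret N': prob_space N' by fact
  have sp: "space N' = mspace m" "space (N n) = mspace m" for n
    using sets_eq_imp_space_eq[OF N'(2)] sets_eq_imp_space_eq[OF N(2)] by auto
  have ne: "mspace m \<noteq> {}" using N'.not_empty sp by simp
  define Fk where "Fk k x = (INF y\<in>mspace m. F y + real k * mdist m x y)" for k x
  have bdd: "bdd_below ((\<lambda>y. F y + real k * mdist m x y) ` mspace m)" for k x
    by (rule bdd_belowI2[of _ "-B"]) (use B in \<open>force simp: abs_le_iff intro: add_increasing2\<close>)
  have low: "Fk k x \<le> F y + real k * mdist m x y" if "y \<in> mspace m" for k x y
    unfolding Fk_def by (rule cINF_lower[OF bdd that])
  have upp: "c \<le> Fk k x" if "\<And>y. y \<in> mspace m \<Longrightarrow> c \<le> F y + real k * mdist m x y" for c k x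
    unfolding Fk_def by (rule cINF_greatest[OF ne that])
  have le: "Fk k x \<le> F x" if "x \<in> mspace m" for k x using low[OF that, of k x] that by simp
  have geB: "- B \<le> Fk k x" for k x
    by (rule upp) (use B in \<open>force simp: abs_le_iff intro: add_increasing2\<close>)
  have Fk_bd: "\<bar>Fk k x\<bar> \<le> B" if "x \<in> mspace m" for k x
    using le[OF that] B[OF that] geB[of k x] by (auto simp: abs_le_iff intro: order_trans)
  have one: "Fk k x \<le> Fk k z + real k * mdist m x z" if "x \<in> mspace m" "z \<in> mspace m" for k x z
  proof -
    have "Fk k x - real k * mdist m x z \<le> Fk k z"
    proof (rule upp)
      fix y assume y: "y \<in> mspace m"
      have "real k * mdist m x y \<le> real k * mdist m x z + real k * mdist m z y"
        using triangle[OF that y] by (metis distrib_left mult_left_mono of_nat_0_le_iff)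
      with low[OF y, of k x] show "Fk k x - real k * mdist m x z \<le> F y + real k * mdist m z y" by linarith
    qed
    then show ?thesis by simp
  qed
  have Fk_lip: "\<bar>Fk k x - Fk k z\<bar> \<le> real k * mdist m x z" if "x \<in> mspace m" "z \<in> mspace m" for k x z
    using one[OF that, of k] one[OF that(2,1), of k] commute[of x z] by (simp add: abs_le_iff)
  have cont: "continuous_map (mtopology_of m) euclideanreal (Fk k)" for k
    by (rule Lipschitz_continuous_map[OF Fk_lip])
  have lim: "(\<lambda>k. Fk k x) \<longlonglongrightarrow> F x" if x: "x \<in> mspace m" for x
  proof (rule LIMSEQ_I)
    fix e :: real assume e: "e > 0"
    have "openin (mtopology_of m) {y \<in> topspace (mtopology_of m). F y \<in> {F x - e / 2<..}}"
      using F[unfolded continuous_map_def, THEN conjunct2, rule_format, of "{F x - e / 2<..}"]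
      by simp
    moreover have "x \<in> {y \<in> topspace (mtopology_of m). F y \<in> {F x - e / 2<..}}" using x e by simp
    ultimately obtain \<delta> where \<delta>: "\<delta> > 0" "\<And>y. y \<in> mspace m \<Longrightarrow> mdist m x y < \<delta> \<Longrightarrow> F x - e / 2 < F y"
      unfolding openin_mtopology_of_iff by fastforce
    \<comment> \<open>From this \<open>K\<close> on, the penalty at distance \<open>\<delta>\<close>
      is at least \<open>2 * B\<close>, the largest possible gap between two values of
      \<open>F\<close>, so far away points cannot lower the infimum below
      \<open>F x\<close>.\<close>
    obtain K :: nat where K: "2 * B / \<delta> < real K" using reals_Archimedean2 by blast
    have "norm (Fk k x - F x) < e" if "k \<ge> K" for k
    proof -
      have "F x - e / 2 \<le> Fk k x"
      proof (rule upp)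
        fix y assume y: "y \<in> mspace m"
        show "F x - e / 2 \<le> F y + real k * mdist m x y"
        proof (cases "mdist m x y < \<delta>")
          case True
          then have "F x - e / 2 < F y" by (rule \<delta>(2)[OF y])
          moreover have "0 \<le> real k * mdist m x y" by simp
          ultimately show ?thesis by linarith
        next
          case False
          have "2 * B \<le> real k * \<delta>" using K \<delta>(1) that
            by (smt (verit) of_nat_mono pos_divide_less_eq mult_right_mono)
          also have "\<dots> \<le> real k * mdist m x y" using False by (intro mult_left_mono) auto
          finally show ?thesis using B[OF x] B[OF y] e by (simp add: abs_le_iff)
        qed
      qed
      then show ?thesis using le[OF x, of k] e by (simp add: abs_if)
    qed
    then show "\<exists>no. \<forall>n\<ge>no. norm (Fk n x - F x) < e" by blast
  qed
  note iF = integrable_bounded_continuous_map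
  have "(\<lambda>k. \<integral>x. Fk k x \<partial>N') \<longlonglongrightarrow> (\<integral>x. F x \<partial>N')"
  proof (rule integral_dominated_convergence[where w = "\<lambda>_. B"])
    show "F \<in> borel_measurable N'" "Fk k \<in> borel_measurable N'" for k
      using iF[OF F B N'] iF[OF cont Fk_bd N'] by auto
  qed (use lim Fk_bd sp in auto)
  from order_tendstoD(1)[OF this a] obtain k where k: "a < (\<integral>x. Fk k x \<partial>N')"
    by (auto simp: eventually_sequentially)
  have "eventually (\<lambda>n. a < (\<integral>x. Fk k x \<partial>N n)) sequentially"
    using lip[OF Fk_lip[of _ _ k] Fk_bd] k by (rule order_tendstoD(1))
  then show ?thesis
  proof eventually_elim
    case (elim n)
    have "(\<integral>x. Fk k x \<partial>N n) \<le> (\<integral>x. F x \<partial>N n)"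
      using iF[OF F B N(1,2)] iF[OF cont Fk_bd N(1,2)] le sp by (intro integral_mono) auto
    then show ?case using elim by simp
  qed
qed

text \<open>Approximation from below by Lipschitz functions yields only a lower bound for the
  integrals; the same applied to \<open>- F\<close> yields the upper one.\<close>

lemma weak_conv_metricI:
  assumes N: "\<And>n. prob_space (N n)" "\<And>n. sets (N n) = sets (mborel m)"
    and N': "prob_space N'" "sets N' = sets (mborel m)"
    and lip: "\<And>(F::'a \<Rightarrow> real) L B. (\<And>x y. x \<in> mspace m \<Longrightarrow> y \<in> mspace m \<Longrightarrow> \<bar>F x - F y\<bar> \<le> L * mdist m x y) \<Longrightarrow>
      (\<And>x. x \<in> mspace m \<Longrightarrow> \<bar>F x\<bar> \<le> B) \<Longrightarrow> (\<lambda>n. \<integral>x. F x \<partial>N n) \<longlonglongrightarrow> (\<integral>x. F x \<partial>N')"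
  shows "weak_conv_metric m N N'"
  unfolding weak_conv_metric_def
proof (intro allI impI, elim conjE)
  fix F :: "'a \<Rightarrow> real"
  assume F: "continuous_map (mtopology_of m) euclideanreal F" and "bounded (F ` mspace m)"
  then obtain B where B: "\<And>x. x \<in> mspace m \<Longrightarrow> \<bar>F x\<bar> \<le> B" by (auto simp: bounded_iff)
  have F': "continuous_map (mtopology_of m) euclideanreal (\<lambda>x. - F x)"
    using F by (rule continuous_map_minus)
  show "(\<lambda>n. \<integral>x. F x \<partial>N n) \<longlonglongrightarrow> (\<integral>x. F x \<partial>N')"
  proof (rule order_tendstoI)
    fix a assume a: "a < (\<integral>x. F x \<partial>N')"
    show "eventually (\<lambda>n. a < (\<integral>x. F x \<partial>N n)) sequentially"
      by (rule weak_conv_lower[of N m N' F B a]) (use N N' lip F B a in blast)+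
  next
    fix a assume "(\<integral>x. F x \<partial>N') < a"
    then have a: "- a < (\<integral>x. - F x \<partial>N')" by simp
    have B': "\<bar>- F x\<bar> \<le> B" if "x \<in> mspace m" for x using B[OF that] by simp
    have "eventually (\<lambda>n. - a < (\<integral>x. - F x \<partial>N n)) sequentially"
      by (rule weak_conv_lower[of N m N' "\<lambda>x. - F x" B "- a"]) (use N N' lip F' B' a in blast)+
    then show "eventually (\<lambda>n. (\<integral>x. F x \<partial>N n) < a) sequentially" by simp
  qed
qed

section \<open>Orthonormal expansions and square integrable processes\<close>

abbreviation L2_inner :: "'s measure \<Rightarrow> ('s \<Rightarrow> real) \<Rightarrow> ('s \<Rightarrow> real) \<Rightarrow> real" where
  "L2_inner \<mu> f g \<equiv> (\<integral>s. f s * g s \<partial>\<mu>)"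

lemma L2_norm_sq: "(L2_norm \<mu> f)\<^sup>2 = L2_inner \<mu> f f"
  by (simp add: L2_norm_def power2_eq_square[symmetric])

lemma L2_funs_zero: "(\<lambda>_. 0) \<in> L2_funs \<mu>"
  by (simp add: L2_funs_def)

lemma L2_funs_cmult: "f \<in> L2_funs \<mu> \<Longrightarrow> (\<lambda>s. c * f s) \<in> L2_funs \<mu>"
  by (auto simp: L2_funs_def power_mult_distrib)

lemma L2_funs_sum:
  "(\<And>i. i \<in> I \<Longrightarrow> f i \<in> L2_funs \<mu>) \<Longrightarrow> (\<lambda>s. \<Sum>i\<in>I. f i s) \<in> L2_funs \<mu>"
  by (induction I rule: infinite_finite_induct) (auto intro: L2_funs_add L2_funs_zero)

lemma L2_norm_zero [simp]: "L2_norm \<mu> (\<lambda>_. 0) = 0"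
  by (simp add: L2_norm_def)

lemma L2_norm_cmult: "L2_norm \<mu> (\<lambda>s. c * f s) = \<bar>c\<bar> * L2_norm \<mu> f"
  by (simp add: L2_norm_def power_mult_distrib real_sqrt_mult)

lemma L2_norm_minus_commute: "L2_norm \<mu> (\<lambda>s. f s - g s) = L2_norm \<mu> (\<lambda>s. g s - f s)"
  by (simp add: L2_norm_def power2_commute)

lemma L2_norm_sum_le:
  "(\<And>i. i \<in> I \<Longrightarrow> f i \<in> L2_funs \<mu>) \<Longrightarrow> L2_norm \<mu> (\<lambda>s. \<Sum>i\<in>I. f i s) \<le> (\<Sum>i\<in>I. L2_norm \<mu> (f i))"
proof (induction I rule: infinite_finite_induct)
  case (insert i I)
  have "L2_norm \<mu> (\<lambda>s. f i s + (\<Sum>i\<in>I. f i s)) \<le> L2_norm \<mu> (f i) + L2_norm \<mu> (\<lambda>s. \<Sum>i\<in>I. f i s)"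
    using insert by (intro L2_norm_triangle L2_funs_sum) auto
  with insert show ?case by auto
qed auto

lemma L2_inner_abs_le:
  assumes "f \<in> L2_funs \<mu>" "g \<in> L2_funs \<mu>"
  shows "\<bar>L2_inner \<mu> f g\<bar> \<le> L2_norm \<mu> f * L2_norm \<mu> g"
  using L2_Cauchy_Schwarz[OF assms] L2_Cauchy_Schwarz[OF L2_funs_cmult[OF assms(1), of "-1"] assms(2)]
  by (simp add: abs_le_iff L2_norm_def)

lemma L2_inner_sum_left:
  assumes "\<And>i. i \<in> I \<Longrightarrow> f i \<in> L2_funs \<mu>" "g \<in> L2_funs \<mu>"
  shows "L2_inner \<mu> (\<lambda>s. \<Sum>i\<in>I. c i * f i s) g = (\<Sum>i\<in>I. c i * L2_inner \<mu> (f i) g)"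
proof -
  have "integrable \<mu> (\<lambda>s. c i * (f i s * g s))" if "i \<in> I" for i
    using assms that by (intro integrable_mult_right L2_mult_integrable) auto
  then show ?thesis
    by (simp add: sum_distrib_right mult.assoc Bochner_Integration.integral_sum)
qed

definition orthonormal_or_zero :: "'s measure \<Rightarrow> (nat \<Rightarrow> 's \<Rightarrow> real) \<Rightarrow> bool" where
  "orthonormal_or_zero \<mu> e \<longleftrightarrow> (\<forall>i. e i \<in> L2_funs \<mu>) \<and>
    (\<forall>i j. i \<noteq> j \<longrightarrow> L2_inner \<mu> (e i) (e j) = 0) \<and>
    (\<forall>i. L2_inner \<mu> (e i) (e i) = 1 \<or> e i = (\<lambda>_. 0))"

definition L2_proj :: "'s measure \<Rightarrow> (nat \<Rightarrow> 's \<Rightarrow> real) \<Rightarrow> nat \<Rightarrow> ('s \<Rightarrow> real) \<Rightarrow> 's \<Rightarrow> real" where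
  "L2_proj \<mu> e N h = (\<lambda>s. \<Sum>i<N. L2_inner \<mu> h (e i) * e i s)"

lemma L2_proj_L2_funs: "(\<And>i. e i \<in> L2_funs \<mu>) \<Longrightarrow> L2_proj \<mu> e N h \<in> L2_funs \<mu>"
  unfolding L2_proj_def by (intro L2_funs_sum L2_funs_cmult) auto

lemma L2_proj_diff:
  assumes "\<And>i. e i \<in> L2_funs \<mu>" "f \<in> L2_funs \<mu>" "g \<in> L2_funs \<mu>"
  shows "L2_proj \<mu> e N (\<lambda>s. f s - g s) s = L2_proj \<mu> e N f s - L2_proj \<mu> e N g s"
  using L2_mult_integrable[OF assms(2) assms(1)] L2_mult_integrable[OF assms(3) assms(1)]
  by (simp add: L2_proj_def left_diff_distrib sum_subtractf)

lemma L2_proj_Pythagoras: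
  assumes e: "orthonormal_or_zero \<mu> e" and h: "h \<in> L2_funs \<mu>"
  shows "(L2_norm \<mu> (\<lambda>s. h s - L2_proj \<mu> e N h s))\<^sup>2 = (L2_norm \<mu> h)\<^sup>2 - (\<Sum>i<N. (L2_inner \<mu> h (e i))\<^sup>2)"
proof -
  have eL: "e i \<in> L2_funs \<mu>" for i using e by (simp add: orthonormal_or_zero_def)
  note pL = L2_proj_L2_funs[of e \<mu> N h, OF eL]
  have hp: "L2_inner \<mu> h (L2_proj \<mu> e N h) = (\<Sum>i<N. (L2_inner \<mu> h (e i))\<^sup>2)"
    using L2_inner_sum_left[of "{..<N}" e \<mu> h "\<lambda>i. L2_inner \<mu> h (e i)", OF eL h]
    by (simp add: L2_proj_def mult.commute power2_eq_square)
  have ep: "L2_inner \<mu> (e j) (L2_proj \<mu> e N h) = L2_inner \<mu> h (e j)" if "j < N" for j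
  proof -
    have "L2_inner \<mu> (e j) (L2_proj \<mu> e N h) = (\<Sum>i<N. L2_inner \<mu> h (e i) * L2_inner \<mu> (e i) (e j))"
      using L2_inner_sum_left[of "{..<N}" e \<mu> "e j" "\<lambda>i. L2_inner \<mu> h (e i)", OF eL eL]
      by (simp add: L2_proj_def mult.commute)
    also have "\<dots> = (\<Sum>i<N. if i = j then L2_inner \<mu> h (e j) * L2_inner \<mu> (e j) (e j) else 0)"
      using e by (intro sum.cong) (auto simp: orthonormal_or_zero_def)
    \<comment> \<open>If \<open>e j\<close> is the zero function, both sides vanish; otherwise its
      norm is 1.\<close>
    also have "\<dots> = L2_inner \<mu> h (e j)"
    proof -
      have "L2_inner \<mu> (e j) (e j) = 1 \<or> e j = (\<lambda>_. 0)" using e by (simp add: orthonormal_or_zero_def)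
      then show ?thesis using that by auto
    qed
    finally show ?thesis .
  qed
  have "L2_inner \<mu> (\<lambda>s. \<Sum>i<N. L2_inner \<mu> h (e i) * e i s) (L2_proj \<mu> e N h) = (\<Sum>i<N. (L2_inner \<mu> h (e i))\<^sup>2)"
    using L2_inner_sum_left[of "{..<N}" e \<mu> "L2_proj \<mu> e N h" "\<lambda>i. L2_inner \<mu> h (e i)", OF eL pL] ep
    by (simp add: power2_eq_square)
  then have pp: "L2_inner \<mu> (L2_proj \<mu> e N h) (L2_proj \<mu> e N h) = (\<Sum>i<N. (L2_inner \<mu> h (e i))\<^sup>2)"
    unfolding L2_proj_def .
  have "L2_inner \<mu> (\<lambda>s. h s - L2_proj \<mu> e N h s) (\<lambda>s. h s - L2_proj \<mu> e N h s) =
    (\<integral>s. h s * h s - 2 * (h s * L2_proj \<mu> e N h s) + L2_proj \<mu> e N h s * L2_proj \<mu> e N h s \<partial>\<mu>)"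
    by (intro Bochner_Integration.integral_cong) (auto simp: algebra_simps)
  also have "\<dots> = L2_inner \<mu> h h - 2 * L2_inner \<mu> h (L2_proj \<mu> e N h) + L2_inner \<mu> (L2_proj \<mu> e N h) (L2_proj \<mu> e N h)"
    using L2_mult_integrable[OF h h] L2_mult_integrable[OF h pL] L2_mult_integrable[OF pL pL] by simp
  finally show ?thesis unfolding L2_norm_sq hp pp by simp
qed

lemma L2_proj_contraction:
  assumes e: "orthonormal_or_zero \<mu> e" and h: "h \<in> L2_funs \<mu>"
  shows "L2_norm \<mu> (\<lambda>s. h s - L2_proj \<mu> e N h s) \<le> L2_norm \<mu> h"
proof (rule power2_le_imp_le)
  show "(L2_norm \<mu> (\<lambda>s. h s - L2_proj \<mu> e N h s))\<^sup>2 \<le> (L2_norm \<mu> h)\<^sup>2"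
    unfolding L2_proj_Pythagoras[OF assms] by (simp add: sum_nonneg)
qed (rule L2_norm_nonneg)

section \<open>Gram-Schmidt orthogonalisation and a basis of the separable space\<close>

text \<open>Division by 0 is 0, so a vector that depends on its predecessors up to a null set yields
  the zero function and needs no case distinction.\<close>

function gram_schmidt :: "'s measure \<Rightarrow> (nat \<Rightarrow> 's \<Rightarrow> real) \<Rightarrow> nat \<Rightarrow> 's \<Rightarrow> real" where
  "gram_schmidt \<mu> f n = (\<lambda>s. 
     (f n s - (\<Sum>i<n. L2_inner \<mu> (f n) (gram_schmidt \<mu> f i) * gram_schmidt \<mu> f i s)) /
     L2_norm \<mu> (\<lambda>s. f n s - (\<Sum>i<n. L2_inner \<mu> (f n) (gram_schmidt \<mu> f i) * gram_schmidt \<mu> f i s)))"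
  by auto
termination
  by (relation "Wellfounded.measure (\<lambda>(_, _, n). n)") auto

declare gram_schmidt.simps [simp del]

lemma gram_schmidt_eq:
  fixes \<mu> f
  defines "e \<equiv> gram_schmidt \<mu> f"
  defines "u \<equiv> \<lambda>n s. f n s - L2_proj \<mu> e n (f n) s"
  shows "e n = (\<lambda>s. u n s / L2_norm \<mu> (u n))"
  unfolding e_def u_def L2_proj_def by (subst gram_schmidt.simps) simp

lemma gram_schmidt_orthonormal:
  assumes f: "\<And>n. f n \<in> L2_funs \<mu>"
  shows "orthonormal_or_zero \<mu> (gram_schmidt \<mu> f)"
proof -
  define e where "e = gram_schmidt \<mu> f"
  define u where "u n s = f n s - L2_proj \<mu> e n (f n) s" for n s
  have eq: "e n = (\<lambda>s. u n s / L2_norm \<mu> (u n))" for n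
    using gram_schmidt_eq[of \<mu> f n] unfolding e_def u_def .
  have eL: "e n \<in> L2_funs \<mu>" for n
  proof (induction n rule: less_induct)
    case (less n)
    have "u n \<in> L2_funs \<mu>" unfolding u_def L2_proj_def
      by (intro L2_funs_diff L2_funs_sum L2_funs_cmult less f) auto
    then show ?case unfolding eq[of n] using L2_funs_cmult[of "u n" \<mu> "1 / L2_norm \<mu> (u n)"] by simp
  qed
  have uL: "u n \<in> L2_funs \<mu>" for n
    unfolding u_def by (intro L2_funs_diff f L2_proj_L2_funs eL)
  have unit: "L2_inner \<mu> (e n) (e n) = 1 \<or> e n = (\<lambda>_. 0)" for n
  proof (cases "L2_norm \<mu> (u n) = 0")
    case False
    have "L2_inner \<mu> (e n) (e n) = L2_inner \<mu> (u n) (u n) / (L2_norm \<mu> (u n))\<^sup>2"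
      unfolding eq by (simp add: power2_eq_square)
    with False show ?thesis by (simp add: L2_norm_sq[symmetric])
  qed (simp add: eq)
  have orth: "L2_inner \<mu> (e n) (e j) = 0" if "j < n" for n j
    using that
  proof (induction n arbitrary: j rule: less_induct)
    case (less n)
    have o: "L2_inner \<mu> (e i) (e j) = 0" if "i < n" "i \<noteq> j" for i
      using less.IH[of i j] less.IH[of j i] that less.prems by (cases "i < j") (auto simp: mult.commute)
    have "L2_inner \<mu> (L2_proj \<mu> e n (f n)) (e j) = (\<Sum>i<n. L2_inner \<mu> (f n) (e i) * L2_inner \<mu> (e i) (e j))"
      unfolding L2_proj_def using L2_inner_sum_left[of "{..<n}" e \<mu> "e j" "\<lambda>i. L2_inner \<mu> (f n) (e i)", OF eL eL] .
    also have "\<dots> = (\<Sum>i<n. if i = j then L2_inner \<mu> (f n) (e j) * L2_inner \<mu> (e j) (e j) else 0)"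
      using o by (intro sum.cong) auto
    also have "\<dots> = L2_inner \<mu> (f n) (e j)"
      using unit[of j] less.prems by auto
    finally have p: "L2_inner \<mu> (L2_proj \<mu> e n (f n)) (e j) = L2_inner \<mu> (f n) (e j)" .
    have "L2_inner \<mu> (u n) (e j) = L2_inner \<mu> (f n) (e j) - L2_inner \<mu> (L2_proj \<mu> e n (f n)) (e j)"
      unfolding u_def left_diff_distrib
      by (intro Bochner_Integration.integral_diff L2_mult_integrable f eL L2_proj_L2_funs)
    then have "L2_inner \<mu> (u n) (e j) = 0" using p by simp
    then show ?case unfolding eq[of n] by simp
  qed
  have "L2_inner \<mu> (e i) (e j) = 0" if "i \<noteq> j" for i j
    using orth[of j i] orth[of i j] that by (cases "i < j") (auto simp: mult.commute)
  then show ?thesis using eL unit unfolding orthonormal_or_zero_def e_def[symmetric] by blast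
qed

text \<open>If \<open>u n\<close> has norm 0, then \<open>e n\<close> is zero and the residual is
  \<open>u n\<close> itself, which may differ from 0 on a null set; hence the norm in the statement.
  Otherwise \<open>u n\<close> is exactly its coefficient times \<open>e n\<close>.\<close>

lemma gram_schmidt_residual:
  assumes f: "\<And>n. f n \<in> L2_funs \<mu>"
  shows "L2_norm \<mu> (\<lambda>s. f n s - L2_proj \<mu> (gram_schmidt \<mu> f) (Suc n) (f n) s) = 0"
proof -
  define e where "e = gram_schmidt \<mu> f"
  have o: "orthonormal_or_zero \<mu> e" unfolding e_def by (rule gram_schmidt_orthonormal[OF f])
  then have eL: "e i \<in> L2_funs \<mu>" for i by (simp add: orthonormal_or_zero_def)
  define u where "u n s = f n s - L2_proj \<mu> e n (f n) s" for n s
  have eq: "e n = (\<lambda>s. u n s / L2_norm \<mu> (u n))" for n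
    using gram_schmidt_eq[of \<mu> f n] unfolding e_def u_def .
  have r: "f n s - L2_proj \<mu> e (Suc n) (f n) s = u n s - L2_inner \<mu> (f n) (e n) * e n s" for s
    by (simp add: u_def L2_proj_def)
  show ?thesis
  proof (cases "L2_norm \<mu> (u n) = 0")
    case True
    then have "e n = (\<lambda>_. 0)" by (simp add: eq)
    then show ?thesis unfolding e_def[symmetric] r using True by simp
  next
    case False
    have uL: "u n \<in> L2_funs \<mu>"
      unfolding u_def by (intro L2_funs_diff f L2_proj_L2_funs eL)
    have "L2_inner \<mu> (L2_proj \<mu> e n (f n)) (e n) = 0"
      unfolding L2_proj_def
      using L2_inner_sum_left[of "{..<n}" e \<mu> "e n" "\<lambda>i. L2_inner \<mu> (f n) (e i)", OF eL eL] o
      by (simp add: orthonormal_or_zero_def)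
    moreover have "L2_inner \<mu> (u n) (e n) = L2_inner \<mu> (f n) (e n) - L2_inner \<mu> (L2_proj \<mu> e n (f n)) (e n)"
      unfolding u_def left_diff_distrib
      by (intro Bochner_Integration.integral_diff L2_mult_integrable f eL L2_proj_L2_funs)
    ultimately have "L2_inner \<mu> (f n) (e n) = L2_inner \<mu> (u n) (e n)" by simp
    also have "\<dots> = L2_inner \<mu> (u n) (u n) / L2_norm \<mu> (u n)" by (subst eq) simp
    also have "\<dots> = L2_norm \<mu> (u n)" using False by (simp add: L2_norm_sq[symmetric] power2_eq_square)
    finally have i: "L2_inner \<mu> (f n) (e n) = L2_norm \<mu> (u n)" .
    have "f n s - L2_proj \<mu> e (Suc n) (f n) s = 0" for s
      unfolding r i using False by (simp add: eq)
    then show ?thesis unfolding e_def[symmetric] by simp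
  qed
qed

text \<open>Density concerns classes; a representative is fixed for each member of a countable dense
  set, which is listed with repetitions if it is finite.\<close>

lemma L2_dense_sequence:
  assumes "separable_space (mtopology_of (L2 \<mu>))"
  obtains f :: "nat \<Rightarrow> 's \<Rightarrow> real" where "\<And>n. f n \<in> L2_funs \<mu>"
    "\<And>h \<eta>. h \<in> L2_funs \<mu> \<Longrightarrow> 0 < \<eta> \<Longrightarrow> \<exists>n. L2_norm \<mu> (\<lambda>s. h s - f n s) < \<eta>"
proof -
  interpret Metric_space "L2_carrier \<mu>" "L2_dist \<mu>" by (rule Metric_space_L2)
  have top: "mtopology_of (L2 \<mu>) = mtopology"
    unfolding mtopology_of_def mspace_L2 mdist_L2 ..
  obtain C where C: "countable C" "C \<subseteq> L2_carrier \<mu>" "mtopology closure_of C = L2_carrier \<mu>"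
    using assms unfolding separable_space_def top by auto
  have z: "L2_class \<mu> (\<lambda>_. 0) \<in> L2_carrier \<mu>" using L2_funs_zero by (auto simp: L2_carrier_def)
  have ne: "C \<noteq> {}" using C(3) z by auto
  define f where "f n = (SOME g. g \<in> L2_funs \<mu> \<and> from_nat_into C n = L2_class \<mu> g)" for n
  have f: "f n \<in> L2_funs \<mu> \<and> from_nat_into C n = L2_class \<mu> (f n)" for n
  proof -
    have "from_nat_into C n \<in> L2_carrier \<mu>" using from_nat_into[OF ne] C(2) by blast
    then have "\<exists>g. g \<in> L2_funs \<mu> \<and> from_nat_into C n = L2_class \<mu> g" by (auto simp: L2_carrier_def)
    from someI_ex[OF this] show ?thesis unfolding f_def .
  qed
  have "\<exists>n. L2_norm \<mu> (\<lambda>s. h s - f n s) < \<eta>" if h: "h \<in> L2_funs \<mu>" "0 < \<eta>" for h \<eta>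
  proof -
    have "L2_class \<mu> h \<in> mtopology closure_of C" using C(3) h by (auto simp: L2_carrier_def)
    then obtain A where A: "A \<in> C" "A \<in> mball (L2_class \<mu> h) \<eta>"
      unfolding metric_closure_of using h by auto
    obtain n where n: "A = from_nat_into C n" using from_nat_into_surj[OF C(1) A(1)] by metis
    have "L2_dist \<mu> (L2_class \<mu> h) (L2_class \<mu> (f n)) < \<eta>" using A(2) f[of n] n by auto
    then show ?thesis using L2_dist_class[of h \<mu> "f n"] h f by auto
  qed
  with f that show thesis by blast
qed

text \<open>Residual norms decrease with \<open>N\<close>, and the first \<open>Suc n\<close>
  vectors reproduce \<open>f n\<close>. From there on the residual of \<open>h\<close> is at most
  that of \<open>h - f n\<close>, hence at most the norm of \<open>h - f n\<close>.\<close>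

lemma L2_basis:
  assumes "separable_space (mtopology_of (L2 \<mu>))"
  obtains e :: "nat \<Rightarrow> 's \<Rightarrow> real" where "orthonormal_or_zero \<mu> e"
    "\<And>h. h \<in> L2_funs \<mu> \<Longrightarrow> (\<lambda>N. L2_norm \<mu> (\<lambda>s. h s - L2_proj \<mu> e N h s)) \<longlonglongrightarrow> 0"
proof -
  obtain f :: "nat \<Rightarrow> 's \<Rightarrow> real" where f: "\<And>n. f n \<in> L2_funs \<mu>"
    and dense: "\<And>h \<eta>. h \<in> L2_funs \<mu> \<Longrightarrow> 0 < \<eta> \<Longrightarrow> \<exists>n. L2_norm \<mu> (\<lambda>s. h s - f n s) < \<eta>"
    using L2_dense_sequence[OF assms] by metis
  define e where "e = gram_schmidt \<mu> f"
  have o: "orthonormal_or_zero \<mu> e" unfolding e_def by (rule gram_schmidt_orthonormal[OF f])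
  then have eL: "e i \<in> L2_funs \<mu>" for i by (simp add: orthonormal_or_zero_def)
  have "(\<lambda>N. L2_norm \<mu> (\<lambda>s. h s - L2_proj \<mu> e N h s)) \<longlonglongrightarrow> 0" if h: "h \<in> L2_funs \<mu>" for h
  proof (rule LIMSEQ_I)
    fix \<eta> :: real assume "0 < \<eta>"
    then obtain n where n: "L2_norm \<mu> (\<lambda>s. h s - f n s) < \<eta>" using dense h by blast
    have "L2_norm \<mu> (\<lambda>s. h s - L2_proj \<mu> e N h s) < \<eta>" if N: "N \<ge> Suc n" for N
    proof -
      have "L2_norm \<mu> (\<lambda>s. h s - L2_proj \<mu> e N h s) \<le> L2_norm \<mu> (\<lambda>s. h s - L2_proj \<mu> e (Suc n) h s)"
      proof (rule power2_le_imp_le)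
        have "(\<Sum>i<Suc n. (L2_inner \<mu> h (e i))\<^sup>2) \<le> (\<Sum>i<N. (L2_inner \<mu> h (e i))\<^sup>2)"
          using N by (intro sum_mono2) auto
        then show "(L2_norm \<mu> (\<lambda>s. h s - L2_proj \<mu> e N h s))\<^sup>2 \<le> (L2_norm \<mu> (\<lambda>s. h s - L2_proj \<mu> e (Suc n) h s))\<^sup>2"
          unfolding L2_proj_Pythagoras[OF o h] by simp
      qed (rule L2_norm_nonneg)
      also have "\<dots> \<le> L2_norm \<mu> (\<lambda>s. (h s - f n s) - L2_proj \<mu> e (Suc n) (\<lambda>s. h s - f n s) s) +
          L2_norm \<mu> (\<lambda>s. f n s - L2_proj \<mu> e (Suc n) (f n) s)"
      proof -
        have "(\<lambda>s. h s - L2_proj \<mu> e (Suc n) h s) = (\<lambda>s. ((h s - f n s) - L2_proj \<mu> e (Suc n) (\<lambda>s. h s - f n s) s) +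
          (f n s - L2_proj \<mu> e (Suc n) (f n) s))"
          by (simp add: L2_proj_diff[OF eL h f])
        then show ?thesis
          by (simp only:) (intro L2_norm_triangle L2_funs_diff L2_proj_L2_funs h f eL)
      qed
      also have "\<dots> \<le> L2_norm \<mu> (\<lambda>s. h s - f n s)"
        using gram_schmidt_residual[of f \<mu> n, OF f] L2_proj_contraction[OF o L2_funs_diff[OF h f[of n]], of "Suc n"]
        by (simp add: e_def)
      finally show ?thesis using n by simp
    qed
    then show "\<exists>no. \<forall>N\<ge>no. norm (L2_norm \<mu> (\<lambda>s. h s - L2_proj \<mu> e N h s) - 0) < \<eta>"
      by (intro exI[of _ "Suc n"]) (simp add: abs_of_nonneg L2_norm_nonneg)
  qed
  with o that show thesis by blast
qed

section \<open>Square integrable processes with a prescribed covariance\<close>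

text \<open>The quadratic form of the covariance operator. It is an iterated integral because that
  is what two applications of Fubini with the probability space produce.\<close>

definition quad_kernel :: "'s measure \<Rightarrow> ('s \<Rightarrow> 's \<Rightarrow> real) \<Rightarrow> ('s \<Rightarrow> real) \<Rightarrow> real" where
  "quad_kernel \<mu> \<sigma> h = (\<integral>s. h s * (\<integral>r. h r * \<sigma> r s \<partial>\<mu>) \<partial>\<mu>)"

text \<open>\<open>kernel_gap \<mu> \<sigma> h A a\<close> is the mean square distance between \<open>\<integral> h x d\<mu>\<close> and
  \<open>\<Sum>s\<in>A. a s * x s\<close> for a process \<open>x\<close> with covariance \<open>\<sigma>\<close>.\<close>

definition kernel_gap ::
  "'s measure \<Rightarrow> ('s \<Rightarrow> 's \<Rightarrow> real) \<Rightarrow> ('s \<Rightarrow> real) \<Rightarrow> 's set \<Rightarrow> ('s \<Rightarrow> real) \<Rightarrow> real" where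
  "kernel_gap \<mu> \<sigma> h A a = quad_kernel \<mu> \<sigma> h - 2 * (\<Sum>s\<in>A. a s * (\<integral>r. h r * \<sigma> r s \<partial>\<mu>)) +
     (\<Sum>s\<in>A. \<Sum>t\<in>A. a s * a t * \<sigma> s t)"

text \<open>The discriminant of a quadratic in \<open>t\<close>, read off at its minimiser
  \<open>b / c\<close>; for \<open>c = 0\<close> the linear term has to vanish.\<close>

lemma sq_le_of_quadratic:
  fixes b c \<epsilon> :: real
  assumes "\<And>t. 2 * t * b \<le> \<epsilon> + t\<^sup>2 * c" "0 \<le> c"
  shows "b\<^sup>2 \<le> \<epsilon> * c"
proof (cases "c = 0")
  case True
  have "b = 0"
  proof (rule ccontr)
    assume "b \<noteq> 0"
    \<comment> \<open>At this \<open>t\<close> the left side is \<open>\<epsilon> + 1\<close> and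
      the right side \<open>\<epsilon>\<close>.\<close>
    then show False using assms(1)[of "(\<epsilon> + 1) / (2 * b)"] True by simp
  qed
  then show ?thesis using True by simp
next
  case False
  have "2 * (b / c) * b \<le> \<epsilon> + (b / c)\<^sup>2 * c" by (rule assms(1))
  then have "b\<^sup>2 / c \<le> \<epsilon>" using False by (simp add: power2_eq_square)
  then show ?thesis using False assms(2) by (simp add: pos_divide_le_eq)
qed

text \<open>The factor \<open>\<kappa>\<close> is elapsed time: \<open>m\<close> for the walk,
  \<open>j / J\<close> for the Wiener process, 1 for an innovation. Covariances are required at
  points only; everything about norms and integrals over \<open>s\<close> is derived by Fubini, in
  terms of \<open>\<kappa>\<close> and \<open>\<sigma>\<close>.\<close>

locale L2_process = pair_sigma_finite M \<mu> + prob_space M for M :: "'w measure" and \<mu> :: "'s measure" +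
  fixes x :: "'w \<Rightarrow> 's \<Rightarrow> real" and \<sigma> :: "'s \<Rightarrow> 's \<Rightarrow> real" and \<kappa> :: real
  assumes x_meas [measurable]: "case_prod x \<in> borel_measurable (M \<Otimes>\<^sub>M \<mu>)"
    and x_sq: "\<And>s. s \<in> space \<mu> \<Longrightarrow> integrable M (\<lambda>\<omega>. (x \<omega> s)\<^sup>2)"
    and x_cov: "\<And>r s. r \<in> space \<mu> \<Longrightarrow> s \<in> space \<mu> \<Longrightarrow> (\<integral>\<omega>. x \<omega> r * x \<omega> s \<partial>M) = \<kappa> * \<sigma> r s"
    and \<sigma>_int: "integrable \<mu> (\<lambda>s. \<sigma> s s)"
begin

lemma x_meas_fst [measurable]: "s \<in> space \<mu> \<Longrightarrow> (\<lambda>\<omega>. x \<omega> s) \<in> borel_measurable M"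
  using measurable_compose[OF measurable_Pair2'[of s \<mu> M] x_meas] by simp

lemma x_sq_eq: "s \<in> space \<mu> \<Longrightarrow> (\<integral>\<omega>. (x \<omega> s)\<^sup>2 \<partial>M) = \<kappa> * \<sigma> s s"
  using x_cov[of s s] by (simp add: power2_eq_square)

lemma x_sq_integrable_pair: "integrable (M \<Otimes>\<^sub>M \<mu>) (\<lambda>(\<omega>, s). (x \<omega> s)\<^sup>2)"
proof (rule integrableI_bounded)
  have "(\<integral>\<^sup>+p. ennreal (norm (case p of (\<omega>, s) \<Rightarrow> (x \<omega> s)\<^sup>2)) \<partial>(M \<Otimes>\<^sub>M \<mu>)) =
      (\<integral>\<^sup>+s. (\<integral>\<^sup>+\<omega>. ennreal ((x \<omega> s)\<^sup>2) \<partial>M) \<partial>\<mu>)"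
    by (subst nn_integral_snd[symmetric]) (auto simp: case_prod_beta')
  also have "\<dots> = (\<integral>\<^sup>+s. ennreal (\<kappa> * \<sigma> s s) \<partial>\<mu>)"
    by (intro nn_integral_cong) (simp add: nn_integral_eq_integral[OF x_sq] x_sq_eq)
  also have "\<dots> \<le> (\<integral>\<^sup>+s. ennreal (norm (\<kappa> * \<sigma> s s)) \<partial>\<mu>)"
    by (intro nn_integral_mono ennreal_leI) simp
  also have "\<dots> < \<infinity>"
    using integrable_mult_right[OF \<sigma>_int, of \<kappa>] unfolding integrable_iff_bounded by blast
  finally show "(\<integral>\<^sup>+p. ennreal (norm (case p of (\<omega>, s) \<Rightarrow> (x \<omega> s)\<^sup>2)) \<partial>(M \<Otimes>\<^sub>M \<mu>)) < \<infinity>" .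
qed simp

lemma AE_L2_funs: "AE \<omega> in M. x \<omega> \<in> L2_funs \<mu>"
  using AE_integrable_fst[OF x_sq_integrable_pair] AE_space
  by eventually_elim (auto simp: L2_funs_def)

lemma L2_norm_measurable [measurable]: "(\<lambda>\<omega>. L2_norm \<mu> (x \<omega>)) \<in> borel_measurable M"
  unfolding L2_norm_def by measurable

lemma L2_norm_sq_eq: "(L2_norm \<mu> (x \<omega>))\<^sup>2 = (\<integral>s. (x \<omega> s)\<^sup>2 \<partial>\<mu>)"
  by (simp add: L2_norm_def)

lemma L2_norm_sq_integrable: "integrable M (\<lambda>\<omega>. (L2_norm \<mu> (x \<omega>))\<^sup>2)"
  unfolding L2_norm_sq_eq by (rule integrable_fst[OF x_sq_integrable_pair])

lemma L2_norm_sq_expectation: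
  "(\<integral>\<omega>. (L2_norm \<mu> (x \<omega>))\<^sup>2 \<partial>M) = \<kappa> * (\<integral>s. \<sigma> s s \<partial>\<mu>)"
proof -
  have "(\<integral>\<omega>. (L2_norm \<mu> (x \<omega>))\<^sup>2 \<partial>M) = (\<integral>s. (\<integral>\<omega>. (x \<omega> s)\<^sup>2 \<partial>M) \<partial>\<mu>)"
    unfolding L2_norm_sq_eq by (rule Fubini_integral[OF x_sq_integrable_pair, symmetric])
  also have "\<dots> = (\<integral>s. \<kappa> * \<sigma> s s \<partial>\<mu>)"
    by (intro Bochner_Integration.integral_cong) (auto simp: x_sq_eq)
  finally show ?thesis by simp
qed

text \<open>\<open>h s * Z \<omega>\<close> and \<open>x \<omega> s\<close> are both square
  integrable on the product space, so their product is integrable.\<close>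

lemma mult_integrable_pair:
  assumes Z: "Z \<in> borel_measurable M" "integrable M (\<lambda>\<omega>. (Z \<omega>)\<^sup>2)" and h: "h \<in> L2_funs \<mu>"
  shows "integrable (M \<Otimes>\<^sub>M \<mu>) (\<lambda>(\<omega>, s). h s * (Z \<omega> * x \<omega> s))"
proof -
  have [measurable]: "h \<in> borel_measurable \<mu>" "Z \<in> borel_measurable M"
    using h Z by (auto simp: L2_funs_def)
  have ih: "integrable \<mu> (\<lambda>s. (h s)\<^sup>2)" using h by (simp add: L2_funs_def)
  have "integrable (M \<Otimes>\<^sub>M \<mu>) (\<lambda>(\<omega>, s). (h s * Z \<omega>)\<^sup>2)"
  proof (rule Fubini_integrable)
    show "integrable M (\<lambda>\<omega>. \<integral>s. norm (case (\<omega>, s) of (\<omega>, s) \<Rightarrow> (h s * Z \<omega>)\<^sup>2) \<partial>\<mu>)"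
      using Z by (simp add: power_mult_distrib)
    show "AE \<omega> in M. integrable \<mu> (\<lambda>s. case (\<omega>, s) of (\<omega>, s) \<Rightarrow> (h s * Z \<omega>)\<^sup>2)"
      using ih by (simp add: power_mult_distrib)
  qed measurable
  then have "integrable (M \<Otimes>\<^sub>M \<mu>) (\<lambda>p. (case p of (\<omega>, s) \<Rightarrow> h s * Z \<omega>) * (case p of (\<omega>, s) \<Rightarrow> x \<omega> s))"
    using x_sq_integrable_pair by (intro integrable_mult_L2) (auto simp: case_prod_beta')
  then show ?thesis by (simp add: case_prod_beta' mult.assoc)
qed

text \<open>The one interchange of integrals from which all second moments follow: with a point
  value for \<open>Z\<close> it gives the covariance of an integral and a point value, with the
  integral itself for \<open>Z\<close> its variance.\<close>

lemma inner_mult_expectation: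
  assumes Z: "Z \<in> borel_measurable M" "integrable M (\<lambda>\<omega>. (Z \<omega>)\<^sup>2)" and h: "h \<in> L2_funs \<mu>"
  shows "integrable \<mu> (\<lambda>s. h s * (\<integral>\<omega>. Z \<omega> * x \<omega> s \<partial>M))"
    and "(\<integral>\<omega>. Z \<omega> * L2_inner \<mu> (x \<omega>) h \<partial>M) = (\<integral>s. h s * (\<integral>\<omega>. Z \<omega> * x \<omega> s \<partial>M) \<partial>\<mu>)"
proof -
  note i = mult_integrable_pair[OF assms]
  show "integrable \<mu> (\<lambda>s. h s * (\<integral>\<omega>. Z \<omega> * x \<omega> s \<partial>M))"
    using integrable_snd[OF i] by simp
  have "(\<integral>s. (\<integral>\<omega>. h s * (Z \<omega> * x \<omega> s) \<partial>M) \<partial>\<mu>) = (\<integral>\<omega>. (\<integral>s. h s * (Z \<omega> * x \<omega> s) \<partial>\<mu>) \<partial>M)"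
    by (rule Fubini_integral[OF i])
  moreover have "(\<integral>s. h s * (Z \<omega> * x \<omega> s) \<partial>\<mu>) = Z \<omega> * L2_inner \<mu> (x \<omega>) h" for \<omega>
    by (subst integral_mult_right_zero[symmetric]) (simp add: mult_ac)
  ultimately show "(\<integral>\<omega>. Z \<omega> * L2_inner \<mu> (x \<omega>) h \<partial>M) = (\<integral>s. h s * (\<integral>\<omega>. Z \<omega> * x \<omega> s \<partial>M) \<partial>\<mu>)"
    by simp
qed

lemma inner_measurable [measurable]:
  assumes [measurable]: "h \<in> borel_measurable \<mu>"
  shows "(\<lambda>\<omega>. L2_inner \<mu> (x \<omega>) h) \<in> borel_measurable M"
  by measurable

lemma inner_sq_integrable:
  assumes h: "h \<in> L2_funs \<mu>"
  shows "integrable M (\<lambda>\<omega>. (L2_inner \<mu> (x \<omega>) h)\<^sup>2)"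
proof (rule Bochner_Integration.integrable_bound)
  show "integrable M (\<lambda>\<omega>. (L2_norm \<mu> h)\<^sup>2 * (L2_norm \<mu> (x \<omega>))\<^sup>2)"
    using L2_norm_sq_integrable by simp
  have [measurable]: "h \<in> borel_measurable \<mu>" using h by (simp add: L2_funs_def)
  show "(\<lambda>\<omega>. (L2_inner \<mu> (x \<omega>) h)\<^sup>2) \<in> borel_measurable M" by measurable
  show "AE \<omega> in M. norm ((L2_inner \<mu> (x \<omega>) h)\<^sup>2) \<le> norm ((L2_norm \<mu> h)\<^sup>2 * (L2_norm \<mu> (x \<omega>))\<^sup>2)"
    using AE_L2_funs
  proof eventually_elim
    case (elim \<omega>)
    have "\<bar>L2_inner \<mu> (x \<omega>) h\<bar>\<^sup>2 \<le> (L2_norm \<mu> (x \<omega>) * L2_norm \<mu> h)\<^sup>2"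
      by (intro power_mono L2_inner_abs_le elim h) simp
    then show ?case by (simp add: power_mult_distrib mult.commute)
  qed
qed

lemma inner_x_expectation:
  assumes h: "h \<in> L2_funs \<mu>" and r: "r \<in> space \<mu>"
  shows "(\<integral>\<omega>. x \<omega> r * L2_inner \<mu> (x \<omega>) h \<partial>M) = \<kappa> * (\<integral>s. h s * \<sigma> s r \<partial>\<mu>)"
proof -
  have "(\<integral>\<omega>. x \<omega> r * L2_inner \<mu> (x \<omega>) h \<partial>M) = (\<integral>s. h s * (\<integral>\<omega>. x \<omega> r * x \<omega> s \<partial>M) \<partial>\<mu>)"
    using r by (intro inner_mult_expectation x_sq h) auto
  also have "\<dots> = (\<integral>s. \<kappa> * (h s * \<sigma> s r) \<partial>\<mu>)"
    using r by (intro Bochner_Integration.integral_cong) (auto simp: x_cov[of _ r] mult.commute[of "x _ r"])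
  finally show ?thesis by simp
qed

lemma inner_sq_expectation:
  assumes h: "h \<in> L2_funs \<mu>"
  shows "(\<integral>\<omega>. (L2_inner \<mu> (x \<omega>) h)\<^sup>2 \<partial>M) = \<kappa> * quad_kernel \<mu> \<sigma> h"
proof -
  have [measurable]: "h \<in> borel_measurable \<mu>" using h by (simp add: L2_funs_def)
  have "(\<integral>\<omega>. L2_inner \<mu> (x \<omega>) h * L2_inner \<mu> (x \<omega>) h \<partial>M) = 
      (\<integral>s. h s * (\<integral>\<omega>. L2_inner \<mu> (x \<omega>) h * x \<omega> s \<partial>M) \<partial>\<mu>)"
    by (intro inner_mult_expectation inner_sq_integrable h) measurable
  also have "\<dots> = (\<integral>s. \<kappa> * (h s * (\<integral>r. h r * \<sigma> r s \<partial>\<mu>)) \<partial>\<mu>)"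
    using inner_x_expectation[OF h] by (intro Bochner_Integration.integral_cong) (auto simp: mult.commute)
  finally show ?thesis by (simp add: quad_kernel_def power2_eq_square)
qed

lemma combination_sq_integrable:
  assumes "finite A" "A \<subseteq> space \<mu>"
  shows "integrable M (\<lambda>\<omega>. (\<Sum>s\<in>A. a s * x \<omega> s)\<^sup>2)"
  using assms
proof (induction A)
  case (insert s A)
  have "(\<lambda>\<omega>. \<Sum>s\<in>A. a s * x \<omega> s) \<in> borel_measurable M"
    using insert by (intro borel_measurable_sum borel_measurable_times) auto
  with insert have "integrable M (\<lambda>\<omega>. a s * x \<omega> s * (\<Sum>s\<in>A. a s * x \<omega> s))"
    using x_sq[of s] by (intro integrable_mult_L2) (auto simp: power_mult_distrib)
  with insert show ?case
    using x_sq[of s] by (auto simp: power2_sum power_mult_distrib mult.assoc)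
qed simp

text \<open>All three terms of the expanded square are \<open>\<kappa>\<close> times an expression
  in \<open>\<sigma>\<close>. A combination of point values that is good for one process is thus
  equally good, up to \<open>\<kappa>\<close>, for every process with this covariance.\<close>

lemma gap_expectation:
  assumes h: "h \<in> L2_funs \<mu>" and A: "finite A" "A \<subseteq> space \<mu>"
  shows "integrable M (\<lambda>\<omega>. (L2_inner \<mu> (x \<omega>) h - (\<Sum>s\<in>A. a s * x \<omega> s))\<^sup>2)"
    and "(\<integral>\<omega>. (L2_inner \<mu> (x \<omega>) h - (\<Sum>s\<in>A. a s * x \<omega> s))\<^sup>2 \<partial>M) = \<kappa> * kernel_gap \<mu> \<sigma> h A a"
proof -
  have [measurable]: "h \<in> borel_measurable \<mu>" using h by (simp add: L2_funs_def)
  have Am: "s \<in> A \<Longrightarrow> s \<in> space \<mu>" for s using A by auto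
  let ?Y = "\<lambda>\<omega>. L2_inner \<mu> (x \<omega>) h"
  have [measurable]: "(\<lambda>\<omega>. \<Sum>s\<in>A. a s * x \<omega> s) \<in> borel_measurable M"
    using Am by measurable
  have iY: "integrable M (\<lambda>\<omega>. (?Y \<omega>)\<^sup>2)" by (rule inner_sq_integrable[OF h])
  have iYx: "integrable M (\<lambda>\<omega>. x \<omega> s * ?Y \<omega>)" if "s \<in> A" for s
    using Am[OF that] by (intro integrable_mult_L2 iY x_sq) auto
  have ixx: "integrable M (\<lambda>\<omega>. x \<omega> s * x \<omega> t)" if "s \<in> A" "t \<in> A" for s t
    using Am[OF that(1)] Am[OF that(2)] by (intro integrable_mult_L2 x_sq) auto
  have eq: "(?Y \<omega> - (\<Sum>s\<in>A. a s * x \<omega> s))\<^sup>2 = (?Y \<omega>)\<^sup>2 - 2 * (\<Sum>s\<in>A. a s * (x \<omega> s * ?Y \<omega>)) +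
      (\<Sum>s\<in>A. \<Sum>t\<in>A. a s * a t * (x \<omega> s * x \<omega> t))" for \<omega>
  proof -
    have "(\<Sum>s\<in>A. a s * (x \<omega> s * ?Y \<omega>)) = (\<Sum>s\<in>A. a s * x \<omega> s) * ?Y \<omega>"
      by (simp add: sum_distrib_right mult.assoc)
    moreover have "(\<Sum>s\<in>A. \<Sum>t\<in>A. a s * a t * (x \<omega> s * x \<omega> t)) = (\<Sum>s\<in>A. a s * x \<omega> s)\<^sup>2"
      by (simp add: power2_eq_square sum_product mult_ac)
    ultimately show ?thesis by (simp add: power2_diff)
  qed
  have i2: "integrable M (\<lambda>\<omega>. \<Sum>s\<in>A. a s * (x \<omega> s * ?Y \<omega>))"
    using iYx by (intro Bochner_Integration.integrable_sum integrable_mult_right) auto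
  have i3: "integrable M (\<lambda>\<omega>. \<Sum>s\<in>A. \<Sum>t\<in>A. a s * a t * (x \<omega> s * x \<omega> t))"
    using ixx by (intro Bochner_Integration.integrable_sum integrable_mult_right) auto
  show "integrable M (\<lambda>\<omega>. (?Y \<omega> - (\<Sum>s\<in>A. a s * x \<omega> s))\<^sup>2)"
    unfolding eq using iY i2 i3 by simp
  have e2: "(\<integral>\<omega>. (\<Sum>s\<in>A. a s * (x \<omega> s * ?Y \<omega>)) \<partial>M) = (\<Sum>s\<in>A. a s * (\<kappa> * (\<integral>r. h r * \<sigma> r s \<partial>\<mu>)))"
    using iYx Am by (subst Bochner_Integration.integral_sum) (auto simp: inner_x_expectation[OF h])
  have e3: "(\<integral>\<omega>. (\<Sum>s\<in>A. \<Sum>t\<in>A. a s * a t * (x \<omega> s * x \<omega> t)) \<partial>M) = (\<Sum>s\<in>A. \<Sum>t\<in>A. a s * a t * (\<kappa> * \<sigma> s t))"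
  proof -
    have "(\<integral>\<omega>. (\<Sum>s\<in>A. \<Sum>t\<in>A. a s * a t * (x \<omega> s * x \<omega> t)) \<partial>M) =
      (\<Sum>s\<in>A. \<integral>\<omega>. (\<Sum>t\<in>A. a s * a t * (x \<omega> s * x \<omega> t)) \<partial>M)"
      using ixx by (intro Bochner_Integration.integral_sum Bochner_Integration.integrable_sum integrable_mult_right) auto
    also have "\<dots> = (\<Sum>s\<in>A. \<Sum>t\<in>A. \<integral>\<omega>. a s * a t * (x \<omega> s * x \<omega> t) \<partial>M)"
      using ixx by (intro sum.cong refl Bochner_Integration.integral_sum integrable_mult_right) auto
    also have "\<dots> = (\<Sum>s\<in>A. \<Sum>t\<in>A. a s * a t * (\<kappa> * \<sigma> s t))"
      using x_cov Am by (intro sum.cong refl) simp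
    finally show ?thesis .
  qed
  show "(\<integral>\<omega>. (?Y \<omega> - (\<Sum>s\<in>A. a s * x \<omega> s))\<^sup>2 \<partial>M) = \<kappa> * kernel_gap \<mu> \<sigma> h A a"
  proof -
    have "(\<integral>\<omega>. (?Y \<omega> - (\<Sum>s\<in>A. a s * x \<omega> s))\<^sup>2 \<partial>M) = (\<integral>\<omega>. (?Y \<omega>)\<^sup>2 \<partial>M) -
      2 * (\<integral>\<omega>. (\<Sum>s\<in>A. a s * (x \<omega> s * ?Y \<omega>)) \<partial>M) +
      (\<integral>\<omega>. (\<Sum>s\<in>A. \<Sum>t\<in>A. a s * a t * (x \<omega> s * x \<omega> t)) \<partial>M)"
      unfolding eq using iY i2 i3
      by (subst Bochner_Integration.integral_add Bochner_Integration.integral_diff | simp)+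
    also have "\<dots> = \<kappa> * kernel_gap \<mu> \<sigma> h A a"
      unfolding e2 e3 inner_sq_expectation[OF h] kernel_gap_def
      by (simp add: algebra_simps sum_distrib_left)
    finally show ?thesis .
  qed
qed

text \<open>Pythagoras under the expectation. The mean residual again depends on the process through
  \<open>\<kappa>\<close> and \<open>\<sigma>\<close> only, so a truncation of the basis chosen for
  one innovation works for the walk at all times.\<close>

lemma proj_residual:
  assumes e: "orthonormal_or_zero \<mu> e"
  shows "(\<lambda>\<omega>. L2_norm \<mu> (\<lambda>s. x \<omega> s - L2_proj \<mu> e N (x \<omega>) s)) \<in> borel_measurable M"
    and "integrable M (\<lambda>\<omega>. (L2_norm \<mu> (\<lambda>s. x \<omega> s - L2_proj \<mu> e N (x \<omega>) s))\<^sup>2)"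
    and "(\<integral>\<omega>. (L2_norm \<mu> (\<lambda>s. x \<omega> s - L2_proj \<mu> e N (x \<omega>) s))\<^sup>2 \<partial>M) =
      \<kappa> * ((\<integral>s. \<sigma> s s \<partial>\<mu>) - (\<Sum>i<N. quad_kernel \<mu> \<sigma> (e i)))"
proof -
  have eL: "e i \<in> L2_funs \<mu>" for i using e by (simp add: orthonormal_or_zero_def)
  then have [measurable]: "e i \<in> borel_measurable \<mu>" for i by (simp add: L2_funs_def)
  show m: "(\<lambda>\<omega>. L2_norm \<mu> (\<lambda>s. x \<omega> s - L2_proj \<mu> e N (x \<omega>) s)) \<in> borel_measurable M"
    unfolding L2_norm_def L2_proj_def by measurable
  have ae: "AE \<omega> in M. (L2_norm \<mu> (\<lambda>s. x \<omega> s - L2_proj \<mu> e N (x \<omega>) s))\<^sup>2 =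
      (L2_norm \<mu> (x \<omega>))\<^sup>2 - (\<Sum>i<N. (L2_inner \<mu> (x \<omega>) (e i))\<^sup>2)"
    using AE_L2_funs by eventually_elim (rule L2_proj_Pythagoras[OF e])
  have i: "integrable M (\<lambda>\<omega>. (L2_norm \<mu> (x \<omega>))\<^sup>2 - (\<Sum>i<N. (L2_inner \<mu> (x \<omega>) (e i))\<^sup>2))"
    using L2_norm_sq_integrable inner_sq_integrable[OF eL] by auto
  show "integrable M (\<lambda>\<omega>. (L2_norm \<mu> (\<lambda>s. x \<omega> s - L2_proj \<mu> e N (x \<omega>) s))\<^sup>2)"
    by (subst integrable_cong_AE[OF _ _ ae]) (use i m in \<open>auto intro: borel_measurable_integrable\<close>)
  have "(\<integral>\<omega>. (L2_norm \<mu> (\<lambda>s. x \<omega> s - L2_proj \<mu> e N (x \<omega>) s))\<^sup>2 \<partial>M) =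
      (\<integral>\<omega>. (L2_norm \<mu> (x \<omega>))\<^sup>2 - (\<Sum>i<N. (L2_inner \<mu> (x \<omega>) (e i))\<^sup>2) \<partial>M)"
    by (rule integral_cong_AE[OF _ _ ae]) (use i m in \<open>auto intro: borel_measurable_integrable\<close>)
  also have "\<dots> = \<kappa> * (\<integral>s. \<sigma> s s \<partial>\<mu>) - (\<Sum>i<N. \<kappa> * quad_kernel \<mu> \<sigma> (e i))"
    using L2_norm_sq_integrable inner_sq_integrable[OF eL]
    by (simp add: Bochner_Integration.integral_sum L2_norm_sq_expectation inner_sq_expectation[OF eL])
  finally show "(\<integral>\<omega>. (L2_norm \<mu> (\<lambda>s. x \<omega> s - L2_proj \<mu> e N (x \<omega>) s))\<^sup>2 \<partial>M) =
      \<kappa> * ((\<integral>s. \<sigma> s s \<partial>\<mu>) - (\<Sum>i<N. quad_kernel \<mu> \<sigma> (e i)))"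
    by (simp add: right_diff_distrib sum_distrib_left)
qed

end

text \<open>The infimum of the gap is approached along combinations whose residual is almost orthogonal to
  every \<open>x s\<close>, hence to \<open>\<integral> h x d\<mu>\<close>, so the infimum is 0.\<close>

lemma (in L2_process) kernel_gap_small:
  assumes \<kappa>: "\<kappa> = 1" and h: "h \<in> L2_funs \<mu>" and \<eta>: "0 < \<eta>"
  shows "\<exists>A a. finite A \<and> A \<subseteq> space \<mu> \<and> kernel_gap \<mu> \<sigma> h A a < \<eta>"
proof -
  have [measurable]: "h \<in> borel_measurable \<mu>" using h by (simp add: L2_funs_def)
  define Y where "Y \<omega> = L2_inner \<mu> (x \<omega>) h" for \<omega>
  have [measurable]: "Y \<in> borel_measurable M" unfolding Y_def by measurable
  have iY: "integrable M (\<lambda>\<omega>. (Y \<omega>)\<^sup>2)" unfolding Y_def by (rule inner_sq_integrable[OF h])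
  define V where "V = {Z. \<exists>A a. finite A \<and> A \<subseteq> space \<mu> \<and> Z = (\<lambda>\<omega>. \<Sum>s\<in>A. a s * x \<omega> s)}"
  have Vm: "Z \<in> borel_measurable M" if "Z \<in> V" for Z
    using that unfolding V_def by (auto intro!: borel_measurable_sum borel_measurable_times)
  have Vi: "integrable M (\<lambda>\<omega>. (Z \<omega>)\<^sup>2)" if "Z \<in> V" for Z
    using that unfolding V_def by (auto intro: combination_sq_integrable)
  have Vscale: "(\<lambda>\<omega>. c * Z \<omega>) \<in> V" if Z: "Z \<in> V" for Z c
  proof -
    obtain A a where "finite A" "A \<subseteq> space \<mu>" "Z = (\<lambda>\<omega>. \<Sum>s\<in>A. a s * x \<omega> s)" using Z by (auto simp: V_def)
    then show ?thesis unfolding V_def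
      by (intro CollectI exI[of _ A] exI[of _ "\<lambda>s. c * a s"]) (simp add: sum_distrib_left mult.assoc)
  qed
  have Vadd: "(\<lambda>\<omega>. Z \<omega> + c * x \<omega> r) \<in> V" if Z: "Z \<in> V" and r: "r \<in> space \<mu>" for Z c r
  proof -
    obtain A a where A: "finite A" "A \<subseteq> space \<mu>" "Z = (\<lambda>\<omega>. \<Sum>s\<in>A. a s * x \<omega> s)" using Z by (auto simp: V_def)
    define b where "b s = (if s \<in> A then a s else 0) + (if s = r then c else 0)" for s
    have "(\<Sum>s\<in>insert r A. b s * x \<omega> s) = (\<Sum>s\<in>insert r A. (if s \<in> A then a s * x \<omega> s else 0)) + 
      (\<Sum>s\<in>insert r A. (if s = r then c * x \<omega> s else 0))" for \<omega>
      unfolding sum.distrib[symmetric] by (intro sum.cong) (auto simp: b_def algebra_simps)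
    moreover have "(\<Sum>s\<in>insert r A. (if s \<in> A then a s * x \<omega> s else 0)) = (\<Sum>s\<in>A. a s * x \<omega> s)" for \<omega>
      using A(1) by (intro sum.mono_neutral_cong_right) auto
    ultimately have "(\<lambda>\<omega>. Z \<omega> + c * x \<omega> r) = (\<lambda>\<omega>. \<Sum>s\<in>insert r A. b s * x \<omega> s)"
      using A by simp
    then show ?thesis unfolding V_def using A r by (intro CollectI exI[of _ "insert r A"] exI[of _ b]) auto
  qed
  have V0: "(\<lambda>_. 0) \<in> V" unfolding V_def by (intro CollectI exI[of _ "{}"]) auto
  define dist2 where "dist2 Z = (\<integral>\<omega>. (Y \<omega> - Z \<omega>)\<^sup>2 \<partial>M)" for Z
  define d where "d = (INF Z\<in>V. dist2 Z)"
  have bdd: "bdd_below (dist2 ` V)" by (rule bdd_belowI2[of _ 0]) (simp add: dist2_def)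
  have d_le: "d \<le> dist2 Z" if "Z \<in> V" for Z unfolding d_def by (rule cINF_lower[OF bdd that])
  have d0: "0 \<le> d" unfolding d_def using V0 by (intro cINF_greatest) (auto simp: dist2_def)
  define CY where "CY = (\<integral>\<omega>. (Y \<omega>)\<^sup>2 \<partial>M)"
  define C1 where "C1 = (\<integral>s. \<bar>h s\<bar> * sqrt \<bar>\<sigma> s s\<bar> \<partial>\<mu>)"
  have \<sigma>_nonneg: "0 \<le> \<sigma> s s" if "s \<in> space \<mu>" for s
  proof -
    have "0 \<le> (\<integral>\<omega>. (x \<omega> s)\<^sup>2 \<partial>M)" by simp
    then show ?thesis using x_sq_eq[OF that] \<kappa> by simp
  qed
  have iC1: "integrable \<mu> (\<lambda>s. \<bar>h s\<bar> * sqrt \<bar>\<sigma> s s\<bar>)"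
  proof (rule integrable_mult_L2)
    show "(\<lambda>s. sqrt \<bar>\<sigma> s s\<bar>) \<in> borel_measurable \<mu>" using \<sigma>_int by (auto intro: borel_measurable_integrable)
  qed (use h \<sigma>_int in \<open>auto simp: L2_funs_def\<close>)
  have C1_nonneg: "0 \<le> C1" unfolding C1_def by simp
  have main: "dist2 Z \<le> sqrt \<epsilon> * (C1 + sqrt (2 * CY + 2 * (d + \<epsilon>)))"
    if Z: "Z \<in> V" and near: "dist2 Z < d + \<epsilon>" and \<epsilon>: "0 < \<epsilon>" for Z \<epsilon>
  proof -
    note Zm[measurable] = Vm[OF Z] and iZ = Vi[OF Z]
    define D where "D \<omega> = Y \<omega> - Z \<omega>" for \<omega>
    have [measurable]: "D \<in> borel_measurable M" unfolding D_def by measurable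
    have iYZ: "integrable M (\<lambda>\<omega>. Y \<omega> * Z \<omega>)" by (intro integrable_mult_L2 iY iZ) measurable
    have iD: "integrable M (\<lambda>\<omega>. (D \<omega>)\<^sup>2)"
      unfolding D_def power2_diff using iY iZ iYZ by (simp add: mult.assoc)
    have near': "(\<integral>\<omega>. (D \<omega>)\<^sup>2 \<partial>M) < d + \<epsilon>" using near by (simp add: dist2_def D_def)
    \<comment> \<open>Moving \<open>Z\<close> within \<open>V\<close> along \<open>U\<close> lowers
      the squared distance by less than \<open>\<epsilon>\<close>, as it was within
      \<open>\<epsilon>\<close> of the infimum. Having this for all \<open>t\<close> is a quadratic
      inequality.\<close>
    have orth: "(\<integral>\<omega>. D \<omega> * U \<omega> \<partial>M)\<^sup>2 \<le> \<epsilon> * (\<integral>\<omega>. (U \<omega>)\<^sup>2 \<partial>M)"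
      if U: "U \<in> borel_measurable M" "integrable M (\<lambda>\<omega>. (U \<omega>)\<^sup>2)" "\<And>t. (\<lambda>\<omega>. Z \<omega> + t * U \<omega>) \<in> V" for U
    proof (rule sq_le_of_quadratic)
      fix t
      have iDU: "integrable M (\<lambda>\<omega>. D \<omega> * U \<omega>)" by (rule integrable_mult_L2[OF _ U(1) iD U(2)]) simp
      have "d \<le> (\<integral>\<omega>. (Y \<omega> - (Z \<omega> + t * U \<omega>))\<^sup>2 \<partial>M)" using d_le[OF U(3)] by (simp add: dist2_def)
      also have "\<dots> = (\<integral>\<omega>. (D \<omega>)\<^sup>2 - 2 * t * (D \<omega> * U \<omega>) + t\<^sup>2 * (U \<omega>)\<^sup>2 \<partial>M)"
        by (intro Bochner_Integration.integral_cong) (auto simp: D_def power2_eq_square algebra_simps)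
      also have "\<dots> = (\<integral>\<omega>. (D \<omega>)\<^sup>2 \<partial>M) - 2 * t * (\<integral>\<omega>. D \<omega> * U \<omega> \<partial>M) + t\<^sup>2 * (\<integral>\<omega>. (U \<omega>)\<^sup>2 \<partial>M)"
        using iD iDU U(2) by simp
      finally show "2 * t * (\<integral>\<omega>. D \<omega> * U \<omega> \<partial>M) \<le> \<epsilon> + t\<^sup>2 * (\<integral>\<omega>. (U \<omega>)\<^sup>2 \<partial>M)" using near' by simp
    qed simp
    have ox: "\<bar>\<integral>\<omega>. D \<omega> * x \<omega> r \<partial>M\<bar> \<le> sqrt \<epsilon> * sqrt \<bar>\<sigma> r r\<bar>" if r: "r \<in> space \<mu>" for r
    proof -
      have "(\<integral>\<omega>. D \<omega> * x \<omega> r \<partial>M)\<^sup>2 \<le> \<epsilon> * \<sigma> r r"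
        using orth[of "\<lambda>\<omega>. x \<omega> r"] x_sq[OF r] Vadd[OF Z r] x_sq_eq[OF r] \<kappa> r by simp
      then have "sqrt ((\<integral>\<omega>. D \<omega> * x \<omega> r \<partial>M)\<^sup>2) \<le> sqrt (\<epsilon> * \<bar>\<sigma> r r\<bar>)"
        using \<sigma>_nonneg[OF r] by (intro real_sqrt_le_mono) simp
      then show ?thesis by (simp add: real_sqrt_mult)
    qed
    \<comment> \<open>\<open>Z\<close> is itself an admissible direction, and its second moment
      stays bounded as \<open>\<epsilon>\<close> shrinks.\<close>
    have "(\<lambda>\<omega>. Z \<omega> + t * Z \<omega>) \<in> V" for t
      using Vscale[OF Z, of "1 + t"] by (simp add: algebra_simps)
    then have "(\<integral>\<omega>. D \<omega> * Z \<omega> \<partial>M)\<^sup>2 \<le> \<epsilon> * (\<integral>\<omega>. (Z \<omega>)\<^sup>2 \<partial>M)"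
      by (intro orth iZ) auto
    also have "(\<integral>\<omega>. (Z \<omega>)\<^sup>2 \<partial>M) \<le> (\<integral>\<omega>. 2 * (Y \<omega>)\<^sup>2 + 2 * (D \<omega>)\<^sup>2 \<partial>M)"
    proof (rule integral_mono)
      show "(Z \<omega>)\<^sup>2 \<le> 2 * (Y \<omega>)\<^sup>2 + 2 * (D \<omega>)\<^sup>2" for \<omega>
        using sum_squares_bound[of "Y \<omega>" "- D \<omega>"] by (simp add: D_def power2_eq_square algebra_simps)
    qed (use iZ iY iD in auto)
    also have "\<dots> \<le> 2 * CY + 2 * (d + \<epsilon>)"
      using iY iD near' by (simp add: CY_def)
    finally have "(\<integral>\<omega>. D \<omega> * Z \<omega> \<partial>M)\<^sup>2 \<le> \<epsilon> * (2 * CY + 2 * (d + \<epsilon>))"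
      using \<epsilon> by (simp add: mult_left_mono)
    then have "sqrt ((\<integral>\<omega>. D \<omega> * Z \<omega> \<partial>M)\<^sup>2) \<le> sqrt (\<epsilon> * (2 * CY + 2 * (d + \<epsilon>)))"
      by (rule real_sqrt_le_mono)
    then have oZ: "\<bar>\<integral>\<omega>. D \<omega> * Z \<omega> \<partial>M\<bar> \<le> sqrt \<epsilon> * sqrt (2 * CY + 2 * (d + \<epsilon>))"
      by (simp add: real_sqrt_mult)
    have iDx: "integrable \<mu> (\<lambda>s. h s * (\<integral>\<omega>. D \<omega> * x \<omega> s \<partial>M))"
      by (intro inner_mult_expectation iD h) measurable
    have "(\<integral>\<omega>. D \<omega> * Y \<omega> \<partial>M) = (\<integral>s. h s * (\<integral>\<omega>. D \<omega> * x \<omega> s \<partial>M) \<partial>\<mu>)"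
      unfolding Y_def by (intro inner_mult_expectation iD h) measurable
    also have "\<dots> \<le> (\<integral>s. sqrt \<epsilon> * (\<bar>h s\<bar> * sqrt \<bar>\<sigma> s s\<bar>) \<partial>\<mu>)"
    proof (intro integral_mono_AE iDx integrable_mult_right iC1 AE_I2)
      fix s assume s: "s \<in> space \<mu>"
      have "h s * (\<integral>\<omega>. D \<omega> * x \<omega> s \<partial>M) \<le> \<bar>h s\<bar> * \<bar>\<integral>\<omega>. D \<omega> * x \<omega> s \<partial>M\<bar>"
        using abs_ge_self[of "h s * (\<integral>\<omega>. D \<omega> * x \<omega> s \<partial>M)"] by (simp add: abs_mult)
      also have "\<dots> \<le> \<bar>h s\<bar> * (sqrt \<epsilon> * sqrt \<bar>\<sigma> s s\<bar>)" by (intro mult_left_mono ox s) simp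
      finally show "h s * (\<integral>\<omega>. D \<omega> * x \<omega> s \<partial>M) \<le> sqrt \<epsilon> * (\<bar>h s\<bar> * sqrt \<bar>\<sigma> s s\<bar>)" by (simp add: mult_ac)
    qed
    also have "\<dots> = sqrt \<epsilon> * C1" by (simp add: C1_def)
    finally have oY: "(\<integral>\<omega>. D \<omega> * Y \<omega> \<partial>M) \<le> sqrt \<epsilon> * C1" .
    have iDY: "integrable M (\<lambda>\<omega>. D \<omega> * Y \<omega>)" and iDZ: "integrable M (\<lambda>\<omega>. D \<omega> * Z \<omega>)"
      by (intro integrable_mult_L2 iD iY iZ; measurable)+
    \<comment> \<open>\<open>D\<^sup>2 = D * Y - D * Z\<close>, and the means of both products have
      been controlled at order \<open>sqrt \<epsilon>\<close>.\<close>
    have "dist2 Z = (\<integral>\<omega>. D \<omega> * Y \<omega> - D \<omega> * Z \<omega> \<partial>M)"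
      unfolding dist2_def by (intro Bochner_Integration.integral_cong) (auto simp: D_def power2_eq_square algebra_simps)
    also have "\<dots> = (\<integral>\<omega>. D \<omega> * Y \<omega> \<partial>M) - (\<integral>\<omega>. D \<omega> * Z \<omega> \<partial>M)" using iDY iDZ by simp
    also have "\<dots> \<le> sqrt \<epsilon> * C1 + sqrt \<epsilon> * sqrt (2 * CY + 2 * (d + \<epsilon>))" using oY oZ by linarith
    finally show ?thesis by (simp add: distrib_left)
  qed
  have lim: "((\<lambda>\<epsilon>. sqrt \<epsilon> * (C1 + sqrt (2 * CY + 2 * (d + \<epsilon>)))) \<longlongrightarrow> sqrt 0 * (C1 + sqrt (2 * CY + 2 * (d + 0)))) (at_right 0)"
    by (intro tendsto_intros)
  then have "eventually (\<lambda>\<epsilon>. sqrt \<epsilon> * (C1 + sqrt (2 * CY + 2 * (d + \<epsilon>))) < \<eta>) (at_right 0)"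
    using \<eta> by (intro order_tendstoD(2)) auto
  then obtain \<epsilon> where \<epsilon>: "0 < \<epsilon>" "sqrt \<epsilon> * (C1 + sqrt (2 * CY + 2 * (d + \<epsilon>))) < \<eta>"
    using eventually_happens'[OF _ eventually_conj[OF _ eventually_at_right_less[of 0]]] trivial_limit_at_right_real
    by (metis (no_types, lifting))
  have "\<exists>Z\<in>V. dist2 Z < d + \<epsilon>"
    using cInf_lessD[of "dist2 ` V" "d + \<epsilon>"] V0 \<epsilon>(1) by (auto simp: d_def)
  then obtain Z where Z: "Z \<in> V" "dist2 Z < d + \<epsilon>" by blast
  then obtain A a where A: "finite A" "A \<subseteq> space \<mu>" "Z = (\<lambda>\<omega>. \<Sum>s\<in>A. a s * x \<omega> s)" by (auto simp: V_def)
  have "kernel_gap \<mu> \<sigma> h A a = dist2 Z"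
    using gap_expectation(2)[OF h A(1,2), of a] \<kappa> by (simp add: dist2_def Y_def A(3))
  also have "\<dots> < \<eta>" using main[OF Z \<epsilon>(1)] \<epsilon>(2) by simp
  finally show ?thesis using A by blast
qed

section \<open>Trigonometric polynomials and the Cramer-Wold device\<close>

text \<open>Cosines with a phase are real, contain the sines and are closed under products, so they
  generate an algebra for Stone-Weierstrass; the expectation of each is determined by the
  characteristic function of a linear combination.\<close>

inductive trig_poly :: "'i set \<Rightarrow> (('i \<Rightarrow> real) \<Rightarrow> real) \<Rightarrow> bool" for I where
  cos: "trig_poly I (\<lambda>x. b * cos ((\<Sum>k\<in>I. u k * x k) + c))"
| add: "trig_poly I f \<Longrightarrow> trig_poly I g \<Longrightarrow> trig_poly I (\<lambda>x. f x + g x)"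

lemma trig_poly_mult_cos:
  "trig_poly I g \<Longrightarrow> trig_poly I (\<lambda>x. b * cos ((\<Sum>k\<in>I. u k * x k) + c) * g x)"
proof (induction rule: trig_poly.induct)
  case (cos b' u' c')
  have "b * cos ((\<Sum>k\<in>I. u k * x k) + c) * (b' * cos ((\<Sum>k\<in>I. u' k * x k) + c')) =
    (b * b' / 2) * cos ((\<Sum>k\<in>I. (u k + u' k) * x k) + (c + c')) +
    (b * b' / 2) * cos ((\<Sum>k\<in>I. (u k - u' k) * x k) + (c - c'))" for x
  proof -
    have 1: "(\<Sum>k\<in>I. (u k + u' k) * x k) + (c + c') =
        ((\<Sum>k\<in>I. u k * x k) + c) + ((\<Sum>k\<in>I. u' k * x k) + c')"
      by (simp add: distrib_right sum.distrib)
    have 2: "(\<Sum>k\<in>I. (u k - u' k) * x k) + (c - c') =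
        ((\<Sum>k\<in>I. u k * x k) + c) - ((\<Sum>k\<in>I. u' k * x k) + c')"
      by (simp add: left_diff_distrib sum_subtractf)
    show ?thesis unfolding 1 2 cos_add cos_diff by (simp add: algebra_simps)
  qed
  then show ?case by (simp only:) (intro trig_poly.intros)
next
  case (add f g)
  then show ?case by (simp only: distrib_left) (rule trig_poly.add)
qed

lemma trig_poly_mult:
  "trig_poly I f \<Longrightarrow> trig_poly I g \<Longrightarrow> trig_poly I (\<lambda>x. f x * g x)"
proof (induction rule: trig_poly.induct)
  case (cos b u c)
  then show ?case by (rule trig_poly_mult_cos)
next
  case (add f h)
  then show ?case by (simp only: distrib_right) (rule trig_poly.add, auto)
qed

lemma trig_poly_const: "trig_poly I (\<lambda>_. c)"
  using trig_poly.cos[of I c "\<lambda>_. 0" 0] by simp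

lemma trig_poly_sin:
  assumes "finite I" "k \<in> I"
  shows "trig_poly I (\<lambda>x. sin (a * x k))"
proof -
  have "(\<lambda>x. sin (a * x k)) = (\<lambda>x. 1 * cos ((\<Sum>j\<in>I. (if j = k then a else 0) * x j) + - (pi / 2)))"
  proof
    fix x :: "'a \<Rightarrow> real"
    have "(\<Sum>j\<in>I. (if j = k then a else 0) * x j) = a * x k"
      using assms by (simp add: if_distrib[of "\<lambda>c. c * x _"] cong: if_cong)
    then show "sin (a * x k) = 1 * cos ((\<Sum>j\<in>I. (if j = k then a else 0) * x j) + - (pi / 2))"
      by (simp add: cos_diff)
  qed
  then show ?thesis by (simp only:) (rule trig_poly.cos)
qed

text \<open>Every continuous function of finitely many coordinates agrees on a box with a bounded function
  of period \<open>4 * R\<close>, obtained by inserting the triangle wave \<open>arcsin (sin (a * t)) / a\<close>, and the latter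
  is uniformly close to a trigonometric polynomial.\<close>

lemma trig_poly_approx:
  fixes f :: "('i::countable \<Rightarrow> real) \<Rightarrow> real"
  assumes I: "finite I" and f: "continuous_on UNIV f"
    and dep: "\<And>x y. (\<And>k. k \<in> I \<Longrightarrow> x k = y k) \<Longrightarrow> f x = f y"
    and B: "\<And>x. \<bar>f x\<bar> \<le> B" and e: "0 < e" and R: "0 < R"
  shows "\<exists>p. trig_poly I p \<and> (\<forall>x. \<bar>f x - p x\<bar> \<le> e + 2 * B * (\<Sum>k\<in>I. (x k)\<^sup>2 / R\<^sup>2))"
proof -
  \<comment> \<open>With this frequency \<open>[-R, R]\<close> is mapped onto
    \<open>[-pi / 2, pi / 2]\<close>, where arcsine inverts the sine.\<close>
  define a where "a = pi / (2 * R)"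
  have a: "0 < a" using R by (simp add: a_def)
  \<comment> \<open>Coordinates outside \<open>I\<close> are pinned to 0, so that those in
    \<open>I\<close> separate the points of the box.\<close>
  define K where "K = (\<Pi>\<^sub>E k\<in>(UNIV::'i set). if k \<in> I then {-1..1} else {0::real})"
  define s where "s x = (\<lambda>k. if k \<in> I then sin (a * x k) else 0)" for x :: "'i \<Rightarrow> real"
  have sK: "s x \<in> K" for x by (auto simp: s_def K_def)
  define F where "F y = f (\<lambda>k. arcsin (y k) / a)" for y
  \<comment> \<open>Continuous functions on the box that become trigonometric polynomials when sines
    are inserted. The coordinates in \<open>I\<close> belong to it, so it separates points.\<close>
  define \<A> where "\<A> = {q. continuous_on K q \<and> trig_poly I (\<lambda>x. q (s x))}"
  interpret function_ring_on \<A> K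
  proof
    have "compactin (product_topology (\<lambda>_. euclidean) UNIV) K"
      unfolding K_def compactin_PiE by auto
    then show "compact K" unfolding euclidean_product_topology by simp
    show "\<exists>q\<in>\<A>. q y \<noteq> q z" if yz: "y \<in> K" "z \<in> K" "y \<noteq> z" for y z
    proof -
      obtain k where k: "y k \<noteq> z k" using yz(3) by auto
      then have kI: "k \<in> I" using yz by (auto simp: K_def PiE_iff split: if_splits) (metis singletonD)
      have "(\<lambda>y. y k) \<in> \<A>" unfolding \<A>_def
        using trig_poly_sin[OF I kI, of a] kI
        by (auto simp: s_def intro: continuous_on_subset[OF continuous_on_product_coordinates])
      with k show ?thesis by (intro bexI[of _ "\<lambda>y. y k"])
    qed
    show "(\<lambda>y. q y + q' y) \<in> \<A>" "(\<lambda>y. q y * q' y) \<in> \<A>" if "q \<in> \<A>" "q' \<in> \<A>" for q q'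
      using that unfolding \<A>_def
      by (simp_all add: continuous_on_add continuous_on_mult trig_poly.add trig_poly_mult)
    show "(\<lambda>_. c) \<in> \<A>" for c by (simp add: \<A>_def trig_poly_const)
  qed (simp add: \<A>_def)
  have "continuous_on K F"
    unfolding F_def
  proof (rule continuous_on_compose2[OF f])
    show "continuous_on K (\<lambda>y k. arcsin (y k) / a)"
    proof (intro continuous_on_coordinatewise_then_product)
      fix k
      have "continuous_on K (\<lambda>y. y k)" by (rule continuous_on_subset[OF continuous_on_product_coordinates]) simp
      moreover have "\<forall>y\<in>K. -1 \<le> y k \<and> y k \<le> 1" by (auto simp: K_def PiE_iff dest!: spec[of _ k] split: if_splits)
      ultimately show "continuous_on K (\<lambda>y. arcsin (y k) / a)"
        using a by (intro continuous_intros) auto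
    qed
  qed simp
  then obtain q where q: "q \<in> \<A>" "\<And>y. y \<in> K \<Longrightarrow> \<bar>F y - q y\<bar> < e"
    using Stone_Weierstrass_basic[OF _ e] by blast
  have "\<bar>f x - q (s x)\<bar> \<le> e + 2 * B * (\<Sum>k\<in>I. (x k)\<^sup>2 / R\<^sup>2)" for x
  proof (cases "\<forall>k\<in>I. \<bar>x k\<bar> \<le> R")
    case True
    have "F (s x) = f x"
      unfolding F_def
    proof (rule dep)
      fix k assume k: "k \<in> I"
      have "- R \<le> x k" "x k \<le> R" using True k by (auto simp: abs_le_iff)
      then have "a * (- R) \<le> a * x k" "a * x k \<le> a * R"
        using a by (simp_all only: mult_left_mono less_imp_le)
      then have "arcsin (sin (a * x k)) = a * x k"
        using R by (intro arcsin_sin) (auto simp: a_def)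
      then show "arcsin (s x k) / a = x k" using k a by (simp add: s_def)
    qed
    then have "\<bar>f x - q (s x)\<bar> \<le> e" using q(2)[OF sK[of x]] by simp
    moreover have "0 \<le> 2 * B * (\<Sum>k\<in>I. (x k)\<^sup>2 / R\<^sup>2)"
      using B[of x] by (intro mult_nonneg_nonneg sum_nonneg) auto
    ultimately show ?thesis by linarith
  next
    case False
    then obtain k where k: "k \<in> I" "R < \<bar>x k\<bar>" by auto
    \<comment> \<open>Outside the box the second-moment term alone is at least \<open>2 * B\<close>,
      the largest possible difference of two values of \<open>f\<close>.\<close>
    have "R\<^sup>2 \<le> (x k)\<^sup>2" using k(2) R by (metis abs_le_square_iff abs_of_pos less_imp_le)
    then have "1 \<le> (x k)\<^sup>2 / R\<^sup>2" using R by simp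
    also have "\<dots> \<le> (\<Sum>k\<in>I. (x k)\<^sup>2 / R\<^sup>2)"
      using I k(1) by (intro member_le_sum) auto
    finally have "2 * B * 1 \<le> 2 * B * (\<Sum>k\<in>I. (x k)\<^sup>2 / R\<^sup>2)"
      using B[of x] by (intro mult_left_mono) auto
    moreover have "\<bar>f x - q (s x)\<bar> \<le> 2 * B + e"
      using q(2)[OF sK[of x]] B[of x] B[of "\<lambda>k. arcsin (s x k) / a"] by (simp add: F_def abs_if split: if_splits)
    ultimately show ?thesis by simp
  qed
  then show ?thesis using q(1) unfolding \<A>_def by blast
qed

lemma trig_poly_continuous:
  fixes p :: "('i::countable \<Rightarrow> real) \<Rightarrow> real"
  shows "trig_poly I p \<Longrightarrow> continuous_on UNIV p"
  by (induction rule: trig_poly.induct)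
    (auto intro!: continuous_on_add continuous_on_mult continuous_on_cos continuous_on_sum continuous_on_const
      continuous_on_product_coordinates)

lemma trig_poly_bounded: "trig_poly I p \<Longrightarrow> \<exists>C. \<forall>x. \<bar>p x\<bar> \<le> C"
proof (induction rule: trig_poly.induct)
  case (cos b u c)
  then show ?case by (intro exI[of _ "\<bar>b\<bar>"]) (auto simp: abs_mult intro: mult_left_le)
next
  case (add f g)
  then show ?case by (meson abs_triangle_ineq add_mono order_trans)
qed

lemma (in prob_space) trig_poly_integrable:
  fixes X :: "'a \<Rightarrow> 'i::countable \<Rightarrow> real" and f :: "('i \<Rightarrow> real) \<Rightarrow> real"
  assumes "X \<in> borel_measurable M" "continuous_on UNIV f" "\<And>x. \<bar>f x\<bar> \<le> C"
  shows "integrable M (\<lambda>\<omega>. f (X \<omega>))"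
  using assms measurable_compose[OF assms(1) borel_measurable_continuous_onI[OF assms(2)]]
  by (intro integrable_const_bound[of _ C]) auto

lemma (in prob_space) trig_poly_error:
  fixes X :: "'a \<Rightarrow> 'i::countable \<Rightarrow> real" and f :: "('i \<Rightarrow> real) \<Rightarrow> real"
  assumes X: "X \<in> borel_measurable M" and f: "continuous_on UNIV f" "\<And>x. \<bar>f x\<bar> \<le> B"
    and I: "finite I" and p: "trig_poly I p"
    and err: "\<And>x. \<bar>f x - p x\<bar> \<le> e + 2 * B * (\<Sum>k\<in>I. (x k)\<^sup>2 / R\<^sup>2)"
    and sq: "\<And>k. k \<in> I \<Longrightarrow> integrable M (\<lambda>\<omega>. (X \<omega> k)\<^sup>2)"
    and C: "\<And>k. k \<in> I \<Longrightarrow> (\<integral>\<omega>. (X \<omega> k)\<^sup>2 \<partial>M) \<le> C"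
  shows "\<bar>(\<integral>\<omega>. f (X \<omega>) \<partial>M) - (\<integral>\<omega>. p (X \<omega>) \<partial>M)\<bar> \<le> e + 2 * B * (real (card I) * C / R\<^sup>2)"
proof -
  obtain D where D: "\<And>x. \<bar>p x\<bar> \<le> D" using trig_poly_bounded[OF p] by blast
  have i: "integrable M (\<lambda>\<omega>. f (X \<omega>))" "integrable M (\<lambda>\<omega>. p (X \<omega>))"
    using trig_poly_integrable[OF X f] trig_poly_integrable[OF X trig_poly_continuous[OF p] D] by auto
  have B0: "0 \<le> B" using f(2)[of undefined] abs_ge_zero[of "f undefined"] by linarith
  have "\<bar>(\<integral>\<omega>. f (X \<omega>) \<partial>M) - (\<integral>\<omega>. p (X \<omega>) \<partial>M)\<bar> = \<bar>\<integral>\<omega>. f (X \<omega>) - p (X \<omega>) \<partial>M\<bar>"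
    using i by simp
  also have "\<dots> \<le> (\<integral>\<omega>. \<bar>f (X \<omega>) - p (X \<omega>)\<bar> \<partial>M)" by (rule integral_abs_bound)
  also have "\<dots> \<le> (\<integral>\<omega>. e + 2 * B * (\<Sum>k\<in>I. (X \<omega> k)\<^sup>2 / R\<^sup>2) \<partial>M)"
    using i sq err by (intro integral_mono) auto
  also have "\<dots> = e + 2 * B * (\<Sum>k\<in>I. (\<integral>\<omega>. (X \<omega> k)\<^sup>2 \<partial>M) / R\<^sup>2)"
    using sq by (simp add: prob_space Bochner_Integration.integral_sum)
  also have "\<dots> \<le> e + 2 * B * (\<Sum>k\<in>I. C / R\<^sup>2)"
    using B0 C by (intro add_left_mono mult_left_mono sum_mono divide_right_mono) auto
  finally show ?thesis by simp
qed

text \<open>Uniform second moments take the place of tightness: on both sides they bound the mean of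
  the error outside the box by \<open>2 * B * card I * C / R\<^sup>2\<close>, which a large
  \<open>R\<close> makes small before the trigonometric polynomial is chosen.\<close>

lemma cramer_wold_conv:
  fixes X :: "nat \<Rightarrow> 'w \<Rightarrow> 'i::countable \<Rightarrow> real" and Z :: "'v \<Rightarrow> 'i \<Rightarrow> real"
    and f :: "('i \<Rightarrow> real) \<Rightarrow> real"
  assumes "prob_space M" "prob_space Q"
    and X: "\<And>n. X n \<in> borel_measurable M" and Z: "Z \<in> borel_measurable Q"
    and I: "finite I" and f: "continuous_on UNIV f" "\<And>x. \<bar>f x\<bar> \<le> B"
    and dep: "\<And>x y. (\<And>k. k \<in> I \<Longrightarrow> x k = y k) \<Longrightarrow> f x = f y"
    and sqX: "\<And>n k. k \<in> I \<Longrightarrow> integrable M (\<lambda>\<omega>. (X n \<omega> k)\<^sup>2)"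
    and CX: "\<And>n k. k \<in> I \<Longrightarrow> (\<integral>\<omega>. (X n \<omega> k)\<^sup>2 \<partial>M) \<le> C"
    and sqZ: "\<And>k. k \<in> I \<Longrightarrow> integrable Q (\<lambda>v. (Z v k)\<^sup>2)"
    and CZ: "\<And>k. k \<in> I \<Longrightarrow> (\<integral>v. (Z v k)\<^sup>2 \<partial>Q) \<le> C"
    and conv: "\<And>u c. (\<lambda>n. \<integral>\<omega>. cos ((\<Sum>k\<in>I. u k * X n \<omega> k) + c) \<partial>M) \<longlonglongrightarrow>
        (\<integral>v. cos ((\<Sum>k\<in>I. u k * Z v k) + c) \<partial>Q)"
  shows "(\<lambda>n. \<integral>\<omega>. f (X n \<omega>) \<partial>M) \<longlonglongrightarrow> (\<integral>v. f (Z v) \<partial>Q)"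
proof (rule LIMSEQ_I)
  interpret M: prob_space M by fact
  interpret Q: prob_space Q by fact
  have B0: "0 \<le> B" using f(2)[of undefined] abs_ge_zero[of "f undefined"] by linarith
  fix r :: real assume r: "0 < r"
  \<comment> \<open>Each of the two laws costs \<open>2 * e\<close> and the trigonometric polynomial
    less than \<open>e\<close>, in all five eighths of \<open>r\<close>.\<close>
  define e where "e = r / 8"
  have e: "0 < e" using r by (simp add: e_def)
  obtain m :: nat where m: "2 * B * (real (card I) * \<bar>C\<bar>) / e < real m" using reals_Archimedean2 by blast
  define R where "R = sqrt (real m + 1)"
  have R: "0 < R" "R\<^sup>2 = real m + 1" by (auto simp: R_def)
  have Rsmall: "2 * B * (real (card I) * C / R\<^sup>2) \<le> e"
  proof -
    have "2 * B * (real (card I) * C) \<le> 2 * B * (real (card I) * \<bar>C\<bar>)" using B0 by (intro mult_left_mono) auto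
    also have "\<dots> \<le> e * R\<^sup>2" using m e unfolding R(2) by (simp add: field_simps)
    finally show ?thesis using R by (simp add: pos_divide_le_eq)
  qed
  obtain p where p: "trig_poly I p" "\<And>x. \<bar>f x - p x\<bar> \<le> e + 2 * B * (\<Sum>k\<in>I. (x k)\<^sup>2 / R\<^sup>2)"
    using trig_poly_approx[OF I f(1) dep f(2) e R(1)] by blast
  have 1: "\<bar>(\<integral>\<omega>. f (X n \<omega>) \<partial>M) - (\<integral>\<omega>. p (X n \<omega>) \<partial>M)\<bar> \<le> 2 * e" for n
    using M.trig_poly_error[OF X f I p sqX CX, of n] Rsmall by simp
  have 2: "\<bar>(\<integral>v. f (Z v) \<partial>Q) - (\<integral>v. p (Z v) \<partial>Q)\<bar> \<le> 2 * e"
    using Q.trig_poly_error[OF Z f I p sqZ CZ] Rsmall by simp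
  have "(\<lambda>n. \<integral>\<omega>. p (X n \<omega>) \<partial>M) \<longlonglongrightarrow> (\<integral>v. p (Z v) \<partial>Q)"
    using p(1)
  proof (induction rule: trig_poly.induct)
    case (cos b u c)
    show ?case using tendsto_mult_left[OF conv[of u c], of b] by simp
  next
    case (add g h)
    obtain C1 C2 where C12: "\<And>x. \<bar>g x\<bar> \<le> C1" "\<And>x. \<bar>h x\<bar> \<le> C2"
      using add.hyps trig_poly_bounded by metis
    note c = trig_poly_continuous[OF add.hyps(1)] trig_poly_continuous[OF add.hyps(2)]
    show ?case
      using tendsto_add[OF add.IH]
        M.trig_poly_integrable[OF X c(1) C12(1)] M.trig_poly_integrable[OF X c(2) C12(2)]
        Q.trig_poly_integrable[OF Z c(1) C12(1)] Q.trig_poly_integrable[OF Z c(2) C12(2)]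
      by simp
  qed
  then obtain N where N: "\<And>n. n \<ge> N \<Longrightarrow> \<bar>(\<integral>\<omega>. p (X n \<omega>) \<partial>M) - (\<integral>v. p (Z v) \<partial>Q)\<bar> < e"
    using LIMSEQ_D[OF _ e] by (metis real_norm_def)
  have "norm ((\<integral>\<omega>. f (X n \<omega>) \<partial>M) - (\<integral>v. f (Z v) \<partial>Q)) < r" if "n \<ge> N" for n
    using 1[of n] 2 N[OF that] r unfolding e_def real_norm_def by linarith
  then show "\<exists>no. \<forall>n\<ge>no. norm ((\<integral>\<omega>. f (X n \<omega>) \<partial>M) - (\<integral>v. f (Z v) \<partial>Q)) < r" by blast
qed

section \<open>A central limit theorem with a dominating variable\<close>

lemma cos_eq_Re_iexp: "cos (x + c) = Re (iexp c * iexp x)"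
  by (simp add: cos_add exp_Euler cos_of_real sin_of_real)

lemma (in prob_space) integral_cos_char:
  assumes [measurable]: "T \<in> borel_measurable M"
  shows "(\<integral>\<omega>. cos (T \<omega> + c) \<partial>M) = Re (iexp c * char (distr M borel T) 1)"
proof -
  have i: "integrable M (\<lambda>\<omega>. iexp c * iexp (T \<omega>))"
    by (intro integrable_mult_right integrable_iexp) auto
  have "char (distr M borel T) 1 = (\<integral>\<omega>. iexp (T \<omega>) \<partial>M)"
    by (simp add: char_def integral_distr)
  then have "Re (iexp c * char (distr M borel T) 1) = Re (\<integral>\<omega>. iexp c * iexp (T \<omega>) \<partial>M)"
    by simp
  also have "\<dots> = (\<integral>\<omega>. Re (iexp c * iexp (T \<omega>)) \<partial>M)"
    by (rule integral_Re[OF i, symmetric])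
  also have "\<dots> = (\<integral>\<omega>. cos (T \<omega> + c) \<partial>M)" by (simp only: cos_eq_Re_iexp)
  finally show ?thesis ..
qed

text \<open>The point mass is covered by the same formula: mean zero forces \<open>m = 0\<close>,
  and then \<open>V = 0\<close>.\<close>

lemma (in prob_space) integral_cos_gaussian:
  assumes G: "gaussian_rv M T" and mean: "(\<integral>\<omega>. T \<omega> \<partial>M) = 0" and var: "(\<integral>\<omega>. (T \<omega>)\<^sup>2 \<partial>M) = V"
  shows "(\<integral>\<omega>. cos (T \<omega> + c) \<partial>M) = cos c * exp (- V / 2)"
proof -
  have [measurable]: "T \<in> borel_measurable M" using G by (simp add: gaussian_rv_def)
  obtain m where m: "distr M borel T = return borel m \<or>
      (\<exists>\<sigma>>0. distributed M lborel T (normal_density m \<sigma>))"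
    using G by (auto simp: gaussian_rv_def)
  then show ?thesis
  proof
    assume d: "distr M borel T = return borel m"
    have ev: "(\<integral>\<omega>. g (T \<omega>) \<partial>M) = g m" if "g \<in> borel_measurable borel" for g :: "real \<Rightarrow> real"
      using integral_distr[of T M borel g] that unfolding d by (simp add: integral_return)
    have "m = 0" using ev[of "\<lambda>x. x"] mean by simp
    moreover have "V = m\<^sup>2" using ev[of "\<lambda>x. x\<^sup>2"] var by simp
    ultimately show ?thesis using ev[of "\<lambda>x. cos (x + c)"] by simp
  next
    assume "\<exists>\<sigma>>0. distributed M lborel T (normal_density m \<sigma>)"
    then obtain \<sigma> where \<sigma>: "0 < \<sigma>" "distributed M lborel T (normal_density m \<sigma>)" by blast
    have m0: "m = 0" using normal_distributed_expectation[OF \<sigma>] mean by simp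
    have V: "V = \<sigma>\<^sup>2" using normal_distributed_variance[OF \<sigma>] mean var by simp
    have "distributed M lborel (\<lambda>\<omega>. T \<omega> / \<sigma>) std_normal_density"
      using \<sigma>(2) normal_standard_normal_convert[OF \<sigma>(1), of T m] m0 by simp
    then have D: "distr M borel (\<lambda>\<omega>. T \<omega> / \<sigma>) = std_normal_distribution"
      using distributed_distr_eq_density[of M lborel "\<lambda>\<omega>. T \<omega> / \<sigma>"] by (simp cong: distr_cong)
    have "char (distr M borel T) 1 = char (distr M borel (\<lambda>\<omega>. T \<omega> / \<sigma>)) \<sigma>"
      using \<sigma>(1) by (simp add: char_def integral_distr)
    also have "\<dots> = of_real (exp (- V / 2))"
      unfolding D char_std_normal_distribution V by simp
    finally show ?thesis
      unfolding integral_cos_char[OF \<open>T \<in> borel_measurable M\<close>] by (simp add: exp_Euler cos_of_real sin_of_real)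
  qed
qed

lemma exp_minus_approx:
  fixes x :: real
  assumes "0 \<le> x" "x \<le> 1"
  shows "\<bar>exp (- x) - (1 - x)\<bar> \<le> x\<^sup>2"
proof -
  have "1 - x \<le> exp (- x)" using exp_ge_add_one_self[of "- x"] by simp
  moreover have "exp (- x) \<le> 1 - x + x\<^sup>2"
  proof -
    have "1 + x \<le> exp x" by (rule exp_ge_add_one_self)
    then have "inverse (exp x) \<le> inverse (1 + x)" using assms by (intro le_imp_inverse_le) auto
    also have "\<dots> \<le> 1 - x + x\<^sup>2"
    proof -
      \<comment> \<open>The product is \<open>1 + x ^ 3\<close>.\<close>
      have "1 \<le> (1 - x + x\<^sup>2) * (1 + x)" using assms by (simp add: algebra_simps power2_eq_square)
      then show ?thesis using assms by (simp add: inverse_eq_divide pos_divide_le_eq)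
    qed
    finally show ?thesis by (simp add: exp_minus)
  qed
  ultimately show ?thesis by (simp add: abs_if)
qed

text \<open>The rows of the array share the dominating variables \<open>g k\<close>, which have one
  common law. A single number \<open>\<delta> n\<close> therefore bounds the remainders of all
  characteristic functions in row \<open>n\<close>, which is what the Lindeberg condition is for.
  The variances may vary within a row; only their average has to converge.\<close>

lemma (in prob_space) dominated_Lindeberg:
  fixes Y :: "nat \<Rightarrow> nat \<Rightarrow> 'a \<Rightarrow> real" and g :: "nat \<Rightarrow> 'a \<Rightarrow> real"
  assumes ind: "\<And>n. indep_vars (\<lambda>_. borel) (Y n) {..<n}"
    and Ym: "\<And>n k. Y n k \<in> borel_measurable M"
    and E0: "\<And>n k. k < n \<Longrightarrow> (\<integral>\<omega>. Y n k \<omega> \<partial>M) = 0"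
    and dom: "\<And>n k \<omega>. \<omega> \<in> space M \<Longrightarrow> \<bar>Y n k \<omega>\<bar> \<le> g k \<omega>"
    and g [measurable]: "\<And>k. g k \<in> borel_measurable M"
    and gd: "\<And>k. distr M borel (g k) = distr M borel (g 0)"
    and g2: "integrable M (\<lambda>\<omega>. (g 0 \<omega>)\<^sup>2)"
    and V: "(\<lambda>n. (\<Sum>k<n. \<integral>\<omega>. (Y n k \<omega>)\<^sup>2 \<partial>M) / real n) \<longlonglongrightarrow> V"
  shows "(\<lambda>n. \<integral>\<omega>. cos ((\<Sum>k<n. Y n k \<omega>) / sqrt n + c) \<partial>M) \<longlonglongrightarrow> cos c * exp (- V / 2)"
proof -
  note [measurable] = Ym
  have gsq: "integrable M (\<lambda>\<omega>. (g k \<omega>)\<^sup>2)" for k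
    using g2 integrable_distr_eq[of "g k" M borel "\<lambda>x. x\<^sup>2"] integrable_distr_eq[of "g 0" M borel "\<lambda>x. x\<^sup>2"] gd[of k]
    by simp
  have g_int: "(\<integral>\<omega>. h (g k \<omega>) \<partial>M) = (\<integral>\<omega>. h (g 0 \<omega>) \<partial>M)" if "h \<in> borel_measurable borel" for h :: "real \<Rightarrow> real" and k
    using integral_distr[of "g k" M borel h] integral_distr[of "g 0" M borel h] gd[of k] that by simp
  define \<Gamma> where "\<Gamma> = (\<integral>\<omega>. (g 0 \<omega>)\<^sup>2 \<partial>M)"
  have Ysq: "integrable M (\<lambda>\<omega>. (Y n k \<omega>)\<^sup>2)" for n k
  proof (rule Bochner_Integration.integrable_bound[OF gsq[of k]])
    show "AE \<omega> in M. norm ((Y n k \<omega>)\<^sup>2) \<le> norm ((g k \<omega>)\<^sup>2)"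
    proof (rule AE_I2)
      fix \<omega> assume "\<omega> \<in> space M"
      then have "\<bar>Y n k \<omega>\<bar> ^ 2 \<le> (g k \<omega>) ^ 2" by (intro power_mono dom) auto
      then show "norm ((Y n k \<omega>)\<^sup>2) \<le> norm ((g k \<omega>)\<^sup>2)" by simp
    qed
  qed simp
  have Yi: "integrable M (Y n k)" for n k by (rule integrable_L2[OF Ym Ysq])
  define v where "v n k = (\<integral>\<omega>. (Y n k \<omega>)\<^sup>2 \<partial>M)" for n k
  have v0: "0 \<le> v n k" for n k by (simp add: v_def)
  have v\<Gamma>: "v n k \<le> \<Gamma>" for n k
  proof -
    have "v n k \<le> (\<integral>\<omega>. (g k \<omega>)\<^sup>2 \<partial>M)"
      unfolding v_def
    proof (rule integral_mono[OF Ysq gsq])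
      fix \<omega> assume "\<omega> \<in> space M"
      then have "\<bar>Y n k \<omega>\<bar> ^ 2 \<le> (g k \<omega>) ^ 2" by (intro power_mono dom) auto
      then show "(Y n k \<omega>)\<^sup>2 \<le> (g k \<omega>)\<^sup>2" by simp
    qed
    then show ?thesis using g_int[of "\<lambda>x. x\<^sup>2" k] by (simp add: \<Gamma>_def)
  qed
  define \<phi> where "\<phi> n k = char (distr M borel (Y n k)) (1 / sqrt n)" for n k
  \<comment> \<open>The integrand is the second-order Taylor remainder capped by a multiple of the
    square, so dominated convergence works with a second moment only.\<close>
  define \<delta> where "\<delta> n = (\<integral>\<omega>. min (6 * (g 0 \<omega>)\<^sup>2) (\<bar>1 / sqrt (real n)\<bar> * \<bar>g 0 \<omega>\<bar> ^ 3) \<partial>M)" for n :: nat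
  have \<delta>_lim: "\<delta> \<longlonglongrightarrow> 0"
  proof -
    have "(\<lambda>n. \<integral>\<omega>. min (6 * (g 0 \<omega>)\<^sup>2) (\<bar>1 / sqrt (real n)\<bar> * \<bar>g 0 \<omega>\<bar> ^ 3) \<partial>M) \<longlonglongrightarrow> (\<integral>\<omega>. 0 \<partial>M)"
    proof (rule integral_dominated_convergence[where w = "\<lambda>\<omega>. 6 * (g 0 \<omega>)\<^sup>2"])
      show "AE \<omega> in M. (\<lambda>n. min (6 * (g 0 \<omega>)\<^sup>2) (\<bar>1 / sqrt (real n)\<bar> * \<bar>g 0 \<omega>\<bar> ^ 3)) \<longlonglongrightarrow> 0"
      proof (rule AE_I2)
        fix \<omega>
        have "(\<lambda>n. 1 / sqrt (real n)) \<longlonglongrightarrow> 0"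
          by (rule real_tendsto_divide_at_top[OF tendsto_const filterlim_compose[OF sqrt_at_top filterlim_real_sequentially]])
        then have "(\<lambda>n. \<bar>1 / sqrt (real n)\<bar> * \<bar>g 0 \<omega>\<bar> ^ 3) \<longlonglongrightarrow> \<bar>0\<bar> * \<bar>g 0 \<omega>\<bar> ^ 3"
          by (intro tendsto_mult tendsto_rabs tendsto_const)
        then have "(\<lambda>n. min (6 * (g 0 \<omega>)\<^sup>2) (\<bar>1 / sqrt (real n)\<bar> * \<bar>g 0 \<omega>\<bar> ^ 3)) \<longlonglongrightarrow> min (6 * (g 0 \<omega>)\<^sup>2) (\<bar>0\<bar> * \<bar>g 0 \<omega>\<bar> ^ 3)"
          by (intro tendsto_min tendsto_const)
        then show "(\<lambda>n. min (6 * (g 0 \<omega>)\<^sup>2) (\<bar>1 / sqrt (real n)\<bar> * \<bar>g 0 \<omega>\<bar> ^ 3)) \<longlonglongrightarrow> 0"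
          by (simp only: abs_zero mult_zero_left min_absorb2 zero_le_power2 mult_nonneg_nonneg zero_le_numeral)
      qed
    qed (use g2 in auto)
    then show ?thesis by (simp add: \<delta>_def[abs_def])
  qed
  have \<phi>_approx: "cmod (\<phi> n k - of_real (1 - v n k / (2 * n))) \<le> \<delta> n / (6 * n)" if k: "k < n" for n k
  proof -
    let ?t = "1 / sqrt (real n)"
    have n: "0 < n" using k by simp
    have t2: "?t\<^sup>2 = 1 / n" using n by (simp add: power_divide)
    have var: "variance (Y n k) = v n k" using E0[OF k] by (simp add: v_def)
    have 1: "cmod (\<phi> n k - (1 - ?t\<^sup>2 * v n k / 2)) \<le> (?t\<^sup>2 / 6) * expectation (\<lambda>\<omega>. min (6 * (Y n k \<omega>)\<^sup>2) (\<bar>?t\<bar> * \<bar>Y n k \<omega>\<bar>^3))"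
      unfolding \<phi>_def by (rule char_approx3'[OF Ym Yi Ysq E0[OF k] var refl])
    have "expectation (\<lambda>\<omega>. min (6 * (Y n k \<omega>)\<^sup>2) (\<bar>?t\<bar> * \<bar>Y n k \<omega>\<bar>^3)) \<le>
        expectation (\<lambda>\<omega>. min (6 * (g k \<omega>)\<^sup>2) (\<bar>?t\<bar> * \<bar>g k \<omega>\<bar>^3))"
    proof (rule integral_mono)
      show "integrable M (\<lambda>\<omega>. min (6 * (Y n k \<omega>)\<^sup>2) (\<bar>?t\<bar> * \<bar>Y n k \<omega>\<bar>^3))"
        by (rule Bochner_Integration.integrable_bound[OF integrable_mult_right[OF Ysq[of n k], of 6]]) (auto simp: min_def)
      show "integrable M (\<lambda>\<omega>. min (6 * (g k \<omega>)\<^sup>2) (\<bar>?t\<bar> * \<bar>g k \<omega>\<bar>^3))"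
        by (rule Bochner_Integration.integrable_bound[OF integrable_mult_right[OF gsq[of k], of 6]]) (auto simp: min_def)
      fix \<omega> assume "\<omega> \<in> space M"
      then have d: "\<bar>Y n k \<omega>\<bar> \<le> \<bar>g k \<omega>\<bar>" using dom[of \<omega> n k] by simp
      have "(Y n k \<omega>)\<^sup>2 \<le> (g k \<omega>)\<^sup>2" using d by (simp add: abs_le_square_iff)
      moreover have "\<bar>Y n k \<omega>\<bar>^3 \<le> \<bar>g k \<omega>\<bar>^3" by (intro power_mono d) simp
      ultimately show "min (6 * (Y n k \<omega>)\<^sup>2) (\<bar>?t\<bar> * \<bar>Y n k \<omega>\<bar>^3) \<le> min (6 * (g k \<omega>)\<^sup>2) (\<bar>?t\<bar> * \<bar>g k \<omega>\<bar>^3)"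
        by (intro min.mono mult_left_mono) auto
    qed
    also have "expectation (\<lambda>\<omega>. min (6 * (g k \<omega>)\<^sup>2) (\<bar>?t\<bar> * \<bar>g k \<omega>\<bar>^3)) = \<delta> n"
      unfolding \<delta>_def by (rule g_int) measurable
    finally have "(?t\<^sup>2 / 6) * expectation (\<lambda>\<omega>. min (6 * (Y n k \<omega>)\<^sup>2) (\<bar>?t\<bar> * \<bar>Y n k \<omega>\<bar>^3)) \<le> (?t\<^sup>2 / 6) * \<delta> n"
      by (rule mult_left_mono) simp
    with 1 have "cmod (\<phi> n k - (1 - ?t\<^sup>2 * v n k / 2)) \<le> (?t\<^sup>2 / 6) * \<delta> n" by (rule order_trans)
    then show ?thesis unfolding t2 by (simp add: mult.commute)
  qed
  define A where "A n = (\<Sum>k<n. v n k) / n" for n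
  \<comment> \<open>The condition on \<open>\<Gamma>\<close> keeps every
    \<open>v n k / (2 * n)\<close> in \<open>[0, 1]\<close>, where \<open>exp_minus_approx\<close>
    applies.\<close>
  have close: "cmod ((\<Prod>k<n. \<phi> n k) - of_real (exp (- A n / 2))) \<le> \<delta> n / 6 + \<Gamma>\<^sup>2 / n"
    if n: "n > 0" "\<Gamma> \<le> 2 * n" for n
  proof -
    have x01: "0 \<le> v n k / (2 * n)" "v n k / (2 * n) \<le> 1" for k
      using v0[of n k] v\<Gamma>[of n k] n by (auto simp: field_simps)
    have "exp (- A n / 2) = (\<Prod>k<n. exp (- (v n k / (2 * n))))"
      unfolding A_def by (simp add: exp_sum[symmetric] sum_negf sum_divide_distrib[symmetric])
    then have "cmod ((\<Prod>k<n. \<phi> n k) - of_real (exp (- A n / 2))) =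
        cmod ((\<Prod>k<n. \<phi> n k) - (\<Prod>k<n. of_real (exp (- (v n k / (2 * n))))))" by simp
    \<comment> \<open>As variances depend on \<open>k\<close>, the comparison is with a product of
      exponentials, factor by factor; all factors lie in the unit disc, so the errors merely add
      up.\<close>
    also have "\<dots> \<le> (\<Sum>k<n. cmod (\<phi> n k - of_real (exp (- (v n k / (2 * n))))))"
    proof (rule norm_prod_diff)
      show "cmod (\<phi> n k) \<le> 1" for k
        unfolding \<phi>_def by (intro real_distribution.cmod_char_le_1 real_distribution_distr) measurable
      show "cmod (of_real (exp (- (v n k / (2 * n))))) \<le> 1" for k
        using x01(1)[of k] by simp
    qed
    also have "\<dots> \<le> (\<Sum>k<n. \<delta> n / (6 * n) + (\<Gamma> / n)\<^sup>2)"
    proof (rule sum_mono)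
      fix k assume "k \<in> {..<n}"
      then have k: "k < n" by simp
      let ?b = "of_real (1 - v n k / (2 * n)) :: complex" and ?c = "of_real (exp (- (v n k / (2 * n)))) :: complex"
      have "cmod (\<phi> n k - ?c) \<le> cmod (\<phi> n k - ?b) + cmod (?b - ?c)"
        using norm_triangle_ineq[of "\<phi> n k - ?b" "?b - ?c"] by (simp only: diff_add_cancel add_diff_eq)
      moreover have "cmod (?b - ?c) \<le> (v n k / (2 * n))\<^sup>2"
        using exp_minus_approx[OF x01, of k] unfolding of_real_diff[symmetric] norm_of_real
        by (simp add: abs_minus_commute)
      moreover have "(v n k / (2 * n))\<^sup>2 \<le> (\<Gamma> / n)\<^sup>2"
        using v0[of n k] v\<Gamma>[of n k] n by (intro power_mono frac_le) auto
      ultimately show "cmod (\<phi> n k - ?c) \<le> \<delta> n / (6 * n) + (\<Gamma> / n)\<^sup>2"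
        using \<phi>_approx[OF k] by linarith
    qed
    also have "\<dots> = \<delta> n / 6 + \<Gamma>\<^sup>2 / n" using n by (simp add: power_divide power2_eq_square field_simps)
    finally show ?thesis .
  qed
  have char_eq: "char (distr M borel (\<lambda>\<omega>. (\<Sum>k<n. Y n k \<omega>) / sqrt n)) 1 = (\<Prod>k<n. \<phi> n k)" for n
  proof -
    have "char (distr M borel (\<lambda>\<omega>. (\<Sum>k<n. Y n k \<omega>) / sqrt n)) 1 = char (distr M borel (\<lambda>\<omega>. \<Sum>k<n. Y n k \<omega>)) (1 / sqrt n)"
      by (simp add: char_def integral_distr)
    also have "\<dots> = (\<Prod>k<n. \<phi> n k)" unfolding \<phi>_def by (rule char_distr_sum[OF ind])
    finally show ?thesis .
  qed
  have diff0: "(\<lambda>n. (\<Prod>k<n. \<phi> n k) - of_real (exp (- A n / 2))) \<longlonglongrightarrow> 0"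
  proof (rule Lim_null_comparison)
    show "(\<lambda>n. \<delta> n / 6 + \<Gamma>\<^sup>2 / n) \<longlonglongrightarrow> 0"
    proof -
      have "(\<lambda>n. \<delta> n / 6 + \<Gamma>\<^sup>2 / n) \<longlonglongrightarrow> 0 / 6 + 0"
        by (intro tendsto_add tendsto_divide \<delta>_lim tendsto_const
            real_tendsto_divide_at_top[OF tendsto_const filterlim_real_sequentially]) simp
      then show ?thesis by simp
    qed
    obtain m :: nat where m: "\<Gamma> < real m" using reals_Archimedean2 by blast
    show "eventually (\<lambda>n. norm ((\<Prod>k<n. \<phi> n k) - of_real (exp (- A n / 2))) \<le> \<delta> n / 6 + \<Gamma>\<^sup>2 / n) sequentially"
    proof (rule eventually_sequentiallyI[of "Suc m"])
      fix n assume "Suc m \<le> n"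
      then have "n > 0" "real m \<le> real n" by auto
      then show "norm ((\<Prod>k<n. \<phi> n k) - of_real (exp (- A n / 2))) \<le> \<delta> n / 6 + \<Gamma>\<^sup>2 / n"
        using m by (intro close) auto
    qed
  qed
  have "A \<longlonglongrightarrow> V" using V by (simp add: A_def[abs_def] v_def)
  then have "(\<lambda>n. of_real (exp (- A n / 2)) :: complex) \<longlonglongrightarrow> of_real (exp (- V / 2))"
    by (intro tendsto_of_real tendsto_exp tendsto_divide tendsto_minus tendsto_const) auto
  from tendsto_add[OF diff0 this] have "(\<lambda>n. \<Prod>k<n. \<phi> n k) \<longlonglongrightarrow> of_real (exp (- V / 2))" by simp
  then have "(\<lambda>n. Re (iexp c * (\<Prod>k<n. \<phi> n k))) \<longlonglongrightarrow> Re (iexp c * of_real (exp (- V / 2)))"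
    by (intro tendsto_intros)
  moreover have "(\<integral>\<omega>. cos ((\<Sum>k<n. Y n k \<omega>) / sqrt n + c) \<partial>M) = Re (iexp c * (\<Prod>k<n. \<phi> n k))" for n
    using integral_cos_char[of "\<lambda>\<omega>. (\<Sum>k<n. Y n k \<omega>) / sqrt n" c] char_eq[of n] by simp
  ultimately show ?thesis by (simp add: exp_Euler cos_of_real sin_of_real)
qed

section \<open>Polygonal paths\<close>

text \<open>Tent functions: on \<open>[0, 1]\<close> they form a partition of unity, so a polygon is
  at each time a convex combination of its vertices, and every estimate between polygons reduces to
  one between vertices.\<close>

definition hat :: "nat \<Rightarrow> real \<Rightarrow> nat \<Rightarrow> real" where
  "hat n t m = max 0 (1 - \<bar>real n * t - real m\<bar>)"

definition polygon :: "nat \<Rightarrow> (nat \<Rightarrow> 's \<Rightarrow> real) \<Rightarrow> real \<Rightarrow> 's \<Rightarrow> real" where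
  "polygon n v t s = (\<Sum>m\<le>n. hat n t m * v m s)"

lemma hat_nonneg: "0 \<le> hat n t m"
  by (simp add: hat_def)

lemma hat_eq_0: "1 \<le> \<bar>real n * t - real m\<bar> \<Longrightarrow> hat n t m = 0"
  by (simp add: hat_def)

lemma hat_Lipschitz: "\<bar>hat n t m - hat n t' m\<bar> \<le> real n * \<bar>t - t'\<bar>"
proof -
  have "\<bar>max 0 (1 - \<bar>a\<bar>) - max 0 (1 - \<bar>b\<bar>)\<bar> \<le> \<bar>a - b\<bar>" for a b :: real
    by linarith
  from this[of "real n * t - real m" "real n * t' - real m"]
  have "\<bar>hat n t m - hat n t' m\<bar> \<le> \<bar>real n * t - real n * t'\<bar>"
    unfolding hat_def by simp
  also have "\<dots> = real n * \<bar>t - t'\<bar>" by (simp add: right_diff_distrib[symmetric] abs_mult)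
  finally show ?thesis .
qed

text \<open>At most the two nodes enclosing \<open>n * t\<close> contribute. At \<open>t = 1\<close>
  the node \<open>k + 1 = n + 1\<close> is missing from the sum, but then the fractional part is
  0.\<close>

lemma hat_sum:
  fixes n :: nat and t :: real
  assumes t: "0 \<le> t" "t \<le> 1"
  defines "k \<equiv> nat \<lfloor>real n * t\<rfloor>"
  shows "(\<Sum>m\<le>n. hat n t m * c m) = c k + frac (real n * t) * (c (k + 1) - c k)"
proof -
  let ?x = "real n * t"
  have x: "0 \<le> ?x" "?x \<le> real n" using t by (auto simp: mult_left_le)
  have k: "real k = of_int \<lfloor>?x\<rfloor>" using x(1) by (simp add: k_def)
  have xk: "?x = real k + frac ?x" unfolding k frac_def by simp
  have fr: "0 \<le> frac ?x" "frac ?x < 1" by (simp_all add: frac_lt_1)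
  have kn: "k \<le> n" using xk x fr by linarith
  have dk: "?x - real k = frac ?x" "?x - real (k + 1) = frac ?x - 1" using xk by linarith+
  have h0: "hat n t k = 1 - frac ?x" unfolding hat_def dk using fr by simp
  have h1: "hat n t (k + 1) = frac ?x" unfolding hat_def dk using fr by simp
  have other: "hat n t m = 0" if "m \<noteq> k" "m \<noteq> k + 1" for m
  proof (rule hat_eq_0)
    have "m < k \<or> m \<ge> k + 2" using that by linarith
    then have "real m \<le> real k - 1 \<or> real m \<ge> real k + 2" by auto
    then show "1 \<le> \<bar>?x - real m\<bar>" using xk fr by linarith
  qed
  show ?thesis
  proof (cases "k < n")
    case True
    have "(\<Sum>m\<le>n. hat n t m * c m) = (\<Sum>m\<in>{k, k + 1}. hat n t m * c m)"
      using True other by (intro sum.mono_neutral_right) auto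
    also have "\<dots> = hat n t k * c k + hat n t (k + 1) * c (k + 1)" by simp
    finally show ?thesis unfolding h0 h1 by (simp add: algebra_simps)
  next
    case False
    then have kn': "k = n" using kn by simp
    then have f0: "frac ?x = 0" using xk x fr by linarith
    have "(\<Sum>m\<le>n. hat n t m * c m) = (\<Sum>m\<in>{k}. hat n t m * c m)"
      using kn' other by (intro sum.mono_neutral_right) auto
    then show ?thesis using h0 f0 by simp
  qed
qed

lemma hat_sum_1: "0 \<le> t \<Longrightarrow> t \<le> 1 \<Longrightarrow> (\<Sum>m\<le>n. hat n t m) = 1"
  using hat_sum[of t n "\<lambda>_. 1"] by simp

lemma zeta_eq_polygon:
  assumes t: "0 \<le> t" "t \<le> 1"
  shows "zeta X n \<omega> t s = polygon n (\<lambda>m. partial_sum X m \<omega>) t s"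
  unfolding polygon_def hat_sum[OF t] zeta_def by (simp add: partial_sum_def)

lemma polygon_cmult: "polygon n (\<lambda>m s. c * v m s) t s = c * polygon n v t s"
  by (simp add: polygon_def sum_distrib_left mult_ac)

lemma polygon_L2_funs: "(\<And>m. m \<le> n \<Longrightarrow> v m \<in> L2_funs \<mu>) \<Longrightarrow> polygon n v t \<in> L2_funs \<mu>"
  unfolding polygon_def[abs_def] by (intro L2_funs_sum L2_funs_cmult) auto

text \<open>The bound is asked only where the weight is nonzero; this is what later restricts
  attention to nodes close to \<open>t\<close>.\<close>

lemma L2_norm_convex:
  assumes f: "\<And>i. i \<in> I \<Longrightarrow> f i \<in> L2_funs \<mu>" and w: "\<And>i. i \<in> I \<Longrightarrow> 0 \<le> w i" "sum w I = 1"
    and B: "\<And>i. i \<in> I \<Longrightarrow> w i \<noteq> 0 \<Longrightarrow> L2_norm \<mu> (f i) \<le> B"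
  shows "L2_norm \<mu> (\<lambda>s. \<Sum>i\<in>I. w i * f i s) \<le> B"
proof -
  have "L2_norm \<mu> (\<lambda>s. \<Sum>i\<in>I. w i * f i s) \<le> (\<Sum>i\<in>I. L2_norm \<mu> (\<lambda>s. w i * f i s))"
    by (intro L2_norm_sum_le L2_funs_cmult f)
  also have "\<dots> = (\<Sum>i\<in>I. w i * L2_norm \<mu> (f i))"
    using w by (intro sum.cong) (auto simp: L2_norm_cmult)
  also have "\<dots> \<le> (\<Sum>i\<in>I. w i * B)"
  proof (rule sum_mono)
    fix i assume i: "i \<in> I"
    show "w i * L2_norm \<mu> (f i) \<le> w i * B"
      using B[OF i] w(1)[OF i] by (cases "w i = 0") (auto intro: mult_left_mono)
  qed
  also have "\<dots> = B" using w(2) by (simp add: sum_distrib_right[symmetric])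
  finally show ?thesis .
qed

lemma polygon_diff_le:
  assumes v: "\<And>m. m \<le> n \<Longrightarrow> v m \<in> L2_funs \<mu>" "\<And>m. m \<le> n \<Longrightarrow> v' m \<in> L2_funs \<mu>"
    and t: "0 \<le> t" "t \<le> 1"
    and B: "\<And>m. m \<le> n \<Longrightarrow> L2_norm \<mu> (\<lambda>s. v m s - v' m s) \<le> B"
  shows "L2_norm \<mu> (\<lambda>s. polygon n v t s - polygon n v' t s) \<le> B"
proof -
  have "(\<lambda>s. polygon n v t s - polygon n v' t s) = (\<lambda>s. \<Sum>m\<in>{..n}. hat n t m * (v m s - v' m s))"
    by (simp add: polygon_def sum_subtractf right_diff_distrib)
  then show ?thesis
    using v B hat_sum_1[OF t]
    by (simp only:) (intro L2_norm_convex L2_funs_diff hat_nonneg; simp)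
qed

lemma point_polygon_diff_le:
  assumes v: "f \<in> L2_funs \<mu>" "\<And>m. m \<le> n \<Longrightarrow> v m \<in> L2_funs \<mu>"
    and t: "0 \<le> t" "t \<le> 1"
    and B: "\<And>m. m \<le> n \<Longrightarrow> \<bar>real n * t - real m\<bar> < 1 \<Longrightarrow> L2_norm \<mu> (\<lambda>s. f s - v m s) \<le> B"
  shows "L2_norm \<mu> (\<lambda>s. f s - polygon n v t s) \<le> B"
proof -
  have "f s - polygon n v t s = (\<Sum>m\<in>{..n}. hat n t m * (f s - v m s))" for s
  proof -
    have "(\<Sum>m\<in>{..n}. hat n t m * (f s - v m s)) = (\<Sum>m\<le>n. hat n t m) * f s - polygon n v t s"
      by (simp add: polygon_def sum_subtractf right_diff_distrib sum_distrib_right)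
    then show ?thesis using hat_sum_1[OF t] by simp
  qed
  then have e: "(\<lambda>s. f s - polygon n v t s) = (\<lambda>s. \<Sum>m\<in>{..n}. hat n t m * (f s - v m s))" by simp
  show ?thesis
    unfolding e
  proof (rule L2_norm_convex)
    show "L2_norm \<mu> (\<lambda>s. f s - v i s) \<le> B" if "i \<in> {..n}" "hat n t i \<noteq> 0" for i
      using that B[of i] hat_eq_0[of n t i] by (cases "1 \<le> \<bar>real n * t - real i\<bar>") auto
  qed (use v hat_sum_1[OF t] in \<open>auto intro: L2_funs_diff hat_nonneg\<close>)
qed

text \<open>At time \<open>t\<close> only nodes \<open>m / n\<close> within \<open>1 / n\<close> and
  nodes \<open>j / J\<close> within \<open>1 / J\<close> of \<open>t\<close> count. Measured in
  steps of the first polygon they are at most \<open>1 + n / J\<close> apart.\<close>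

lemma polygon_polygon_diff_le:
  assumes v: "\<And>m. m \<le> n \<Longrightarrow> v m \<in> L2_funs \<mu>" "\<And>j. j \<le> J \<Longrightarrow> w j \<in> L2_funs \<mu>"
    and t: "0 \<le> t" "t \<le> 1" and J: "0 < J"
    and B: "\<And>m j. m \<le> n \<Longrightarrow> j \<le> J \<Longrightarrow> \<bar>real m - real n * real j / real J\<bar> \<le> 1 + real n / real J \<Longrightarrow>
      L2_norm \<mu> (\<lambda>s. v m s - w j s) \<le> B"
  shows "L2_norm \<mu> (\<lambda>s. polygon n v t s - polygon J w t s) \<le> B"
proof (rule point_polygon_diff_le[OF polygon_L2_funs[of n v, OF v(1)] v(2) t])
  fix j assume j: "j \<le> J" "\<bar>real J * t - real j\<bar> < 1"
  have "L2_norm \<mu> (\<lambda>s. w j s - polygon n v t s) \<le> B"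
  proof (rule point_polygon_diff_le[OF v(2)[OF j(1)] v(1) t])
    fix m assume m: "m \<le> n" "\<bar>real n * t - real m\<bar> < 1"
    have "\<bar>real n * t - real n * real j / real J\<bar> = real n / real J * \<bar>real J * t - real j\<bar>"
    proof -
      have "real n * t - real n * real j / real J = real n / real J * (real J * t - real j)"
        using J by (simp add: field_simps)
      then show ?thesis by (simp only: abs_mult) simp
    qed
    also have "\<dots> \<le> real n / real J * 1" using j by (intro mult_left_mono) auto
    finally have "\<bar>real m - real n * real j / real J\<bar> \<le> 1 + real n / real J" using m by linarith
    from B[OF m(1) j(1) this] show "L2_norm \<mu> (\<lambda>s. w j s - v m s) \<le> B"
      unfolding L2_norm_minus_commute[of \<mu> "w j" "v m"] .
  qed
  then show "L2_norm \<mu> (\<lambda>s. polygon n v t s - w j s) \<le> B"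
    unfolding L2_norm_minus_commute[of \<mu> "polygon n v t" "w j"] .
qed

text \<open>A crude constant that grows with \<open>n\<close>; it serves only to see that a single
  polygon is a continuous path.\<close>

lemma polygon_Lipschitz:
  assumes v: "\<And>m. m \<le> n \<Longrightarrow> v m \<in> L2_funs \<mu>"
  shows "L2_norm \<mu> (\<lambda>s. polygon n v t s - polygon n v t' s) \<le> (real n * (\<Sum>m\<le>n. L2_norm \<mu> (v m))) * \<bar>t - t'\<bar>"
proof -
  have "L2_norm \<mu> (\<lambda>s. polygon n v t s - polygon n v t' s) =
      L2_norm \<mu> (\<lambda>s. \<Sum>m\<in>{..n}. (hat n t m - hat n t' m) * v m s)"
    by (simp add: polygon_def sum_subtractf left_diff_distrib)
  also have "\<dots> \<le> (\<Sum>m\<le>n. L2_norm \<mu> (\<lambda>s. (hat n t m - hat n t' m) * v m s))"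
    using v by (intro L2_norm_sum_le L2_funs_cmult) auto
  also have "\<dots> \<le> (\<Sum>m\<le>n. real n * \<bar>t - t'\<bar> * L2_norm \<mu> (v m))"
    unfolding L2_norm_cmult by (intro sum_mono mult_right_mono hat_Lipschitz L2_norm_nonneg)
  also have "\<dots> = (real n * (\<Sum>m\<le>n. L2_norm \<mu> (v m))) * \<bar>t - t'\<bar>"
    by (simp add: sum_distrib_left mult_ac)
  finally show ?thesis .
qed

section \<open>Continuous paths and their polygonal approximation\<close>

lemma mspace_C01_L2:
  "mspace (C01_L2 \<mu>) = {p. (\<forall>t\<in>{0..1}. p t \<in> L2_carrier \<mu>) \<and> p \<in> extensional {0..1} \<and>
     continuous_map (top_of_set {0..1}) (mtopology_of (L2 \<mu>)) p}"
  unfolding C01_L2_def by (subst compactin_mspace_cfunspace) (simp_all add: compactin_subtopology mspace_L2)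

lemma continuous_map_L2_iff:
  assumes "\<And>t. t \<in> {0..1} \<Longrightarrow> p t \<in> L2_carrier \<mu>"
  shows "continuous_map (top_of_set {0..1::real}) (mtopology_of (L2 \<mu>)) p \<longleftrightarrow>
    (\<forall>t\<in>{0..1}. \<forall>\<epsilon>>0. \<exists>\<delta>>0. \<forall>u\<in>{0..1}. \<bar>u - t\<bar> < \<delta> \<longrightarrow> L2_dist \<mu> (p t) (p u) < \<epsilon>)"
proof -
  interpret Metric_space "L2_carrier \<mu>" "L2_dist \<mu>" by (rule Metric_space_L2)
  have top: "mtopology_of (L2 \<mu>) = mtopology"
    unfolding mtopology_of_def mspace_L2 mdist_L2 ..
  have "(\<exists>U. openin (top_of_set {0..1}) U \<and> t \<in> U \<and> (\<forall>u\<in>U. p u \<in> mball (p t) \<epsilon>)) \<longleftrightarrow>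
      (\<exists>\<delta>>0. \<forall>u\<in>{0..1}. \<bar>u - t\<bar> < \<delta> \<longrightarrow> L2_dist \<mu> (p t) (p u) < \<epsilon>)" (is "?A \<longleftrightarrow> ?B")
    if t: "t \<in> {0..1}" for t \<epsilon>
  proof
    assume ?A
    then obtain U where U: "openin (top_of_set {0..1}) U" "t \<in> U" "\<And>u. u \<in> U \<Longrightarrow> p u \<in> mball (p t) \<epsilon>" by blast
    then obtain \<delta> where "\<delta> > 0" "\<And>u. u \<in> {0..1} \<Longrightarrow> dist u t < \<delta> \<Longrightarrow> u \<in> U"
      unfolding openin_euclidean_subtopology_iff by blast
    then show ?B using U(3) by (intro exI[of _ \<delta>]) (auto simp: dist_real_def)
  next
    assume ?B
    then obtain \<delta> where \<delta>: "\<delta> > 0" "\<And>u. u \<in> {0..1} \<Longrightarrow> \<bar>u - t\<bar> < \<delta> \<Longrightarrow> L2_dist \<mu> (p t) (p u) < \<epsilon>" by blast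
    show ?A
    proof (intro exI conjI ballI)
      show "openin (top_of_set {0..1}) ({0..1} \<inter> ball t \<delta>)" by (rule openin_open_Int) simp
      show "t \<in> {0..1} \<inter> ball t \<delta>" using t \<delta> by simp
      show "p u \<in> mball (p t) \<epsilon>" if "u \<in> {0..1} \<inter> ball t \<delta>" for u
        using that \<delta>(2)[of u] assms t by (auto simp: dist_real_def abs_minus_commute)
    qed
  qed
  then show ?thesis unfolding top continuous_map_to_metric by simp
qed

lemma L2_path_in_C01:
  assumes f: "\<And>t. t \<in> {0..1} \<Longrightarrow> f t \<in> L2_funs \<mu>"
    and lip: "\<And>t u. t \<in> {0..1} \<Longrightarrow> u \<in> {0..1} \<Longrightarrow> L2_norm \<mu> (\<lambda>s. f t s - f u s) \<le> C * \<bar>t - u\<bar>"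
  shows "L2_path \<mu> f \<in> mspace (C01_L2 \<mu>)"
proof -
  have car: "L2_path \<mu> f t \<in> L2_carrier \<mu>" if "t \<in> {0..1}" for t
    using f[OF that] that by (auto simp: L2_path_def L2_carrier_def)
  moreover have "continuous_map (top_of_set {0..1}) (mtopology_of (L2 \<mu>)) (L2_path \<mu> f)"
  proof (subst continuous_map_L2_iff[of "L2_path \<mu> f" \<mu>, OF car], assumption, intro ballI allI impI)
    fix t \<epsilon> :: real assume t: "t \<in> {0..1}" and \<epsilon>: "0 < \<epsilon>"
    have "L2_dist \<mu> (L2_path \<mu> f t) (L2_path \<mu> f u) < \<epsilon>" if u: "u \<in> {0..1}" "\<bar>u - t\<bar> < \<epsilon> / (\<bar>C\<bar> + 1)" for u
    proof -
      have "L2_dist \<mu> (L2_path \<mu> f t) (L2_path \<mu> f u) \<le> C * \<bar>t - u\<bar>"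
        using lip[OF t u(1)] t u by (simp add: L2_path_def L2_dist_class f)
      also have "\<dots> \<le> (\<bar>C\<bar> + 1) * \<bar>t - u\<bar>" by (intro mult_right_mono) auto
      also have "\<dots> < \<epsilon>" using u by (simp add: field_simps add_pos_nonneg abs_minus_commute)
      finally show ?thesis .
    qed
    moreover have "0 < \<epsilon> / (\<bar>C\<bar> + 1)" using \<epsilon> by (simp add: add_nonneg_pos)
    ultimately show "\<exists>\<delta>>0. \<forall>u\<in>{0..1}. \<bar>u - t\<bar> < \<delta> \<longrightarrow> L2_dist \<mu> (L2_path \<mu> f t) (L2_path \<mu> f u) < \<epsilon>" by blast
  qed
  ultimately show ?thesis unfolding mspace_C01_L2 by (auto simp: L2_path_def)
qed

lemma polygon_in_C01:
  "(\<And>m. m \<le> n \<Longrightarrow> v m \<in> L2_funs \<mu>) \<Longrightarrow> L2_path \<mu> (polygon n v) \<in> mspace (C01_L2 \<mu>)"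
  by (rule L2_path_in_C01[OF polygon_L2_funs polygon_Lipschitz])

lemma mdist_C01_le:
  assumes "0 \<le> B" "\<And>t. t \<in> {0..1} \<Longrightarrow> L2_dist \<mu> (p t) (q t) \<le> B"
  shows "mdist (C01_L2 \<mu>) p q \<le> B"
  unfolding C01_L2_def by (rule mdist_cfunspace_le) (use assms in \<open>auto simp: mdist_L2\<close>)

lemma mdist_L2_path_le:
  assumes "0 \<le> B" "\<And>t. t \<in> {0..1} \<Longrightarrow> f t \<in> L2_funs \<mu>" "\<And>t. t \<in> {0..1} \<Longrightarrow> g t \<in> L2_funs \<mu>"
    and "\<And>t. t \<in> {0..1} \<Longrightarrow> L2_norm \<mu> (\<lambda>s. f t s - g t s) \<le> B"
  shows "mdist (C01_L2 \<mu>) (L2_path \<mu> f) (L2_path \<mu> g) \<le> B"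
  using assms by (intro mdist_C01_le) (auto simp: L2_path_def L2_dist_class)

lemma C01_uniformly_continuous:
  assumes p: "p \<in> mspace (C01_L2 \<mu>)" and \<epsilon>: "0 < \<epsilon>"
  obtains \<delta> where "0 < \<delta>"
    "\<And>t u. t \<in> {0..1} \<Longrightarrow> u \<in> {0..1} \<Longrightarrow> \<bar>t - u\<bar> < \<delta> \<Longrightarrow> L2_dist \<mu> (p t) (p u) < \<epsilon>"
proof -
  interpret Metric_space "L2_carrier \<mu>" "L2_dist \<mu>" by (rule Metric_space_L2)
  have car: "t \<in> {0..1} \<Longrightarrow> p t \<in> L2_carrier \<mu>" for t using p by (simp add: mspace_C01_L2)
  have cont: "\<forall>t\<in>{0..1}. \<forall>\<epsilon>>0. \<exists>\<delta>>0. \<forall>u\<in>{0..1}. \<bar>u - t\<bar> < \<delta> \<longrightarrow> L2_dist \<mu> (p t) (p u) < \<epsilon>"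
    using p continuous_map_L2_iff[OF car] by (simp add: mspace_C01_L2)
  have "compact {0..1::real}" by simp
  define r where "r t = (SOME \<delta>. \<delta> > 0 \<and> (\<forall>u\<in>{0..1}. \<bar>u - t\<bar> < \<delta> \<longrightarrow> L2_dist \<mu> (p t) (p u) < \<epsilon> / 2))" for t
  have r: "r t > 0 \<and> (\<forall>u\<in>{0..1}. \<bar>u - t\<bar> < r t \<longrightarrow> L2_dist \<mu> (p t) (p u) < \<epsilon> / 2)" if "t \<in> {0..1}" for t
  proof -
    have "\<exists>\<delta>. \<delta> > 0 \<and> (\<forall>u\<in>{0..1}. \<bar>u - t\<bar> < \<delta> \<longrightarrow> L2_dist \<mu> (p t) (p u) < \<epsilon> / 2)"
      using cont that \<epsilon> by (meson half_gt_zero)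
    from someI_ex[OF this] show ?thesis unfolding r_def .
  qed
  \<comment> \<open>\<open>\<delta>\<close> is a Lebesgue number of the cover by balls on which the
    path moves by less than \<open>\<epsilon> / 2\<close> from its value at the centre.\<close>
  obtain \<delta> where \<delta>: "\<delta> > 0" "\<And>t. t \<in> {0..1} \<Longrightarrow> \<exists>G\<in>(\<lambda>t. ball t (r t)) ` {0..1}. ball t \<delta> \<subseteq> G"
  proof (rule Heine_Borel_lemma[of "{0..1::real}" "(\<lambda>t. ball t (r t)) ` {0..1}"])
    show "{0..1} \<subseteq> \<Union> ((\<lambda>t. ball t (r t)) ` {0..1})"
    proof
      fix t :: real assume t: "t \<in> {0..1}"
      then have "t \<in> ball t (r t)" using r[OF t] by simp
      then show "t \<in> \<Union> ((\<lambda>t. ball t (r t)) ` {0..1})" using t by blast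
    qed
  qed auto
  show thesis
  proof (rule that[OF \<delta>(1)])
    fix t u :: real assume tu: "t \<in> {0..1}" "u \<in> {0..1}" "\<bar>t - u\<bar> < \<delta>"
    obtain c where c: "c \<in> {0..1}" "ball t \<delta> \<subseteq> ball c (r c)" using \<delta>(2)[OF tu(1)] by blast
    have "t \<in> ball c (r c)" "u \<in> ball c (r c)" using c(2) tu(3) \<delta>(1) by (auto simp: subset_iff dist_real_def)
    then have "L2_dist \<mu> (p c) (p t) < \<epsilon> / 2" "L2_dist \<mu> (p c) (p u) < \<epsilon> / 2"
      using r[OF c(1)] tu by (auto simp: dist_real_def abs_minus_commute)
    then show "L2_dist \<mu> (p t) (p u) < \<epsilon>"
      using triangle[OF car[OF tu(1)] car[OF c(1)] car[OF tu(2)]] commute[of "p t" "p c"] by linarith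
  qed
qed

text \<open>Uniform continuity fixes the number of nodes, and then the expansions at these finitely
  many nodes must be accurate, so \<open>N0\<close> depends on \<open>J\<close>. The bound holds for
  all representatives \<open>f\<close> at once, because the Gaussian process supplies
  representatives that are not the chosen ones.\<close>

lemma C01_polygon_approx:
  assumes p: "p \<in> mspace (C01_L2 \<mu>)" and \<epsilon>: "0 < \<epsilon>"
    and e: "\<And>i. e i \<in> L2_funs \<mu>"
      "\<And>h. h \<in> L2_funs \<mu> \<Longrightarrow> (\<lambda>N. L2_norm \<mu> (\<lambda>s. h s - L2_proj \<mu> e N h s)) \<longlonglongrightarrow> 0"
  shows "\<exists>J0. \<forall>J\<ge>J0. \<exists>N0. \<forall>N\<ge>N0. \<forall>f. (\<forall>j\<le>J. f j \<in> L2_funs \<mu> \<and> p (real j / real J) = L2_class \<mu> (f j)) \<longrightarrow>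
      mdist (C01_L2 \<mu>) p (L2_path \<mu> (polygon J (\<lambda>j. L2_proj \<mu> e N (f j)))) \<le> \<epsilon>"
proof -
  obtain \<delta> where \<delta>: "0 < \<delta>"
    "\<And>t u. t \<in> {0..1} \<Longrightarrow> u \<in> {0..1} \<Longrightarrow> \<bar>t - u\<bar> < \<delta> \<Longrightarrow> L2_dist \<mu> (p t) (p u) < \<epsilon> / 2"
    using C01_uniformly_continuous[OF p, of "\<epsilon> / 2"] \<epsilon> by auto
  obtain J0 :: nat where J0: "1 / \<delta> < real J0" using reals_Archimedean2 by blast
  have car: "t \<in> {0..1} \<Longrightarrow> p t \<in> L2_carrier \<mu>" for t using p by (simp add: mspace_C01_L2)
  define \<rho> where "\<rho> t = (SOME g. g \<in> L2_funs \<mu> \<and> p t = L2_class \<mu> g)" for t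
  have \<rho>: "\<rho> t \<in> L2_funs \<mu> \<and> p t = L2_class \<mu> (\<rho> t)" if "t \<in> {0..1}" for t
  proof -
    have "\<exists>g. g \<in> L2_funs \<mu> \<and> p t = L2_class \<mu> g" using car[OF that] by (auto simp: L2_carrier_def)
    from someI_ex[OF this] show ?thesis unfolding \<rho>_def .
  qed
  have "\<exists>N0. \<forall>N\<ge>N0. \<forall>f. (\<forall>j\<le>J. f j \<in> L2_funs \<mu> \<and> p (real j / real J) = L2_class \<mu> (f j)) \<longrightarrow>
      mdist (C01_L2 \<mu>) p (L2_path \<mu> (polygon J (\<lambda>j. L2_proj \<mu> e N (f j)))) \<le> \<epsilon>" if J: "J \<ge> J0" for J
  proof -
    have "0 < real J0" using J0 \<delta>(1) by (meson divide_pos_pos less_trans zero_less_one)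
    then have Jpos: "0 < J" using J by simp
    have J\<delta>: "1 / real J < \<delta>"
    proof -
      have "1 / \<delta> < real J" using J0 J by simp
      then show ?thesis using \<delta>(1) Jpos by (simp add: field_simps)
    qed
    have tj: "real j / real J \<in> {0..1}" if "j \<le> J" for j using that Jpos by auto
    have "eventually (\<lambda>N. \<forall>j\<in>{..J}. L2_norm \<mu> (\<lambda>s. \<rho> (real j / real J) s - L2_proj \<mu> e N (\<rho> (real j / real J)) s) < \<epsilon> / 2) sequentially"
      using \<epsilon> \<rho>[OF tj] by (intro eventually_ball_finite ballI order_tendstoD(2)[OF e(2)]) auto
    then obtain N0 where N0: "\<And>N j. N \<ge> N0 \<Longrightarrow> j \<le> J \<Longrightarrow>
        L2_norm \<mu> (\<lambda>s. \<rho> (real j / real J) s - L2_proj \<mu> e N (\<rho> (real j / real J)) s) < \<epsilon> / 2"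
      unfolding eventually_sequentially by auto
    have "mdist (C01_L2 \<mu>) p (L2_path \<mu> (polygon J (\<lambda>j. L2_proj \<mu> e N (f j)))) \<le> \<epsilon>"
      if N: "N \<ge> N0" and f: "\<And>j. j \<le> J \<Longrightarrow> f j \<in> L2_funs \<mu> \<and> p (real j / real J) = L2_class \<mu> (f j)" for N f
    proof (rule mdist_C01_le)
      fix t :: real assume t: "t \<in> {0..1}"
      have pol: "polygon J (\<lambda>j. L2_proj \<mu> e N (f j)) t \<in> L2_funs \<mu>"
        by (intro polygon_L2_funs L2_proj_L2_funs e)
      have ae: "AE s in \<mu>. f j s = \<rho> (real j / real J) s" if "j \<le> J" for j
        using f[OF that] \<rho>[OF tj[OF that]] L2_class_eq_iff[of "f j" \<mu> "\<rho> (real j / real J)"] by auto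
      have "L2_norm \<mu> (\<lambda>s. \<rho> t s - polygon J (\<lambda>j. L2_proj \<mu> e N (f j)) t s) \<le> \<epsilon>"
      proof (rule point_polygon_diff_le)
        fix j assume j: "j \<le> J" "\<bar>real J * t - real j\<bar> < 1"
        let ?u = "real j / real J"
        have "\<bar>t - ?u\<bar> = \<bar>real J * t - real j\<bar> / real J"
          using Jpos by (simp add: abs_div_pos diff_divide_distrib)
        also have "\<dots> < 1 / real J" using j(2) Jpos by (intro divide_strict_right_mono) auto
        finally have "\<bar>t - ?u\<bar> < \<delta>" using J\<delta> by simp
        then have "L2_dist \<mu> (p t) (p ?u) < \<epsilon> / 2" using t tj[OF j(1)] by (intro \<delta>(2))
        then have 1: "L2_norm \<mu> (\<lambda>s. \<rho> t s - \<rho> ?u s) < \<epsilon> / 2"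
          using \<rho>[OF t] \<rho>[OF tj[OF j(1)]] by (metis L2_dist_class)
        \<comment> \<open>The coefficients are integrals and depend only on the class, so the
          representative may be exchanged.\<close>
        have pe: "L2_proj \<mu> e N (f j) = L2_proj \<mu> e N (\<rho> ?u)"
        proof -
          have "L2_inner \<mu> (f j) (e i) = L2_inner \<mu> (\<rho> ?u) (e i)" for i
          proof (rule integral_cong_AE)
            show "AE s in \<mu>. f j s * e i s = \<rho> ?u s * e i s" using ae[OF j(1)] by eventually_elim simp
          qed (use f[OF j(1)] \<rho>[OF tj[OF j(1)]] e(1) in \<open>auto simp: L2_funs_def intro!: borel_measurable_times\<close>)
          then show ?thesis by (simp add: L2_proj_def)
        qed
        have "L2_norm \<mu> (\<lambda>s. \<rho> t s - L2_proj \<mu> e N (\<rho> ?u) s) =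
            L2_norm \<mu> (\<lambda>s. (\<rho> t s - \<rho> ?u s) + (\<rho> ?u s - L2_proj \<mu> e N (\<rho> ?u) s))" by simp
        also have "\<dots> \<le> L2_norm \<mu> (\<lambda>s. \<rho> t s - \<rho> ?u s) + L2_norm \<mu> (\<lambda>s. \<rho> ?u s - L2_proj \<mu> e N (\<rho> ?u) s)"
          using \<rho>[OF t] \<rho>[OF tj[OF j(1)]] by (intro L2_norm_triangle L2_funs_diff L2_proj_L2_funs e) auto
        finally show "L2_norm \<mu> (\<lambda>s. \<rho> t s - L2_proj \<mu> e N (f j) s) \<le> \<epsilon>"
          unfolding pe using 1 N0[OF N j(1)] by linarith
      qed (use t \<rho>[OF t] e in \<open>auto intro: L2_proj_L2_funs\<close>)
      then show "L2_dist \<mu> (p t) (L2_path \<mu> (polygon J (\<lambda>j. L2_proj \<mu> e N (f j))) t) \<le> \<epsilon>"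
        using t \<rho>[OF t] pol by (simp add: L2_path_def L2_dist_class)
    qed (use \<epsilon> in simp)
    then show ?thesis by blast
  qed
  then show ?thesis by blast
qed

text \<open>The coordinates \<open>x (j, i)\<close> determine the polygon with vertices \<open>\<Sum>i<N. x (j, i) * e i\<close>.\<close>

definition coord_polygon ::
  "'s measure \<Rightarrow> (nat \<Rightarrow> 's \<Rightarrow> real) \<Rightarrow> nat \<Rightarrow> nat \<Rightarrow> (nat \<times> nat \<Rightarrow> real) \<Rightarrow> real \<Rightarrow> ('s \<Rightarrow> real) set" where
  "coord_polygon \<mu> e J N x = L2_path \<mu> (polygon J (\<lambda>j s. \<Sum>i<N. x (j, i) * e i s))"

lemma coord_polygon_in_C01:
  "(\<And>i. e i \<in> L2_funs \<mu>) \<Longrightarrow> coord_polygon \<mu> e J N x \<in> mspace (C01_L2 \<mu>)"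
  unfolding coord_polygon_def by (intro polygon_in_C01 L2_funs_sum L2_funs_cmult) auto

lemma coord_polygon_cong:
  "(\<And>k. k \<in> {..J} \<times> {..<N} \<Longrightarrow> x k = y k) \<Longrightarrow> coord_polygon \<mu> e J N x = coord_polygon \<mu> e J N y"
  unfolding coord_polygon_def polygon_def[abs_def] by (intro arg_cong[where f = "L2_path \<mu>"] ext sum.cong) auto

lemma coord_polygon_dist_le:
  assumes e: "\<And>i. e i \<in> L2_funs \<mu>"
  shows "mdist (C01_L2 \<mu>) (coord_polygon \<mu> e J N x) (coord_polygon \<mu> e J N y) \<le>
    (\<Sum>j\<le>J. \<Sum>i<N. \<bar>x (j, i) - y (j, i)\<bar> * L2_norm \<mu> (e i))"
  unfolding coord_polygon_def
proof (rule mdist_L2_path_le)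
  let ?c = "\<lambda>j. \<Sum>i<N. \<bar>x (j, i) - y (j, i)\<bar> * L2_norm \<mu> (e i)"
  have c0: "0 \<le> ?c j" for j by (intro sum_nonneg mult_nonneg_nonneg L2_norm_nonneg) simp
  show "0 \<le> (\<Sum>j\<le>J. ?c j)" by (intro sum_nonneg c0)
  fix t :: real assume t: "t \<in> {0..1}"
  show "L2_norm \<mu> (\<lambda>s. polygon J (\<lambda>j s. \<Sum>i<N. x (j, i) * e i s) t s - polygon J (\<lambda>j s. \<Sum>i<N. y (j, i) * e i s) t s)
      \<le> (\<Sum>j\<le>J. ?c j)"
  proof (rule polygon_diff_le)
    fix j assume j: "j \<le> J"
    have "L2_norm \<mu> (\<lambda>s. (\<Sum>i<N. x (j, i) * e i s) - (\<Sum>i<N. y (j, i) * e i s)) =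
        L2_norm \<mu> (\<lambda>s. \<Sum>i<N. (x (j, i) - y (j, i)) * e i s)"
      by (simp add: sum_subtractf left_diff_distrib)
    also have "\<dots> \<le> ?c j"
      unfolding L2_norm_cmult[symmetric] by (intro L2_norm_sum_le L2_funs_cmult e)
    also have "\<dots> \<le> (\<Sum>j\<le>J. ?c j)" using j c0 by (intro member_le_sum) auto
    finally show "L2_norm \<mu> (\<lambda>s. (\<Sum>i<N. x (j, i) * e i s) - (\<Sum>i<N. y (j, i) * e i s)) \<le> (\<Sum>j\<le>J. ?c j)" .
  qed (use t e in \<open>auto intro!: L2_funs_sum L2_funs_cmult\<close>)
qed (use e in \<open>auto intro!: polygon_L2_funs L2_funs_sum L2_funs_cmult\<close>)

text \<open>The distance is dominated by a finite sum of coordinate differences, which is continuous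
  for the product topology although there are infinitely many coordinates.\<close>

lemma coord_polygon_continuous:
  assumes e: "\<And>i. e i \<in> L2_funs \<mu>"
    and U: "openin (mtopology_of (C01_L2 \<mu>)) U"
  shows "open (coord_polygon \<mu> e J N -` U)"
proof -
  have "\<exists>V. open V \<and> x \<in> V \<and> V \<subseteq> coord_polygon \<mu> e J N -` U" if x: "x \<in> coord_polygon \<mu> e J N -` U" for x
  proof -
    obtain r where r: "r > 0" "\<And>q. q \<in> mspace (C01_L2 \<mu>) \<Longrightarrow> mdist (C01_L2 \<mu>) (coord_polygon \<mu> e J N x) q < r \<Longrightarrow> q \<in> U"
      using U x unfolding openin_mtopology_of_iff by auto
    define d where "d y = (\<Sum>j\<le>J. \<Sum>i<N. \<bar>x (j, i) - y (j, i)\<bar> * L2_norm \<mu> (e i))" for y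
    have "continuous_on UNIV d"
      unfolding d_def[abs_def]
      by (intro continuous_on_sum continuous_on_mult continuous_on_rabs continuous_on_diff continuous_on_const
          continuous_on_product_coordinates)
    then have "open (d -` {..<r})" by (rule open_vimage[OF open_lessThan])
    moreover have "x \<in> d -` {..<r}" using r(1) by (simp add: d_def)
    moreover have "d -` {..<r} \<subseteq> coord_polygon \<mu> e J N -` U"
      using coord_polygon_dist_le[where e=e and J=J and N=N and x=x, OF e] unfolding d_def
      by (auto intro!: r(2) coord_polygon_in_C01 e intro: le_less_trans)
    ultimately show ?thesis by blast
  qed
  then show ?thesis by (subst open_subopen) blast
qed

section \<open>Innovations and their random walk\<close>

text \<open>Fubini and Jensen turn second-moment bounds at fixed \<open>s\<close> into a bound for
  the first moment of a norm. A maximum over times may sit inside \<open>D\<close>, and so it ends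
  up inside the norm.\<close>

lemma (in pair_sigma_finite) sqrt_integral_expectation:
  fixes D :: "'a \<Rightarrow> 'b \<Rightarrow> real"
  assumes P: "prob_space M1"
    and D [measurable]: "case_prod D \<in> borel_measurable (M1 \<Otimes>\<^sub>M M2)" and nn: "\<And>\<omega> s. 0 \<le> D \<omega> s"
    and i: "\<And>s. s \<in> space M2 \<Longrightarrow> integrable M1 (\<lambda>\<omega>. D \<omega> s)"
    and B: "\<And>s. s \<in> space M2 \<Longrightarrow> (\<integral>\<omega>. D \<omega> s \<partial>M1) \<le> B s" "integrable M2 B"
  shows "AE \<omega> in M1. integrable M2 (D \<omega>)"
    and "integrable M1 (\<lambda>\<omega>. sqrt (\<integral>s. D \<omega> s \<partial>M2))"
    and "(\<integral>\<omega>. sqrt (\<integral>s. D \<omega> s \<partial>M2) \<partial>M1) \<le> sqrt (\<integral>s. B s \<partial>M2)"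
proof -
  interpret M1: prob_space M1 by (rule P)
  have B0: "0 \<le> B s" if "s \<in> space M2" for s
    using B(1)[OF that] nn by (meson Bochner_Integration.integral_nonneg order_trans)
  have int: "integrable (M1 \<Otimes>\<^sub>M M2) (case_prod D)"
  proof (rule integrableI_bounded)
    have "(\<integral>\<^sup>+p. ennreal (norm (case_prod D p)) \<partial>(M1 \<Otimes>\<^sub>M M2)) = (\<integral>\<^sup>+s. (\<integral>\<^sup>+\<omega>. ennreal (D \<omega> s) \<partial>M1) \<partial>M2)"
      by (subst nn_integral_snd[symmetric]) (auto simp: case_prod_beta' nn)
    also have "\<dots> \<le> (\<integral>\<^sup>+s. ennreal (B s) \<partial>M2)"
      using B(1) by (intro nn_integral_mono) (auto simp: nn_integral_eq_integral[OF i] nn intro: ennreal_leI)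
    also have "\<dots> = ennreal (\<integral>s. B s \<partial>M2)"
      using B0 by (intro nn_integral_eq_integral B(2) AE_I2)
    also have "\<dots> < \<infinity>" by simp
    finally show "(\<integral>\<^sup>+p. ennreal (norm (case_prod D p)) \<partial>(M1 \<Otimes>\<^sub>M M2)) < \<infinity>" .
  qed simp
  show "AE \<omega> in M1. integrable M2 (D \<omega>)" by (rule AE_integrable_fst[OF int])
  have i1: "integrable M1 (\<lambda>\<omega>. \<integral>s. D \<omega> s \<partial>M2)" by (rule integrable_fst[OF int])
  let ?U = "\<lambda>\<omega>. sqrt (\<integral>s. D \<omega> s \<partial>M2)"
  have U2: "(?U \<omega>)\<^sup>2 = (\<integral>s. D \<omega> s \<partial>M2)" for \<omega> by (simp add: nn)
  have i2: "integrable M1 (\<lambda>\<omega>. (?U \<omega>)\<^sup>2)" unfolding U2 by (rule i1)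
  show i3: "integrable M1 ?U" by (rule M1.integrable_L2[OF _ i2]) measurable
  have "(\<integral>\<omega>. ?U \<omega> \<partial>M1)\<^sup>2 \<le> (\<integral>\<omega>. (?U \<omega>)\<^sup>2 \<partial>M1)"
    using M1.variance_eq[OF i3 i2] M1.variance_positive[of ?U] by simp
  also have "\<dots> = (\<integral>s. (\<integral>\<omega>. D \<omega> s \<partial>M1) \<partial>M2)" unfolding U2 by (rule Fubini_integral[OF int, symmetric])
  also have "\<dots> \<le> (\<integral>s. B s \<partial>M2)"
    using integrable_snd[OF int] B by (intro integral_mono) auto
  finally show "(\<integral>\<omega>. ?U \<omega> \<partial>M1) \<le> sqrt (\<integral>s. B s \<partial>M2)" by (rule real_le_rsqrt)
qed

locale iid_L2 = pair_sigma_finite P \<mu> + prob_space P for P :: "'w measure" and \<mu> :: "'s measure" +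
  fixes \<epsilon> :: "int \<Rightarrow> 'w \<Rightarrow> 's \<Rightarrow> real" and \<sigma> :: "'s \<Rightarrow> 's \<Rightarrow> real"
  assumes iid: "iid_processes P \<mu> \<epsilon>"
    and sq0: "\<And>s. s \<in> space \<mu> \<Longrightarrow> integrable P (\<lambda>\<omega>. (\<epsilon> 0 \<omega> s)\<^sup>2)"
    and mean0: "\<And>s. s \<in> space \<mu> \<Longrightarrow> (\<integral>\<omega>. \<epsilon> 0 \<omega> s \<partial>P) = 0"
    and L2_ae: "AE \<omega> in P. \<epsilon> 0 \<omega> \<in> L2_funs \<mu>"
    and L2_sq: "integrable P (\<lambda>\<omega>. (L2_norm \<mu> (\<epsilon> 0 \<omega>))\<^sup>2)"
    and \<sigma>_eq: "\<And>r s. \<sigma> r s = (\<integral>\<omega>. \<epsilon> 0 \<omega> r * \<epsilon> 0 \<omega> s \<partial>P)"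
begin

lemma \<epsilon>_meas [measurable]: "case_prod (\<epsilon> k) \<in> borel_measurable (P \<Otimes>\<^sub>M \<mu>)"
  using iid by (simp add: iid_processes_def case_prod_beta')

lemma \<epsilon>_meas_fst [measurable]: "s \<in> space \<mu> \<Longrightarrow> (\<lambda>\<omega>. \<epsilon> k \<omega> s) \<in> borel_measurable P"
  using measurable_compose[OF measurable_Pair2'[of s \<mu> P] \<epsilon>_meas] by simp

lemma restrict_meas [measurable]:
  "(\<lambda>\<omega>. restrict (\<epsilon> k \<omega>) (space \<mu>)) \<in> P \<rightarrow>\<^sub>M Pi\<^sub>M (space \<mu>) (\<lambda>_. borel)"
  by (rule measurable_restrict) measurable

text \<open>Independence and equality of laws are known on the product sigma-algebra only, so
  functionals must be measurable functions of the restricted path. Integrals over \<open>s\<close>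
  need not be of this kind, which is one more reason for working at fixed points first.\<close>

lemma indep_fun:
  assumes "\<And>k. H k \<in> Pi\<^sub>M (space \<mu>) (\<lambda>_. borel) \<rightarrow>\<^sub>M N"
  shows "indep_vars (\<lambda>_. N) (\<lambda>k \<omega>. H k (restrict (\<epsilon> k \<omega>) (space \<mu>))) UNIV"
proof -
  have "indep_vars (\<lambda>_. Pi\<^sub>M (space \<mu>) (\<lambda>_. borel)) (\<lambda>k \<omega>. restrict (\<epsilon> k \<omega>) (space \<mu>)) UNIV"
    using iid unfolding iid_processes_def by blast
  then show ?thesis by (rule indep_vars_compose2[OF _ assms])
qed

lemma distr_fun:
  assumes H: "H \<in> borel_measurable (Pi\<^sub>M (space \<mu>) (\<lambda>_. borel))"
  shows "distr P borel (\<lambda>\<omega>. H (restrict (\<epsilon> k \<omega>) (space \<mu>)) :: real) =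
    distr P borel (\<lambda>\<omega>. H (restrict (\<epsilon> 0 \<omega>) (space \<mu>)))"
proof -
  have "distr P borel (\<lambda>\<omega>. H (restrict (\<epsilon> k \<omega>) (space \<mu>))) =
      distr (distr P (Pi\<^sub>M (space \<mu>) (\<lambda>_. borel)) (\<lambda>\<omega>. restrict (\<epsilon> k \<omega>) (space \<mu>))) borel H" for k
    using H by (subst distr_distr) (auto simp: comp_def)
  moreover have "distr P (Pi\<^sub>M (space \<mu>) (\<lambda>_. borel)) (\<lambda>\<omega>. restrict (\<epsilon> k \<omega>) (space \<mu>)) =
      distr P (Pi\<^sub>M (space \<mu>) (\<lambda>_. borel)) (\<lambda>\<omega>. restrict (\<epsilon> 0 \<omega>) (space \<mu>))"
    using iid unfolding iid_processes_def by blast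
  ultimately show ?thesis by metis
qed

lemma integral_fun:
  assumes H: "H \<in> borel_measurable (Pi\<^sub>M (space \<mu>) (\<lambda>_. borel))"
  shows "(\<integral>\<omega>. H (restrict (\<epsilon> k \<omega>) (space \<mu>)) \<partial>P) = (\<integral>\<omega>. H (restrict (\<epsilon> 0 \<omega>) (space \<mu>)) \<partial>P :: real)"
    and "integrable P (\<lambda>\<omega>. H (restrict (\<epsilon> k \<omega>) (space \<mu>)) :: real) \<longleftrightarrow>
      integrable P (\<lambda>\<omega>. H (restrict (\<epsilon> 0 \<omega>) (space \<mu>)))"
proof -
  have m: "(\<lambda>\<omega>. H (restrict (\<epsilon> k \<omega>) (space \<mu>))) \<in> borel_measurable P" for k
    by (rule measurable_compose[OF restrict_meas H])
  show "(\<integral>\<omega>. H (restrict (\<epsilon> k \<omega>) (space \<mu>)) \<partial>P) = (\<integral>\<omega>. H (restrict (\<epsilon> 0 \<omega>) (space \<mu>)) \<partial>P)"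
    using integral_distr[OF m, of "\<lambda>x. x" k] integral_distr[OF m, of "\<lambda>x. x" 0] distr_fun[OF H, of k] by simp
  show "integrable P (\<lambda>\<omega>. H (restrict (\<epsilon> k \<omega>) (space \<mu>))) \<longleftrightarrow>
      integrable P (\<lambda>\<omega>. H (restrict (\<epsilon> 0 \<omega>) (space \<mu>)))"
    using integrable_distr_eq[OF m, of "\<lambda>x. x" k] integrable_distr_eq[OF m, of "\<lambda>x. x" 0] distr_fun[OF H, of k] by simp
qed

lemma point_fun:
  assumes s: "s \<in> space \<mu>" and f [measurable]: "f \<in> borel_measurable borel"
  shows "(\<integral>\<omega>. f (\<epsilon> k \<omega> s) \<partial>P) = (\<integral>\<omega>. f (\<epsilon> 0 \<omega> s) \<partial>P :: real)"
    and "integrable P (\<lambda>\<omega>. f (\<epsilon> k \<omega> s) :: real) \<longleftrightarrow> integrable P (\<lambda>\<omega>. f (\<epsilon> 0 \<omega> s))"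
  using integral_fun[of "\<lambda>z. f (z s)" k] s by simp_all

lemma \<epsilon>_sq: "s \<in> space \<mu> \<Longrightarrow> integrable P (\<lambda>\<omega>. (\<epsilon> k \<omega> s)\<^sup>2)"
  using point_fun(2)[of s "\<lambda>x. x\<^sup>2" k] sq0 by simp

lemma \<epsilon>_sq_eq: "s \<in> space \<mu> \<Longrightarrow> (\<integral>\<omega>. (\<epsilon> k \<omega> s)\<^sup>2 \<partial>P) = \<sigma> s s"
  using point_fun(1)[of s "\<lambda>x. x\<^sup>2" k] by (simp add: \<sigma>_eq power2_eq_square)

lemma \<epsilon>_int: "s \<in> space \<mu> \<Longrightarrow> integrable P (\<lambda>\<omega>. \<epsilon> k \<omega> s)"
  by (rule integrable_L2[OF _ \<epsilon>_sq]) auto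

lemma \<epsilon>_mean: "s \<in> space \<mu> \<Longrightarrow> (\<integral>\<omega>. \<epsilon> k \<omega> s \<partial>P) = 0"
  using point_fun(1)[of s "\<lambda>x. x" k] mean0 by simp

lemma \<epsilon>_prod_int: "r \<in> space \<mu> \<Longrightarrow> s \<in> space \<mu> \<Longrightarrow> integrable P (\<lambda>\<omega>. \<epsilon> k \<omega> r * \<epsilon> l \<omega> s)"
  by (intro integrable_mult_L2 \<epsilon>_sq) auto

lemma \<epsilon>_cov:
  assumes r: "r \<in> space \<mu>" and s: "s \<in> space \<mu>"
  shows "(\<integral>\<omega>. \<epsilon> k \<omega> r * \<epsilon> l \<omega> s \<partial>P) = (if k = l then \<sigma> r s else 0)"
proof (cases "k = l")
  case True
  have "(\<integral>\<omega>. \<epsilon> k \<omega> r * \<epsilon> k \<omega> s \<partial>P) = (\<integral>\<omega>. \<epsilon> 0 \<omega> r * \<epsilon> 0 \<omega> s \<partial>P)"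
    using integral_fun(1)[of "\<lambda>z. z r * z s" k] r s by simp
  then show ?thesis using True by (simp add: \<sigma>_eq)
next
  case False
  define H where "H i = (\<lambda>z :: 's \<Rightarrow> real. if i = k then z r else z s)" for i :: int
  have ind: "indep_vars (\<lambda>_. borel) (\<lambda>i \<omega>. H i (restrict (\<epsilon> i \<omega>) (space \<mu>))) UNIV"
    by (rule indep_fun) (use r s in \<open>auto simp: H_def\<close>)
  have "(\<integral>\<omega>. (\<Prod>i\<in>{k, l}. H i (restrict (\<epsilon> i \<omega>) (space \<mu>))) \<partial>P) =
      (\<Prod>i\<in>{k, l}. \<integral>\<omega>. H i (restrict (\<epsilon> i \<omega>) (space \<mu>)) \<partial>P)"
  proof (rule indep_vars_lebesgue_integral)
    show "indep_vars (\<lambda>_. borel) (\<lambda>i \<omega>. H i (restrict (\<epsilon> i \<omega>) (space \<mu>))) {k, l}"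
      by (rule indep_vars_subset[OF ind]) simp
    show "integrable P (\<lambda>\<omega>. H i (restrict (\<epsilon> i \<omega>) (space \<mu>)))" for i
      using r s \<epsilon>_int by (cases "i = k") (simp_all add: H_def)
  qed simp
  then show ?thesis using False r s \<epsilon>_mean by (auto simp: H_def)
qed

lemma \<sigma>_meas [measurable]: "(\<lambda>s. \<sigma> s s) \<in> borel_measurable \<mu>"
proof -
  have [measurable]: "(\<lambda>(s, \<omega>). \<epsilon> 0 \<omega> s) \<in> borel_measurable (\<mu> \<Otimes>\<^sub>M P)"
    using measurable_compose[OF measurable_pair_swap' \<epsilon>_meas[of 0]] by (simp add: case_prod_beta')
  show ?thesis unfolding \<sigma>_eq by measurable
qed

lemma \<sigma>_nonneg: "0 \<le> \<sigma> s s"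
  by (simp add: \<sigma>_eq)

text \<open>By Tonelli the integral is the second moment of the norm of an innovation; it is the
  trace of the covariance operator.\<close>

lemma \<sigma>_integrable: "integrable \<mu> (\<lambda>s. \<sigma> s s)"
proof (rule integrableI_bounded)
  have "(\<integral>\<^sup>+s. ennreal (norm (\<sigma> s s)) \<partial>\<mu>) = (\<integral>\<^sup>+s. (\<integral>\<^sup>+\<omega>. ennreal ((\<epsilon> 0 \<omega> s)\<^sup>2) \<partial>P) \<partial>\<mu>)"
    by (intro nn_integral_cong) (simp add: nn_integral_eq_integral[OF \<epsilon>_sq] \<epsilon>_sq_eq \<sigma>_nonneg)
  also have "\<dots> = (\<integral>\<^sup>+\<omega>. (\<integral>\<^sup>+s. ennreal ((\<epsilon> 0 \<omega> s)\<^sup>2) \<partial>\<mu>) \<partial>P)"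
    using Fubini[of "\<lambda>(\<omega>, s). ennreal ((\<epsilon> 0 \<omega> s)\<^sup>2)"] by simp
  also have "\<dots> = (\<integral>\<^sup>+\<omega>. ennreal ((L2_norm \<mu> (\<epsilon> 0 \<omega>))\<^sup>2) \<partial>P)"
    by (rule nn_integral_cong_AE, use L2_ae in eventually_elim)
      (simp add: L2_norm_def L2_funs_def nn_integral_eq_integral)
  also have "\<dots> = ennreal (\<integral>\<omega>. (L2_norm \<mu> (\<epsilon> 0 \<omega>))\<^sup>2 \<partial>P)"
    by (rule nn_integral_eq_integral[OF L2_sq]) simp
  also have "\<dots> < \<infinity>" by simp
  finally show "(\<integral>\<^sup>+s. ennreal (norm (\<sigma> s s)) \<partial>\<mu>) < \<infinity>" .
qed measurable

lemma L2_process_sum: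
  assumes K: "finite K"
  shows "L2_process P \<mu> (\<lambda>\<omega> s. \<Sum>k\<in>K. c k * \<epsilon> k \<omega> s) \<sigma> (\<Sum>k\<in>K. (c k)\<^sup>2)"
proof unfold_locales
  show "(\<lambda>(\<omega>, s). \<Sum>k\<in>K. c k * \<epsilon> k \<omega> s) \<in> borel_measurable (P \<Otimes>\<^sub>M \<mu>)" by measurable
  show "integrable P (\<lambda>\<omega>. (\<Sum>k\<in>K. c k * \<epsilon> k \<omega> s)\<^sup>2)" if s: "s \<in> space \<mu>" for s
  proof -
    have "(\<Sum>k\<in>K. c k * \<epsilon> k \<omega> s)\<^sup>2 = (\<Sum>k\<in>K. \<Sum>l\<in>K. c k * c l * (\<epsilon> k \<omega> s * \<epsilon> l \<omega> s))" for \<omega>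
      by (simp add: power2_eq_square sum_product mult_ac)
    then show ?thesis using \<epsilon>_prod_int[OF s s]
      by (simp only:) (intro Bochner_Integration.integrable_sum integrable_mult_right)
  qed
  show "(\<integral>\<omega>. (\<Sum>k\<in>K. c k * \<epsilon> k \<omega> r) * (\<Sum>k\<in>K. c k * \<epsilon> k \<omega> s) \<partial>P) = (\<Sum>k\<in>K. (c k)\<^sup>2) * \<sigma> r s"
    if r: "r \<in> space \<mu>" and s: "s \<in> space \<mu>" for r s
  proof -
    have "(\<integral>\<omega>. (\<Sum>k\<in>K. c k * \<epsilon> k \<omega> r) * (\<Sum>k\<in>K. c k * \<epsilon> k \<omega> s) \<partial>P) =
        (\<integral>\<omega>. (\<Sum>k\<in>K. \<Sum>l\<in>K. c k * c l * (\<epsilon> k \<omega> r * \<epsilon> l \<omega> s)) \<partial>P)"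
      by (simp add: sum_product mult_ac)
    also have "\<dots> = (\<Sum>k\<in>K. \<Sum>l\<in>K. \<integral>\<omega>. c k * c l * (\<epsilon> k \<omega> r * \<epsilon> l \<omega> s) \<partial>P)"
      using \<epsilon>_prod_int[OF r s]
      by (simp add: Bochner_Integration.integral_sum Bochner_Integration.integrable_sum)
    also have "\<dots> = (\<Sum>k\<in>K. \<Sum>l\<in>K. if k = l then (c k)\<^sup>2 * \<sigma> r s else 0)"
      by (intro sum.cong) (auto simp: \<epsilon>_cov[OF r s] power2_eq_square)
    also have "\<dots> = (\<Sum>k\<in>K. (c k)\<^sup>2 * \<sigma> r s)"
      using K by (intro sum.cong) auto
    finally show ?thesis by (simp add: sum_distrib_right)
  qed
  show "integrable \<mu> (\<lambda>s. \<sigma> s s)" by (rule \<sigma>_integrable)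
qed

lemma L2_process_\<epsilon>: "L2_process P \<mu> (\<epsilon> k) \<sigma> 1"
  using L2_process_sum[of "{k}" "\<lambda>_. 1"] by simp

lemma indep_point:
  fixes f :: "nat \<Rightarrow> int"
  assumes s: "s \<in> space \<mu>" and f: "inj f"
  shows "indep_vars (\<lambda>_. borel) (\<lambda>i \<omega>. c i * \<epsilon> (f i) \<omega> s) UNIV"
proof -
  have 1: "indep_vars (\<lambda>_. borel) (\<lambda>k \<omega>. restrict (\<epsilon> k \<omega>) (space \<mu>) s) UNIV"
    using s by (intro indep_fun) auto
  have "indep_vars (\<lambda>_. borel) (\<lambda>i \<omega>. \<epsilon> (f i) \<omega> s) UNIV"
    using indep_vars_inj[OF 1 f] s by simp
  then show ?thesis by (rule indep_vars_compose2) simp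
qed

section \<open>Convergence of the linear process and its remote innovations\<close>

text \<open>For \<open>n = 0\<close> this is the whole linear process at time \<open>k\<close>, so
  measurability of both is proved once.\<close>

definition tail :: "int \<Rightarrow> nat \<Rightarrow> 'w \<Rightarrow> 's \<Rightarrow> real" where
  "tail k n \<omega> s = (\<Sum>j. \<epsilon> (k - int (j + n)) \<omega> s / real (j + n + 1))"

lemma tail_meas [measurable]: "case_prod (tail k n) \<in> borel_measurable (P \<Otimes>\<^sub>M \<mu>)"
  unfolding tail_def by measurable

text \<open>Telescoping, from \<open>1 / (i + 1)\<^sup>2 \<le> 1 / i - 1 / (i + 1)\<close>.\<close>

lemma inverse_squares_le:
  assumes "1 \<le> n"
  shows "(\<Sum>j<m. 1 / (real (j + n + 1))\<^sup>2) \<le> 1 / real n - 1 / real (n + m)"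
proof (induction m)
  case (Suc m)
  have "1 / (real (m + n + 1))\<^sup>2 \<le> 1 / real (n + m) - 1 / real (n + Suc m)"
    using assms by (simp add: divide_simps power2_eq_square) (simp add: algebra_simps)
  with Suc show ?case by simp
qed simp

text \<open>The coefficients are square summable but not summable, so convergence rests on
  independence and is almost sure at fixed \<open>s\<close>.\<close>

lemma summable_\<epsilon>:
  assumes s: "s \<in> space \<mu>"
  shows "AE \<omega> in P. summable (\<lambda>j. \<epsilon> (k - int j) \<omega> s / real (j + 1))"
proof -
  have e: "\<epsilon> (k - int j) \<omega> s / real (j + 1) = (1 / real (j + 1)) * \<epsilon> (k - int j) \<omega> s" for j \<omega> by simp
  have "AE \<omega> in P. summable (\<lambda>j. (1 / real (j + 1)) * \<epsilon> (k - int j) \<omega> s)"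
  proof (rule kolmogorov_summable)
    show "indep_vars (\<lambda>_. borel) (\<lambda>j \<omega>. (1 / real (j + 1)) * \<epsilon> (k - int j) \<omega> s) UNIV"
      by (rule indep_point[OF s]) (auto simp: inj_on_def)
    show "(\<integral>\<omega>. (1 / real (j + 1)) * \<epsilon> (k - int j) \<omega> s \<partial>P) = 0" for j using \<epsilon>_mean[OF s] by simp
    show "integrable P (\<lambda>\<omega>. ((1 / real (j + 1)) * \<epsilon> (k - int j) \<omega> s)\<^sup>2)" for j
      unfolding power_mult_distrib using \<epsilon>_sq[OF s] by simp
    have "summable (\<lambda>j. \<sigma> s s * (1 / (real (Suc j))\<^sup>2))"
      using inverse_squares_sums by (intro summable_mult) (auto simp: sums_iff)
    then show "summable (\<lambda>j. \<integral>\<omega>. ((1 / real (j + 1)) * \<epsilon> (k - int j) \<omega> s)\<^sup>2 \<partial>P)"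
      unfolding power_mult_distrib using \<epsilon>_sq_eq[OF s] by (simp add: power_divide)
  qed
  then show ?thesis unfolding e .
qed

text \<open>Finite sums have second moment at most \<open>\<sigma> s s / n\<close> by orthogonality
  and telescoping; Fatou passes this to the limit.\<close>

lemma tail_sq:
  assumes s: "s \<in> space \<mu>" and n: "1 \<le> n"
  shows "integrable P (\<lambda>\<omega>. (tail k n \<omega> s)\<^sup>2)" and "(\<integral>\<omega>. (tail k n \<omega> s)\<^sup>2 \<partial>P) \<le> \<sigma> s s / real n"
proof -
  have [measurable]: "(\<lambda>\<omega>. tail k n \<omega> s) \<in> borel_measurable P"
    using s unfolding tail_def by measurable
  define T where "T M \<omega> = (\<Sum>j<M. (1 / real (j + n + 1)) * \<epsilon> (k - int (j + n)) \<omega> s)" for M \<omega>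
  have [measurable]: "T M \<in> borel_measurable P" for M using s unfolding T_def by measurable
  have ind: "indep_vars (\<lambda>_. borel) (\<lambda>j \<omega>. (1 / real (j + n + 1)) * \<epsilon> (k - int (j + n)) \<omega> s) UNIV"
    by (rule indep_point[OF s]) (auto simp: inj_on_def)
  have m0: "(\<integral>\<omega>. (1 / real (j + n + 1)) * \<epsilon> (k - int (j + n)) \<omega> s \<partial>P) = 0" for j using \<epsilon>_mean[OF s] by simp
  have i0: "integrable P (\<lambda>\<omega>. ((1 / real (j + n + 1)) * \<epsilon> (k - int (j + n)) \<omega> s)\<^sup>2)" for j
    unfolding power_mult_distrib using \<epsilon>_sq[OF s] by simp
  have "(\<integral>\<omega>. (T M \<omega>)\<^sup>2 \<partial>P) = (\<Sum>j<M. 1 / (real (j + n + 1))\<^sup>2 * \<sigma> s s)" for M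
    unfolding T_def indep_sum_sq(2)[OF ind m0 i0]
    unfolding power_mult_distrib by (simp add: \<epsilon>_sq_eq[OF s] power_divide)
  moreover have "(\<Sum>j<M. 1 / (real (j + n + 1))\<^sup>2 * \<sigma> s s) \<le> \<sigma> s s / real n" for M
  proof -
    have "(\<Sum>j<M. 1 / (real (j + n + 1))\<^sup>2) \<le> 1 / real n"
      using inverse_squares_le[OF n, of M] by (rule order_trans) simp
    then have "(\<Sum>j<M. 1 / (real (j + n + 1))\<^sup>2) * \<sigma> s s \<le> 1 / real n * \<sigma> s s"
      using \<sigma>_nonneg[of s] by (rule mult_right_mono)
    then show ?thesis by (simp add: sum_distrib_right)
  qed
  moreover have "integrable P (\<lambda>\<omega>. (T M \<omega>)\<^sup>2)" for M
    unfolding T_def by (rule indep_sum_sq(1)[OF ind m0 i0])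
  ultimately have TM: "(\<integral>\<^sup>+\<omega>. ennreal ((T M \<omega>)\<^sup>2) \<partial>P) \<le> ennreal (\<sigma> s s / real n)" for M
    by (subst nn_integral_eq_integral) (auto intro: ennreal_leI)
  have lim: "AE \<omega> in P. ennreal ((tail k n \<omega> s)\<^sup>2) = liminf (\<lambda>M. ennreal ((T M \<omega>)\<^sup>2))"
    using summable_\<epsilon>[OF s, of k]
  proof eventually_elim
    case (elim \<omega>)
    from summable_ignore_initial_segment[OF this, of n]
    have "(\<lambda>M. T M \<omega>) \<longlonglongrightarrow> tail k n \<omega> s"
      unfolding T_def tail_def using summable_LIMSEQ[of "\<lambda>j. \<epsilon> (k - int (j + n)) \<omega> s / real (j + n + 1)"]
      by simp
    then have "(\<lambda>M. ennreal ((T M \<omega>)\<^sup>2)) \<longlonglongrightarrow> ennreal ((tail k n \<omega> s)\<^sup>2)"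
      by (intro tendsto_ennrealI tendsto_power)
    then show ?case by (metis lim_imp_Liminf sequentially_bot)
  qed
  have "(\<integral>\<^sup>+\<omega>. ennreal ((tail k n \<omega> s)\<^sup>2) \<partial>P) = (\<integral>\<^sup>+\<omega>. liminf (\<lambda>M. ennreal ((T M \<omega>)\<^sup>2)) \<partial>P)"
    by (rule nn_integral_cong_AE[OF lim])
  also have "\<dots> \<le> liminf (\<lambda>M. \<integral>\<^sup>+\<omega>. ennreal ((T M \<omega>)\<^sup>2) \<partial>P)"
    by (rule nn_integral_liminf) measurable
  also have "\<dots> \<le> liminf (\<lambda>M::nat. ennreal (\<sigma> s s / real n))"
    by (intro Liminf_mono always_eventually allI TM)
  finally have le: "(\<integral>\<^sup>+\<omega>. ennreal ((tail k n \<omega> s)\<^sup>2) \<partial>P) \<le> ennreal (\<sigma> s s / real n)"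
    by (simp add: Liminf_const)
  show i: "integrable P (\<lambda>\<omega>. (tail k n \<omega> s)\<^sup>2)"
    using le by (intro integrableI_bounded) (auto simp: le_less_trans[OF _ ennreal_less_top])
  show "(\<integral>\<omega>. (tail k n \<omega> s)\<^sup>2 \<partial>P) \<le> \<sigma> s s / real n"
    using le \<sigma>_nonneg[of s] unfolding nn_integral_eq_integral[OF i AE_I2[OF zero_le_power2]] by (simp add: ennreal_le_iff)
qed

text \<open>The mean norm is of order \<open>1 / sqrt n\<close>, so that \<open>n\<close> such terms
  add up to order \<open>sqrt n\<close>, which the extra \<open>ln n\<close> in the normalisation
  makes negligible.\<close>

lemma tail_L2:
  assumes n: "1 \<le> n"
  shows "AE \<omega> in P. tail k n \<omega> \<in> L2_funs \<mu>"
    and "integrable P (\<lambda>\<omega>. L2_norm \<mu> (tail k n \<omega>))"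
    and "(\<integral>\<omega>. L2_norm \<mu> (tail k n \<omega>) \<partial>P) \<le> sqrt ((\<integral>s. \<sigma> s s \<partial>\<mu>) / real n)"
proof -
  have iB: "integrable \<mu> (\<lambda>s. \<sigma> s s / real n)" using \<sigma>_integrable by simp
  note S = sqrt_integral_expectation[of "\<lambda>\<omega> s. (tail k n \<omega> s)\<^sup>2" "\<lambda>s. \<sigma> s s / real n", OF prob_space_axioms _ _ tail_sq[OF _ n] iB]
  have "AE \<omega> in P. integrable \<mu> (\<lambda>s. (tail k n \<omega> s)\<^sup>2)" by (rule S(1)) auto
  then show "AE \<omega> in P. tail k n \<omega> \<in> L2_funs \<mu>"
    using AE_space
  proof eventually_elim
    case (elim \<omega>)
    have "tail k n \<omega> \<in> borel_measurable \<mu>"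
      using measurable_compose[OF measurable_Pair1'[OF elim(2), of \<mu>] tail_meas] by simp
    then show ?case using elim by (simp add: L2_funs_def)
  qed
  show "integrable P (\<lambda>\<omega>. L2_norm \<mu> (tail k n \<omega>))"
    unfolding L2_norm_def by (rule S(2)) auto
  show "(\<integral>\<omega>. L2_norm \<mu> (tail k n \<omega>) \<partial>P) \<le> sqrt ((\<integral>s. \<sigma> s s \<partial>\<mu>) / real n)"
    using S(3) unfolding L2_norm_def by simp
qed

text \<open>The null sets of \<open>summable_\<epsilon>\<close> depend on \<open>s\<close>; by
  Fubini the quantifiers can be exchanged, at the price of a null set of \<open>s\<close>.\<close>

lemma AE_summable: "AE \<omega> in P. AE s in \<mu>. summable (\<lambda>j. \<epsilon> (k - int j) \<omega> s / real (j + 1))"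
proof -
  have "Measurable.pred (P \<Otimes>\<^sub>M \<mu>) (\<lambda>p. summable (\<lambda>j. \<epsilon> (k - int j) (fst p) (snd p) / real (j + 1)))"
    unfolding summable_iff_convergent Cauchy_convergent_iff[symmetric] by measurable
  then have m: "{p \<in> space (P \<Otimes>\<^sub>M \<mu>). summable (\<lambda>j. \<epsilon> (k - int j) (fst p) (snd p) / real (j + 1))} \<in> sets (P \<Otimes>\<^sub>M \<mu>)"
    by (simp add: pred_def)
  have "AE s in \<mu>. AE \<omega> in P. summable (\<lambda>j. \<epsilon> (k - int j) \<omega> s / real (j + 1))"
    by (rule AE_I2) (rule summable_\<epsilon>)
  then show ?thesis using AE_commute[OF m] by blast
qed


section \<open>The random walk of the innovations and the norm of its increments\<close>

definition walk :: "nat \<Rightarrow> 'w \<Rightarrow> 's \<Rightarrow> real" where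
  "walk m \<omega> s = (\<Sum>k<m. \<epsilon> (int k + 1) \<omega> s)"

text \<open>The increments are indexed so that the origin of the walk sits at position \<open>n\<close>.\<close>

definition block :: "nat \<Rightarrow> nat \<Rightarrow> nat \<Rightarrow> 'w \<Rightarrow> 's \<Rightarrow> real" where
  "block n a b \<omega> s = (\<Sum>i\<in>{a..<b}. \<epsilon> (int i + 1 - int n) \<omega> s)"

text \<open>The window of \<open>2 * n\<close> steps contains the first \<open>n\<close> steps of
  the walk together with all their shifts into the past by up to \<open>n\<close>.\<close>

definition modulus :: "nat \<Rightarrow> nat \<Rightarrow> 'w \<Rightarrow> real" where
  "modulus n L \<omega> = sqrt (\<integral>s. wmod (2 * n) L (\<lambda>i. \<epsilon> (int i + 1 - int n) \<omega> s) \<partial>\<mu>)"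

text \<open>An integral that does not exist is 0, so \<open>modulus\<close> bounds increments only
  where this holds.\<close>

definition good_modulus :: "nat \<Rightarrow> nat \<Rightarrow> 'w \<Rightarrow> bool" where
  "good_modulus n L \<omega> \<longleftrightarrow> integrable \<mu> (\<lambda>s. wmod (2 * n) L (\<lambda>i. \<epsilon> (int i + 1 - int n) \<omega> s))"

abbreviation total_var :: real where
  "total_var \<equiv> (\<integral>s. \<sigma> s s \<partial>\<mu>)"

lemma total_var_nonneg: "0 \<le> total_var"
  by (simp add: \<sigma>_nonneg)

lemma block_meas: "\<omega> \<in> space P \<Longrightarrow> block n a b \<omega> \<in> borel_measurable \<mu>"
  unfolding block_def[abs_def] by measurable

lemma walk_eq_block: "walk m \<omega> s = block n n (n + m) \<omega> s"
proof -
  have "block n n (n + m) \<omega> s = (\<Sum>i\<in>{0 + n..<m + n}. \<epsilon> (int i + 1 - int n) \<omega> s)"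
    by (simp add: block_def add.commute)
  also have "\<dots> = walk m \<omega> s"
    unfolding sum.shift_bounds_nat_ivl walk_def by (simp add: lessThan_atLeast0)
  finally show ?thesis ..
qed

lemma block_split: "a \<le> b \<Longrightarrow> b \<le> c \<Longrightarrow> block n a c \<omega> s = block n a b \<omega> s + block n b c \<omega> s"
  unfolding block_def by (simp add: sum.atLeastLessThan_concat)

text \<open>Shifting the window back by \<open>j\<close> trades the last \<open>j\<close> steps for
  \<open>j\<close> steps before the origin: the stretch from \<open>n - j\<close> to
  \<open>n + m\<close> is split in two ways. Both corrections are increments over \<open>j\<close>
  steps.\<close>

lemma shifted_walk_eq:
  assumes "j \<le> n"
  shows "(\<Sum>i<m. \<epsilon> (int i + 1 - int j) \<omega> s) =
    walk m \<omega> s + block n (n - j) n \<omega> s - block n (n + m - j) (n + m) \<omega> s"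
proof -
  have "(\<Sum>i<m. \<epsilon> (int i + 1 - int j) \<omega> s) = (\<Sum>i\<in>{0..<m}. \<epsilon> (int (i + (n - j)) + 1 - int n) \<omega> s)"
    using assms by (simp add: lessThan_atLeast0 of_nat_diff algebra_simps)
  also have "\<dots> = block n (n - j) (n + m - j) \<omega> s"
    unfolding block_def using assms
    by (subst sum.shift_bounds_nat_ivl[symmetric]) (simp add: algebra_simps)
  finally have 1: "(\<Sum>i<m. \<epsilon> (int i + 1 - int j) \<omega> s) = block n (n - j) (n + m - j) \<omega> s" .
  have "block n (n - j) (n + m) \<omega> s = block n (n - j) (n + m - j) \<omega> s + block n (n + m - j) (n + m) \<omega> s"
    by (rule block_split) auto
  moreover have "block n (n - j) (n + m) \<omega> s = block n (n - j) n \<omega> s + block n n (n + m) \<omega> s"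
    by (rule block_split) auto
  ultimately show ?thesis using 1 walk_eq_block[of m \<omega> s n] by simp
qed

lemma modulus_basic:
  assumes B: "\<And>s. s \<in> space \<mu> \<Longrightarrow> (\<integral>\<omega>. wmod (2 * n) L (\<lambda>i. \<epsilon> (int i + 1 - int n) \<omega> s) \<partial>P) \<le> B s" "integrable \<mu> B"
  shows "AE \<omega> in P. good_modulus n L \<omega>" and "integrable P (modulus n L)"
    and "(\<integral>\<omega>. modulus n L \<omega> \<partial>P) \<le> sqrt (\<integral>s. B s \<partial>\<mu>)"
proof -
  let ?D = "\<lambda>\<omega> s. wmod (2 * n) L (\<lambda>i. \<epsilon> (int i + 1 - int n) \<omega> s)"
  have m: "case_prod ?D \<in> borel_measurable (P \<Otimes>\<^sub>M \<mu>)"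
    by measurable
  have i: "integrable P (\<lambda>\<omega>. ?D \<omega> s)" if s: "s \<in> space \<mu>" for s
  proof (rule wmod_expectation_crude(1))
    show "indep_vars (\<lambda>_. borel) (\<lambda>i \<omega>. \<epsilon> (int i + 1 - int n) \<omega> s) UNIV"
      using indep_point[OF s, of "\<lambda>i. int i + 1 - int n" "\<lambda>_. 1"] by (simp add: inj_on_def)
  qed (use \<epsilon>_mean[OF s] \<epsilon>_sq[OF s] \<epsilon>_sq_eq[OF s] in auto)
  note S = sqrt_integral_expectation[OF prob_space_axioms m wmod_nonneg i B]
  show "AE \<omega> in P. good_modulus n L \<omega>" unfolding good_modulus_def by (rule S(1))
  show "integrable P (modulus n L)" unfolding modulus_def[abs_def] by (rule S(2))
  show "(\<integral>\<omega>. modulus n L \<omega> \<partial>P) \<le> sqrt (\<integral>s. B s \<partial>\<mu>)" unfolding modulus_def by (rule S(3))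
qed

text \<open>The 32 is the 16 of \<open>wmod_expectation_crude\<close> times the 2 from the window of
  length \<open>2 * n\<close>. This bound ignores \<open>L\<close>; it controls the long increments,
  and it is the integrable majorant for the short ones.\<close>

lemma wmod_crude:
  assumes s: "s \<in> space \<mu>"
  shows "(\<integral>\<omega>. wmod (2 * n) L (\<lambda>i. \<epsilon> (int i + 1 - int n) \<omega> s) \<partial>P) \<le> real n * (32 * \<sigma> s s)"
proof -
  have "(\<integral>\<omega>. wmod (2 * n) L (\<lambda>i. \<epsilon> (int i + 1 - int n) \<omega> s) \<partial>P) \<le> 16 * real (2 * n) * \<sigma> s s"
  proof (rule wmod_expectation_crude(2))
    show "indep_vars (\<lambda>_. borel) (\<lambda>i \<omega>. \<epsilon> (int i + 1 - int n) \<omega> s) UNIV"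
      using indep_point[OF s, of "\<lambda>i. int i + 1 - int n" "\<lambda>_. 1"] by (simp add: inj_on_def)
  qed (use \<epsilon>_mean[OF s] \<epsilon>_sq[OF s] \<epsilon>_sq_eq[OF s] in auto)
  then show ?thesis by simp
qed

lemma modulus_crude:
  shows "AE \<omega> in P. good_modulus n L \<omega>" and "integrable P (modulus n L)"
    and "(\<integral>\<omega>. modulus n L \<omega> \<partial>P) \<le> sqrt (real n) * sqrt (32 * total_var)"
proof -
  have i: "integrable \<mu> (\<lambda>s. real n * (32 * \<sigma> s s))" using \<sigma>_integrable by simp
  note M = modulus_basic[OF wmod_crude i]
  show "AE \<omega> in P. good_modulus n L \<omega>" by (rule M(1))
  show "integrable P (modulus n L)" by (rule M(2))
  show "(\<integral>\<omega>. modulus n L \<omega> \<partial>P) \<le> sqrt (real n) * sqrt (32 * total_var)"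
    using M(3) by (simp add: real_sqrt_mult)
qed

lemma modulus_nonneg: "0 \<le> modulus n L \<omega>"
  unfolding modulus_def by (simp add: wmod_nonneg)

lemma block_le_modulus:
  assumes \<omega>: "\<omega> \<in> space P" and good: "good_modulus n L \<omega>"
    and ab: "a \<le> b" "b \<le> 2 * n" "b - a \<le> L"
  shows "block n a b \<omega> \<in> L2_funs \<mu>" and "L2_norm \<mu> (block n a b \<omega>) \<le> modulus n L \<omega>"
proof -
  have le: "(block n a b \<omega> s)\<^sup>2 \<le> wmod (2 * n) L (\<lambda>i. \<epsilon> (int i + 1 - int n) \<omega> s)" for s
    unfolding block_def by (rule wmod_ge[OF ab])
  have i: "integrable \<mu> (\<lambda>s. (block n a b \<omega> s)\<^sup>2)"
    by (rule Bochner_Integration.integrable_bound[OF good[unfolded good_modulus_def]])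
      (use block_meas[OF \<omega>] le wmod_nonneg in auto)
  then show "block n a b \<omega> \<in> L2_funs \<mu>" using block_meas[OF \<omega>] by (simp add: L2_funs_def)
  show "L2_norm \<mu> (block n a b \<omega>) \<le> modulus n L \<omega>"
    unfolding L2_norm_def modulus_def
    by (intro real_sqrt_le_mono integral_mono i good[unfolded good_modulus_def] le)
qed

text \<open>Truncating at level \<open>l powr (1/8)\<close> makes the fourth-moment bound of the truncated part small,
  while the untruncated remainder is controlled by uniform integrability.\<close>

lemma modulus_small:
  assumes \<eta>: "0 < \<eta>"
  shows "\<exists>l\<ge>1. \<forall>n L. 1 \<le> L \<longrightarrow> L * l \<le> n \<longrightarrow> (\<integral>\<omega>. modulus n L \<omega> \<partial>P) \<le> \<eta> * sqrt (real n)"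
proof -
  define A where "A l = sqrt (sqrt (sqrt (real l)))" for l :: nat
  have A2: "(A l)\<^sup>2 = sqrt (sqrt (real l))" for l by (simp add: A_def)
  define \<tau> where "\<tau> l s = (\<integral>\<omega>. (\<epsilon> 0 \<omega> s)\<^sup>2 * indicator {x. A l < \<bar>x\<bar>} (\<epsilon> 0 \<omega> s) \<partial>P)" for l s
  \<comment> \<open>At each \<open>s\<close> the second entry tends to 0 as \<open>l\<close> grows,
    while the first is integrable over \<open>s\<close>; their minimum admits dominated convergence.
    The 480 is \<open>320 * 3 / 2\<close>.\<close>
  define b where "b l s = min (32 * \<sigma> s s) (64 * \<tau> l s + 480 / sqrt (sqrt (real l)))" for l s
  have [measurable]: "(\<lambda>(s, \<omega>). \<epsilon> 0 \<omega> s) \<in> borel_measurable (\<mu> \<Otimes>\<^sub>M P)"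
    using measurable_compose[OF measurable_pair_swap' \<epsilon>_meas[of 0]] by (simp add: case_prod_beta')
  have [measurable]: "\<tau> l \<in> borel_measurable \<mu>" for l unfolding \<tau>_def by measurable
  have [measurable]: "b l \<in> borel_measurable \<mu>" for l unfolding b_def by measurable
  have \<tau>0: "0 \<le> \<tau> l s" for l s unfolding \<tau>_def by simp
  have b0: "0 \<le> b l s" for l s unfolding b_def using \<tau>0[of l s] \<sigma>_nonneg[of s] by simp
  have b_le: "b l s \<le> 32 * \<sigma> s s" for l s by (simp add: b_def)
  have ib: "integrable \<mu> (b l)" for l
    by (rule Bochner_Integration.integrable_bound[OF integrable_mult_right[OF \<sigma>_integrable, of 32]])
      (use b0 b_le \<sigma>_nonneg in \<open>auto simp: abs_of_nonneg\<close>)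
  have Alim: "filterlim A at_top sequentially"
    unfolding A_def[abs_def]
    by (intro filterlim_compose[OF sqrt_at_top] filterlim_real_sequentially)
  have \<tau>_lim: "(\<lambda>l. \<tau> l s) \<longlonglongrightarrow> 0" if s: "s \<in> space \<mu>" for s
  proof -
    have "(\<lambda>l. \<tau> l s) \<longlonglongrightarrow> (\<integral>\<omega>. 0 \<partial>P)"
      unfolding \<tau>_def
    proof (rule integral_dominated_convergence[where w = "\<lambda>\<omega>. (\<epsilon> 0 \<omega> s)\<^sup>2"])
      show "AE \<omega> in P. (\<lambda>l. (\<epsilon> 0 \<omega> s)\<^sup>2 * indicator {x. A l < \<bar>x\<bar>} (\<epsilon> 0 \<omega> s)) \<longlonglongrightarrow> 0"
      proof (rule AE_I2)
        fix \<omega>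
        have "eventually (\<lambda>l. \<bar>\<epsilon> 0 \<omega> s\<bar> \<le> A l) sequentially"
          using Alim by (simp add: filterlim_at_top)
        then have "eventually (\<lambda>l. (\<epsilon> 0 \<omega> s)\<^sup>2 * indicator {x. A l < \<bar>x\<bar>} (\<epsilon> 0 \<omega> s) = (0::real)) sequentially"
          by eventually_elim (simp add: indicator_def)
        then show "(\<lambda>l. (\<epsilon> 0 \<omega> s)\<^sup>2 * indicator {x. A l < \<bar>x\<bar>} (\<epsilon> 0 \<omega> s)) \<longlonglongrightarrow> 0"
          by (rule tendsto_eventually)
      qed
      show "AE \<omega> in P. norm ((\<epsilon> 0 \<omega> s)\<^sup>2 * indicator {x. A l < \<bar>x\<bar>} (\<epsilon> 0 \<omega> s)) \<le> (\<epsilon> 0 \<omega> s)\<^sup>2" for l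
        by (rule AE_I2) (simp add: indicator_def)
    qed (use s sq0[OF s] in auto)
    then show ?thesis by simp
  qed
  have b_lim: "(\<lambda>l. b l s) \<longlonglongrightarrow> 0" if s: "s \<in> space \<mu>" for s
  proof (rule tendsto_sandwich[OF always_eventually always_eventually tendsto_const])
    have "(\<lambda>l. 480 / sqrt (sqrt (real l))) \<longlonglongrightarrow> 0"
      by (rule real_tendsto_divide_at_top[OF tendsto_const])
        (intro filterlim_compose[OF sqrt_at_top] filterlim_real_sequentially)
    with \<tau>_lim[OF s] have "(\<lambda>l. 64 * \<tau> l s + 480 / sqrt (sqrt (real l))) \<longlonglongrightarrow> 64 * 0 + 0"
      by (intro tendsto_intros)
    then show "(\<lambda>l. 64 * \<tau> l s + 480 / sqrt (sqrt (real l))) \<longlonglongrightarrow> 0" by simp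
  qed (use b0 in \<open>auto simp: b_def\<close>)
  have "(\<lambda>l. \<integral>s. b l s \<partial>\<mu>) \<longlonglongrightarrow> (\<integral>s. 0 \<partial>\<mu>)"
    by (rule integral_dominated_convergence[where w = "\<lambda>s. 32 * \<sigma> s s"])
      (use b_lim b0 b_le \<sigma>_integrable in \<open>auto intro!: AE_I2 simp: abs_of_nonneg\<close>)
  then have "eventually (\<lambda>l. (\<integral>s. b l s \<partial>\<mu>) < \<eta>\<^sup>2 \<and> 1 \<le> l) sequentially"
    using \<eta> by (intro eventually_conj order_tendstoD(2)[where y = 0] eventually_ge_at_top) auto
  then obtain l where l: "(\<integral>s. b l s \<partial>\<mu>) < \<eta>\<^sup>2" "1 \<le> l" by (auto simp: eventually_sequentially)
  have "(\<integral>\<omega>. modulus n L \<omega> \<partial>P) \<le> \<eta> * sqrt (real n)" if L: "1 \<le> L" "L * l \<le> n" for n L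
  proof -
    have Ln: "L \<le> 2 * n" using L l(2) by (metis le_trans mult_le_mono2 nat_mult_1_right mult_2 le_add1)
    \<comment> \<open>\<open>sqrt 2\<close> is rounded up to \<open>3 / 2\<close>.\<close>
    have sq: "sqrt (real (2 * n) * real L) \<le> 3 / 2 * real n / sqrt (real l)"
    proof (rule real_le_lsqrt)
      have "real L * real l \<le> real n" using L(2) by (metis of_nat_le_iff of_nat_mult)
      then have "real L \<le> real n / real l" using l(2) by (simp add: pos_le_divide_eq)
      then have "real (2 * n) * real L \<le> real (2 * n) * (real n / real l)" by (intro mult_left_mono) auto
      also have "\<dots> = 2 * (real n * real n) / real l" by simp
      also have "\<dots> \<le> 9 / 4 * (real n * real n) / real l"
        by (intro divide_right_mono mult_right_mono) auto
      also have "\<dots> = (3 / 2 * real n / sqrt (real l))\<^sup>2"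
        by (simp add: power_divide power_mult_distrib power2_eq_square)
      finally show "real (2 * n) * real L \<le> (3 / 2 * real n / sqrt (real l))\<^sup>2" .
    qed simp
    have B: "(\<integral>\<omega>. wmod (2 * n) L (\<lambda>i. \<epsilon> (int i + 1 - int n) \<omega> s) \<partial>P) \<le> real n * b l s" if s: "s \<in> space \<mu>" for s
    proof -
      have "(\<integral>\<omega>. wmod (2 * n) L (\<lambda>i. \<epsilon> (int i + 1 - int n) \<omega> s) \<partial>P) \<le>
          32 * real (2 * n) * \<tau> l s + 320 * sqrt (real (2 * n) * real L) * (A l)\<^sup>2"
      proof (rule wmod_expectation_truncated[of _ "A l" "\<tau> l s" L "2 * n", unfolded of_nat_mult[of "2 * n" L]])
        show "indep_vars (\<lambda>_. borel) (\<lambda>i \<omega>. \<epsilon> (int i + 1 - int n) \<omega> s) UNIV"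
          using indep_point[OF s, of "\<lambda>i. int i + 1 - int n" "\<lambda>_. 1"] by (simp add: inj_on_def)
        show "(\<integral>\<omega>. (\<epsilon> (int i + 1 - int n) \<omega> s)\<^sup>2 * indicator {x. A l < \<bar>x\<bar>} (\<epsilon> (int i + 1 - int n) \<omega> s) \<partial>P) \<le> \<tau> l s" for i
          using point_fun(1)[OF s, of "\<lambda>x. x\<^sup>2 * indicator {x. A l < \<bar>x\<bar>} x" "int i + 1 - int n"]
          unfolding \<tau>_def by simp
      qed (use \<epsilon>_mean[OF s] \<epsilon>_sq[OF s] L Ln in \<open>auto simp: A_def\<close>)
      also have "\<dots> \<le> 32 * real (2 * n) * \<tau> l s + 320 * (3 / 2 * real n / sqrt (real l)) * (A l)\<^sup>2"
        using sq by (intro add_left_mono mult_right_mono mult_left_mono) auto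
      also have "\<dots> = real n * (64 * \<tau> l s + 480 * (sqrt (sqrt (real l)) / sqrt (real l)))"
        unfolding A2 by (simp add: algebra_simps)
      also have "sqrt (sqrt (real l)) / sqrt (real l) = 1 / sqrt (sqrt (real l))"
        using l(2) real_sqrt_mult_self[of "sqrt (real l)"] by (simp add: divide_simps)
      finally show ?thesis using wmod_crude[OF s, of n L] by (simp add: b_def min_def)
    qed
    have "(\<integral>\<omega>. modulus n L \<omega> \<partial>P) \<le> sqrt (\<integral>s. real n * b l s \<partial>\<mu>)"
      using ib by (intro modulus_basic(3) B) auto
    also have "\<dots> \<le> sqrt (real n * \<eta>\<^sup>2)"
      using l(1) by (intro real_sqrt_le_mono) (simp add: mult_left_mono)
    also have "\<dots> = \<eta> * sqrt (real n)" using \<eta> by (simp add: real_sqrt_mult)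
    finally show ?thesis .
  qed
  then show ?thesis using l(2) by blast
qed

section \<open>The linear process against a multiple of the walk\<close>

definition lin :: "nat \<Rightarrow> 'w \<Rightarrow> 's \<Rightarrow> real" where
  "lin k \<omega> s = tail (int k) 0 \<omega> s"

text \<open>\<open>S\<^sub>m - H\<^sub>n W\<^sub>m\<close> is a weighted sum of increments of the walk over \<open>j < n\<close> steps, plus the
  contribution of the innovations which are at least \<open>n\<close> steps older than the summand.\<close>

lemma partial_sum_decomposition:
  assumes "\<And>k. 1 \<le> k \<Longrightarrow> k \<le> m \<Longrightarrow> summable (\<lambda>j. \<epsilon> (int k - int j) \<omega> s / real (j + 1))"
  shows "partial_sum lin m \<omega> s = harm n * walk m \<omega> s +
    (\<Sum>j<n. 1 / real (j + 1) * (block n (n - j) n \<omega> s - block n (n + m - j) (n + m) \<omega> s)) +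
    (\<Sum>k=1..m. tail (int k) n \<omega> s)"
proof -
  have lin: "lin k \<omega> s = (\<Sum>j<n. \<epsilon> (int k - int j) \<omega> s / real (j + 1)) + tail (int k) n \<omega> s"
    if "1 \<le> k" "k \<le> m" for k
    using suminf_split_initial_segment[OF assms[OF that], of n]
    by (simp add: lin_def tail_def add.commute[of "suminf _"])
  have "partial_sum lin m \<omega> s = (\<Sum>k=1..m. (\<Sum>j<n. \<epsilon> (int k - int j) \<omega> s / real (j + 1)) + tail (int k) n \<omega> s)"
    unfolding partial_sum_def using lin by (intro sum.cong) auto
  also have "\<dots> = (\<Sum>j<n. 1 / real (j + 1) * (\<Sum>k=1..m. \<epsilon> (int k - int j) \<omega> s)) + (\<Sum>k=1..m. tail (int k) n \<omega> s)"
    unfolding sum.distrib sum.swap[of "\<lambda>k j. \<epsilon> (int k - int j) \<omega> s / real (j + 1)" "{..<n}" "{1..m}"]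
    by (simp add: sum_divide_distrib)
  also have "(\<Sum>j<n. 1 / real (j + 1) * (\<Sum>k=1..m. \<epsilon> (int k - int j) \<omega> s)) =
      (\<Sum>j<n. 1 / real (j + 1) * (walk m \<omega> s + block n (n - j) n \<omega> s - block n (n + m - j) (n + m) \<omega> s))"
  proof (rule sum.cong[OF refl])
    fix j assume "j \<in> {..<n}"
    then have "j \<le> n" by simp
    have "(\<Sum>k=1..m. \<epsilon> (int k - int j) \<omega> s) = (\<Sum>i<m. \<epsilon> (int i + 1 - int j) \<omega> s)"
      by (rule sum.reindex_bij_witness[where i = Suc and j = "\<lambda>k. k - 1"]) auto
    then show "1 / real (j + 1) * (\<Sum>k=1..m. \<epsilon> (int k - int j) \<omega> s) =
        1 / real (j + 1) * (walk m \<omega> s + block n (n - j) n \<omega> s - block n (n + m - j) (n + m) \<omega> s)"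
      unfolding shifted_walk_eq[OF \<open>j \<le> n\<close>] by simp
  qed
  also have "\<dots> = harm n * walk m \<omega> s +
      (\<Sum>j<n. 1 / real (j + 1) * (block n (n - j) n \<omega> s - block n (n + m - j) (n + m) \<omega> s))"
  proof -
    have "harm n = (\<Sum>j<n. 1 / real (j + 1))"
      unfolding harm_def by (rule sum.reindex_bij_witness[where i = Suc and j = "\<lambda>k. k - 1"])
        (auto simp: inverse_eq_divide)
    moreover have "1 / real (j + 1) * (walk m \<omega> s + block n (n - j) n \<omega> s - block n (n + m - j) (n + m) \<omega> s) =
        1 / real (j + 1) * walk m \<omega> s + 1 / real (j + 1) * (block n (n - j) n \<omega> s - block n (n + m - j) (n + m) \<omega> s)" for j
      by (simp only: distrib_left[symmetric] add_diff_eq)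
    ultimately show ?thesis by (simp only: sum.distrib sum_distrib_right)
  qed
  finally show ?thesis by simp
qed

text \<open>Lags up to \<open>L\<close> carry nearly the full harmonic weight but meet short
  increments; each of the at most \<open>n\<close> longer lags has weight below \<open>1 / L\<close>
  and meets an arbitrary increment; the tails are added. The factors 2 stand for the two increments
  per lag.\<close>

definition node_bound :: "nat \<Rightarrow> nat \<Rightarrow> 'w \<Rightarrow> real" where
  "node_bound n L \<omega> = 2 * harm n * modulus n L \<omega> + 2 * (real n / real L) * modulus n (2 * n) \<omega> +
     (\<Sum>k=1..n. L2_norm \<mu> (tail (int k) n \<omega>))"

text \<open>Stated for a fixed \<open>\<omega>\<close> off the exceptional sets, so that one
  \<open>\<omega>\<close> serves all \<open>m \<le> n\<close>. The decomposition behind it holds for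
  almost every \<open>s\<close> only, which norms do not notice.\<close>

lemma partial_sum_node_bound:
  assumes \<omega>: "\<omega> \<in> space P" and good: "good_modulus n L \<omega>" "good_modulus n (2 * n) \<omega>"
    and summ: "\<And>k. AE s in \<mu>. summable (\<lambda>j. \<epsilon> (k - int j) \<omega> s / real (j + 1))"
    and tl: "\<And>k. tail k n \<omega> \<in> L2_funs \<mu>"
    and m: "m \<le> n" and L: "1 \<le> L"
  shows "partial_sum lin m \<omega> \<in> L2_funs \<mu>" (is ?th1)
    and "L2_norm \<mu> (\<lambda>s. partial_sum lin m \<omega> s - harm n * walk m \<omega> s) \<le> node_bound n L \<omega>" (is ?th2)
proof -
  define r where "r s = (\<Sum>j<n. 1 / real (j + 1) * (block n (n - j) n \<omega> s - block n (n + m - j) (n + m) \<omega> s)) +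
    (\<Sum>k=1..m. tail (int k) n \<omega> s)" for s
  have bl: "block n a b \<omega> \<in> L2_funs \<mu>" if "a \<le> b" "b \<le> 2 * n" for a b
    using block_le_modulus(1)[OF \<omega> good(2) that] that by auto
  have bL: "block n (n - j) n \<omega> \<in> L2_funs \<mu>" "block n (n + m - j) (n + m) \<omega> \<in> L2_funs \<mu>" for j
    using m by (auto intro!: bl)
  have wL: "walk m \<omega> \<in> L2_funs \<mu>"
  proof -
    have "walk m \<omega> = block n n (n + m) \<omega>" by (rule ext) (rule walk_eq_block)
    then show ?thesis using bl[of n "n + m"] m by simp
  qed
  have rL: "r \<in> L2_funs \<mu>"
    unfolding r_def[abs_def] by (intro L2_funs_add L2_funs_sum L2_funs_cmult L2_funs_diff bL tl)
  have "AE s in \<mu>. \<forall>k\<in>{1..m}. summable (\<lambda>j. \<epsilon> (int k - int j) \<omega> s / real (j + 1))"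
    using summ by (intro AE_finite_allI) auto
  then have ae: "AE s in \<mu>. partial_sum lin m \<omega> s = harm n * walk m \<omega> s + r s"
    by eventually_elim (subst partial_sum_decomposition[of m _ _ n], auto simp: r_def)
  have pm: "partial_sum lin m \<omega> \<in> borel_measurable \<mu>"
  proof -
    have "tail k 0 \<omega> \<in> borel_measurable \<mu>" for k
      using measurable_compose[OF measurable_Pair1'[OF \<omega>, of \<mu>] tail_meas] by simp
    then show ?thesis unfolding partial_sum_def[abs_def] lin_def by (intro borel_measurable_sum)
  qed
  have hL: "(\<lambda>s. harm n * walk m \<omega> s + r s) \<in> L2_funs \<mu>" by (intro L2_funs_add L2_funs_cmult wL rL)
  have "integrable \<mu> (\<lambda>s. (partial_sum lin m \<omega> s)\<^sup>2) \<longleftrightarrow> integrable \<mu> (\<lambda>s. (harm n * walk m \<omega> s + r s)\<^sup>2)"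
    by (rule integrable_cong_AE) (use pm hL ae in \<open>auto simp: L2_funs_def\<close>)
  then show ?th1 using pm hL by (simp add: L2_funs_def)
  have "L2_norm \<mu> (\<lambda>s. partial_sum lin m \<omega> s - harm n * walk m \<omega> s) = L2_norm \<mu> r"
    by (rule L2_norm_cong_AE) (use pm wL rL ae in \<open>auto simp: L2_funs_def\<close>)
  also have "\<dots> \<le> L2_norm \<mu> (\<lambda>s. \<Sum>j<n. 1 / real (j + 1) * (block n (n - j) n \<omega> s - block n (n + m - j) (n + m) \<omega> s)) +
      L2_norm \<mu> (\<lambda>s. \<Sum>k=1..m. tail (int k) n \<omega> s)"
    unfolding r_def[abs_def] by (intro L2_norm_triangle L2_funs_sum L2_funs_cmult L2_funs_diff bL tl)
  also have "L2_norm \<mu> (\<lambda>s. \<Sum>k=1..m. tail (int k) n \<omega> s) \<le> (\<Sum>k=1..m. L2_norm \<mu> (tail (int k) n \<omega>))"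
    by (intro L2_norm_sum_le tl)
  also have "\<dots> \<le> (\<Sum>k=1..n. L2_norm \<mu> (tail (int k) n \<omega>))"
    using m by (intro sum_mono2) (auto simp: L2_norm_nonneg)
  also have "L2_norm \<mu> (\<lambda>s. \<Sum>j<n. 1 / real (j + 1) * (block n (n - j) n \<omega> s - block n (n + m - j) (n + m) \<omega> s)) \<le>
      (\<Sum>j<n. L2_norm \<mu> (\<lambda>s. 1 / real (j + 1) * (block n (n - j) n \<omega> s - block n (n + m - j) (n + m) \<omega> s)))"
    by (intro L2_norm_sum_le L2_funs_cmult L2_funs_diff bL)
  \<comment> \<open>Both bounds are granted to every lag, although each lag needs just one; the sum
    then evaluates without being cut at \<open>L\<close>.\<close>
  also have "\<dots> \<le> (\<Sum>j<n. 2 * (inverse (real (j + 1)) * modulus n L \<omega>) + 2 * (1 / real L * modulus n (2 * n) \<omega>))"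
  proof (rule sum_mono)
    fix j assume j: "j \<in> {..<n}"
    let ?a = "block n (n - j) n \<omega>" and ?b = "block n (n + m - j) (n + m) \<omega>"
    have tri: "L2_norm \<mu> (\<lambda>s. ?a s - ?b s) \<le> L2_norm \<mu> ?a + L2_norm \<mu> ?b"
      using L2_norm_triangle[OF bL(1)[of j] L2_funs_cmult[OF bL(2)[of j], of "-1"]] L2_norm_cmult[of \<mu> "-1" ?b] by simp
    have 1: "L2_norm \<mu> (\<lambda>s. 1 / real (j + 1) * (?a s - ?b s)) \<le> inverse (real (j + 1)) * (L2_norm \<mu> ?a + L2_norm \<mu> ?b)"
      using mult_left_mono[OF tri, of "inverse (real (j + 1))"] unfolding L2_norm_cmult by (simp add: inverse_eq_divide)
    show "L2_norm \<mu> (\<lambda>s. 1 / real (j + 1) * (?a s - ?b s)) \<le>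
        2 * (inverse (real (j + 1)) * modulus n L \<omega>) + 2 * (1 / real L * modulus n (2 * n) \<omega>)"
    proof (cases "j \<le> L")
      case True
      have "L2_norm \<mu> ?a \<le> modulus n L \<omega>" "L2_norm \<mu> ?b \<le> modulus n L \<omega>"
        using m True j by (auto intro!: block_le_modulus(2)[OF \<omega> good(1)])
      then have "inverse (real (j + 1)) * (L2_norm \<mu> ?a + L2_norm \<mu> ?b) \<le> inverse (real (j + 1)) * (2 * modulus n L \<omega>)"
        by (intro mult_left_mono) auto
      moreover have "0 \<le> 1 / real L * modulus n (2 * n) \<omega>" by (simp add: modulus_nonneg)
      ultimately show ?thesis using 1 by linarith
    next
      case False
      have "L2_norm \<mu> ?a \<le> modulus n (2 * n) \<omega>" "L2_norm \<mu> ?b \<le> modulus n (2 * n) \<omega>"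
        using m j by (auto intro!: block_le_modulus(2)[OF \<omega> good(2)])
      then have "inverse (real (j + 1)) * (L2_norm \<mu> ?a + L2_norm \<mu> ?b) \<le> 1 / real L * (2 * modulus n (2 * n) \<omega>)"
        using False L by (intro mult_mono) (auto simp: inverse_eq_divide L2_norm_nonneg intro!: frac_le)
      moreover have "0 \<le> inverse (real (j + 1)) * modulus n L \<omega>" by (simp add: modulus_nonneg)
      ultimately show ?thesis using 1 by linarith
    qed
  qed
  also have "\<dots> = 2 * harm n * modulus n L \<omega> + 2 * (real n / real L) * modulus n (2 * n) \<omega>"
  proof -
    have "harm n = (\<Sum>j<n. inverse (real (j + 1)))"
      unfolding harm_def by (rule sum.reindex_bij_witness[where i = Suc and j = "\<lambda>k. k - 1"]) auto
    then show ?thesis by (simp add: sum.distrib sum_distrib_right sum_distrib_left mult.assoc)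
  qed
  finally show ?th2 unfolding node_bound_def by simp
qed

lemma node_bound_expectation:
  assumes n: "1 \<le> n"
  shows "integrable P (node_bound n L)"
    and "(\<integral>\<omega>. node_bound n L \<omega> \<partial>P) \<le> 2 * harm n * (\<integral>\<omega>. modulus n L \<omega> \<partial>P) +
      (2 * (real n / real L) * sqrt (32 * total_var) + sqrt total_var) * sqrt (real n)"
proof -
  note i = modulus_crude(2) tail_L2(2)[OF n]
  show "integrable P (node_bound n L)"
    unfolding node_bound_def[abs_def] using i by auto
  have "(\<integral>\<omega>. node_bound n L \<omega> \<partial>P) = 2 * harm n * (\<integral>\<omega>. modulus n L \<omega> \<partial>P) +
      2 * (real n / real L) * (\<integral>\<omega>. modulus n (2 * n) \<omega> \<partial>P) + (\<Sum>k=1..n. \<integral>\<omega>. L2_norm \<mu> (tail (int k) n \<omega>) \<partial>P)"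
    unfolding node_bound_def using i by (simp add: Bochner_Integration.integral_sum)
  also have "\<dots> \<le> 2 * harm n * (\<integral>\<omega>. modulus n L \<omega> \<partial>P) +
      2 * (real n / real L) * (sqrt (real n) * sqrt (32 * total_var)) + (\<Sum>k=1..n. sqrt (total_var / real n))"
    by (intro add_mono mult_left_mono sum_mono modulus_crude(3) tail_L2(3)[OF n]) (auto simp: harm_nonneg)
  also have "(\<Sum>k=1..n. sqrt (total_var / real n)) = sqrt total_var * sqrt (real n)"
  proof -
    have "real n / sqrt (real n) = sqrt (real n)" by (rule real_div_sqrt) simp
    then have "sqrt total_var * (real n / sqrt (real n)) = sqrt total_var * sqrt (real n)" by simp
    then show ?thesis by (simp add: real_sqrt_divide mult.commute)
  qed
  finally show "(\<integral>\<omega>. node_bound n L \<omega> \<partial>P) \<le> 2 * harm n * (\<integral>\<omega>. modulus n L \<omega> \<partial>P) +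
      (2 * (real n / real L) * sqrt (32 * total_var) + sqrt total_var) * sqrt (real n)"
    by (simp add: algebra_simps)
qed

end

section \<open>Finite-dimensional distributions\<close>

text \<open>Prescribed means and covariances are equations between integrals and give no
  integrability; that has to come from the Gaussian law.\<close>

lemma (in prob_space) gaussian_rv_sq_integrable:
  assumes G: "gaussian_rv M T" and mean: "(\<integral>\<omega>. T \<omega> \<partial>M) = 0"
  shows "integrable M (\<lambda>\<omega>. (T \<omega>)\<^sup>2)"
proof -
  have [measurable]: "T \<in> borel_measurable M" using G by (simp add: gaussian_rv_def)
  obtain m where "distr M borel T = return borel m \<or>
      (\<exists>\<sigma>>0. distributed M lborel T (normal_density m \<sigma>))"
    using G by (auto simp: gaussian_rv_def)
  then show ?thesis
  proof
    assume d: "distr M borel T = return borel m"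
    have "integrable (return borel m) (\<lambda>x. x\<^sup>2 :: real)"
      by (rule integrableI_bounded) (auto simp: nn_integral_return)
    then show ?thesis unfolding d[symmetric] by (simp add: integrable_distr_eq)
  next
    assume "\<exists>\<sigma>>0. distributed M lborel T (normal_density m \<sigma>)"
    then obtain \<sigma> where \<sigma>: "0 < \<sigma>" "distributed M lborel T (normal_density m \<sigma>)" by blast
    have "m = 0" using normal_distributed_expectation[OF \<sigma>] mean by simp
    then show ?thesis
      using distributed_integrable[OF \<sigma>(2), of "\<lambda>x. x\<^sup>2"] integrable_normal_moment[OF \<sigma>(1), of m 2] by simp
  qed
qed

lemma (in prob_space) cos_expectation_diff:
  fixes A B :: "'a \<Rightarrow> real"
  assumes [measurable]: "A \<in> borel_measurable M" "B \<in> borel_measurable M"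
    and i: "integrable M (\<lambda>\<omega>. A \<omega> - B \<omega>)"
  shows "\<bar>(\<integral>\<omega>. cos (A \<omega> + c) \<partial>M) - (\<integral>\<omega>. cos (B \<omega> + c) \<partial>M)\<bar> \<le> (\<integral>\<omega>. \<bar>A \<omega> - B \<omega>\<bar> \<partial>M)"
proof -
  have cos: "\<bar>cos x - cos y\<bar> \<le> \<bar>x - y\<bar>" for x y :: real
  proof -
    have "\<bar>cos x - cos y\<bar> = 2 * (\<bar>sin ((x + y) / 2)\<bar> * \<bar>sin ((y - x) / 2)\<bar>)"
      unfolding cos_diff_cos by (simp add: abs_mult)
    also have "\<dots> \<le> 2 * (1 * \<bar>(y - x) / 2\<bar>)"
      by (intro mult_left_mono mult_mono abs_sin_le_one abs_sin_x_le_abs_x) auto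
    finally show ?thesis by simp
  qed
  have ic: "integrable M (\<lambda>\<omega>. cos (f \<omega> + c))" if [measurable]: "f \<in> borel_measurable M" for f
  proof (rule integrable_const_bound[of _ 1])
    show "AE \<omega> in M. norm (cos (f \<omega> + c)) \<le> 1" by (rule AE_I2) simp
  qed measurable
  have "\<bar>(\<integral>\<omega>. cos (A \<omega> + c) \<partial>M) - (\<integral>\<omega>. cos (B \<omega> + c) \<partial>M)\<bar> = \<bar>\<integral>\<omega>. cos (A \<omega> + c) - cos (B \<omega> + c) \<partial>M\<bar>"
    using ic[of A] ic[of B] by simp
  also have "\<dots> \<le> (\<integral>\<omega>. \<bar>cos (A \<omega> + c) - cos (B \<omega> + c)\<bar> \<partial>M)" by (rule integral_abs_bound)
  also have "\<dots> \<le> (\<integral>\<omega>. \<bar>A \<omega> - B \<omega>\<bar> \<partial>M)"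
  proof (rule integral_mono)
    show "\<bar>cos (A \<omega> + c) - cos (B \<omega> + c)\<bar> \<le> \<bar>A \<omega> - B \<omega>\<bar>" for \<omega> using cos[of "A \<omega> + c" "B \<omega> + c"] by simp
  qed (use ic[of A] ic[of B] i in auto)
  finally show ?thesis .
qed

lemma (in prob_space) cos_expectation_sum_diff:
  fixes A B :: "'i \<Rightarrow> 'a \<Rightarrow> real"
  assumes [measurable]: "\<And>j. j \<in> I \<Longrightarrow> A j \<in> borel_measurable M" "\<And>j. j \<in> I \<Longrightarrow> B j \<in> borel_measurable M"
    and i: "\<And>j. j \<in> I \<Longrightarrow> integrable M (\<lambda>\<omega>. (A j \<omega> - B j \<omega>)\<^sup>2)"
    and le: "\<And>j. j \<in> I \<Longrightarrow> (\<integral>\<omega>. (A j \<omega> - B j \<omega>)\<^sup>2 \<partial>M) \<le> \<delta>\<^sup>2" and \<delta>: "0 \<le> \<delta>"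
  shows "\<bar>(\<integral>\<omega>. cos ((\<Sum>j\<in>I. A j \<omega>) + c) \<partial>M) - (\<integral>\<omega>. cos ((\<Sum>j\<in>I. B j \<omega>) + c) \<partial>M)\<bar> \<le> real (card I) * \<delta>"
proof -
  have i1: "integrable M (\<lambda>\<omega>. A j \<omega> - B j \<omega>)" if "j \<in> I" for j
    by (rule integrable_L2[OF _ i[OF that]]) (use that in measurable)
  have le1: "(\<integral>\<omega>. \<bar>A j \<omega> - B j \<omega>\<bar> \<partial>M) \<le> \<delta>" if j: "j \<in> I" for j
  proof (rule power2_le_imp_le[OF _ \<delta>])
    have "(\<integral>\<omega>. \<bar>A j \<omega> - B j \<omega>\<bar> \<partial>M)\<^sup>2 \<le> (\<integral>\<omega>. \<bar>A j \<omega> - B j \<omega>\<bar>\<^sup>2 \<partial>M)"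
      using variance_eq[of "\<lambda>\<omega>. \<bar>A j \<omega> - B j \<omega>\<bar>"] variance_positive[of "\<lambda>\<omega>. \<bar>A j \<omega> - B j \<omega>\<bar>"] i1[OF j] i[OF j]
      by simp
    also have "\<dots> \<le> \<delta>\<^sup>2" using le[OF j] by simp
    finally show "(\<integral>\<omega>. \<bar>A j \<omega> - B j \<omega>\<bar> \<partial>M)\<^sup>2 \<le> \<delta>\<^sup>2" .
  qed
  have d: "(\<Sum>j\<in>I. A j \<omega>) - (\<Sum>j\<in>I. B j \<omega>) = (\<Sum>j\<in>I. A j \<omega> - B j \<omega>)" for \<omega> by (simp add: sum_subtractf)
  have "\<bar>(\<integral>\<omega>. cos ((\<Sum>j\<in>I. A j \<omega>) + c) \<partial>M) - (\<integral>\<omega>. cos ((\<Sum>j\<in>I. B j \<omega>) + c) \<partial>M)\<bar> \<le>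
      (\<integral>\<omega>. \<bar>(\<Sum>j\<in>I. A j \<omega>) - (\<Sum>j\<in>I. B j \<omega>)\<bar> \<partial>M)"
    by (rule cos_expectation_diff) (use i1 in \<open>auto simp: d\<close>)
  also have "\<dots> \<le> (\<integral>\<omega>. (\<Sum>j\<in>I. \<bar>A j \<omega> - B j \<omega>\<bar>) \<partial>M)"
    unfolding d using i1 by (intro integral_mono sum_abs) auto
  also have "\<dots> = (\<Sum>j\<in>I. \<integral>\<omega>. \<bar>A j \<omega> - B j \<omega>\<bar> \<partial>M)"
    using i1 by (intro Bochner_Integration.integral_sum) auto
  also have "\<dots> \<le> real (card I) * \<delta>"
    using sum_bounded_above[of I "\<lambda>j. \<integral>\<omega>. \<bar>A j \<omega> - B j \<omega>\<bar> \<partial>M" \<delta>] le1 by simp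
  finally show ?thesis .
qed

lemma grid_tendsto:
  assumes "1 \<le> J"
  shows "(\<lambda>n. real (n * j div J) / real n) \<longlonglongrightarrow> real j / real J"
proof (rule tendsto_sandwich)
  show "eventually (\<lambda>n. real j / real J - 1 / real n \<le> real (n * j div J) / real n) sequentially"
  proof (rule eventually_sequentiallyI[of 1])
    fix n :: nat assume n: "1 \<le> n"
    have "n * j < (n * j div J + 1) * J" using assms dividend_less_div_times[of J "n * j"] by simp
    then have "real n * real j < (real (n * j div J) + 1) * real J"
      by (metis of_nat_1 of_nat_add of_nat_less_iff of_nat_mult)
    then have "real n * real j / real J \<le> real (n * j div J) + 1"
      using assms by (simp add: pos_divide_le_eq)
    then have "(real n * real j / real J - 1) / real n \<le> real (n * j div J) / real n"
      using n by (intro divide_right_mono) auto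
    then show "real j / real J - 1 / real n \<le> real (n * j div J) / real n"
      using n by (simp add: diff_divide_distrib)
  qed
  show "eventually (\<lambda>n. real (n * j div J) / real n \<le> real j / real J) sequentially"
  proof (rule eventually_sequentiallyI[of 1])
    fix n :: nat assume n: "1 \<le> n"
    have "real (n * j div J) \<le> real (n * j) / real J" by (rule of_nat_div_le_of_nat)
    then have "real (n * j div J) / real n \<le> real (n * j) / real J / real n" by (intro divide_right_mono) auto
    then show "real (n * j div J) / real n \<le> real j / real J" using n by simp
  qed
  have "(\<lambda>n. real j / real J - 1 / real n) \<longlonglongrightarrow> real j / real J - 0"
    by (intro tendsto_diff tendsto_const real_tendsto_divide_at_top[OF tendsto_const filterlim_real_sequentially])
  then show "(\<lambda>n. real j / real J - 1 / real n) \<longlonglongrightarrow> real j / real J" by simp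
qed simp

lemma grid_le:
  fixes n j J :: nat
  assumes "j \<le> J"
  shows "n * j div J \<le> n"
proof -
  have "n * j div J \<le> n * J div J" using assms by (intro div_le_mono mult_le_mono2)
  also have "\<dots> \<le> n" by (cases "J = 0") simp_all
  finally show ?thesis .
qed

context iid_L2
begin

lemma walk_process: "L2_process P \<mu> (walk m) \<sigma> (real m)"
proof -
  let ?K = "(\<lambda>k. int k + 1) ` {..<m}"
  have 1: "(\<lambda>\<omega> s. \<Sum>k\<in>?K. 1 * \<epsilon> k \<omega> s) = walk m"
    by (subst sum.reindex) (auto simp: inj_on_def walk_def fun_eq_iff)
  have 2: "(\<Sum>k\<in>?K. (1::real)\<^sup>2) = real m"
    by (simp add: card_image inj_on_def)
  have "L2_process P \<mu> (\<lambda>\<omega> s. \<Sum>k\<in>?K. 1 * \<epsilon> k \<omega> s) \<sigma> (\<Sum>k\<in>?K. (1::real)\<^sup>2)"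
    by (rule L2_process_sum) simp
  then show ?thesis unfolding 1 2 .
qed

text \<open>The variance of the combination with coefficients \<open>a\<close> of the values of the
  Wiener process at times \<open>j / J\<close> and points of \<open>A j\<close>.\<close>

definition fdd_var :: "nat \<Rightarrow> (nat \<Rightarrow> 's set) \<Rightarrow> (nat \<Rightarrow> 's \<Rightarrow> real) \<Rightarrow> real" where
  "fdd_var J A a = (\<Sum>j\<le>J. \<Sum>j'\<le>J. min (real j / real J) (real j' / real J) *
     (\<Sum>s\<in>A j. \<Sum>r\<in>A j'. a j s * a j' r * \<sigma> s r))"

text \<open>Values of the walk at several times share innovations, so the combination is regrouped
  by innovation: the one with index \<open>k\<close> enters through \<open>\<Lambda> j\<close> for
  those \<open>j\<close> whose time lies beyond \<open>k\<close>. The regrouped summands are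
  independent and dominated by \<open>g k\<close>, whose law does not depend on
  \<open>k\<close>.\<close>

lemma walk_points_conv:
  assumes A: "\<And>j. finite (A j)" "\<And>j. A j \<subseteq> space \<mu>" and J: "1 \<le> J"
  shows "(\<lambda>n. \<integral>\<omega>. cos ((\<Sum>j\<le>J. (\<Sum>s\<in>A j. a j s * walk (n * j div J) \<omega> s) / sqrt (real n)) + c) \<partial>P)
    \<longlonglongrightarrow> cos c * exp (- fdd_var J A a / 2)"
proof -
  have As: "s \<in> space \<mu>" if "s \<in> A j" for s j using A(2) that by blast
  define \<Lambda> where "\<Lambda> j z = (\<Sum>s\<in>A j. a j s * z s)" for j and z :: "'s \<Rightarrow> real"
  define m where "m n j = n * j div J" for n j
  define Y where "Y n k \<omega> = (\<Sum>j\<le>J. if k < m n j then \<Lambda> j (\<epsilon> (int k + 1) \<omega>) else 0)" for n k :: nat and \<omega>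
  define g where "g k \<omega> = (\<Sum>j\<le>J. \<bar>\<Lambda> j (\<epsilon> (int k + 1) \<omega>)\<bar>)" for k :: nat and \<omega>
  define q where "q j j' = (\<Sum>s\<in>A j. \<Sum>r\<in>A j'. a j s * a j' r * \<sigma> s r)" for j j'
  have \<Lambda>m [measurable]: "\<Lambda> j \<in> borel_measurable (Pi\<^sub>M (space \<mu>) (\<lambda>_. borel))" for j
    unfolding \<Lambda>_def by (intro borel_measurable_sum borel_measurable_times borel_measurable_const measurable_component_singleton As)
  have \<Lambda>r: "\<Lambda> j (restrict z (space \<mu>)) = \<Lambda> j z" for j z
    unfolding \<Lambda>_def using As by (intro sum.cong) auto
  have \<Lambda>\<epsilon>m [measurable]: "(\<lambda>\<omega>. \<Lambda> j (\<epsilon> k \<omega>)) \<in> borel_measurable P" for j k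
    unfolding \<Lambda>_def using As by (intro borel_measurable_sum borel_measurable_times borel_measurable_const \<epsilon>_meas_fst)
  have \<Lambda>int: "integrable P (\<lambda>\<omega>. \<Lambda> j (\<epsilon> k \<omega>))" for j k
    unfolding \<Lambda>_def using \<epsilon>_int As by (intro Bochner_Integration.integrable_sum integrable_mult_right) auto
  have \<Lambda>mean: "(\<integral>\<omega>. \<Lambda> j (\<epsilon> k \<omega>) \<partial>P) = 0" for j k
    unfolding \<Lambda>_def using \<epsilon>_int As \<epsilon>_mean by (subst Bochner_Integration.integral_sum) auto
  have \<Lambda>\<Lambda>: "\<Lambda> j z * \<Lambda> j' z = (\<Sum>s\<in>A j. \<Sum>r\<in>A j'. a j s * a j' r * (z s * z r))" for j j' z
    unfolding \<Lambda>_def sum_product by (intro sum.cong) auto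
  have \<Lambda>\<Lambda>int: "integrable P (\<lambda>\<omega>. \<Lambda> j (\<epsilon> k \<omega>) * \<Lambda> j' (\<epsilon> k \<omega>))" for j j' k
    unfolding \<Lambda>\<Lambda> using As \<epsilon>_prod_int by (intro Bochner_Integration.integrable_sum integrable_mult_right) auto
  have \<Lambda>\<Lambda>E: "(\<integral>\<omega>. \<Lambda> j (\<epsilon> k \<omega>) * \<Lambda> j' (\<epsilon> k \<omega>) \<partial>P) = q j j'" for j j' k
  proof -
    have "(\<integral>\<omega>. \<Lambda> j (\<epsilon> k \<omega>) * \<Lambda> j' (\<epsilon> k \<omega>) \<partial>P) =
        (\<Sum>s\<in>A j. \<integral>\<omega>. (\<Sum>r\<in>A j'. a j s * a j' r * (\<epsilon> k \<omega> s * \<epsilon> k \<omega> r)) \<partial>P)"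
      unfolding \<Lambda>\<Lambda> using As \<epsilon>_prod_int
      by (intro Bochner_Integration.integral_sum Bochner_Integration.integrable_sum integrable_mult_right) auto
    also have "\<dots> = (\<Sum>s\<in>A j. \<Sum>r\<in>A j'. \<integral>\<omega>. a j s * a j' r * (\<epsilon> k \<omega> s * \<epsilon> k \<omega> r) \<partial>P)"
      using As \<epsilon>_prod_int by (intro sum.cong refl Bochner_Integration.integral_sum integrable_mult_right) auto
    also have "\<dots> = q j j'"
      unfolding q_def using As \<epsilon>_cov by (intro sum.cong refl) auto
    finally show ?thesis .
  qed
  have Ymeas [measurable]: "Y n k \<in> borel_measurable P" for n k
    unfolding Y_def by measurable
  have gmeas [measurable]: "g k \<in> borel_measurable P" for k
    unfolding g_def by measurable
  have "(\<lambda>n. \<integral>\<omega>. cos ((\<Sum>k<n. Y n k \<omega>) / sqrt (real n) + c) \<partial>P) \<longlonglongrightarrow> cos c * exp (- fdd_var J A a / 2)"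
  proof (rule dominated_Lindeberg[where g = g])
    fix n
    \<comment> \<open>Independence is stated over integer indices; at the innovation
      \<open>i = int k + 1\<close> the number \<open>nat (i - 1)\<close> is
      \<open>k\<close>.\<close>
    have "indep_vars (\<lambda>_. borel) (\<lambda>i \<omega>. (\<Sum>j\<le>J. if nat (i - 1) < m n j then \<Lambda> j (restrict (\<epsilon> i \<omega>) (space \<mu>)) else 0)) UNIV"
      by (rule indep_fun[of "\<lambda>i z. \<Sum>j\<le>J. if nat (i - 1) < m n j then \<Lambda> j z else 0"]) measurable
    then have "indep_vars (\<lambda>_. borel) (\<lambda>k \<omega>. (\<Sum>j\<le>J. if nat (int k + 1 - 1) < m n j then \<Lambda> j (restrict (\<epsilon> (int k + 1) \<omega>) (space \<mu>)) else 0)) UNIV"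
      by (rule indep_vars_inj) (auto simp: inj_on_def)
    then have "indep_vars (\<lambda>_. borel) (Y n) UNIV"
      unfolding Y_def[abs_def] \<Lambda>r by simp
    then show "indep_vars (\<lambda>_. borel) (Y n) {..<n}" by (rule indep_vars_subset) simp
  next
    fix n k :: nat
    show "(\<integral>\<omega>. Y n k \<omega> \<partial>P) = 0"
    proof -
      have "integrable P (\<lambda>\<omega>. if k < m n j then \<Lambda> j (\<epsilon> (int k + 1) \<omega>) else 0)"
        "(\<integral>\<omega>. (if k < m n j then \<Lambda> j (\<epsilon> (int k + 1) \<omega>) else 0) \<partial>P) = 0" for j
        using \<Lambda>int \<Lambda>mean by (cases "k < m n j"; simp)+
      then show ?thesis unfolding Y_def by (subst Bochner_Integration.integral_sum) auto
    qed
    show "\<bar>Y n k \<omega>\<bar> \<le> g k \<omega>" for \<omega>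
      unfolding Y_def g_def by (rule order_trans[OF sum_abs]) (auto intro!: sum_mono)
  next
    fix k :: nat
    have H: "(\<lambda>z. \<Sum>j\<le>J. \<bar>\<Lambda> j z\<bar>) \<in> borel_measurable (Pi\<^sub>M (space \<mu>) (\<lambda>_. borel))" by measurable
    show "distr P borel (g k) = distr P borel (g 0)"
      using distr_fun[OF H, of "int k + 1"] distr_fun[OF H, of "int 0 + 1"] unfolding g_def[abs_def] \<Lambda>r by metis
  next
    have "(g 0 \<omega>)\<^sup>2 = (\<Sum>j\<le>J. \<Sum>j'\<le>J. \<bar>\<Lambda> j (\<epsilon> (int 0 + 1) \<omega>) * \<Lambda> j' (\<epsilon> (int 0 + 1) \<omega>)\<bar>)" for \<omega>
      unfolding g_def power2_eq_square sum_product abs_mult ..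
    then show "integrable P (\<lambda>\<omega>. (g 0 \<omega>)\<^sup>2)"
      using \<Lambda>\<Lambda>int by (simp only:) (intro Bochner_Integration.integrable_sum integrable_abs)
  next
    have EY: "(\<integral>\<omega>. (Y n k \<omega>)\<^sup>2 \<partial>P) = (\<Sum>j\<le>J. \<Sum>j'\<le>J. (if k < m n j \<and> k < m n j' then 1 else 0) * q j j')" for n k
    proof -
      have "(Y n k \<omega>)\<^sup>2 = (\<Sum>j\<le>J. \<Sum>j'\<le>J. (if k < m n j \<and> k < m n j' then 1 else 0) *
          (\<Lambda> j (\<epsilon> (int k + 1) \<omega>) * \<Lambda> j' (\<epsilon> (int k + 1) \<omega>)))" for \<omega>
        unfolding Y_def power2_eq_square sum_product by (intro sum.cong) auto
      then have "(\<integral>\<omega>. (Y n k \<omega>)\<^sup>2 \<partial>P) = (\<integral>\<omega>. (\<Sum>j\<le>J. \<Sum>j'\<le>J. (if k < m n j \<and> k < m n j' then 1 else 0) *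
          (\<Lambda> j (\<epsilon> (int k + 1) \<omega>) * \<Lambda> j' (\<epsilon> (int k + 1) \<omega>))) \<partial>P)" by simp
      also have "\<dots> = (\<Sum>j\<le>J. \<integral>\<omega>. (\<Sum>j'\<le>J. (if k < m n j \<and> k < m n j' then 1 else 0) *
          (\<Lambda> j (\<epsilon> (int k + 1) \<omega>) * \<Lambda> j' (\<epsilon> (int k + 1) \<omega>))) \<partial>P)"
        using \<Lambda>\<Lambda>int by (intro Bochner_Integration.integral_sum Bochner_Integration.integrable_sum integrable_mult_right)
      also have "\<dots> = (\<Sum>j\<le>J. \<Sum>j'\<le>J. \<integral>\<omega>. (if k < m n j \<and> k < m n j' then 1 else 0) *
          (\<Lambda> j (\<epsilon> (int k + 1) \<omega>) * \<Lambda> j' (\<epsilon> (int k + 1) \<omega>)) \<partial>P)"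
        using \<Lambda>\<Lambda>int by (intro sum.cong refl Bochner_Integration.integral_sum integrable_mult_right)
      also have "\<dots> = (\<Sum>j\<le>J. \<Sum>j'\<le>J. (if k < m n j \<and> k < m n j' then 1 else 0) * q j j')"
        by (simp only: integral_mult_right_zero \<Lambda>\<Lambda>E)
      finally show ?thesis .
    qed
    have sumY: "(\<Sum>k<n. \<integral>\<omega>. (Y n k \<omega>)\<^sup>2 \<partial>P) / real n =
        (\<Sum>j\<le>J. \<Sum>j'\<le>J. min (real (m n j) / real n) (real (m n j') / real n) * q j j')" for n
    proof -
      \<comment> \<open>The number of innovations common to two times; divided by \<open>n\<close>
        it becomes the minimum of the times, which is the covariance in time of the Wiener
        process.\<close>
      have cnt: "(\<Sum>k<n. (if k < m n j \<and> k < m n j' then 1 else 0)) = real (min (m n j) (m n j'))" if "j \<le> J" "j' \<le> J" for j j'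
      proof -
        have "{k \<in> {..<n}. k < m n j \<and> k < m n j'} = {..<min (m n j) (m n j')}"
          using grid_le[OF that(1), of n] by (auto simp: m_def)
        then show ?thesis by (simp add: sum.If_cases Int_def)
      qed
      have "(\<Sum>k<n. \<integral>\<omega>. (Y n k \<omega>)\<^sup>2 \<partial>P) = (\<Sum>j\<le>J. \<Sum>j'\<le>J. (\<Sum>k<n. (if k < m n j \<and> k < m n j' then 1 else 0)) * q j j')"
        unfolding EY by (simp add: sum.swap[of _ "{..<n}"] sum_distrib_right)
      also have "\<dots> = (\<Sum>j\<le>J. \<Sum>j'\<le>J. real (min (m n j) (m n j')) * q j j')"
        using cnt by (intro sum.cong refl) auto
      finally have "(\<Sum>k<n. \<integral>\<omega>. (Y n k \<omega>)\<^sup>2 \<partial>P) = (\<Sum>j\<le>J. \<Sum>j'\<le>J. real (min (m n j) (m n j')) * q j j')" .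
      moreover have "min (real (m n j) / real n) (real (m n j') / real n) = real (min (m n j) (m n j')) / real n" for j j'
        by (simp add: min_divide_distrib_right of_nat_min)
      ultimately show ?thesis by (simp add: sum_divide_distrib)
    qed
    show "(\<lambda>n. (\<Sum>k<n. \<integral>\<omega>. (Y n k \<omega>)\<^sup>2 \<partial>P) / real n) \<longlonglongrightarrow> fdd_var J A a"
      unfolding sumY fdd_var_def q_def[symmetric] m_def
      by (intro tendsto_sum tendsto_mult tendsto_min tendsto_const grid_tendsto J)
  qed (use Ymeas gmeas in auto)
  moreover have "(\<Sum>k<n. Y n k \<omega>) / sqrt (real n) = (\<Sum>j\<le>J. (\<Sum>s\<in>A j. a j s * walk (n * j div J) \<omega> s) / sqrt (real n))" for n \<omega>
  proof -
    have "(\<Sum>k<n. Y n k \<omega>) = (\<Sum>j\<le>J. \<Sum>k<n. if k < m n j then \<Lambda> j (\<epsilon> (int k + 1) \<omega>) else 0)"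
      unfolding Y_def by (rule sum.swap)
    also have "\<dots> = (\<Sum>j\<le>J. \<Sum>s\<in>A j. a j s * walk (n * j div J) \<omega> s)"
    proof (rule sum.cong[OF refl])
      fix j assume j: "j \<in> {..J}"
      have "(\<Sum>k<n. if k < m n j then \<Lambda> j (\<epsilon> (int k + 1) \<omega>) else 0) = (\<Sum>k<m n j. \<Lambda> j (\<epsilon> (int k + 1) \<omega>))"
        using grid_le[of j J n] j by (intro sum.mono_neutral_cong_right) (auto simp: m_def)
      also have "\<dots> = (\<Sum>s\<in>A j. a j s * walk (n * j div J) \<omega> s)"
        unfolding \<Lambda>_def walk_def m_def sum_distrib_left by (rule sum.swap)
      finally show "(\<Sum>k<n. if k < m n j then \<Lambda> j (\<epsilon> (int k + 1) \<omega>) else 0) = (\<Sum>s\<in>A j. a j s * walk (n * j div J) \<omega> s)" .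
    qed
    finally show ?thesis by (simp add: sum_divide_distrib)
  qed
  ultimately show ?thesis by simp
qed

lemma gaussian_points_cos:
  assumes Q: "prob_space Q"
    and G: "centered_gaussian_process Q (space \<mu> \<times> {0..1}) (\<lambda>(r, t) (s, u). \<sigma> r s * min t u) g"
    and A: "\<And>j. finite (A j)" "\<And>j. A j \<subseteq> space \<mu>" and J: "1 \<le> J"
  shows "(\<integral>v. cos ((\<Sum>j\<le>J. \<Sum>s\<in>A j. a j s * g v (s, real j / real J)) + c) \<partial>Q) = cos c * exp (- fdd_var J A a / 2)"
proof -
  interpret Q: prob_space Q by (rule Q)
  have gp: "gaussian_process Q (space \<mu> \<times> {0..1}) g"
    and mean: "\<And>i. i \<in> space \<mu> \<times> {0..1} \<Longrightarrow> (\<integral>v. g v i \<partial>Q) = 0"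
    and cov: "\<And>r t s u. (r, t) \<in> space \<mu> \<times> {0..1} \<Longrightarrow> (s, u) \<in> space \<mu> \<times> {0..1} \<Longrightarrow>
        (\<integral>v. g v (r, t) * g v (s, u) \<partial>Q) = \<sigma> r s * min t u"
    using G by (auto simp: centered_gaussian_process_def)
  have g1: "gaussian_rv Q (\<lambda>v. g v i)" if "i \<in> space \<mu> \<times> {0..1}" for i
    using gp[unfolded gaussian_process_def, rule_format, of "{i}" "\<lambda>_. 1"] that by simp
  have gm: "(\<lambda>v. g v i) \<in> borel_measurable Q" if "i \<in> space \<mu> \<times> {0..1}" for i
    using g1[OF that] by (simp add: gaussian_rv_def)
  have gsq: "integrable Q (\<lambda>v. (g v i)\<^sup>2)" if "i \<in> space \<mu> \<times> {0..1}" for i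
    by (rule Q.gaussian_rv_sq_integrable[OF g1[OF that] mean[OF that]])
  have gi: "integrable Q (\<lambda>v. g v i)" if "i \<in> space \<mu> \<times> {0..1}" for i
    by (rule Q.integrable_L2[OF gm[OF that] gsq[OF that]])
  have gg: "integrable Q (\<lambda>v. g v i * g v i')" if "i \<in> space \<mu> \<times> {0..1}" "i' \<in> space \<mu> \<times> {0..1}" for i i'
    using that by (intro integrable_mult_L2 gm gsq)
  define X where "X = Sigma {..J} A"
  define \<phi> where "\<phi> = (\<lambda>(j::nat, s::'s). (s, real j / real J))"
  define b where "b = (\<lambda>(j, s). a j s)"
  have fX: "finite X" using A(1) by (auto simp: X_def)
  have \<phi>X: "\<phi> x \<in> space \<mu> \<times> {0..1}" if "x \<in> X" for x
    using that A(2) J by (auto simp: X_def \<phi>_def divide_le_eq)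
  \<comment> \<open>A Gaussian process is tested on sets of indices, so the pairs
    \<open>(j, s)\<close> must give distinct points \<open>(s, j / J)\<close>; this uses that
    \<open>J\<close> is not 0.\<close>
  have inj: "inj_on \<phi> X" using J by (auto simp: inj_on_def \<phi>_def X_def)
  define T where "T v = (\<Sum>x\<in>X. b x * g v (\<phi> x))" for v
  have T_eq: "(\<Sum>j\<le>J. \<Sum>s\<in>A j. a j s * g v (s, real j / real J)) = T v" for v
    unfolding T_def X_def b_def \<phi>_def using A(1) by (simp add: sum.Sigma case_prod_beta')
  have "T = (\<lambda>v. \<Sum>i\<in>\<phi> ` X. b (inv_into X \<phi> i) * g v i)"
    unfolding T_def by (rule ext) (simp add: sum.reindex[OF inj] inj)
  then have GT: "gaussian_rv Q T"
    using gp[unfolded gaussian_process_def, rule_format, of "\<phi> ` X" "\<lambda>i. b (inv_into X \<phi> i)"] fX image_subsetI[of X \<phi>, OF \<phi>X]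
    by simp
  have ET: "(\<integral>v. T v \<partial>Q) = 0"
    unfolding T_def using gi \<phi>X mean by (subst Bochner_Integration.integral_sum) auto
  have "(T v)\<^sup>2 = (\<Sum>x\<in>X. \<Sum>y\<in>X. b x * b y * (g v (\<phi> x) * g v (\<phi> y)))" for v
    unfolding T_def power2_eq_square sum_product by (intro sum.cong) auto
  then have "(\<integral>v. (T v)\<^sup>2 \<partial>Q) = (\<integral>v. (\<Sum>x\<in>X. \<Sum>y\<in>X. b x * b y * (g v (\<phi> x) * g v (\<phi> y))) \<partial>Q)" by simp
  also have "\<dots> = (\<Sum>x\<in>X. \<integral>v. (\<Sum>y\<in>X. b x * b y * (g v (\<phi> x) * g v (\<phi> y))) \<partial>Q)"
    using gg \<phi>X by (intro Bochner_Integration.integral_sum Bochner_Integration.integrable_sum integrable_mult_right) auto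
  also have "\<dots> = (\<Sum>x\<in>X. \<Sum>y\<in>X. \<integral>v. b x * b y * (g v (\<phi> x) * g v (\<phi> y)) \<partial>Q)"
    using gg \<phi>X by (intro sum.cong refl Bochner_Integration.integral_sum integrable_mult_right) auto
  also have "\<dots> = (\<Sum>x\<in>X. \<Sum>y\<in>X. b x * b y * (\<sigma> (snd x) (snd y) * min (real (fst x) / real J) (real (fst y) / real J)))"
  proof (intro sum.cong refl)
    fix x y assume xy: "x \<in> X" "y \<in> X"
    have "(\<integral>v. g v (\<phi> x) * g v (\<phi> y) \<partial>Q) = \<sigma> (snd x) (snd y) * min (real (fst x) / real J) (real (fst y) / real J)"
      using cov[of "snd x" "real (fst x) / real J" "snd y" "real (fst y) / real J"] \<phi>X[OF xy(1)] \<phi>X[OF xy(2)]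
      by (simp add: \<phi>_def case_prod_beta')
    then show "(\<integral>v. b x * b y * (g v (\<phi> x) * g v (\<phi> y)) \<partial>Q) =
        b x * b y * (\<sigma> (snd x) (snd y) * min (real (fst x) / real J) (real (fst y) / real J))" by simp
  qed
  also have "\<dots> = (\<Sum>j\<le>J. \<Sum>s\<in>A j. \<Sum>j'\<le>J. \<Sum>r\<in>A j'. a j s * a j' r * (\<sigma> s r * min (real j / real J) (real j' / real J)))"
  proof -
    have "(\<Sum>x\<in>X. F x) = (\<Sum>j\<le>J. \<Sum>s\<in>A j. F (j, s))" for F :: "nat \<times> 's \<Rightarrow> real"
      unfolding X_def using A(1) by (simp add: sum.Sigma)
    then show ?thesis by (simp add: b_def)
  qed
  also have "\<dots> = fdd_var J A a"
    unfolding fdd_var_def sum_distrib_left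
    by (rule sum.cong[OF refl], subst sum.swap, intro sum.cong refl) (simp add: mult_ac)
  finally have "(\<integral>v. (T v)\<^sup>2 \<partial>Q) = fdd_var J A a" .
  from Q.integral_cos_gaussian[OF GT ET this] show ?thesis unfolding T_eq .
qed

lemma gaussian_process_L2:
  assumes Q: "prob_space Q"
    and G: "centered_gaussian_process Q (space \<mu> \<times> {0..1}) (\<lambda>(r, t) (s, u). \<sigma> r s * min t u) g"
    and m: "(\<lambda>(v, s). g v (s, t)) \<in> borel_measurable (Q \<Otimes>\<^sub>M \<mu>)" and t: "t \<in> {0..1}"
  shows "L2_process Q \<mu> (\<lambda>v s. g v (s, t)) \<sigma> t"
proof -
  interpret Q: prob_space Q by (rule Q)
  interpret Q\<mu>: pair_sigma_finite Q \<mu> ..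
  have gp: "gaussian_process Q (space \<mu> \<times> {0..1}) g"
    and cov: "\<And>r t s u. (r, t) \<in> space \<mu> \<times> {0..1} \<Longrightarrow> (s, u) \<in> space \<mu> \<times> {0..1} \<Longrightarrow>
        (\<integral>v. g v (r, t) * g v (s, u) \<partial>Q) = \<sigma> r s * min t u"
    using G by (auto simp: centered_gaussian_process_def)
  show ?thesis
  proof unfold_locales
    show "integrable Q (\<lambda>v. (g v (s, t))\<^sup>2)" if "s \<in> space \<mu>" for s
    proof (rule Q.gaussian_rv_sq_integrable)
      show "gaussian_rv Q (\<lambda>v. g v (s, t))"
        using gp[unfolded gaussian_process_def, rule_format, of "{(s, t)}" "\<lambda>_. 1"] that t by simp
      show "(\<integral>v. g v (s, t) \<partial>Q) = 0" using G that t by (auto simp: centered_gaussian_process_def)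
    qed
    show "(\<integral>v. g v (r, t) * g v (s, t) \<partial>Q) = t * \<sigma> r s" if "r \<in> space \<mu>" "s \<in> space \<mu>" for r s
      using cov[of r t s t] that t by (simp add: mult.commute)
  qed (use m \<sigma>_integrable in \<open>auto simp: case_prod_beta'\<close>)
qed

text \<open>On both sides the integrals are replaced by the same combinations of point values. The
  squared error carries the factor \<open>(n * j div J) / n\<close> for the walk and
  \<open>j / J\<close> for the Wiener process, both at most 1, so the choice of points does not
  depend on \<open>n\<close>. For point values the limit is already known.\<close>

lemma inner_fdd_conv:
  assumes Q: "prob_space Q"
    and G: "centered_gaussian_process Q (space \<mu> \<times> {0..1}) (\<lambda>(r, t) (s, u). \<sigma> r s * min t u) g"
    and m: "\<And>t. t \<in> {0..1} \<Longrightarrow> (\<lambda>(v, s). g v (s, t)) \<in> borel_measurable (Q \<Otimes>\<^sub>M \<mu>)"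
    and h: "\<And>j. h j \<in> L2_funs \<mu>" and J: "1 \<le> J"
  shows "(\<lambda>n. \<integral>\<omega>. cos ((\<Sum>j\<le>J. L2_inner \<mu> (walk (n * j div J) \<omega>) (h j) / sqrt (real n)) + c) \<partial>P) \<longlonglongrightarrow>
    (\<integral>v. cos ((\<Sum>j\<le>J. L2_inner \<mu> (\<lambda>s. g v (s, real j / real J)) (h j)) + c) \<partial>Q)"
proof (rule LIMSEQ_I)
  fix r :: real assume r: "0 < r"
  interpret Q: prob_space Q by (rule Q)
  interpret \<epsilon>0: L2_process P \<mu> "\<epsilon> 0" \<sigma> 1 by (rule L2_process_\<epsilon>)
  have hm [measurable]: "h j \<in> borel_measurable \<mu>" for j using h[of j] by (simp add: L2_funs_def)
  \<comment> \<open>There are \<open>J + 1\<close> nodes, each allowed an error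
    \<open>\<delta>\<close>; together they cost \<open>r / 4\<close> on either side.\<close>
  define \<delta> where "\<delta> = r / (4 * (real J + 1))"
  have \<delta>: "0 < \<delta>" using r by (simp add: \<delta>_def)
  have "\<exists>A a. finite A \<and> A \<subseteq> space \<mu> \<and> kernel_gap \<mu> \<sigma> (h j) A a < \<delta>\<^sup>2" for j
    using \<delta> by (intro \<epsilon>0.kernel_gap_small h) auto
  then obtain A a where A: "\<And>j. finite (A j)" "\<And>j. A j \<subseteq> space \<mu>"
    and gap: "\<And>j. kernel_gap \<mu> \<sigma> (h j) (A j) (a j) < \<delta>\<^sup>2" by metis
  have As: "s \<in> space \<mu>" if "s \<in> A j" for s j using A(2) that by blast
  have \<kappa>gap: "\<kappa> * kernel_gap \<mu> \<sigma> (h j) (A j) (a j) \<le> \<delta>\<^sup>2" if "0 \<le> \<kappa>" "\<kappa> \<le> 1" for \<kappa> j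
  proof -
    have "\<kappa> * kernel_gap \<mu> \<sigma> (h j) (A j) (a j) \<le> \<kappa> * \<delta>\<^sup>2" using gap[of j] that by (intro mult_left_mono) auto
    also have "\<dots> \<le> 1 * \<delta>\<^sup>2" using that by (intro mult_right_mono) auto
    finally show ?thesis by simp
  qed
  let ?I = "\<lambda>n j \<omega>. L2_inner \<mu> (walk (n * j div J) \<omega>) (h j) / sqrt (real n)"
  let ?L = "\<lambda>n j \<omega>. (\<Sum>s\<in>A j. a j s * walk (n * j div J) \<omega> s) / sqrt (real n)"
  let ?IG = "\<lambda>j v. L2_inner \<mu> (\<lambda>s. g v (s, real j / real J)) (h j)"
  let ?LG = "\<lambda>j v. \<Sum>s\<in>A j. a j s * g v (s, real j / real J)"
  have card: "real (card {..J}) * \<delta> = r / 4" by (simp add: \<delta>_def field_simps)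
  have 1: "\<bar>(\<integral>\<omega>. cos ((\<Sum>j\<le>J. ?I n j \<omega>) + c) \<partial>P) - (\<integral>\<omega>. cos ((\<Sum>j\<le>J. ?L n j \<omega>) + c) \<partial>P)\<bar> \<le> r / 4" for n
    unfolding card[symmetric]
  proof (rule cos_expectation_sum_diff)
    fix j assume j: "j \<in> {..J}"
    interpret W: L2_process P \<mu> "walk (n * j div J)" \<sigma> "real (n * j div J)" by (rule walk_process)
    note ge = W.gap_expectation[OF h[of j] A(1)[of j] A(2)[of j], of "a j"]
    show "?I n j \<in> borel_measurable P" using W.inner_measurable[OF hm, of j] by simp
    show "?L n j \<in> borel_measurable P"
      using As by (intro borel_measurable_divide borel_measurable_sum borel_measurable_times borel_measurable_const W.x_meas_fst)
    have eq: "(?I n j \<omega> - ?L n j \<omega>)\<^sup>2 = (1 / real n) * (L2_inner \<mu> (walk (n * j div J) \<omega>) (h j) - (\<Sum>s\<in>A j. a j s * walk (n * j div J) \<omega> s))\<^sup>2" for \<omega>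
      unfolding diff_divide_distrib[symmetric] power_divide by simp
    show "integrable P (\<lambda>\<omega>. (?I n j \<omega> - ?L n j \<omega>)\<^sup>2)"
      unfolding eq by (rule integrable_mult_right[OF ge(1)])
    have "(\<integral>\<omega>. (?I n j \<omega> - ?L n j \<omega>)\<^sup>2 \<partial>P) = (1 / real n) * (real (n * j div J) * kernel_gap \<mu> \<sigma> (h j) (A j) (a j))"
      unfolding eq integral_mult_right_zero ge(2) ..
    also have "\<dots> = (real (n * j div J) / real n) * kernel_gap \<mu> \<sigma> (h j) (A j) (a j)" by simp
    also have "\<dots> \<le> \<delta>\<^sup>2"
      using grid_le[of j J n] j by (intro \<kappa>gap) (auto simp: divide_le_eq)
    finally show "(\<integral>\<omega>. (?I n j \<omega> - ?L n j \<omega>)\<^sup>2 \<partial>P) \<le> \<delta>\<^sup>2" .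
  qed (use \<delta> in simp)
  have 2: "\<bar>(\<integral>v. cos ((\<Sum>j\<le>J. ?IG j v) + c) \<partial>Q) - (\<integral>v. cos ((\<Sum>j\<le>J. ?LG j v) + c) \<partial>Q)\<bar> \<le> r / 4"
    unfolding card[symmetric]
  proof (rule Q.cos_expectation_sum_diff)
    fix j assume j: "j \<in> {..J}"
    have t: "real j / real J \<in> {0..1}" using j J by (auto simp: divide_le_eq)
    interpret W: L2_process Q \<mu> "\<lambda>v s. g v (s, real j / real J)" \<sigma> "real j / real J"
      by (rule gaussian_process_L2[OF Q G m[OF t] t])
    note ge = W.gap_expectation[OF h[of j] A(1)[of j] A(2)[of j], of "a j"]
    show "?IG j \<in> borel_measurable Q" using W.inner_measurable[OF hm, of j] by simp
    show "?LG j \<in> borel_measurable Q"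
      using As by (intro borel_measurable_sum borel_measurable_times borel_measurable_const W.x_meas_fst)
    show "integrable Q (\<lambda>v. (?IG j v - ?LG j v)\<^sup>2)" by (rule ge(1))
    show "(\<integral>v. (?IG j v - ?LG j v)\<^sup>2 \<partial>Q) \<le> \<delta>\<^sup>2"
      unfolding ge(2) using t by (intro \<kappa>gap) auto
  qed (use \<delta> in simp)
  obtain N where N: "\<And>n. n \<ge> N \<Longrightarrow> \<bar>(\<integral>\<omega>. cos ((\<Sum>j\<le>J. ?L n j \<omega>) + c) \<partial>P) - (\<integral>v. cos ((\<Sum>j\<le>J. ?LG j v) + c) \<partial>Q)\<bar> < r / 4"
    using LIMSEQ_D[OF walk_points_conv[where A=A and J=J and a=a and c=c, OF A J], of "r / 4"] r
    unfolding gaussian_points_cos[where A=A and J=J and a=a and c=c, OF Q G A J] by auto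
  have "norm ((\<integral>\<omega>. cos ((\<Sum>j\<le>J. ?I n j \<omega>) + c) \<partial>P) - (\<integral>v. cos ((\<Sum>j\<le>J. ?IG j v) + c) \<partial>Q)) < r" if "n \<ge> N" for n
    using 1[of n] 2 N[OF that] r unfolding real_norm_def by linarith
  then show "\<exists>no. \<forall>n\<ge>no. norm ((\<integral>\<omega>. cos ((\<Sum>j\<le>J. ?I n j \<omega>) + c) \<partial>P) - (\<integral>v. cos ((\<Sum>j\<le>J. ?IG j v) + c) \<partial>Q)) < r"
    by blast
qed

end

section \<open>Approximation by finitely many coordinates\<close>

lemma coord_polygon_measurable:
  assumes e: "\<And>i. e i \<in> L2_funs \<mu>"
  shows "coord_polygon \<mu> e J N \<in> borel \<rightarrow>\<^sub>M mborel (C01_L2 \<mu>)"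
  using coord_polygon_continuous[of e \<mu> _ J N, OF e]
  by (intro measurable_mborelI coord_polygon_in_C01 e) auto

text \<open>The difference \<open>harm n - ln n\<close> converges, to Euler's constant, while
  \<open>ln n\<close> diverges.\<close>

lemma harm_div_ln_tendsto: "(\<lambda>n. harm n / ln (real n)) \<longlonglongrightarrow> (1::real)"
proof -
  have l: "filterlim (\<lambda>n. ln (real n)) at_top sequentially"
    by (rule filterlim_compose[OF ln_at_top filterlim_real_sequentially])
  have "(\<lambda>n. (harm n - ln (real n)) / ln (real n)) \<longlonglongrightarrow> (0::real)"
    by (rule real_tendsto_divide_at_top[OF _ l]) (use euler_mascheroni_LIMSEQ in simp)
  then have "(\<lambda>n. (harm n - ln (real n)) / ln (real n) + 1) \<longlonglongrightarrow> (0::real) + 1"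
    by (intro tendsto_intros)
  moreover have "eventually (\<lambda>n. (harm n - ln (real n)) / ln (real n) + 1 = harm n / ln (real n)) sequentially"
    using eventually_gt_at_top[of 1] by eventually_elim (simp add: diff_divide_distrib)
  ultimately show ?thesis using tendsto_cong by fastforce
qed

lemma L2_class_cong:
  assumes "\<And>s. s \<in> space \<mu> \<Longrightarrow> f s = f' s"
  shows "L2_class \<mu> f = L2_class \<mu> f'"
proof -
  have "(AE s in \<mu>. g s = f s) \<longleftrightarrow> (AE s in \<mu>. g s = f' s)" for g
    using assms by (intro AE_cong) simp
  then show ?thesis by (simp add: L2_class_def)
qed

context iid_L2
begin

text \<open>The trace of the covariance operator is the sum of its diagonal in the basis. It is read
  off from one innovation, whose residual norm is dominated by its norm.\<close>

lemma proj_gap_tendsto: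
  assumes e: "orthonormal_or_zero \<mu> e"
    and lim: "\<And>h. h \<in> L2_funs \<mu> \<Longrightarrow> (\<lambda>N. L2_norm \<mu> (\<lambda>s. h s - L2_proj \<mu> e N h s)) \<longlonglongrightarrow> 0"
  shows "(\<lambda>N. total_var - (\<Sum>i<N. quad_kernel \<mu> \<sigma> (e i))) \<longlonglongrightarrow> 0"
proof -
  interpret E: L2_process P \<mu> "\<epsilon> 0" \<sigma> 1 by (rule L2_process_\<epsilon>)
  have "(\<lambda>N. \<integral>\<omega>. (L2_norm \<mu> (\<lambda>s. \<epsilon> 0 \<omega> s - L2_proj \<mu> e N (\<epsilon> 0 \<omega>) s))\<^sup>2 \<partial>P) \<longlonglongrightarrow> (\<integral>\<omega>. 0 \<partial>P)"
  proof (rule integral_dominated_convergence[where w = "\<lambda>\<omega>. (L2_norm \<mu> (\<epsilon> 0 \<omega>))\<^sup>2"])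
    show "AE \<omega> in P. (\<lambda>N. (L2_norm \<mu> (\<lambda>s. \<epsilon> 0 \<omega> s - L2_proj \<mu> e N (\<epsilon> 0 \<omega>) s))\<^sup>2) \<longlonglongrightarrow> 0"
      using E.AE_L2_funs
    proof eventually_elim
      case (elim \<omega>)
      show ?case using tendsto_power[OF lim[OF elim], of 2] by simp
    qed
    show "AE \<omega> in P. norm ((L2_norm \<mu> (\<lambda>s. \<epsilon> 0 \<omega> s - L2_proj \<mu> e N (\<epsilon> 0 \<omega>) s))\<^sup>2) \<le> (L2_norm \<mu> (\<epsilon> 0 \<omega>))\<^sup>2" for N
      using E.AE_L2_funs
    proof eventually_elim
      case (elim \<omega>)
      show ?case using power_mono[OF L2_proj_contraction[OF e elim, of N] L2_norm_nonneg, of 2] by simp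
    qed
    show "(\<lambda>\<omega>. (L2_norm \<mu> (\<lambda>s. \<epsilon> 0 \<omega> s - L2_proj \<mu> e N (\<epsilon> 0 \<omega>) s))\<^sup>2) \<in> borel_measurable P" for N
      using E.proj_residual(1)[OF e] by simp
  qed (use L2_sq in auto)
  then show ?thesis unfolding E.proj_residual(3)[OF e] by simp
qed

lemma AE_good:
  assumes n: "1 \<le> n"
  shows "AE \<omega> in P. \<omega> \<in> space P \<and> good_modulus n L \<omega> \<and> good_modulus n (2 * n) \<omega> \<and>
    (\<forall>k. AE s in \<mu>. summable (\<lambda>j. \<epsilon> (k - int j) \<omega> s / real (j + 1))) \<and> (\<forall>k. tail k n \<omega> \<in> L2_funs \<mu>)"
proof -
  have "AE \<omega> in P. \<forall>k. AE s in \<mu>. summable (\<lambda>j. \<epsilon> (k - int j) \<omega> s / real (j + 1))"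
    using AE_summable by (simp add: AE_all_countable)
  moreover have "AE \<omega> in P. \<forall>k. tail k n \<omega> \<in> L2_funs \<mu>"
    using tail_L2(1)[OF n] by (simp add: AE_all_countable)
  ultimately show ?thesis
    using AE_space modulus_crude(1)[of n L] modulus_crude(1)[of n "2 * n"] by eventually_elim blast
qed

lemma AE_partial_sum_L2: "AE \<omega> in P. \<forall>m\<le>n. partial_sum lin m \<omega> \<in> L2_funs \<mu>"
proof -
  \<comment> \<open>\<open>Suc n\<close> makes room for \<open>n = 0\<close>, where the estimates on
    the tails do not apply.\<close>
  have "1 \<le> Suc n" by simp
  from AE_good[OF this, of 1] show ?thesis
  proof eventually_elim
    case (elim \<omega>)
    then show ?case using partial_sum_node_bound(1)[of \<omega> "Suc n" 1] by simp
  qed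
qed

section \<open>The normalised polygon as a random element\<close>

definition scale :: "nat \<Rightarrow> real" where
  "scale n = inverse (sqrt (real n) * ln (real n))"

text \<open>The vertices of the normalised polygon, replaced by 0 on the null set where they are not
  square integrable.\<close>

definition vertex :: "nat \<Rightarrow> nat \<Rightarrow> 'w \<Rightarrow> 's \<Rightarrow> real" where
  "vertex n m \<omega> s = (if \<forall>m\<le>n. partial_sum lin m \<omega> \<in> L2_funs \<mu> then scale n * partial_sum lin m \<omega> s else 0)"

definition version :: "nat \<Rightarrow> 'w \<Rightarrow> real \<Rightarrow> ('s \<Rightarrow> real) set" where
  "version n \<omega> = L2_path \<mu> (polygon n (\<lambda>m. vertex n m \<omega>))"

lemma vertex_good: "\<forall>k\<le>n. partial_sum lin k \<omega> \<in> L2_funs \<mu> \<Longrightarrow> vertex n m \<omega> = (\<lambda>s. scale n * partial_sum lin m \<omega> s)"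
  by (simp add: vertex_def fun_eq_iff)

lemma vertex_bad: "\<not> (\<forall>k\<le>n. partial_sum lin k \<omega> \<in> L2_funs \<mu>) \<Longrightarrow> vertex n m \<omega> = (\<lambda>s. 0)"
  unfolding vertex_def fun_eq_iff by (subst if_not_P) auto

lemma vertex_L2: "m \<le> n \<Longrightarrow> vertex n m \<omega> \<in> L2_funs \<mu>"
  by (cases "\<forall>k\<le>n. partial_sum lin k \<omega> \<in> L2_funs \<mu>")
    (simp_all add: vertex_good vertex_bad L2_funs_zero L2_funs_cmult del: not_all)

lemma version_in_C01: "version n \<omega> \<in> mspace (C01_L2 \<mu>)"
  unfolding version_def by (rule polygon_in_C01[OF vertex_L2])

lemma partial_sum_meas [measurable]: "case_prod (partial_sum lin m) \<in> borel_measurable (P \<Otimes>\<^sub>M \<mu>)"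
  unfolding partial_sum_def lin_def by measurable

text \<open>Membership in \<open>L2_funs\<close> is rewritten as finiteness of a nonnegative
  integral, which is a measurable condition on \<open>\<omega>\<close>.\<close>

lemma vertex_inner_meas:
  assumes h: "h \<in> L2_funs \<mu>"
  shows "(\<lambda>\<omega>. L2_inner \<mu> (vertex n m \<omega>) h) \<in> borel_measurable P"
proof -
  have [measurable]: "h \<in> borel_measurable \<mu>" using h by (simp add: L2_funs_def)
  have iff: "partial_sum lin m \<omega> \<in> L2_funs \<mu> \<longleftrightarrow> (\<integral>\<^sup>+s. ennreal ((partial_sum lin m \<omega> s)\<^sup>2) \<partial>\<mu>) < \<infinity>"
    if \<omega>: "\<omega> \<in> space P" for \<omega> m
  proof -
    have "partial_sum lin m \<omega> \<in> borel_measurable \<mu>"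
      using measurable_compose[OF measurable_Pair1'[OF \<omega>, of \<mu>] partial_sum_meas] by simp
    then show ?thesis by (simp add: L2_funs_def integrable_iff_bounded)
  qed
  have "(\<lambda>\<omega>. if \<forall>m\<in>{..n}. (\<integral>\<^sup>+s. ennreal ((partial_sum lin m \<omega> s)\<^sup>2) \<partial>\<mu>) < \<infinity>
      then scale n * L2_inner \<mu> (partial_sum lin m \<omega>) h else 0) \<in> borel_measurable P"
    by measurable
  also have "?this \<longleftrightarrow> ?thesis"
  proof (rule measurable_cong)
    fix \<omega> assume \<omega>: "\<omega> \<in> space P"
    show "(if \<forall>m\<in>{..n}. (\<integral>\<^sup>+s. ennreal ((partial_sum lin m \<omega> s)\<^sup>2) \<partial>\<mu>) < \<infinity>
      then scale n * L2_inner \<mu> (partial_sum lin m \<omega>) h else 0) = L2_inner \<mu> (vertex n m \<omega>) h"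
      unfolding iff[OF \<omega>, symmetric]
      by (cases "\<forall>k\<le>n. partial_sum lin k \<omega> \<in> L2_funs \<mu>") (auto simp: vertex_good vertex_bad mult.assoc)
  qed
  finally show ?thesis .
qed

text \<open>Finitely many coordinates are random variables on which the polygon depends
  continuously, and \<open>version\<close> is the limit of such polygons as \<open>N\<close> grows.
  The limit is needed at every \<open>\<omega>\<close>, not just almost surely; this is why the
  vertices were set to 0 on the bad set.\<close>

lemma version_measurable:
  assumes sep: "separable_space (mtopology_of (L2 \<mu>))"
  shows "version n \<in> P \<rightarrow>\<^sub>M mborel (C01_L2 \<mu>)"
proof -
  obtain e where e: "orthonormal_or_zero \<mu> e"
    and lim: "\<And>h. h \<in> L2_funs \<mu> \<Longrightarrow> (\<lambda>N. L2_norm \<mu> (\<lambda>s. h s - L2_proj \<mu> e N h s)) \<longlonglongrightarrow> 0"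
    using L2_basis[OF sep] by metis
  have eL: "e i \<in> L2_funs \<mu>" for i using e by (simp add: orthonormal_or_zero_def)
  define c where "c \<omega> = (\<lambda>(m, i). L2_inner \<mu> (vertex n m \<omega>) (e i))" for \<omega>
  have [measurable]: "c \<in> borel_measurable P"
    by (rule measurable_coordinatewise_then_product) (use vertex_inner_meas[OF eL] in \<open>auto simp: c_def case_prod_beta'\<close>)
  show ?thesis
  proof (rule measurable_mborel_limit[where Y = "\<lambda>N \<omega>. coord_polygon \<mu> e n N (c \<omega>)"])
    show "(\<lambda>\<omega>. coord_polygon \<mu> e n N (c \<omega>)) \<in> P \<rightarrow>\<^sub>M mborel (C01_L2 \<mu>)" for N
      by (rule measurable_compose[OF _ coord_polygon_measurable[of e \<mu> n N, OF eL]]) measurable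
    show "(\<lambda>N. mdist (C01_L2 \<mu>) (coord_polygon \<mu> e n N (c \<omega>)) (version n \<omega>)) \<longlonglongrightarrow> 0" for \<omega>
    proof (rule tendsto_sandwich[OF always_eventually always_eventually tendsto_const])
      let ?b = "\<lambda>N. \<Sum>m\<le>n. L2_norm \<mu> (\<lambda>s. vertex n m \<omega> s - L2_proj \<mu> e N (vertex n m \<omega>) s)"
      have "?b \<longlonglongrightarrow> (\<Sum>m\<le>n. 0)" by (intro tendsto_sum lim vertex_L2) simp
      then show "?b \<longlonglongrightarrow> 0" by simp
      show "\<forall>N. mdist (C01_L2 \<mu>) (coord_polygon \<mu> e n N (c \<omega>)) (version n \<omega>) \<le> ?b N"
      proof
        fix N
        have cp: "(\<lambda>m s. \<Sum>i<N. c \<omega> (m, i) * e i s) = (\<lambda>m. L2_proj \<mu> e N (vertex n m \<omega>))"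
          by (simp add: c_def L2_proj_def)
        show "mdist (C01_L2 \<mu>) (coord_polygon \<mu> e n N (c \<omega>)) (version n \<omega>) \<le> ?b N"
          unfolding coord_polygon_def version_def cp
        proof (rule mdist_L2_path_le)
          show "0 \<le> ?b N" by (intro sum_nonneg L2_norm_nonneg)
          fix t :: real assume t: "t \<in> {0..1}"
          show "L2_norm \<mu> (\<lambda>s. polygon n (\<lambda>m. L2_proj \<mu> e N (vertex n m \<omega>)) t s - polygon n (\<lambda>m. vertex n m \<omega>) t s) \<le> ?b N"
          proof (rule polygon_diff_le)
            fix m assume m: "m \<le> n"
            have "L2_norm \<mu> (\<lambda>s. L2_proj \<mu> e N (vertex n m \<omega>) s - vertex n m \<omega> s) =
                L2_norm \<mu> (\<lambda>s. vertex n m \<omega> s - L2_proj \<mu> e N (vertex n m \<omega>) s)"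
              by (rule L2_norm_minus_commute)
            also have "\<dots> \<le> ?b N" using m by (intro member_le_sum) (auto simp: L2_norm_nonneg)
            finally show "L2_norm \<mu> (\<lambda>s. L2_proj \<mu> e N (vertex n m \<omega>) s - vertex n m \<omega> s) \<le> ?b N" .
          qed (use t eL vertex_L2 in \<open>auto intro: L2_proj_L2_funs\<close>)
        qed (use eL vertex_L2 in \<open>auto intro!: polygon_L2_funs L2_proj_L2_funs\<close>)
      qed
    qed (auto simp: mdist_nonneg)
  qed (rule version_in_C01)
qed

section \<open>Distance from the normalised polygon to finitely many coordinates of the walk\<close>

definition walk_coord :: "(nat \<Rightarrow> 's \<Rightarrow> real) \<Rightarrow> nat \<Rightarrow> nat \<Rightarrow> 'w \<Rightarrow> nat \<times> nat \<Rightarrow> real" where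
  "walk_coord e J n \<omega> = (\<lambda>(j, i). L2_inner \<mu> (walk (n * j div J) \<omega>) (e i) / sqrt (real n))"

text \<open>Four sources of error: replacing partial sums by \<open>harm n\<close> times the walk,
  replacing \<open>harm n / ln n\<close> by 1, moving to a nearby node of the coarse grid, and
  keeping \<open>N\<close> coordinates.\<close>

definition approx_error :: "(nat \<Rightarrow> 's \<Rightarrow> real) \<Rightarrow> nat \<Rightarrow> nat \<Rightarrow> nat \<Rightarrow> nat \<Rightarrow> 'w \<Rightarrow> real" where
  "approx_error e J N L n \<omega> = scale n * node_bound n L \<omega> +
     \<bar>scale n * harm n - 1 / sqrt (real n)\<bar> * modulus n (2 * n) \<omega> + 1 / sqrt (real n) * modulus n L \<omega> +
     1 / sqrt (real n) * (\<Sum>j\<le>J. L2_norm \<mu> (\<lambda>s. walk (n * j div J) \<omega> s - L2_proj \<mu> e N (walk (n * j div J) \<omega>) s))"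

text \<open>A node of the fine polygon is compared with coarse nodes at most
  \<open>1 + n / J\<close> steps away; rounding \<open>n * j / J\<close> down costs one more step,
  whence the 2 in the condition on \<open>L\<close>.\<close>

lemma version_near_coord_polygon:
  assumes e: "orthonormal_or_zero \<mu> e" and n: "1 \<le> n" and J: "1 \<le> J" and L: "1 \<le> L" "2 + real n / real J \<le> real L"
  shows "AE \<omega> in P. mdist (C01_L2 \<mu>) (version n \<omega>) (coord_polygon \<mu> e J N (walk_coord e J n \<omega>)) \<le> approx_error e J N L n \<omega>"
  using AE_good[OF n, of L] AE_partial_sum_L2[of n]
proof eventually_elim
  case (elim \<omega>)
  then have \<omega>: "\<omega> \<in> space P" and good: "good_modulus n L \<omega>" "good_modulus n (2 * n) \<omega>" by auto
  have eL: "e i \<in> L2_funs \<mu>" for i using e by (simp add: orthonormal_or_zero_def)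
  have bl: "block n a b \<omega> \<in> L2_funs \<mu>" if "a \<le> b" "b \<le> 2 * n" for a b
    using block_le_modulus(1)[OF \<omega> good(2)] that by auto
  have wb: "walk m \<omega> = block n n (n + m) \<omega>" for m by (rule ext) (rule walk_eq_block)
  have wL: "walk m \<omega> \<in> L2_funs \<mu>" if "m \<le> n" for m
    unfolding wb using that by (intro bl) auto
  define mj where "mj j = n * j div J" for j
  have mjn: "mj j \<le> n" if "j \<le> J" for j unfolding mj_def using that by (rule grid_le)
  define w where "w j = (\<lambda>s. 1 / sqrt (real n) * L2_proj \<mu> e N (walk (mj j) \<omega>) s)" for j
  have wj: "w j \<in> L2_funs \<mu>" for j
    unfolding w_def by (intro L2_funs_cmult L2_proj_L2_funs eL)
  have cp: "coord_polygon \<mu> e J N (walk_coord e J n \<omega>) = L2_path \<mu> (polygon J w)"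
    by (simp add: coord_polygon_def w_def[abs_def] walk_coord_def L2_proj_def mj_def sum_distrib_left mult_ac)
  have vx: "vertex n m \<omega> = (\<lambda>s. scale n * partial_sum lin m \<omega> s)" for m
    by (rule vertex_good[OF elim(2)])
  let ?E = "approx_error e J N L n \<omega>"
  have node_bound: "vertex n m \<omega> \<in> L2_funs \<mu> \<and> L2_norm \<mu> (\<lambda>s. vertex n m \<omega> s - w j s) \<le> ?E"
    if m: "m \<le> n" and j: "j \<le> J" and near: "\<bar>real m - real n * real j / real J\<bar> \<le> 1 + real n / real J" for m j
  proof
    show "vertex n m \<omega> \<in> L2_funs \<mu>" by (rule vertex_L2[OF m])
    have ps: "partial_sum lin m \<omega> \<in> L2_funs \<mu>" using elim m by blast
    have scale0: "0 \<le> scale n" using n by (simp add: scale_def)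
    \<comment> \<open>The four pieces correspond to the terms of \<open>approx_error\<close>, in the
      same order.\<close>
    define a1 where "a1 s = scale n * (partial_sum lin m \<omega> s - harm n * walk m \<omega> s)" for s
    define a2 where "a2 s = (scale n * harm n - 1 / sqrt (real n)) * walk m \<omega> s" for s
    define a3 where "a3 s = 1 / sqrt (real n) * (walk m \<omega> s - walk (mj j) \<omega> s)" for s
    define a4 where "a4 s = 1 / sqrt (real n) * (walk (mj j) \<omega> s - L2_proj \<mu> e N (walk (mj j) \<omega>) s)" for s
    have eq: "vertex n m \<omega> s - w j s = (a1 s + a2 s) + (a3 s + a4 s)" for s
      by (simp add: vx w_def a1_def a2_def a3_def a4_def algebra_simps)
    have aL: "a1 \<in> L2_funs \<mu>" "a2 \<in> L2_funs \<mu>" "a3 \<in> L2_funs \<mu>" "a4 \<in> L2_funs \<mu>"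
      unfolding a1_def[abs_def] a2_def[abs_def] a3_def[abs_def] a4_def[abs_def]
      by (intro L2_funs_cmult L2_funs_diff L2_proj_L2_funs ps wL m mjn j eL)+
    have "L2_norm \<mu> (\<lambda>s. vertex n m \<omega> s - w j s) \<le> (L2_norm \<mu> a1 + L2_norm \<mu> a2) + (L2_norm \<mu> a3 + L2_norm \<mu> a4)"
      unfolding eq
      by (rule order_trans[OF L2_norm_triangle add_mono[OF L2_norm_triangle L2_norm_triangle]])
        (intro L2_funs_add aL)+
    moreover have "L2_norm \<mu> a1 \<le> scale n * node_bound n L \<omega>"
      unfolding a1_def[abs_def] L2_norm_cmult abs_of_nonneg[OF scale0]
      using elim L(1) m by (intro mult_left_mono[OF _ scale0] partial_sum_node_bound(2)) auto
    moreover have "L2_norm \<mu> a2 \<le> \<bar>scale n * harm n - 1 / sqrt (real n)\<bar> * modulus n (2 * n) \<omega>"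
      unfolding a2_def[abs_def] L2_norm_cmult wb
      using m by (intro mult_left_mono block_le_modulus(2)[OF \<omega> good(2)]) auto
    moreover have "L2_norm \<mu> a3 \<le> 1 / sqrt (real n) * modulus n L \<omega>"
    proof -
      have "real n * real j / real J - 1 \<le> real (mj j)" "real (mj j) \<le> real n * real j / real J"
      proof -
        have "n * j < (mj j + 1) * J" using J dividend_less_div_times[of J "n * j"] by (simp add: mj_def)
        then have "real (n * j) < real ((mj j + 1) * J)" by (simp only: of_nat_less_iff)
        then have "real n * real j < (real (mj j) + 1) * real J" by (simp add: algebra_simps)
        then have "real n * real j / real J \<le> real (mj j) + 1" using J by (simp add: pos_divide_le_eq)
        then show "real n * real j / real J - 1 \<le> real (mj j)" by simp
        show "real (mj j) \<le> real n * real j / real J"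
          using of_nat_div_le_of_nat[of "n * j" J, where 'a = real] by (simp add: mj_def)
      qed
      then have d: "\<bar>real m - real (mj j)\<bar> \<le> real L" using near L(2) by linarith
      have "L2_norm \<mu> (\<lambda>s. walk m \<omega> s - walk (mj j) \<omega> s) \<le> modulus n L \<omega>"
      proof (cases "mj j \<le> m")
        case True
        have "walk m \<omega> s - walk (mj j) \<omega> s = block n (n + mj j) (n + m) \<omega> s" for s
          using block_split[of n "n + mj j" "n + m" n \<omega> s] True by (simp add: wb)
        then show ?thesis using True m d by (simp only:) (intro block_le_modulus(2)[OF \<omega> good(1)], auto)
      next
        case False
        have "walk (mj j) \<omega> s - walk m \<omega> s = block n (n + m) (n + mj j) \<omega> s" for s
          using block_split[of n "n + m" "n + mj j" n \<omega> s] False by (simp add: wb)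
        then show ?thesis
          unfolding L2_norm_minus_commute[of \<mu> "walk m \<omega>" "walk (mj j) \<omega>"]
          using False mjn[OF j] d by (simp only:) (intro block_le_modulus(2)[OF \<omega> good(1)], auto)
      qed
      then show ?thesis unfolding a3_def[abs_def] L2_norm_cmult by (simp add: divide_right_mono)
    qed
    moreover have "L2_norm \<mu> a4 \<le> 1 / sqrt (real n) * (\<Sum>j\<le>J. L2_norm \<mu> (\<lambda>s. walk (mj j) \<omega> s - L2_proj \<mu> e N (walk (mj j) \<omega>) s))"
    proof -
      have "L2_norm \<mu> (\<lambda>s. walk (mj j) \<omega> s - L2_proj \<mu> e N (walk (mj j) \<omega>) s) \<le>
          (\<Sum>j\<le>J. L2_norm \<mu> (\<lambda>s. walk (mj j) \<omega> s - L2_proj \<mu> e N (walk (mj j) \<omega>) s))"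
        using j by (intro member_le_sum[of j "{..J}" "\<lambda>j. L2_norm \<mu> (\<lambda>s. walk (mj j) \<omega> s - L2_proj \<mu> e N (walk (mj j) \<omega>) s)"])
          (auto simp: L2_norm_nonneg)
      then show ?thesis unfolding a4_def[abs_def] L2_norm_cmult by (simp add: divide_right_mono)
    qed
    ultimately show "L2_norm \<mu> (\<lambda>s. vertex n m \<omega> s - w j s) \<le> ?E"
      unfolding approx_error_def mj_def by linarith
  qed
  have E0: "0 \<le> ?E"
    using node_bound[of 0 0] L2_norm_nonneg[of \<mu> "\<lambda>s. vertex n 0 \<omega> s - w 0 s"] by (auto intro: order_trans)
  show ?case
    unfolding version_def cp
  proof (rule mdist_L2_path_le[OF E0])
    fix t :: real assume t: "t \<in> {0..1}"
    show "L2_norm \<mu> (\<lambda>s. polygon n (\<lambda>m. vertex n m \<omega>) t s - polygon J w t s) \<le> ?E"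
      by (rule polygon_polygon_diff_le) (use t J wj vertex_L2 node_bound in auto)
  qed (use wj vertex_L2 in \<open>auto intro!: polygon_L2_funs\<close>)
qed

lemma approx_error_expectation:
  fixes n J N L :: nat
  assumes e: "orthonormal_or_zero \<mu> e" and n: "2 \<le> n"
  defines "\<theta> \<equiv> total_var - (\<Sum>i<N. quad_kernel \<mu> \<sigma> (e i))"
  shows "integrable P (approx_error e J N L n)"
    and "(\<integral>\<omega>. approx_error e J N L n \<omega> \<partial>P) \<le>
      (2 * (harm n / ln (real n)) + 1) * ((\<integral>\<omega>. modulus n L \<omega> \<partial>P) / sqrt (real n)) +
      (2 * (real n / real L) * sqrt (32 * total_var) + sqrt total_var) / ln (real n) +
      \<bar>harm n / ln (real n) - 1\<bar> * sqrt (32 * total_var) + (real J + 1) * sqrt \<theta>"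
proof -
  have n1: "1 \<le> n" using n by simp
  have sn: "0 < sqrt (real n)" and lnn: "0 < ln (real n)" using n by auto
  let ?R = "\<lambda>j \<omega>. L2_norm \<mu> (\<lambda>s. walk (n * j div J) \<omega> s - L2_proj \<mu> e N (walk (n * j div J) \<omega>) s)"
  have R: "integrable P (?R j)" "j \<le> J \<Longrightarrow> (\<integral>\<omega>. ?R j \<omega> \<partial>P) \<le> sqrt (real n) * sqrt \<theta>" for j
  proof -
    interpret W: L2_process P \<mu> "walk (n * j div J)" \<sigma> "real (n * j div J)" by (rule walk_process)
    interpret E: L2_process P \<mu> "\<epsilon> 0" \<sigma> 1 by (rule L2_process_\<epsilon>)
    show i: "integrable P (?R j)" by (rule integrable_L2[OF W.proj_residual(1)[OF e] W.proj_residual(2)[OF e]])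
    have \<theta>0: "0 \<le> \<theta>"
    proof -
      have "0 \<le> (\<integral>\<omega>. (L2_norm \<mu> (\<lambda>s. \<epsilon> 0 \<omega> s - L2_proj \<mu> e N (\<epsilon> 0 \<omega>) s))\<^sup>2 \<partial>P)" by simp
      then show ?thesis unfolding E.proj_residual(3)[OF e] \<theta>_def by simp
    qed
    assume j: "j \<le> J"
    have "(\<integral>\<omega>. ?R j \<omega> \<partial>P)\<^sup>2 \<le> (\<integral>\<omega>. (?R j \<omega>)\<^sup>2 \<partial>P)"
      using variance_eq[OF i W.proj_residual(2)[OF e]] variance_positive[of "?R j"] by simp
    also have "\<dots> = real (n * j div J) * \<theta>" unfolding W.proj_residual(3)[OF e] \<theta>_def ..
    also have "\<dots> \<le> real n * \<theta>" using grid_le[OF j, of n] \<theta>0 by (intro mult_right_mono) auto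
    finally show "(\<integral>\<omega>. ?R j \<omega> \<partial>P) \<le> sqrt (real n) * sqrt \<theta>"
      unfolding real_sqrt_mult[symmetric] by (rule real_le_rsqrt)
  qed
  note nb = node_bound_expectation[OF n1, of L] and mo = modulus_crude
  show "integrable P (approx_error e J N L n)"
    unfolding approx_error_def[abs_def] using nb(1) mo(2) R(1) by auto
  have sc: "scale n = 1 / (sqrt (real n) * ln (real n))" by (simp add: scale_def inverse_eq_divide)
  have "(\<integral>\<omega>. approx_error e J N L n \<omega> \<partial>P) = scale n * (\<integral>\<omega>. node_bound n L \<omega> \<partial>P) +
     \<bar>scale n * harm n - 1 / sqrt (real n)\<bar> * (\<integral>\<omega>. modulus n (2 * n) \<omega> \<partial>P) + 1 / sqrt (real n) * (\<integral>\<omega>. modulus n L \<omega> \<partial>P) +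
     1 / sqrt (real n) * (\<Sum>j\<le>J. \<integral>\<omega>. ?R j \<omega> \<partial>P)"
    unfolding approx_error_def using nb(1) mo(2) R(1) by (simp add: Bochner_Integration.integral_sum)
  also have "\<dots> \<le> scale n * (2 * harm n * (\<integral>\<omega>. modulus n L \<omega> \<partial>P) +
      (2 * (real n / real L) * sqrt (32 * total_var) + sqrt total_var) * sqrt (real n)) +
     \<bar>scale n * harm n - 1 / sqrt (real n)\<bar> * (sqrt (real n) * sqrt (32 * total_var)) + 1 / sqrt (real n) * (\<integral>\<omega>. modulus n L \<omega> \<partial>P) +
     1 / sqrt (real n) * (\<Sum>j\<le>J. sqrt (real n) * sqrt \<theta>)"
    using R(2) sn lnn by (intro add_mono mult_left_mono nb(2) mo(3) sum_mono order_refl) (auto simp: sc)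
  also have "\<dots> = (2 * (harm n / ln (real n)) + 1) * ((\<integral>\<omega>. modulus n L \<omega> \<partial>P) / sqrt (real n)) +
      (2 * (real n / real L) * sqrt (32 * total_var) + sqrt total_var) / ln (real n) +
      \<bar>harm n / ln (real n) - 1\<bar> * sqrt (32 * total_var) + (real J + 1) * sqrt \<theta>"
  proof -
    \<comment> \<open>The factor \<open>sqrt n\<close> is taken inside the absolute value, where it
      cancels against the normalisation.\<close>
    have "\<bar>scale n * harm n - 1 / sqrt (real n)\<bar> * sqrt (real n) = \<bar>(scale n * harm n - 1 / sqrt (real n)) * sqrt (real n)\<bar>"
      using sn by (simp add: abs_mult)
    also have "(scale n * harm n - 1 / sqrt (real n)) * sqrt (real n) = harm n / ln (real n) - 1"
      using sn lnn by (simp add: sc left_diff_distrib)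
    finally have 1: "\<bar>scale n * harm n - 1 / sqrt (real n)\<bar> * (sqrt (real n) * C) = \<bar>harm n / ln (real n) - 1\<bar> * C" for C
      by (simp only: mult.assoc[symmetric])
    have 2: "scale n * (2 * harm n * I + D * sqrt (real n)) = 2 * (harm n / ln (real n)) * (I / sqrt (real n)) + D / ln (real n)" for I D
      using sn lnn by (simp add: sc field_simps)
    have 3: "1 / sqrt (real n) * (\<Sum>j\<le>J. sqrt (real n) * sqrt \<theta>) = (real J + 1) * sqrt \<theta>"
      using sn by (simp add: add.commute)
    show ?thesis unfolding 1 2 3 by (simp add: algebra_simps)
  qed
  finally show "(\<integral>\<omega>. approx_error e J N L n \<omega> \<partial>P) \<le>
      (2 * (harm n / ln (real n)) + 1) * ((\<integral>\<omega>. modulus n L \<omega> \<partial>P) / sqrt (real n)) +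
      (2 * (real n / real L) * sqrt (32 * total_var) + sqrt total_var) / ln (real n) +
      \<bar>harm n / ln (real n) - 1\<bar> * sqrt (32 * total_var) + (real J + 1) * sqrt \<theta>" .
qed

text \<open>The order of choices matters. \<open>l\<close> makes the modulus small at the scale
  \<open>L = n div l\<close>; \<open>J \<ge> 2 * l\<close> makes the coarse mesh finer than that
  scale; \<open>N\<close> comes after \<open>J\<close>, because its residual is multiplied by
  \<open>J + 1\<close>; and \<open>n\<close> deals with the terms divided by
  \<open>ln n\<close>.\<close>

lemma walk_side:
  assumes e: "orthonormal_or_zero \<mu> e"
    and lim: "\<And>h. h \<in> L2_funs \<mu> \<Longrightarrow> (\<lambda>N. L2_norm \<mu> (\<lambda>s. h s - L2_proj \<mu> e N h s)) \<longlonglongrightarrow> 0"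
    and \<eta>: "0 < \<eta>"
  shows "\<exists>J0\<ge>1. \<forall>J\<ge>J0. \<exists>N0. \<forall>N\<ge>N0. eventually (\<lambda>n. \<exists>U. integrable P U \<and> (\<integral>\<omega>. U \<omega> \<partial>P) \<le> \<eta> \<and>
    (AE \<omega> in P. mdist (C01_L2 \<mu>) (version n \<omega>) (coord_polygon \<mu> e J N (walk_coord e J n \<omega>)) \<le> U \<omega>)) sequentially"
proof -
  \<comment> \<open>In the limit the modulus costs three times \<open>\<eta>'\<close>; a fourth is
    slack and a fifth goes to the residual, so an eighth of \<open>\<eta>\<close> is ample.\<close>
  define \<eta>' where "\<eta>' = \<eta> / 8"
  have \<eta>': "0 < \<eta>'" using \<eta> by (simp add: \<eta>'_def)
  obtain l where l: "1 \<le> l"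
    and small: "\<And>n L. 1 \<le> L \<Longrightarrow> L * l \<le> n \<Longrightarrow> (\<integral>\<omega>. modulus n L \<omega> \<partial>P) \<le> \<eta>' * sqrt (real n)"
    using modulus_small[OF \<eta>'] by blast
  have "\<exists>N0. \<forall>N\<ge>N0. eventually (\<lambda>n. \<exists>U. integrable P U \<and> (\<integral>\<omega>. U \<omega> \<partial>P) \<le> \<eta> \<and>
    (AE \<omega> in P. mdist (C01_L2 \<mu>) (version n \<omega>) (coord_polygon \<mu> e J N (walk_coord e J n \<omega>)) \<le> U \<omega>)) sequentially"
    if J: "J \<ge> 2 * l" for J
  proof -
    define \<theta> where "\<theta> N = total_var - (\<Sum>i<N. quad_kernel \<mu> \<sigma> (e i))" for N
    have "(\<lambda>N. (real J + 1) * sqrt (\<theta> N)) \<longlonglongrightarrow> (real J + 1) * sqrt 0"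
      unfolding \<theta>_def by (intro tendsto_intros proj_gap_tendsto[OF e lim])
    then have "eventually (\<lambda>N. (real J + 1) * sqrt (\<theta> N) < \<eta>') sequentially"
      using \<eta>' by (intro order_tendstoD(2)) auto
    then obtain N0 where N0: "\<And>N. N \<ge> N0 \<Longrightarrow> (real J + 1) * sqrt (\<theta> N) < \<eta>'"
      by (auto simp: eventually_sequentially)
    have "eventually (\<lambda>n. \<exists>U. integrable P U \<and> (\<integral>\<omega>. U \<omega> \<partial>P) \<le> \<eta> \<and>
      (AE \<omega> in P. mdist (C01_L2 \<mu>) (version n \<omega>) (coord_polygon \<mu> e J N (walk_coord e J n \<omega>)) \<le> U \<omega>)) sequentially"
      if N: "N \<ge> N0" for N
    proof -
      let ?C = "2 * (2 * real l) * sqrt (32 * total_var) + sqrt total_var"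
      have ln_top: "filterlim (\<lambda>n. ln (real n)) at_top sequentially"
        by (rule filterlim_compose[OF ln_at_top filterlim_real_sequentially])
      have "(\<lambda>n. (2 * (harm n / ln (real n)) + 1) * \<eta>' + ?C / ln (real n) + \<bar>harm n / ln (real n) - 1\<bar> * sqrt (32 * total_var)) \<longlonglongrightarrow>
          (2 * 1 + 1) * \<eta>' + 0 + \<bar>1 - 1\<bar> * sqrt (32 * total_var)"
        by (intro tendsto_intros harm_div_ln_tendsto real_tendsto_divide_at_top[OF tendsto_const ln_top])
      then have ev: "eventually (\<lambda>n. (2 * (harm n / ln (real n)) + 1) * \<eta>' + ?C / ln (real n) +
          \<bar>harm n / ln (real n) - 1\<bar> * sqrt (32 * total_var) < 4 * \<eta>') sequentially"
        using \<eta>' by (intro order_tendstoD(2)) auto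
      show ?thesis
        using ev eventually_ge_at_top[of "6 * l"] 
      proof eventually_elim
        case (elim n)
        define L where "L = n div l"
        have n2: "2 \<le> n" using elim(2) l by linarith
        have Ll: "L * l \<le> n" unfolding L_def by simp
        have "n < (L + 1) * l" using l dividend_less_div_times[of l n] by (simp add: L_def)
        then have "real n < real ((L + 1) * l)" by (simp only: of_nat_less_iff)
        then have "real n < (real L + 1) * real l" by (simp add: algebra_simps)
        then have nl: "real n / real l \<le> real L + 1" using l by (simp add: pos_divide_le_eq)
        \<comment> \<open>For \<open>x = n / l\<close> the inequality
          \<open>2 + x / 2 \<le> x - 1\<close> requires \<open>x \<ge> 6\<close>; the 1 is lost in
          rounding \<open>L\<close> down.\<close>
        have n6: "6 \<le> real n / real l"
        proof -
          have "real (6 * l) \<le> real n" using elim(2) by (simp only: of_nat_le_iff)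
          then show ?thesis using l by (simp add: pos_le_divide_eq)
        qed
        have L1: "1 \<le> L" using nl n6 by linarith
        have nJ: "real n / real J \<le> real n / real l / 2"
        proof -
          have "real n / real J \<le> real n / real (2 * l)" using J l by (intro divide_left_mono) auto
          then show ?thesis by simp
        qed
        have "2 + y \<le> z" if "x \<le> z + 1" "6 \<le> x" "y \<le> x / 2" for x y z :: real
          using that by linarith
        from this[OF nl n6 nJ] have L2: "2 + real n / real J \<le> real L" .
        have nL: "real n / real L \<le> 2 * real l"
        proof -
          have "real n / real l \<le> 2 * real L" using nl n6 by linarith
          then show ?thesis using l L1 by (simp add: pos_divide_le_eq mult_ac)
        qed
        have J1: "1 \<le> J" using J l by linarith
        have sn: "0 < sqrt (real n)" and lnn: "0 < ln (real n)" using n2 by auto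
        have h0: "0 \<le> harm n / ln (real n)" using lnn by (simp add: harm_nonneg)
        have mod: "(\<integral>\<omega>. modulus n L \<omega> \<partial>P) / sqrt (real n) \<le> \<eta>'"
          using small[OF L1 Ll] sn by (simp add: pos_divide_le_eq)
        note E = approx_error_expectation[OF e n2, of J N L]
        have "(\<integral>\<omega>. approx_error e J N L n \<omega> \<partial>P) \<le>
          (2 * (harm n / ln (real n)) + 1) * ((\<integral>\<omega>. modulus n L \<omega> \<partial>P) / sqrt (real n)) +
          (2 * (real n / real L) * sqrt (32 * total_var) + sqrt total_var) / ln (real n) +
          \<bar>harm n / ln (real n) - 1\<bar> * sqrt (32 * total_var) + (real J + 1) * sqrt (\<theta> N)"
          unfolding \<theta>_def by (rule E(2))
        also have "\<dots> \<le> (2 * (harm n / ln (real n)) + 1) * \<eta>' + ?C / ln (real n) +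
          \<bar>harm n / ln (real n) - 1\<bar> * sqrt (32 * total_var) + \<eta>'"
          using N0[OF N] h0 mod nL lnn total_var_nonneg
          by (intro add_mono mult_left_mono divide_right_mono mult_right_mono order_refl) auto
        also have "\<dots> \<le> \<eta>" using elim(1) \<eta> unfolding \<eta>'_def by linarith
        finally show ?case
          using E(1) version_near_coord_polygon[OF e _ J1 L1 L2, of N] n2
          by (intro exI[of _ "approx_error e J N L n"]) auto
      qed
    qed
    then show ?thesis by blast
  qed
  then show ?thesis using l by (intro exI[of _ "2 * l"]) auto
qed

end

section \<open>Approximation of the Wiener process by its coordinates\<close>

text \<open>The thresholds depend on \<open>v\<close>, and the one for \<open>N\<close> also on
  \<open>J\<close>, so the limits are taken one after the other: the upper limit over
  \<open>N\<close> is moved out of the integral by reverse Fatou, the limit over \<open>J\<close> by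
  dominated convergence, both under the bound \<open>B\<close>.\<close>

lemma iterated_limit_expectation:
  fixes \<psi> :: "nat \<Rightarrow> nat \<Rightarrow> 'v \<Rightarrow> real"
  assumes "finite_measure Q"
    and [measurable]: "\<And>J N. \<psi> J N \<in> borel_measurable Q"
    and b: "\<And>J N v. 0 \<le> \<psi> J N v" "\<And>J N v. v \<in> space Q \<Longrightarrow> \<psi> J N v \<le> B"
    and lim: "AE v in Q. \<forall>\<epsilon>>0. \<exists>J0. \<forall>J\<ge>J0. \<exists>N0. \<forall>N\<ge>N0. \<psi> J N v \<le> \<epsilon>"
    and r: "0 < r"
  shows "\<exists>J0. \<forall>J\<ge>J0. \<exists>N0. \<forall>N\<ge>N0. (\<integral>v. \<psi> J N v \<partial>Q) \<le> r"
proof -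
  interpret finite_measure Q by fact
  define \<phi> where "\<phi> J v = limsup (\<lambda>N. ennreal (\<psi> J N v))" for J v
  have [measurable]: "\<phi> J \<in> borel_measurable Q" for J unfolding \<phi>_def by measurable
  have fin: "(\<integral>\<^sup>+v. ennreal B \<partial>Q) < \<infinity>" by (simp add: emeasure_eq_measure ennreal_mult_eq_top_iff less_top[symmetric])
  have \<phi>B: "AE v in Q. \<phi> J v \<le> ennreal B" for J
    using AE_space
  proof eventually_elim
    case (elim v)
    then show ?case unfolding \<phi>_def
      by (intro Limsup_bounded always_eventually allI ennreal_leI b)
  qed
  have "(\<lambda>J. \<integral>\<^sup>+v. \<phi> J v \<partial>Q) \<longlonglongrightarrow> (\<integral>\<^sup>+v. 0 \<partial>Q)"
  proof (rule nn_integral_dominated_convergence[where w = "\<lambda>v. ennreal B"])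
    show "AE v in Q. (\<lambda>J. \<phi> J v) \<longlonglongrightarrow> 0"
      using lim
    proof eventually_elim
      case (elim v)
      show ?case
      proof (rule order_tendstoI)
        fix a :: ennreal assume "0 < a"
        then obtain \<delta> where \<delta>: "0 < \<delta>" "\<delta> < a" using dense by blast
        then obtain \<epsilon> where \<epsilon>: "\<delta> = ennreal \<epsilon>" "0 < \<epsilon>" by (cases \<delta>) auto
        obtain J0 where "\<forall>J\<ge>J0. \<exists>N0. \<forall>N\<ge>N0. \<psi> J N v \<le> \<epsilon>" using elim \<epsilon>(2) by blast
        then have "\<phi> J v < a" if "J \<ge> J0" for J
        proof -
          from \<open>\<forall>J\<ge>J0. _\<close> that obtain N0 where "\<forall>N\<ge>N0. \<psi> J N v \<le> \<epsilon>" by blast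
          then have "\<phi> J v \<le> \<delta>" unfolding \<phi>_def \<epsilon>(1)
            by (intro Limsup_bounded) (auto simp: eventually_sequentially intro!: exI[of _ N0] ennreal_leI)
          then show ?thesis using \<delta>(2) by (rule order.strict_trans1)
        qed
        then show "eventually (\<lambda>J. \<phi> J v < a) sequentially" by (auto simp: eventually_sequentially)
      qed simp
    qed
  qed (use fin \<phi>B in auto)
  then have "eventually (\<lambda>J. (\<integral>\<^sup>+v. \<phi> J v \<partial>Q) < ennreal r) sequentially"
    using r by (intro order_tendstoD(2)) auto
  then obtain J0 where J0: "\<And>J. J \<ge> J0 \<Longrightarrow> (\<integral>\<^sup>+v. \<phi> J v \<partial>Q) < ennreal r" by (auto simp: eventually_sequentially)
  have "\<exists>N0. \<forall>N\<ge>N0. (\<integral>v. \<psi> J N v \<partial>Q) \<le> r" if J: "J \<ge> J0" for J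
  proof -
    have "limsup (\<lambda>N. \<integral>\<^sup>+v. ennreal (\<psi> J N v) \<partial>Q) \<le> (\<integral>\<^sup>+v. \<phi> J v \<partial>Q)"
      unfolding \<phi>_def
      by (rule nn_integral_limsup[where w = "\<lambda>v. ennreal B"]) (use fin b in \<open>auto intro!: AE_I2 ennreal_leI\<close>)
    also note J0[OF J]
    finally have "eventually (\<lambda>N. (\<integral>\<^sup>+v. ennreal (\<psi> J N v) \<partial>Q) < ennreal r) sequentially" by (rule Limsup_lessD)
    then obtain N0 where N0: "\<And>N. N \<ge> N0 \<Longrightarrow> (\<integral>\<^sup>+v. ennreal (\<psi> J N v) \<partial>Q) < ennreal r"
      by (auto simp: eventually_sequentially)
    have "(\<integral>v. \<psi> J N v \<partial>Q) \<le> r" if "N \<ge> N0" for N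
    proof -
      have "(\<integral>v. \<psi> J N v \<partial>Q) = enn2real (\<integral>\<^sup>+v. ennreal (\<psi> J N v) \<partial>Q)"
        by (intro integral_eq_nn_integral) (auto simp: b)
      also have "\<dots> \<le> r" using N0[OF that] r by (intro enn2real_leI) auto
      finally show ?thesis .
    qed
    then show ?thesis by blast
  qed
  then show ?thesis by blast
qed

text \<open>Indices \<open>j > J\<close> are sent to 0, since the process is measurable only for
  times in \<open>[0, 1]\<close> while the coordinate family must be measurable as a whole.\<close>

definition gauss_coord :: "'s measure \<Rightarrow> (nat \<Rightarrow> 's \<Rightarrow> real) \<Rightarrow> ('s \<times> real \<Rightarrow> real) \<Rightarrow> nat \<Rightarrow> nat \<times> nat \<Rightarrow> real" where
  "gauss_coord \<mu> e y J = (\<lambda>(j, i). if j \<le> J then L2_inner \<mu> (\<lambda>s. y (s, real j / real J)) (e i) else 0)"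

lemma L2_inner_sum_right:
  assumes "\<And>i. i \<in> I \<Longrightarrow> e i \<in> L2_funs \<mu>" "g \<in> L2_funs \<mu>"
  shows "L2_inner \<mu> g (\<lambda>s. \<Sum>i\<in>I. c i * e i s) = (\<Sum>i\<in>I. c i * L2_inner \<mu> g (e i))"
  using L2_inner_sum_left[of I e \<mu> g c, OF assms] by (simp add: mult.commute)

context iid_L2
begin

lemma L2_Wiener_process:
  assumes "prob_space Q"
    and "centered_gaussian_process Q (space \<mu> \<times> {0..1}) (\<lambda>(r, t) (s, u). \<sigma> r s * min t u) g"
    and "\<forall>t\<in>{0..1}. (\<lambda>(v, s). g v (s, t)) \<in> borel_measurable (Q \<Otimes>\<^sub>M \<mu>)" and "j \<le> J"
  shows "L2_process Q \<mu> (\<lambda>v s. g v (s, real j / real J)) \<sigma> (real j / real J)"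
proof -
  have "real j / real J \<in> {0..1}" using \<open>j \<le> J\<close> by (auto simp: divide_le_eq_1)
  then show ?thesis using assms by (intro gaussian_process_L2) auto
qed

lemma walk_coord_measurable:
  assumes e: "\<And>i. e i \<in> L2_funs \<mu>"
  shows "walk_coord e J n \<in> borel_measurable P"
proof (rule measurable_coordinatewise_then_product)
  fix k :: "nat \<times> nat"
  obtain j i where k: "k = (j, i)" by (cases k)
  interpret W: L2_process P \<mu> "walk (n * j div J)" \<sigma> "real (n * j div J)" by (rule walk_process)
  have "e i \<in> borel_measurable \<mu>" using e[of i] by (simp add: L2_funs_def)
  from W.inner_measurable[OF this] show "(\<lambda>\<omega>. walk_coord e J n \<omega> k) \<in> borel_measurable P"
    by (simp add: walk_coord_def k)
qed

lemma gauss_coord_measurable: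
  assumes Q: "prob_space Q"
    and G: "centered_gaussian_process Q (space \<mu> \<times> {0..1}) (\<lambda>(r, t) (s, u). \<sigma> r s * min t u) g"
    and m: "\<forall>t\<in>{0..1}. (\<lambda>(v, s). g v (s, t)) \<in> borel_measurable (Q \<Otimes>\<^sub>M \<mu>)"
    and e: "\<And>i. e i \<in> L2_funs \<mu>"
  shows "(\<lambda>v. gauss_coord \<mu> e (g v) J) \<in> borel_measurable Q"
proof (rule measurable_coordinatewise_then_product)
  fix k :: "nat \<times> nat"
  obtain j i where k: "k = (j, i)" by (cases k)
  show "(\<lambda>v. gauss_coord \<mu> e (g v) J k) \<in> borel_measurable Q"
  proof (cases "j \<le> J")
    case True
    interpret Y: L2_process Q \<mu> "\<lambda>v s. g v (s, real j / real J)" \<sigma> "real j / real J"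
      by (rule L2_Wiener_process[OF Q G m True])
    have "e i \<in> borel_measurable \<mu>" using e[of i] by (simp add: L2_funs_def)
    from Y.inner_measurable[OF this] show ?thesis using True by (simp add: gauss_coord_def k)
  qed (simp add: gauss_coord_def k)
qed

text \<open>\<open>C01_polygon_approx\<close> applies to each continuous path separately, without
  uniformity in \<open>v\<close>; \<open>iterated_limit_expectation\<close> turns this into a bound
  for expectations.\<close>

lemma gauss_side:
  fixes F :: "(real \<Rightarrow> ('s \<Rightarrow> real) set) \<Rightarrow> real"
  assumes Q: "prob_space Q"
    and G: "centered_gaussian_process Q (space \<mu> \<times> {0..1}) (\<lambda>(r, t) (s, u). \<sigma> r s * min t u) g"
    and m: "\<forall>t\<in>{0..1}. (\<lambda>(v, s). g v (s, t)) \<in> borel_measurable (Q \<Otimes>\<^sub>M \<mu>)"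
    and GZ: "Z \<in> Q \<rightarrow>\<^sub>M mborel (C01_L2 \<mu>)" "\<And>t. t \<in> {0..1} \<Longrightarrow> AE v in Q. Z v t = L2_class \<mu> (\<lambda>s. g v (s, t))"
    and e: "\<And>i. e i \<in> L2_funs \<mu>"
    and lim: "\<And>h. h \<in> L2_funs \<mu> \<Longrightarrow> (\<lambda>N. L2_norm \<mu> (\<lambda>s. h s - L2_proj \<mu> e N h s)) \<longlonglongrightarrow> 0"
    and F: "\<And>x y. x \<in> mspace (C01_L2 \<mu>) \<Longrightarrow> y \<in> mspace (C01_L2 \<mu>) \<Longrightarrow> \<bar>F x - F y\<bar> \<le> L * mdist (C01_L2 \<mu>) x y"
      "\<And>x. x \<in> mspace (C01_L2 \<mu>) \<Longrightarrow> \<bar>F x\<bar> \<le> B"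
    and L: "0 < L" and r: "0 < r"
  shows "\<exists>J0. \<forall>J\<ge>J0. \<exists>N0. \<forall>N\<ge>N0.
    \<bar>(\<integral>v. F (coord_polygon \<mu> e J N (gauss_coord \<mu> e (g v) J)) \<partial>Q) - (\<integral>v. F (Z v) \<partial>Q)\<bar> \<le> r"
proof -
  interpret Q: prob_space Q by (rule Q)
  define p where "p J N v = coord_polygon \<mu> e J N (gauss_coord \<mu> e (g v) J)" for J N v
  have p: "p J N v \<in> mspace (C01_L2 \<mu>)" for J N v unfolding p_def by (intro coord_polygon_in_C01 e)
  have Z: "Z v \<in> mspace (C01_L2 \<mu>)" if "v \<in> space Q" for v
    using measurable_space[OF GZ(1) that] by simp
  have Fm: "F \<in> borel_measurable (mborel (C01_L2 \<mu>))"
    by (rule continuous_map_mborel_measurable[OF Lipschitz_continuous_map]) (rule F(1))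
  have pm: "p J N \<in> Q \<rightarrow>\<^sub>M mborel (C01_L2 \<mu>)" for J N
    unfolding p_def by (rule measurable_compose[OF gauss_coord_measurable[OF Q G m e] coord_polygon_measurable[of e, OF e]])
  have [measurable]: "(\<lambda>v. F (p J N v)) \<in> borel_measurable Q" "(\<lambda>v. F (Z v)) \<in> borel_measurable Q" for J N
    by (rule measurable_compose[OF pm Fm], rule measurable_compose[OF GZ(1) Fm])
  have iZ: "integrable Q (\<lambda>v. F (Z v))"
    by (rule Q.integrable_const_bound[where B = B]) (auto intro!: AE_I2 F(2) Z)
  have ip: "integrable Q (\<lambda>v. F (p J N v))" for J N
    by (rule Q.integrable_const_bound[where B = B]) (auto intro!: AE_I2 F(2) p)
  have "\<exists>J0. \<forall>J\<ge>J0. \<exists>N0. \<forall>N\<ge>N0. (\<integral>v. \<bar>F (p J N v) - F (Z v)\<bar> \<partial>Q) \<le> r"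
  proof (rule iterated_limit_expectation[where B = "2 * B"])
    show "\<bar>F (p J N v) - F (Z v)\<bar> \<le> 2 * B" if "v \<in> space Q" for J N v
      using F(2)[OF p, of J N v] F(2)[OF Z[OF that]] by linarith
    \<comment> \<open>There are countably many nodes over all \<open>J\<close>, so one null set is
      enough for the values of \<open>Z\<close> to be represented by \<open>g\<close> at all of
      them.\<close>
    have "AE v in Q. \<forall>J. \<forall>j. j \<le> J \<longrightarrow> (\<lambda>s. g v (s, real j / real J)) \<in> L2_funs \<mu> \<and>
        Z v (real j / real J) = L2_class \<mu> (\<lambda>s. g v (s, real j / real J))"
    proof (unfold AE_all_countable, intro allI)
      fix J j :: nat
      show "AE v in Q. j \<le> J \<longrightarrow> (\<lambda>s. g v (s, real j / real J)) \<in> L2_funs \<mu> \<and>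
        Z v (real j / real J) = L2_class \<mu> (\<lambda>s. g v (s, real j / real J))"
      proof (cases "j \<le> J")
        case True
        interpret Y: L2_process Q \<mu> "\<lambda>v s. g v (s, real j / real J)" \<sigma> "real j / real J"
          by (rule L2_Wiener_process[OF Q G m True])
        have "real j / real J \<in> {0..1}" using True by (auto simp: divide_le_eq_1)
        from Y.AE_L2_funs GZ(2)[OF this] show ?thesis by eventually_elim simp
      qed simp
    qed
    then show "AE v in Q. \<forall>\<epsilon>>0. \<exists>J0. \<forall>J\<ge>J0. \<exists>N0. \<forall>N\<ge>N0. \<bar>F (p J N v) - F (Z v)\<bar> \<le> \<epsilon>"
      using AE_space
    proof eventually_elim
      case (elim v)
      show ?case
      proof (intro allI impI)
        fix \<epsilon> :: real assume "0 < \<epsilon>"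
        then have "0 < \<epsilon> / L" using L by simp
        from C01_polygon_approx[OF Z[OF elim(2)] this, of e, OF e lim]
        obtain J0 where J0: "\<forall>J\<ge>J0. \<exists>N0. \<forall>N\<ge>N0. \<forall>f. (\<forall>j\<le>J. f j \<in> L2_funs \<mu> \<and> Z v (real j / real J) = L2_class \<mu> (f j)) \<longrightarrow>
          mdist (C01_L2 \<mu>) (Z v) (L2_path \<mu> (polygon J (\<lambda>j. L2_proj \<mu> e N (f j)))) \<le> \<epsilon> / L" by blast
        have "\<exists>N0. \<forall>N\<ge>N0. \<bar>F (p J N v) - F (Z v)\<bar> \<le> \<epsilon>" if "J \<ge> J0" for J
        proof -
          obtain N0 where N0: "\<forall>N\<ge>N0. \<forall>f. (\<forall>j\<le>J. f j \<in> L2_funs \<mu> \<and> Z v (real j / real J) = L2_class \<mu> (f j)) \<longrightarrow>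
            mdist (C01_L2 \<mu>) (Z v) (L2_path \<mu> (polygon J (\<lambda>j. L2_proj \<mu> e N (f j)))) \<le> \<epsilon> / L" using J0 \<open>J \<ge> J0\<close> by blast
          have "\<bar>F (p J N v) - F (Z v)\<bar> \<le> \<epsilon>" if "N \<ge> N0" for N
          proof -
            define f where "f j = (\<lambda>s. g v (s, real j / real J))" for j
            have pf: "p J N v = L2_path \<mu> (polygon J (\<lambda>j. L2_proj \<mu> e N (f j)))"
            proof -
              have "polygon J (\<lambda>j s. \<Sum>i<N. gauss_coord \<mu> e (g v) J (j, i) * e i s) = polygon J (\<lambda>j. L2_proj \<mu> e N (f j))"
                unfolding polygon_def[abs_def]
                by (intro ext sum.cong refl) (auto simp: gauss_coord_def f_def L2_proj_def)
              then show ?thesis by (simp add: p_def coord_polygon_def)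
            qed
            have "\<forall>j\<le>J. f j \<in> L2_funs \<mu> \<and> Z v (real j / real J) = L2_class \<mu> (f j)"
              using elim(1) by (simp add: f_def)
            then have d: "mdist (C01_L2 \<mu>) (Z v) (p J N v) \<le> \<epsilon> / L" using N0 \<open>N \<ge> N0\<close> unfolding pf by blast
            have "\<bar>F (Z v) - F (p J N v)\<bar> \<le> L * mdist (C01_L2 \<mu>) (Z v) (p J N v)" by (rule F(1)[OF Z[OF elim(2)] p])
            also have "\<dots> \<le> L * (\<epsilon> / L)" using d L by (intro mult_left_mono) auto
            finally show ?thesis using L by (simp add: abs_minus_commute)
          qed
          then show ?thesis by blast
        qed
        then show "\<exists>J0. \<forall>J\<ge>J0. \<exists>N0. \<forall>N\<ge>N0. \<bar>F (p J N v) - F (Z v)\<bar> \<le> \<epsilon>" by blast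
      qed
    qed
  qed (use r in \<open>auto intro: Q.finite_measure_axioms\<close>)
  moreover have "\<bar>(\<integral>v. F (p J N v) \<partial>Q) - (\<integral>v. F (Z v) \<partial>Q)\<bar> \<le> (\<integral>v. \<bar>F (p J N v) - F (Z v)\<bar> \<partial>Q)" for J N
    using integral_abs_bound[of Q "\<lambda>v. F (p J N v) - F (Z v)"] ip[of J N] iZ by simp
  ultimately show ?thesis unfolding p_def by (meson order_trans)
qed

section \<open>Passage to the limit\<close>

lemma coord_polygon_conv:
  fixes F :: "(real \<Rightarrow> ('s \<Rightarrow> real) set) \<Rightarrow> real"
  assumes Q: "prob_space Q"
    and G: "centered_gaussian_process Q (space \<mu> \<times> {0..1}) (\<lambda>(r, t) (s, u). \<sigma> r s * min t u) g"
    and m: "\<forall>t\<in>{0..1}. (\<lambda>(v, s). g v (s, t)) \<in> borel_measurable (Q \<Otimes>\<^sub>M \<mu>)"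
    and e: "\<And>i. e i \<in> L2_funs \<mu>"
    and F: "continuous_map (mtopology_of (C01_L2 \<mu>)) euclideanreal F"
      "\<And>x. x \<in> mspace (C01_L2 \<mu>) \<Longrightarrow> \<bar>F x\<bar> \<le> B"
    and J: "1 \<le> J"
  shows "(\<lambda>n. \<integral>\<omega>. F (coord_polygon \<mu> e J N (walk_coord e J n \<omega>)) \<partial>P) \<longlonglongrightarrow>
    (\<integral>v. F (coord_polygon \<mu> e J N (gauss_coord \<mu> e (g v) J)) \<partial>Q)"
proof -
  interpret E: L2_process P \<mu> "\<epsilon> 0" \<sigma> 1 by (rule L2_process_\<epsilon>)
  have em: "e i \<in> borel_measurable \<mu>" for i using e[of i] by (simp add: L2_funs_def)
  have q0: "0 \<le> quad_kernel \<mu> \<sigma> (e i)" for i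
  proof -
    have "0 \<le> (\<integral>\<omega>. (L2_inner \<mu> (\<epsilon> 0 \<omega>) (e i))\<^sup>2 \<partial>P)" by simp
    then show ?thesis unfolding E.inner_sq_expectation[OF e] by simp
  qed
  \<comment> \<open>Bounds the second moments of all coordinates on both sides, as the time factors
    are at most 1.\<close>
  define C where "C = (\<Sum>i<N. quad_kernel \<mu> \<sigma> (e i))"
  have C: "c * quad_kernel \<mu> \<sigma> (e i) \<le> C" if "i < N" "0 \<le> c" "c \<le> 1" for i c
  proof -
    have "c * quad_kernel \<mu> \<sigma> (e i) \<le> 1 * quad_kernel \<mu> \<sigma> (e i)" using that q0 by (intro mult_right_mono) auto
    also have "\<dots> \<le> C" unfolding C_def using that q0 by (auto intro!: member_le_sum)
    finally show ?thesis .
  qed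
  show ?thesis
  proof (rule cramer_wold_conv[where I = "{..J} \<times> {..<N}" and B = B and C = C and
        f = "\<lambda>x. F (coord_polygon \<mu> e J N x)"])
    show "walk_coord e J n \<in> borel_measurable P" for n by (rule walk_coord_measurable[OF e])
    show "(\<lambda>v. gauss_coord \<mu> e (g v) J) \<in> borel_measurable Q" by (rule gauss_coord_measurable[OF Q G m e])
    show "continuous_on UNIV (\<lambda>x. F (coord_polygon \<mu> e J N x))"
      unfolding continuous_on_open_vimage[OF open_UNIV]
    proof (intro allI impI)
      fix U :: "real set" assume "open U"
      then have "openin (mtopology_of (C01_L2 \<mu>)) {x \<in> mspace (C01_L2 \<mu>). F x \<in> U}"
        using openin_continuous_map_preimage[OF F(1), of U] by simp
      from coord_polygon_continuous[of e, OF e this, of J N]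
      have "open (coord_polygon \<mu> e J N -` {x \<in> mspace (C01_L2 \<mu>). F x \<in> U})" .
      also have "coord_polygon \<mu> e J N -` {x \<in> mspace (C01_L2 \<mu>). F x \<in> U} = (\<lambda>x. F (coord_polygon \<mu> e J N x)) -` U \<inter> UNIV"
        using coord_polygon_in_C01[of e \<mu>, OF e] by auto
      finally show "open ((\<lambda>x. F (coord_polygon \<mu> e J N x)) -` U \<inter> UNIV)" .
    qed
    show "\<bar>F (coord_polygon \<mu> e J N x)\<bar> \<le> B" for x by (intro F(2) coord_polygon_in_C01 e)
    show "F (coord_polygon \<mu> e J N x) = F (coord_polygon \<mu> e J N y)" if "\<And>k. k \<in> {..J} \<times> {..<N} \<Longrightarrow> x k = y k" for x y
      using coord_polygon_cong[of J N x y \<mu> e] that by simp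
  next
    fix n :: nat and k :: "nat \<times> nat" assume "k \<in> {..J} \<times> {..<N}"
    then obtain j i where k: "k = (j, i)" "j \<le> J" "i < N" by auto
    interpret W: L2_process P \<mu> "walk (n * j div J)" \<sigma> "real (n * j div J)" by (rule walk_process)
    show "integrable P (\<lambda>\<omega>. (walk_coord e J n \<omega> k)\<^sup>2)"
      using W.inner_sq_integrable[OF e[of i]] by (simp add: walk_coord_def k(1) power_divide)
    have "(\<integral>\<omega>. (walk_coord e J n \<omega> k)\<^sup>2 \<partial>P) = real (n * j div J) / real n * quad_kernel \<mu> \<sigma> (e i)"
      using W.inner_sq_expectation[OF e[of i]] by (simp add: walk_coord_def k(1) power_divide)
    also have "\<dots> \<le> C"
    proof (rule C)
      have "real (n * j div J) \<le> real n" using grid_le[OF k(2), of n] by simp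
      then show "real (n * j div J) / real n \<le> 1" by (auto simp: divide_le_eq_1)
    qed (use k in auto)
    finally show "(\<integral>\<omega>. (walk_coord e J n \<omega> k)\<^sup>2 \<partial>P) \<le> C" .
  next
    fix k :: "nat \<times> nat" assume "k \<in> {..J} \<times> {..<N}"
    then obtain j i where k: "k = (j, i)" "j \<le> J" "i < N" by auto
    interpret W: L2_process Q \<mu> "\<lambda>v s. g v (s, real j / real J)" \<sigma> "real j / real J"
      by (rule L2_Wiener_process[OF Q G m k(2)])
    show "integrable Q (\<lambda>v. (gauss_coord \<mu> e (g v) J k)\<^sup>2)"
      using W.inner_sq_integrable[OF e[of i]] k by (simp add: gauss_coord_def)
    have "(\<integral>v. (gauss_coord \<mu> e (g v) J k)\<^sup>2 \<partial>Q) = real j / real J * quad_kernel \<mu> \<sigma> (e i)"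
      using W.inner_sq_expectation[OF e[of i]] k by (simp add: gauss_coord_def)
    also have "\<dots> \<le> C" by (rule C) (use k in \<open>auto simp: divide_le_eq_1\<close>)
    finally show "(\<integral>v. (gauss_coord \<mu> e (g v) J k)\<^sup>2 \<partial>Q) \<le> C" .
  next
    fix u :: "nat \<times> nat \<Rightarrow> real" and c :: real
    \<comment> \<open>Coordinates belonging to the same node combine into the integral against one
      function, so Cramer-Wold combinations have the shape treated by
      \<open>inner_fdd_conv\<close>.\<close>
    define h where "h j = (\<lambda>s. \<Sum>i<N. u (j, i) * e i s)" for j
    have h: "h j \<in> L2_funs \<mu>" for j unfolding h_def by (intro L2_funs_sum L2_funs_cmult e)
    have inner: "L2_inner \<mu> f (h j) = (\<Sum>i<N. u (j, i) * L2_inner \<mu> f (e i))" if "f \<in> L2_funs \<mu>" for f j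
      unfolding h_def using that by (intro L2_inner_sum_right e)
    have hm: "h j \<in> borel_measurable \<mu>" for j using h[of j] by (simp add: L2_funs_def)
    have W: "(\<integral>\<omega>. cos ((\<Sum>k\<in>{..J} \<times> {..<N}. u k * walk_coord e J n \<omega> k) + c) \<partial>P) =
        (\<integral>\<omega>. cos ((\<Sum>j\<le>J. L2_inner \<mu> (walk (n * j div J) \<omega>) (h j) / sqrt (real n)) + c) \<partial>P)" for n
    proof (rule integral_cong_AE)
      have "AE \<omega> in P. \<forall>j. walk (n * j div J) \<omega> \<in> L2_funs \<mu>"
        using L2_process.AE_L2_funs[OF walk_process] by (simp add: AE_all_countable)
      then show "AE \<omega> in P. cos ((\<Sum>k\<in>{..J} \<times> {..<N}. u k * walk_coord e J n \<omega> k) + c) =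
        cos ((\<Sum>j\<le>J. L2_inner \<mu> (walk (n * j div J) \<omega>) (h j) / sqrt (real n)) + c)"
      proof eventually_elim
        case (elim \<omega>)
        have "(\<Sum>k\<in>{..J} \<times> {..<N}. u k * walk_coord e J n \<omega> k) = (\<Sum>j\<le>J. \<Sum>i<N. u (j, i) * walk_coord e J n \<omega> (j, i))"
          by (simp add: sum.cartesian_product)
        also have "\<dots> = (\<Sum>j\<le>J. L2_inner \<mu> (walk (n * j div J) \<omega>) (h j) / sqrt (real n))"
          using elim by (simp add: inner walk_coord_def sum_divide_distrib)
        finally show ?case by simp
      qed
      have [measurable]: "(\<lambda>\<omega>. L2_inner \<mu> (walk i \<omega>) f) \<in> borel_measurable P" if "f \<in> borel_measurable \<mu>" for f i
        by (rule L2_process.inner_measurable[OF walk_process that])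
      show "(\<lambda>\<omega>. cos ((\<Sum>k\<in>{..J} \<times> {..<N}. u k * walk_coord e J n \<omega> k) + c)) \<in> borel_measurable P"
        unfolding walk_coord_def case_prod_beta' using em by measurable
      show "(\<lambda>\<omega>. cos ((\<Sum>j\<le>J. L2_inner \<mu> (walk (n * j div J) \<omega>) (h j) / sqrt (real n)) + c)) \<in> borel_measurable P"
        using hm by measurable
    qed
    have V: "(\<integral>v. cos ((\<Sum>k\<in>{..J} \<times> {..<N}. u k * gauss_coord \<mu> e (g v) J k) + c) \<partial>Q) =
        (\<integral>v. cos ((\<Sum>j\<le>J. L2_inner \<mu> (\<lambda>s. g v (s, real j / real J)) (h j)) + c) \<partial>Q)"
    proof (rule integral_cong_AE)
      note proc = L2_Wiener_process[OF Q G m]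
      have "AE v in Q. \<forall>j\<in>{..J}. (\<lambda>s. g v (s, real j / real J)) \<in> L2_funs \<mu>"
        using L2_process.AE_L2_funs[OF proc] by (intro AE_finite_allI) auto
      then show "AE v in Q. cos ((\<Sum>k\<in>{..J} \<times> {..<N}. u k * gauss_coord \<mu> e (g v) J k) + c) =
        cos ((\<Sum>j\<le>J. L2_inner \<mu> (\<lambda>s. g v (s, real j / real J)) (h j)) + c)"
      proof eventually_elim
        case (elim v)
        have "(\<Sum>k\<in>{..J} \<times> {..<N}. u k * gauss_coord \<mu> e (g v) J k) = (\<Sum>j\<le>J. \<Sum>i<N. u (j, i) * gauss_coord \<mu> e (g v) J (j, i))"
          by (simp add: sum.cartesian_product)
        also have "\<dots> = (\<Sum>j\<le>J. L2_inner \<mu> (\<lambda>s. g v (s, real j / real J)) (h j))"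
          using elim by (intro sum.cong refl) (simp add: inner gauss_coord_def)
        finally show ?case by simp
      qed
      have im: "(\<lambda>v. L2_inner \<mu> (\<lambda>s. g v (s, real j / real J)) f) \<in> borel_measurable Q"
        if "f \<in> borel_measurable \<mu>" "j \<le> J" for f j
        by (rule L2_process.inner_measurable[OF proc[OF that(2)] that(1)])
      have [measurable]: "(\<lambda>v. gauss_coord \<mu> e (g v) J k) \<in> borel_measurable Q" for k
        using measurable_compose[OF gauss_coord_measurable[OF Q G m e], of "\<lambda>x. x k"] by (simp add: measurable_component_singleton)
      show "(\<lambda>v. cos ((\<Sum>k\<in>{..J} \<times> {..<N}. u k * gauss_coord \<mu> e (g v) J k) + c)) \<in> borel_measurable Q"
        by measurable
      have "(\<lambda>v. \<Sum>j\<le>J. L2_inner \<mu> (\<lambda>s. g v (s, real j / real J)) (h j)) \<in> borel_measurable Q"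
        by (intro borel_measurable_sum im hm) simp
      then show "(\<lambda>v. cos ((\<Sum>j\<le>J. L2_inner \<mu> (\<lambda>s. g v (s, real j / real J)) (h j)) + c)) \<in> borel_measurable Q"
        by measurable
    qed
    show "(\<lambda>n. \<integral>\<omega>. cos ((\<Sum>k\<in>{..J} \<times> {..<N}. u k * walk_coord e J n \<omega> k) + c) \<partial>P) \<longlonglongrightarrow>
        (\<integral>v. cos ((\<Sum>k\<in>{..J} \<times> {..<N}. u k * gauss_coord \<mu> e (g v) J k) + c) \<partial>Q)"
      unfolding W V by (rule inner_fdd_conv[OF Q G _ h J]) (use m in auto)
  qed (use Q prob_space_axioms in auto)
qed

text \<open>Three errors for a Lipschitz test function: the normalised polygon against coordinates
  of the walk, these against coordinates of the Wiener process, and those against \<open>G\<close>.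
  \<open>J\<close> has to pass the thresholds of the first and the last before \<open>N\<close> is
  chosen; only then does \<open>n\<close> grow.\<close>

lemma version_weak_conv:
  assumes Q: "prob_space Q" and sep: "separable_space (mtopology_of (L2 \<mu>))" and W: "L2_Wiener \<mu> \<sigma> Q G"
  shows "weak_conv_metric (C01_L2 \<mu>) (\<lambda>n. distr P (mborel (C01_L2 \<mu>)) (version n)) (distr Q (mborel (C01_L2 \<mu>)) G)"
proof -
  obtain e where e: "orthonormal_or_zero \<mu> e"
    and lim: "\<And>h. h \<in> L2_funs \<mu> \<Longrightarrow> (\<lambda>N. L2_norm \<mu> (\<lambda>s. h s - L2_proj \<mu> e N h s)) \<longlonglongrightarrow> 0"
    using L2_basis[OF sep] by metis
  have eL: "e i \<in> L2_funs \<mu>" for i using e by (simp add: orthonormal_or_zero_def)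
  obtain g where g: "centered_gaussian_process Q (space \<mu> \<times> {0..1}) (\<lambda>(r, t) (s, u). \<sigma> r s * min t u) g"
      "\<forall>t\<in>{0..1}. (\<lambda>(v, s). g v (s, t)) \<in> borel_measurable (Q \<Otimes>\<^sub>M \<mu>)"
      "\<And>t. t \<in> {0..1} \<Longrightarrow> AE v in Q. G v t = L2_class \<mu> (\<lambda>s. g v (s, t))"
    and Gm: "G \<in> Q \<rightarrow>\<^sub>M mborel (C01_L2 \<mu>)"
    using W unfolding L2_Wiener_def by blast
  note vm = version_measurable[OF sep]
  show ?thesis
  proof (rule weak_conv_metricI)
    show "prob_space (distr P (mborel (C01_L2 \<mu>)) (version n))" for n by (rule prob_space_distr[OF vm])
    show "prob_space (distr Q (mborel (C01_L2 \<mu>)) G)" by (rule prob_space.prob_space_distr[OF Q Gm])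
    fix F :: "(real \<Rightarrow> ('s \<Rightarrow> real) set) \<Rightarrow> real" and L0 B :: real
    assume F0: "\<And>x y. x \<in> mspace (C01_L2 \<mu>) \<Longrightarrow> y \<in> mspace (C01_L2 \<mu>) \<Longrightarrow> \<bar>F x - F y\<bar> \<le> L0 * mdist (C01_L2 \<mu>) x y"
      and B: "\<And>x. x \<in> mspace (C01_L2 \<mu>) \<Longrightarrow> \<bar>F x\<bar> \<le> B"
    define L where "L = \<bar>L0\<bar> + 1"
    have L: "0 < L" by (simp add: L_def add_nonneg_pos)
    have F: "\<bar>F x - F y\<bar> \<le> L * mdist (C01_L2 \<mu>) x y" if "x \<in> mspace (C01_L2 \<mu>)" "y \<in> mspace (C01_L2 \<mu>)" for x y
    proof -
      have "L0 * mdist (C01_L2 \<mu>) x y \<le> L * mdist (C01_L2 \<mu>) x y"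
        by (intro mult_right_mono) (auto simp: L_def mdist_nonneg)
      then show ?thesis using F0[OF that] by linarith
    qed
    have Fc: "continuous_map (mtopology_of (C01_L2 \<mu>)) euclideanreal F"
      by (rule Lipschitz_continuous_map) (rule F)
    have Fm: "F \<in> borel_measurable (mborel (C01_L2 \<mu>))" by (rule continuous_map_mborel_measurable[OF Fc])
    have iv: "integrable P (\<lambda>\<omega>. F (version n \<omega>))" for n
      by (rule integrable_const_bound[where B = B]) (auto intro!: AE_I2 B version_in_C01 measurable_compose[OF vm Fm])
    have wm: "(\<lambda>\<omega>. walk_coord e J n \<omega>) \<in> borel_measurable P" for J n
      by (rule walk_coord_measurable[OF eL])
    have ic: "integrable P (\<lambda>\<omega>. F (coord_polygon \<mu> e J N (walk_coord e J n \<omega>)))" for J N n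
      by (rule integrable_const_bound[where B = B])
        (auto intro!: AE_I2 B coord_polygon_in_C01 eL
          measurable_compose[OF measurable_compose[OF wm coord_polygon_measurable[of e, OF eL]] Fm])
    have "(\<lambda>n. \<integral>\<omega>. F (version n \<omega>) \<partial>P) \<longlonglongrightarrow> (\<integral>v. F (G v) \<partial>Q)"
    proof (rule LIMSEQ_I)
      fix r :: real assume r: "0 < r"
      \<comment> \<open>The mean distance \<open>\<eta>\<close> costs
        \<open>L * \<eta> = r / 4\<close> under the Lipschitz constant; each of the other two errors
        is also at most \<open>r / 4\<close>.\<close>
      define \<eta> where "\<eta> = r / (4 * L)"
      have \<eta>: "0 < \<eta>" using r L by (simp add: \<eta>_def)
      obtain J0 where J0: "1 \<le> J0" "\<forall>J\<ge>J0. \<exists>N0. \<forall>N\<ge>N0. eventually (\<lambda>n. \<exists>U. integrable P U \<and> (\<integral>\<omega>. U \<omega> \<partial>P) \<le> \<eta> \<and>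
        (AE \<omega> in P. mdist (C01_L2 \<mu>) (version n \<omega>) (coord_polygon \<mu> e J N (walk_coord e J n \<omega>)) \<le> U \<omega>)) sequentially"
        using walk_side[OF e lim \<eta>] by blast
      have "0 < r / 4" using r by simp
      from gauss_side[OF Q g(1,2) Gm g(3) eL lim F B L this]
      obtain J1 where J1: "\<forall>J\<ge>J1. \<exists>N0. \<forall>N\<ge>N0.
        \<bar>(\<integral>v. F (coord_polygon \<mu> e J N (gauss_coord \<mu> e (g v) J)) \<partial>Q) - (\<integral>v. F (G v) \<partial>Q)\<bar> \<le> r / 4" by blast
      define J where "J = max J0 J1"
      have J: "J \<ge> J0" "J \<ge> J1" "1 \<le> J" using J0(1) by (auto simp: J_def)
      obtain N0 where N0: "\<forall>N\<ge>N0. eventually (\<lambda>n. \<exists>U. integrable P U \<and> (\<integral>\<omega>. U \<omega> \<partial>P) \<le> \<eta> \<and>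
        (AE \<omega> in P. mdist (C01_L2 \<mu>) (version n \<omega>) (coord_polygon \<mu> e J N (walk_coord e J n \<omega>)) \<le> U \<omega>)) sequentially"
        using J0(2) J(1) by blast
      obtain N1 where N1: "\<forall>N\<ge>N1. \<bar>(\<integral>v. F (coord_polygon \<mu> e J N (gauss_coord \<mu> e (g v) J)) \<partial>Q) - (\<integral>v. F (G v) \<partial>Q)\<bar> \<le> r / 4"
        using J1 J(2) by blast
      define N where "N = max N0 N1"
      have N: "N \<ge> N0" "N \<ge> N1" by (auto simp: N_def)
      let ?c = "\<lambda>n \<omega>. coord_polygon \<mu> e J N (walk_coord e J n \<omega>)"
      have "(\<lambda>n. \<integral>\<omega>. F (?c n \<omega>) \<partial>P) \<longlonglongrightarrow> (\<integral>v. F (coord_polygon \<mu> e J N (gauss_coord \<mu> e (g v) J)) \<partial>Q)"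
        by (rule coord_polygon_conv[OF Q g(1,2) _ Fc _ J(3)]) (use eL B in auto)
      then have "eventually (\<lambda>n. \<bar>(\<integral>\<omega>. F (?c n \<omega>) \<partial>P) -
          (\<integral>v. F (coord_polygon \<mu> e J N (gauss_coord \<mu> e (g v) J)) \<partial>Q)\<bar> < r / 4) sequentially"
        using tendstoD[of _ _ _ "r / 4"] r by (fastforce simp: dist_real_def)
      moreover have "eventually (\<lambda>n. \<exists>U. integrable P U \<and> (\<integral>\<omega>. U \<omega> \<partial>P) \<le> \<eta> \<and>
          (AE \<omega> in P. mdist (C01_L2 \<mu>) (version n \<omega>) (?c n \<omega>) \<le> U \<omega>)) sequentially"
        using N0 N(1) by blast
      ultimately have "eventually (\<lambda>n. norm ((\<integral>\<omega>. F (version n \<omega>) \<partial>P) - (\<integral>v. F (G v) \<partial>Q)) < r) sequentially"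
      proof eventually_elim
        case (elim n)
        then obtain U where U: "integrable P U" "(\<integral>\<omega>. U \<omega> \<partial>P) \<le> \<eta>"
          "AE \<omega> in P. mdist (C01_L2 \<mu>) (version n \<omega>) (?c n \<omega>) \<le> U \<omega>" by blast
        have "\<bar>(\<integral>\<omega>. F (version n \<omega>) \<partial>P) - (\<integral>\<omega>. F (?c n \<omega>) \<partial>P)\<bar> = \<bar>\<integral>\<omega>. F (version n \<omega>) - F (?c n \<omega>) \<partial>P\<bar>"
          using iv ic by simp
        also have "\<dots> \<le> (\<integral>\<omega>. \<bar>F (version n \<omega>) - F (?c n \<omega>)\<bar> \<partial>P)" by (rule integral_abs_bound)
        also have "\<dots> \<le> (\<integral>\<omega>. L * U \<omega> \<partial>P)"
        proof (rule integral_mono_AE)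
          show "AE \<omega> in P. \<bar>F (version n \<omega>) - F (?c n \<omega>)\<bar> \<le> L * U \<omega>"
            using U(3)
          proof eventually_elim
            case (elim \<omega>)
            have "\<bar>F (version n \<omega>) - F (?c n \<omega>)\<bar> \<le> L * mdist (C01_L2 \<mu>) (version n \<omega>) (?c n \<omega>)"
              by (intro F version_in_C01 coord_polygon_in_C01 eL)
            also have "\<dots> \<le> L * U \<omega>" using elim L by (intro mult_left_mono) auto
            finally show ?case .
          qed
        qed (use U(1) iv ic in auto)
        also have "\<dots> \<le> L * \<eta>" using U(2) L by simp
        also have "\<dots> = r / 4" using L by (simp add: \<eta>_def)
        finally show ?case
          using elim(1) N1[rule_format, OF N(2)] r unfolding real_norm_def by linarith
      qed
      then show "\<exists>no. \<forall>n\<ge>no. norm ((\<integral>\<omega>. F (version n \<omega>) \<partial>P) - (\<integral>v. F (G v) \<partial>Q)) < r"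
        by (simp add: eventually_sequentially)
    qed
    then show "(\<lambda>n. \<integral>x. F x \<partial>distr P (mborel (C01_L2 \<mu>)) (version n)) \<longlonglongrightarrow>
        (\<integral>x. F x \<partial>distr Q (mborel (C01_L2 \<mu>)) G)"
      by (simp add: integral_distr[OF vm Fm] integral_distr[OF Gm Fm])
  qed auto
qed

lemma lin_proc_eq: "d s = 1 \<Longrightarrow> lin_proc d \<epsilon> k \<omega> s = lin k \<omega> s"
  by (simp add: lin_proc_def lin_def tail_def powr_minus_divide)

text \<open>A class depends only on values in \<open>space \<mu>\<close>, where the exponent is 1;
  the exceptional null set is the one on which \<open>vertex\<close> was set to 0.\<close>

lemma version_eq:
  assumes d: "\<And>s. s \<in> space \<mu> \<Longrightarrow> d s = 1"
  shows "AE \<omega> in P. L2_path \<mu> (\<lambda>t s. inverse (sqrt (real n) * ln (real n)) * zeta (lin_proc d \<epsilon>) n \<omega> t s) = version n \<omega>"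
  using AE_partial_sum_L2[of n]
proof eventually_elim
  case (elim \<omega>)
  have "inverse (sqrt (real n) * ln (real n)) * zeta (lin_proc d \<epsilon>) n \<omega> t s = polygon n (\<lambda>m. vertex n m \<omega>) t s"
    if "t \<in> {0..1}" "s \<in> space \<mu>" for t s
  proof -
    have "zeta (lin_proc d \<epsilon>) n \<omega> t s = zeta lin n \<omega> t s"
      using lin_proc_eq[of d s] d[OF that(2)] by (simp add: zeta_def partial_sum_def)
    also have "\<dots> = polygon n (\<lambda>m. partial_sum lin m \<omega>) t s" using that by (intro zeta_eq_polygon) auto
    finally show ?thesis by (simp add: vertex_good[OF elim] polygon_cmult scale_def)
  qed
  then show ?case
    unfolding L2_path_def version_def by (intro restrict_ext L2_class_cong) auto
qed

end

theorem theorem2: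
  fixes \<mu> :: "'s measure" and P :: "'w measure" and Q :: "'v measure"
    and d :: "'s \<Rightarrow> real" and \<epsilon> :: "int \<Rightarrow> 'w \<Rightarrow> 's \<Rightarrow> real" and \<sigma> :: "'s \<Rightarrow> 's \<Rightarrow> real"
    and G :: "'v \<Rightarrow> real \<Rightarrow> ('s \<Rightarrow> real) set" and p :: real
  assumes "sigma_finite_measure \<mu>"
    and "separable_space (mtopology_of (L2 \<mu>))"
    and "prob_space P"
    and "d \<in> borel_measurable \<mu>"
    and "iid_processes P \<mu> \<epsilon>"
    and "\<And>s. s \<in> space \<mu> \<Longrightarrow> integrable P (\<lambda>\<omega>. (\<epsilon> 0 \<omega> s)\<^sup>2)"
    and "\<And>s. s \<in> space \<mu> \<Longrightarrow> (\<integral>\<omega>. \<epsilon> 0 \<omega> s \<partial>P) = 0"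
    and "\<And>k. AE \<omega> in P. \<epsilon> k \<omega> \<in> L2_funs \<mu>"
    and "integrable P (\<lambda>\<omega>. (L2_norm \<mu> (\<epsilon> 0 \<omega>))\<^sup>2)"
    and "\<And>r s. \<sigma> r s = (\<integral>\<omega>. \<epsilon> 0 \<omega> r * \<epsilon> 0 \<omega> s \<partial>P)"
    and "prob_space Q"
    and "L2_Wiener \<mu> \<sigma> Q G"
    and "\<And>s. s \<in> space \<mu> \<Longrightarrow> d s = 1"
    and "p > 2"
    and "integrable P (\<lambda>\<omega>. L2_norm \<mu> (\<epsilon> 0 \<omega>) powr p)"
  shows "conv_in_distr (C01_L2 \<mu>) P
    (\<lambda>n \<omega>. L2_path \<mu> (\<lambda>t s. inverse (sqrt (real n) * ln (real n)) * zeta (lin_proc d \<epsilon>) n \<omega> t s))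
    Q G"
proof -
  interpret \<mu>: sigma_finite_measure \<mu> by fact
  interpret P: prob_space P by fact
  interpret iid_L2 P \<mu> \<epsilon> \<sigma>
    by unfold_locales (fact assms)+
  \<comment> \<open>\<open>version\<close> is the modification that \<open>conv_in_distr\<close>
    asks for.\<close>
  show ?thesis
    unfolding conv_in_distr_def
  proof (intro conjI exI[of _ version] allI)
    show "G \<in> Q \<rightarrow>\<^sub>M mborel (C01_L2 \<mu>)" using assms(12) by (simp add: L2_Wiener_def)
    show "version n \<in> P \<rightarrow>\<^sub>M mborel (C01_L2 \<mu>)" for n by (rule version_measurable[OF assms(2)])
    show "AE \<omega> in P. L2_path \<mu> (\<lambda>t s. inverse (sqrt (real n) * ln (real n)) * zeta (lin_proc d \<epsilon>) n \<omega> t s) = version n \<omega>" for n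
      by (rule version_eq[OF assms(13)])
    show "weak_conv_metric (C01_L2 \<mu>) (\<lambda>n. distr P (mborel (C01_L2 \<mu>)) (version n)) (distr Q (mborel (C01_L2 \<mu>)) G)"
      by (rule version_weak_conv[OF assms(11) assms(2) assms(12)])
  qed
qed

end
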